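(* Let $\Omega=\mathbb{T}^{d}$ ($d=2$ or $3$) be a periodic domain and $\kappa>\nu>0$. Let $(\varrho,u)$ be a weak solution of the pressureless quantum Navier–Stokes system $$\partial_{t}\varrho+\mathrm{div}(\varrho u)=0,\qquad \partial_{t}(\varrho u)+\mathrm{div}(\varrho u\otimes u)-2\nu\,\mathrm{div}(\varrho D(u))=2\kappa^2\varrho\nabla\Big(\frac{\Delta\sqrt{\varrho}}{\sqrt{\varrho}}\Big),$$ understood via its augmented formulation described in the context, and let $(r,U)$ be a strong solution (as described in the context) emanating from the same initial data. Then $(u,\overline{v},w)=(U,\overline{V},W)$, i.e. $(\varrho,u)=(r,U)$ in $(0,T)\times\Omega$.
   Context: $D(u)=(\nabla u+\nabla^tu)/2$. Augmented variables: $w=u+\nu\nabla\log\varrho$, $v=\nabla\log\varrho$, $\overline v=\sqrt{\kappa^2-\nu^2}\,v$ (so $u=w-\nu v$). The weak solution $(\varrho,u)$ is such that $(\varrho,\overline v,w)$ satisfies in the sense of distributions $$\partial_{t}\varrho+\mathrm{div}(\varrho u)=0,$$ $$\partial_{t}(\varrho w)+\mathrm{div}(\varrho w\otimes u)-\nu\,\mathrm{div}(\sqrt{\varrho}\mathbb{T}(w))-\sqrt{\kappa^{2}-\nu^{2}}\,\mathrm{div}(\sqrt{\varrho}\mathbb{T}(\overline{v}))=0,$$ $$\partial_{t}(\varrho\overline{v})+\mathrm{div}(\varrho\overline{v}\otimes u)-\mathrm{div}(\sqrt{\varrho}\mathbb{T}(\overline{v}))+\sqrt{\kappa^{2}-\nu^{2}}\,\mathrm{div}(\sqrt{\varrho}\mathbb{T}(w))=0,$$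 where $\sqrt{\varrho}\mathbb{T}(\vartheta)=\nabla(\varrho\vartheta)-\frac{1}{\sqrt{\kappa^{2}-\nu^{2}}}\varrho\vartheta\otimes\overline{v}$ for $\vartheta=w,\overline v$, together with the energy inequality $\frac{d}{dt}\frac{1}{2}\int_{\Omega}(\varrho|w|^{2}+\varrho|\overline{v}|^{2})dx+\nu\int_{\Omega}(|\mathbb{T}(w)|^{2}+|\mathbb{T}(\overline{v})|^{2})dx\le0$. Strong solution: $(r,U)$ with $V=\nabla\log r$, $\overline V=\sqrt{\kappa^2-\nu^2}V$, $W=U+\nu V$ (so $U=W-\nu V$), satisfying $$\partial_{t}r+\mathrm{div}(rU)=0,\quad r(\partial_{t}W+\nabla W\cdot U)-\nu\,\mathrm{div}(r\nabla W)-\sqrt{\kappa^{2}-\nu^{2}}\,\mathrm{div}(r\nabla\overline{V})=0,$$ $$r(\partial_{t}\overline{V}+\nabla\overline{V}\cdot U)-\nu\,\mathrm{div}(r\nabla\overline{V})+\sqrt{\kappa^{2}-\nu^{2}}\,\mathrm{div}(r\nabla W)=0,$$ and belonging to the class $0<\inf r\le r\le\sup r<\infty$ on $(0,T)\times\Omega$, $\nabla r\in L^{2}(0,T;L^{\infty}(\Omega))\cap L^{1}(0,T;W^{1,\infty}(\Omega))$, $W,\overline{V}\in L^{\infty}(0,T;W^{2,\infty}(\Omega))\cap W^{1,\infty}(0,T;L^{\infty}(\Omega))$.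
   Formalization: In the weak equation for v̄ the term div(√ϱ T(v̄)) carries the coefficient ν (printed with coefficient 1, which for ν≠1 forces smooth positive densities to be constant); the energy inequality is taken integrated from time 0, with finite initial energy. *)

theory Defs
  imports "HOL-Analysis.Analysis"
begin

text \<open>Periodic domain: the torus T^d is represented by functions on R^d (type real^'d)
  integrated over the unit cell [0,1]^d; test functions are periodic in space.
  Space-time functions have type real \<Rightarrow> real^'d \<Rightarrow> _ (time first).\<close>

definition cell :: "(real^'d) set" where
  "cell = cbox 0 One"

definition smooth_fun :: "('a::euclidean_space \<Rightarrow> real) \<Rightarrow> bool" where
  "smooth_fun f \<longleftrightarrow> (\<exists>D :: 'a list \<Rightarrow> 'a \<Rightarrow> real. D [] = f \<and>
      (\<forall>l. continuous_on UNIV (D l)) \<and>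
      (\<forall>l b x. b \<in> Basis \<longrightarrow> ((\<lambda>s. D l (x + s *\<^sub>R b)) has_real_derivative D (b # l) x) (at 0)))"

definition periodic_sp :: "(real \<Rightarrow> real^'d \<Rightarrow> 'b) \<Rightarrow> bool" where
  "periodic_sp f \<longleftrightarrow> (\<forall>t x k. (\<forall>i. k $ i \<in> \<int>) \<longrightarrow> f t (x + k) = f t x)"

definition test_fun :: "real \<Rightarrow> (real \<Rightarrow> real^'d \<Rightarrow> real) \<Rightarrow> bool" where
  "test_fun T \<phi> \<longleftrightarrow> smooth_fun (\<lambda>z::real \<times> (real^'d). \<phi> (fst z) (snd z)) \<and> periodic_sp \<phi> \<and>
      (\<exists>\<tau><T. \<forall>t x. \<tau> \<le> t \<longrightarrow> \<phi> t x = 0)"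

definition itest_fun :: "real \<Rightarrow> (real \<Rightarrow> real^'d \<Rightarrow> real) \<Rightarrow> bool" where
  "itest_fun T \<phi> \<longleftrightarrow> test_fun T \<phi> \<and> (\<exists>\<tau>>0. \<forall>t x. t \<le> \<tau> \<longrightarrow> \<phi> t x = 0)"

definition pdt :: "(real \<Rightarrow> real^'d \<Rightarrow> real) \<Rightarrow> real \<Rightarrow> real^'d \<Rightarrow> real" where
  "pdt \<phi> t x = deriv (\<lambda>s. \<phi> s x) t"

definition pdx :: "'d \<Rightarrow> (real \<Rightarrow> real^'d \<Rightarrow> real) \<Rightarrow> real \<Rightarrow> real^'d \<Rightarrow> real" where
  "pdx j \<phi> t x = deriv (\<lambda>s. \<phi> t (x + s *\<^sub>R axis j 1)) 0"

definition STint :: "real \<Rightarrow> (real \<Rightarrow> real^'d \<Rightarrow> real) \<Rightarrow> real" where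
  "STint T f = set_lebesgue_integral lborel ({0<..<T} \<times> cell) (\<lambda>z. f (fst z) (snd z))"

definition STintegrable :: "real \<Rightarrow> (real \<Rightarrow> real^'d \<Rightarrow> real) \<Rightarrow> bool" where
  "STintegrable T f \<longleftrightarrow> set_integrable lborel ({0<..<T} \<times> cell) (\<lambda>z. f (fst z) (snd z))"

definition Sint :: "(real^'d \<Rightarrow> real) \<Rightarrow> real" where
  "Sint f = set_lebesgue_integral lborel cell f"

definition st_meas :: "(real \<Rightarrow> real^'d \<Rightarrow> 'b::topological_space) \<Rightarrow> bool" where
  "st_meas f \<longleftrightarrow> (\<lambda>z::real \<times> (real^'d). f (fst z) (snd z)) \<in> borel_measurable lborel"

definition st_ae :: "real \<Rightarrow> (real \<Rightarrow> real^'d \<Rightarrow> bool) \<Rightarrow> bool" where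
  "st_ae T P \<longleftrightarrow> (AE z in lborel. z \<in> {0<..<T} \<times> cell \<longrightarrow> P (fst z) (snd z))"

definition st_bdd :: "real \<Rightarrow> (real \<Rightarrow> real^'d \<Rightarrow> 'b::real_normed_vector) \<Rightarrow> bool" where
  "st_bdd T f \<longleftrightarrow> st_meas f \<and> (\<exists>C. st_ae T (\<lambda>t x. norm (f t x) \<le> C))"

definition wdx :: "real \<Rightarrow> (real \<Rightarrow> real^'d \<Rightarrow> real) \<Rightarrow> 'd \<Rightarrow> (real \<Rightarrow> real^'d \<Rightarrow> real) \<Rightarrow> bool" where
  "wdx T f j g \<longleftrightarrow> (\<forall>\<phi>. itest_fun T \<phi> \<longrightarrow>
      STint T (\<lambda>t x. f t x * pdx j \<phi> t x) = - STint T (\<lambda>t x. g t x * \<phi> t x))"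

definition wdt :: "real \<Rightarrow> (real \<Rightarrow> real^'d \<Rightarrow> real) \<Rightarrow> (real \<Rightarrow> real^'d \<Rightarrow> real) \<Rightarrow> (real^'d \<Rightarrow> real) \<Rightarrow> bool" where
  "wdt T f g f0 \<longleftrightarrow> (\<forall>\<phi>. test_fun T \<phi> \<longrightarrow>
      STint T (\<lambda>t x. f t x * pdt \<phi> t x + g t x * \<phi> t x) + Sint (\<lambda>x. f0 x * \<phi> 0 x) = 0)"

text \<open>Weak solution in augmented form: density rho, velocity u, vb = sqrt(kappa^2-nu^2) grad log rho,
  w = u + nu grad log rho, Tw = T(w), Tv = T(vb); initial data (rho0, w0, vb0).\<close>
definition weak_sol :: "real \<Rightarrow> real \<Rightarrow> real \<Rightarrow> (real^'d \<Rightarrow> real) \<Rightarrow> (real^'d \<Rightarrow> real^'d) \<Rightarrow> (real^'d \<Rightarrow> real^'d)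
   \<Rightarrow> (real \<Rightarrow> real^'d \<Rightarrow> real) \<Rightarrow> (real \<Rightarrow> real^'d \<Rightarrow> real^'d) \<Rightarrow> (real \<Rightarrow> real^'d \<Rightarrow> real^'d)
   \<Rightarrow> (real \<Rightarrow> real^'d \<Rightarrow> real^'d^'d) \<Rightarrow> (real \<Rightarrow> real^'d \<Rightarrow> real^'d^'d) \<Rightarrow> bool" where
  "weak_sol T \<nu> \<kappa> \<rho>0 w0 vb0 \<rho> u vb Tw Tv \<longleftrightarrow>
    (let c = sqrt (\<kappa>\<^sup>2 - \<nu>\<^sup>2); w = (\<lambda>t x. u t x + (\<nu> / c) *\<^sub>R vb t x) in
     st_meas \<rho> \<and> st_meas u \<and> st_meas vb \<and> st_meas Tw \<and> st_meas Tv \<and>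
     st_ae T (\<lambda>t x. 0 \<le> \<rho> t x) \<and>
     STintegrable T \<rho> \<and>
     STintegrable T (\<lambda>t x. \<rho> t x * (norm (w t x))\<^sup>2) \<and>
     STintegrable T (\<lambda>t x. \<rho> t x * (norm (vb t x))\<^sup>2) \<and>
     STintegrable T (\<lambda>t x. (norm (Tw t x))\<^sup>2) \<and>
     STintegrable T (\<lambda>t x. (norm (Tv t x))\<^sup>2) \<and>
     \<comment> \<open>rho vb = c grad rho\<close>
     (\<forall>\<phi> j. itest_fun T \<phi> \<longrightarrow>
        STint T (\<lambda>t x. \<rho> t x * vb t x $ j * \<phi> t x) = - c * STint T (\<lambda>t x. \<rho> t x * pdx j \<phi> t x)) \<and>
     \<comment> \<open>sqrt rho T(w) = grad(rho w) - (1/c) rho w \<otimes> vb\<close>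
     (\<forall>\<phi> i j. itest_fun T \<phi> \<longrightarrow>
        STint T (\<lambda>t x. sqrt (\<rho> t x) * Tw t x $ i $ j * \<phi> t x)
          = - STint T (\<lambda>t x. \<rho> t x * w t x $ i * pdx j \<phi> t x)
            - (1 / c) * STint T (\<lambda>t x. \<rho> t x * w t x $ i * vb t x $ j * \<phi> t x)) \<and>
     (\<forall>\<phi> i j. itest_fun T \<phi> \<longrightarrow>
        STint T (\<lambda>t x. sqrt (\<rho> t x) * Tv t x $ i $ j * \<phi> t x)
          = - STint T (\<lambda>t x. \<rho> t x * vb t x $ i * pdx j \<phi> t x)
            - (1 / c) * STint T (\<lambda>t x. \<rho> t x * vb t x $ i * vb t x $ j * \<phi> t x)) \<and>
     \<comment> \<open>continuity equation with initial datum\<close>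
     (\<forall>\<phi>. test_fun T \<phi> \<longrightarrow>
        STint T (\<lambda>t x. \<rho> t x * pdt \<phi> t x + \<rho> t x * (\<Sum>j\<in>UNIV. u t x $ j * pdx j \<phi> t x))
          + Sint (\<lambda>x. \<rho>0 x * \<phi> 0 x) = 0) \<and>
     \<comment> \<open>equation for w\<close>
     (\<forall>\<phi> i. test_fun T \<phi> \<longrightarrow>
        STint T (\<lambda>t x. \<rho> t x * w t x $ i * pdt \<phi> t x
            + (\<Sum>j\<in>UNIV. \<rho> t x * w t x $ i * u t x $ j * pdx j \<phi> t x)
            - \<nu> * (\<Sum>j\<in>UNIV. sqrt (\<rho> t x) * Tw t x $ i $ j * pdx j \<phi> t x)
            - c * (\<Sum>j\<in>UNIV. sqrt (\<rho> t x) * Tv t x $ i $ j * pdx j \<phi> t x))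
          + Sint (\<lambda>x. \<rho>0 x * w0 x $ i * \<phi> 0 x) = 0) \<and>
     \<comment> \<open>equation for vb\<close>
     (\<forall>\<phi> i. test_fun T \<phi> \<longrightarrow>
        STint T (\<lambda>t x. \<rho> t x * vb t x $ i * pdt \<phi> t x
            + (\<Sum>j\<in>UNIV. \<rho> t x * vb t x $ i * u t x $ j * pdx j \<phi> t x)
            - \<nu> * (\<Sum>j\<in>UNIV. sqrt (\<rho> t x) * Tv t x $ i $ j * pdx j \<phi> t x)
            + c * (\<Sum>j\<in>UNIV. sqrt (\<rho> t x) * Tw t x $ i $ j * pdx j \<phi> t x))
          + Sint (\<lambda>x. \<rho>0 x * vb0 x $ i * \<phi> 0 x) = 0) \<and>
     \<comment> \<open>energy inequality (integrated from the initial time)\<close>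
     (AE t in lborel. t \<in> {0<..<T} \<longrightarrow>
        (1/2) * Sint (\<lambda>x. \<rho> t x * ((norm (w t x))\<^sup>2 + (norm (vb t x))\<^sup>2))
        + \<nu> * STint t (\<lambda>s x. (norm (Tw s x))\<^sup>2 + (norm (Tv s x))\<^sup>2)
        \<le> (1/2) * Sint (\<lambda>x. \<rho>0 x * ((norm (w0 x))\<^sup>2 + (norm (vb0 x))\<^sup>2))))"

text \<open>Strong solution (r,U) in the class of the paper, with initial data (rho0, w0, vb0).
  G = grad r, H = grad^2 r; W = U + nu V, Vb = c V, V = grad log r;
  DW $ i $ j = d_j W_i, D2W $ i $ j $ k = d_k d_j W_i, DtW = d_t W (all weak derivatives).\<close>
definition strong_sol :: "real \<Rightarrow> real \<Rightarrow> real \<Rightarrow> (real^'d \<Rightarrow> real) \<Rightarrow> (real^'d \<Rightarrow> real^'d) \<Rightarrow> (real^'d \<Rightarrow> real^'d)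
   \<Rightarrow> (real \<Rightarrow> real^'d \<Rightarrow> real) \<Rightarrow> (real \<Rightarrow> real^'d \<Rightarrow> real^'d) \<Rightarrow> bool" where
  "strong_sol T \<nu> \<kappa> \<rho>0 w0 vb0 r U \<longleftrightarrow>
    (let c = sqrt (\<kappa>\<^sup>2 - \<nu>\<^sup>2) in
     st_meas r \<and> st_meas U \<and>
     (\<exists>m M. 0 < m \<and> st_ae T (\<lambda>t x. m \<le> r t x \<and> r t x \<le> M)) \<and>
     (\<exists>(G :: real \<Rightarrow> real^'d \<Rightarrow> real^'d) (H :: real \<Rightarrow> real^'d \<Rightarrow> real^'d^'d)
        (a :: real \<Rightarrow> real) (b :: real \<Rightarrow> real).
       st_meas G \<and> st_meas H \<and>
       (\<forall>j. wdx T r j (\<lambda>t x. G t x $ j)) \<and>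
       (\<forall>k j. wdx T (\<lambda>t x. G t x $ k) j (\<lambda>t x. H t x $ k $ j)) \<and>
       a \<in> borel_measurable lborel \<and> set_integrable lborel {0<..<T} (\<lambda>t. (a t)\<^sup>2) \<and>
       b \<in> borel_measurable lborel \<and> set_integrable lborel {0<..<T} b \<and>
       st_ae T (\<lambda>t x. norm (G t x) \<le> a t \<and> norm (G t x) \<le> b t \<and> norm (H t x) \<le> b t) \<and>
       (\<exists>(W :: real \<Rightarrow> real^'d \<Rightarrow> real^'d) (Vb :: real \<Rightarrow> real^'d \<Rightarrow> real^'d)
          (DW :: real \<Rightarrow> real^'d \<Rightarrow> real^'d^'d) (DVb :: real \<Rightarrow> real^'d \<Rightarrow> real^'d^'d)
          (D2W :: real \<Rightarrow> real^'d \<Rightarrow> real^'d^'d^'d) (D2Vb :: real \<Rightarrow> real^'d \<Rightarrow> real^'d^'d^'d)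
          (DtW :: real \<Rightarrow> real^'d \<Rightarrow> real^'d) (DtVb :: real \<Rightarrow> real^'d \<Rightarrow> real^'d).
         st_bdd T W \<and> st_bdd T Vb \<and> st_bdd T DW \<and> st_bdd T DVb \<and> st_bdd T D2W \<and> st_bdd T D2Vb \<and>
         st_bdd T DtW \<and> st_bdd T DtVb \<and>
         (\<forall>i j. wdx T (\<lambda>t x. W t x $ i) j (\<lambda>t x. DW t x $ i $ j)) \<and>
         (\<forall>i j. wdx T (\<lambda>t x. Vb t x $ i) j (\<lambda>t x. DVb t x $ i $ j)) \<and>
         (\<forall>i j k. wdx T (\<lambda>t x. DW t x $ i $ j) k (\<lambda>t x. D2W t x $ i $ j $ k)) \<and>
         (\<forall>i j k. wdx T (\<lambda>t x. DVb t x $ i $ j) k (\<lambda>t x. D2Vb t x $ i $ j $ k)) \<and>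
         (\<forall>i. wdt T (\<lambda>t x. W t x $ i) (\<lambda>t x. DtW t x $ i) (\<lambda>x. w0 x $ i)) \<and>
         (\<forall>i. wdt T (\<lambda>t x. Vb t x $ i) (\<lambda>t x. DtVb t x $ i) (\<lambda>x. vb0 x $ i)) \<and>
         st_ae T (\<lambda>t x. Vb t x = (c / r t x) *\<^sub>R G t x \<and> U t x = W t x - (\<nu> / c) *\<^sub>R Vb t x) \<and>
         \<comment> \<open>continuity equation with initial datum\<close>
         (\<forall>\<phi>. test_fun T \<phi> \<longrightarrow>
            STint T (\<lambda>t x. r t x * pdt \<phi> t x + r t x * (\<Sum>j\<in>UNIV. U t x $ j * pdx j \<phi> t x))
              + Sint (\<lambda>x. \<rho>0 x * \<phi> 0 x) = 0) \<and>
         \<comment> \<open>equations for W and Vb, a.e.\<close>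
         st_ae T (\<lambda>t x. \<forall>i.
            r t x * (DtW t x $ i + (\<Sum>j\<in>UNIV. DW t x $ i $ j * U t x $ j))
            - \<nu> * (\<Sum>j\<in>UNIV. G t x $ j * DW t x $ i $ j + r t x * D2W t x $ i $ j $ j)
            - c * (\<Sum>j\<in>UNIV. G t x $ j * DVb t x $ i $ j + r t x * D2Vb t x $ i $ j $ j) = 0) \<and>
         st_ae T (\<lambda>t x. \<forall>i.
            r t x * (DtVb t x $ i + (\<Sum>j\<in>UNIV. DVb t x $ i $ j * U t x $ j))
            - \<nu> * (\<Sum>j\<in>UNIV. G t x $ j * DVb t x $ i $ j + r t x * D2Vb t x $ i $ j $ j)
            + c * (\<Sum>j\<in>UNIV. G t x $ j * DW t x $ i $ j + r t x * D2W t x $ i $ j $ j) = 0))))"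

end

theory Submission
  imports Defs
begin

text \<open>The relative energy $\frac12\int\varrho(|w-W|^2+|\overline v-\overline V|^2)$ is expanded into the energy
  inequality, the weak equations tested with $W$, $\overline V$, $|W|^2/2$, $|\overline V|^2/2$, and the
  flux identities tested with $\nabla W$, $\nabla\overline V$ and their products with the velocities. All derivatives of the strong
  solution that appear are bounded, the viscous terms form a square, and the rest is quadratic in
  the velocity differences. Gronwall's argument is built into the time weight
  $\theta(t)=e^{-Kt}g(\tau_0-t)$ with $g$ flat at 0: for $K$ large the inequality tested with $\theta$
  forces the relative energy density to vanish almost everywhere.
  The strong solution is only a weakly differentiable test function; it is approximated by convolution
  with a kernel that is periodic in space and looks forward in time, so that the approximations
  respect both the periodicity and the initial values.
  Finally $w=W$, $\overline v=\overline V$ where $\varrho>0$ makes the weak gradient of $q=\varrho/r$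
  vanish. Its mollification $q_n$ then depends on time only, and conservation of mass, tested with
  a time weight times $S(q_n-1)$, $S(x)=x/(1+x^2)$, gives $q=1$.\<close>

subsection \<open>Smooth functions\<close>

text \<open>Two obstacles shape the argument. The weak solution may contain vacuum: its velocities
  are controlled only through squares weighted with \<open>\<rho>\<close>, so the relative energy
  says nothing where \<open>\<rho>\<close> vanishes, and the densities need an argument of their
  own. Second, the energy inequality holds only for almost every time. Testing it with a time weight
  avoids any evaluation at a fixed positive time. The weight has to vanish before \<open>T\<close>,
  as test functions do; flatness of \<open>g\<close> at 0 makes it smooth, while its derivative
  stays strictly negative before \<open>\<tau>0\<close>. The flux identities are needed because the
  strong equations contain second derivatives of W and V, which get multiplied by
  \<open>\<rho> w\<close>, \<open>\<rho> v\<close> and \<open>\<rho>\<close>. They are removed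
  through the identities that define T(w), T(v) and the gradient of \<open>\<rho>\<close>, each
  tested so that exactly one such derivative appears. The gradient of \<open>r\<close> is covered by
  the velocities: it equals \<open>r V / c\<close>, and both factors are bounded.\<close>

definition pd :: "'a::euclidean_space \<Rightarrow> ('a \<Rightarrow> real) \<Rightarrow> 'a \<Rightarrow> real" where
  "pd b f z = deriv (\<lambda>s. f (z + s *\<^sub>R b)) 0"

text \<open>\<open>smooth_fun\<close> asks for all iterated derivatives at once. A set of continuous
  functions closed under partial differentiation supplies them: one derivative inside the set is
  chosen for each function and direction, and the choice is iterated.\<close>

lemma smooth_fun_coinduct:
  fixes f :: "'a::euclidean_space \<Rightarrow> real"
  assumes "f \<in> F" and cont: "\<And>f. f \<in> F \<Longrightarrow> continuous_on UNIV f"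
    and der: "\<And>f b. f \<in> F \<Longrightarrow> b \<in> Basis \<Longrightarrow>
      \<exists>g\<in>F. \<forall>x. ((\<lambda>s. f (x + s *\<^sub>R b)) has_real_derivative g x) (at 0)"
  shows "smooth_fun f"
proof -
  have "\<forall>f\<in>F. \<forall>b\<in>Basis. \<exists>g. g \<in> F \<and> (\<forall>x. ((\<lambda>s. f (x + s *\<^sub>R b)) has_real_derivative g x) (at 0))"
    using der by blast
  then obtain d where d: "\<And>f b. f \<in> F \<Longrightarrow> b \<in> Basis \<Longrightarrow> d f b \<in> F"
    "\<And>f b x. f \<in> F \<Longrightarrow> b \<in> Basis \<Longrightarrow> ((\<lambda>s. f (x + s *\<^sub>R b)) has_real_derivative d f b x) (at 0)"
    unfolding bchoice_iff by metis
  \<comment> \<open>Lists may contain vectors outside \<open>Basis\<close>; such letters are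
    skipped, which keeps every \<open>D l\<close> inside \<open>F\<close> and hence
    continuous.\<close>
  define D where "D = (\<lambda>l. foldr (\<lambda>b h. if b \<in> Basis then d h b else h) l f)"
  have mem: "D l \<in> F" for l
    by (induction l) (auto simp: D_def assms(1) d)
  show ?thesis unfolding smooth_fun_def
    by (rule exI[of _ D]) (use mem d cont in \<open>auto simp: D_def\<close>)
qed

lemma smooth_fun_continuous: "smooth_fun f \<Longrightarrow> continuous_on S f"
  unfolding smooth_fun_def by (metis continuous_on_subset subset_UNIV)

lemma smooth_fun_pd_aux:
  assumes "smooth_fun f" "b \<in> Basis"
  shows "((\<lambda>s. f (x + s *\<^sub>R b)) has_real_derivative pd b f x) (at 0)" "smooth_fun (pd b f)"
proof -
  obtain D where D: "D [] = f" "\<And>l. continuous_on UNIV (D l)"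
    "\<And>l b x. b \<in> Basis \<Longrightarrow> ((\<lambda>s. D l (x + s *\<^sub>R b)) has_real_derivative D (b # l) x) (at 0)"
    using assms unfolding smooth_fun_def by blast
  have eq: "D [b] = pd b f"
    using D(3)[OF assms(2), of "[]"] D(1) unfolding pd_def by (auto intro!: ext DERIV_imp_deriv[symmetric])
  show "((\<lambda>s. f (x + s *\<^sub>R b)) has_real_derivative pd b f x) (at 0)"
    using D(3)[OF assms(2), of "[]" x] D(1) eq by simp
  \<comment> \<open>The head of a list is the derivative taken last, so appending \<open>b\<close>
    at the end means differentiating by \<open>b\<close> first.\<close>
  show "smooth_fun (pd b f)" unfolding smooth_fun_def
    by (rule exI[of _ "\<lambda>l. D (l @ [b])"]) (auto simp: eq D)
qed

lemmas smooth_fun_has_pd = smooth_fun_pd_aux(1)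
lemmas smooth_fun_pd = smooth_fun_pd_aux(2)

lemma pd_eqI: "((\<lambda>s. f (x + s *\<^sub>R b)) has_real_derivative D) (at 0) \<Longrightarrow> pd b f x = D"
  unfolding pd_def by (rule DERIV_imp_deriv)

lemma smooth_fun_has_pd_along:
  assumes "smooth_fun f" "b \<in> Basis"
  shows "((\<lambda>s. f (x + s *\<^sub>R b)) has_real_derivative pd b f (x + s *\<^sub>R b)) (at s)"
proof -
  have "((\<lambda>h. f ((x + s *\<^sub>R b) + h *\<^sub>R b)) has_real_derivative pd b f (x + s *\<^sub>R b)) (at 0)"
    by (rule smooth_fun_has_pd[OF assms])
  then show ?thesis
    using DERIV_shift[of "\<lambda>s. f (x + s *\<^sub>R b)" "pd b f (x + s *\<^sub>R b)" 0 s]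
    by (simp add: algebra_simps)
qed

text \<open>A set of continuous functions whose partial derivatives lie in the algebra it generates
  consists of smooth functions: the algebra itself is closed under differentiation.\<close>
inductive_set fun_alg :: "('a \<Rightarrow> real) set \<Rightarrow> ('a \<Rightarrow> real) set" for B where
  base: "f \<in> B \<Longrightarrow> f \<in> fun_alg B"
| add: "f \<in> fun_alg B \<Longrightarrow> g \<in> fun_alg B \<Longrightarrow> (\<lambda>x. f x + g x) \<in> fun_alg B"
| mult: "f \<in> fun_alg B \<Longrightarrow> g \<in> fun_alg B \<Longrightarrow> (\<lambda>x. f x * g x) \<in> fun_alg B"

lemma smooth_fun_alg:
  fixes f :: "'a::euclidean_space \<Rightarrow> real"
  assumes "f \<in> fun_alg B" and cont: "\<And>f. f \<in> B \<Longrightarrow> continuous_on UNIV f"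
    and der: "\<And>f b. f \<in> B \<Longrightarrow> b \<in> Basis \<Longrightarrow>
      \<exists>g\<in>fun_alg B. \<forall>x. ((\<lambda>s. f (x + s *\<^sub>R b)) has_real_derivative g x) (at 0)"
  shows "smooth_fun f"
proof (rule smooth_fun_coinduct[OF assms(1)])
  show "continuous_on UNIV h" if "h \<in> fun_alg B" for h
    using that by induction (auto intro: cont continuous_intros)
  show "\<exists>g\<in>fun_alg B. \<forall>x. ((\<lambda>s. h (x + s *\<^sub>R b)) has_real_derivative g x) (at 0)"
    if "h \<in> fun_alg B" "b \<in> Basis" for h b
    using that
  proof induction
    case (base f) then show ?case using der by blast
  next
    case (add f g)
    then obtain f' g' where *: "f' \<in> fun_alg B" "g' \<in> fun_alg B"
      "\<forall>x. ((\<lambda>s. f (x + s *\<^sub>R b)) has_real_derivative f' x) (at 0)"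
      "\<forall>x. ((\<lambda>s. g (x + s *\<^sub>R b)) has_real_derivative g' x) (at 0)" by metis
    show ?case
      by (rule bexI[of _ "\<lambda>x. f' x + g' x"]) (use * in \<open>auto intro!: fun_alg.add DERIV_add\<close>)
  next
    case (mult f g)
    then obtain f' g' where *: "f' \<in> fun_alg B" "g' \<in> fun_alg B"
      "\<forall>x. ((\<lambda>s. f (x + s *\<^sub>R b)) has_real_derivative f' x) (at 0)"
      "\<forall>x. ((\<lambda>s. g (x + s *\<^sub>R b)) has_real_derivative g' x) (at 0)" by metis
    have "((\<lambda>s. f (x + s *\<^sub>R b) * g (x + s *\<^sub>R b)) has_real_derivative f' x * g x + g' x * f x) (at 0)" for x
      using DERIV_mult[OF *(3)[rule_format, of x] *(4)[rule_format, of x]] by simp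
    then show ?case
      by (intro bexI[of _ "\<lambda>x. f' x * g x + g' x * f x"])
         (use * mult in \<open>auto intro!: fun_alg.add fun_alg.mult\<close>)
  qed
qed

lemma smooth_fun_const [intro, simp]: "smooth_fun (\<lambda>_. c)"
  by (rule smooth_fun_coinduct[of _ "range (\<lambda>c _. c)"]) (auto intro!: exI[of _ 0])

lemma smooth_fun_inner [intro, simp]: "smooth_fun (\<lambda>x. x \<bullet> v)"
proof (rule smooth_fun_coinduct[of _ "insert (\<lambda>x. x \<bullet> v) (Collect smooth_fun)"])
  fix f :: "'a \<Rightarrow> real" and b :: 'a
  assume f: "f \<in> insert (\<lambda>x. x \<bullet> v) (Collect smooth_fun)" and b: "b \<in> Basis"
  have "((\<lambda>s. (x + s *\<^sub>R b) \<bullet> v) has_real_derivative b \<bullet> v) (at 0)" for x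
    by (auto intro!: derivative_eq_intros simp: inner_simps)
  note inner = this
  show "\<exists>g\<in>insert (\<lambda>x. x \<bullet> v) (Collect smooth_fun).
          \<forall>x. ((\<lambda>s. f (x + s *\<^sub>R b)) has_real_derivative g x) (at 0)"
    using f unfolding insert_iff
  proof (elim disjE)
    assume "f = (\<lambda>x. x \<bullet> v)"
    with inner show ?thesis by (intro bexI[of _ "\<lambda>_. b \<bullet> v"]) auto
  next
    assume "f \<in> Collect smooth_fun"
    then show ?thesis using smooth_fun_has_pd[OF _ b] smooth_fun_pd[OF _ b] by blast
  qed
qed (auto intro: smooth_fun_continuous intro!: continuous_intros)

lemma smooth_fun_algI:
  assumes "f \<in> fun_alg (Collect smooth_fun)" shows "smooth_fun f"
  by (rule smooth_fun_alg[OF assms])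
     (auto intro: smooth_fun_continuous fun_alg.base smooth_fun_pd smooth_fun_has_pd)

lemma smooth_fun_add [intro]: "smooth_fun f \<Longrightarrow> smooth_fun g \<Longrightarrow> smooth_fun (\<lambda>x. f x + g x)"
  by (intro smooth_fun_algI fun_alg.intros) auto

lemma smooth_fun_mult [intro]: "smooth_fun f \<Longrightarrow> smooth_fun g \<Longrightarrow> smooth_fun (\<lambda>x. f x * g x)"
  by (intro smooth_fun_algI fun_alg.intros) auto

lemma smooth_fun_diff [intro]: "smooth_fun f \<Longrightarrow> smooth_fun g \<Longrightarrow> smooth_fun (\<lambda>x. f x - g x)"
  using smooth_fun_add[of f "\<lambda>x. (-1) * g x"] smooth_fun_mult[of "\<lambda>_. -1" g] by simp

lemma smooth_fun_sum [intro]: "(\<And>i. i \<in> I \<Longrightarrow> smooth_fun (f i)) \<Longrightarrow> smooth_fun (\<lambda>x. \<Sum>i\<in>I. f i x)"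
  by (induction I rule: infinite_finite_induct) auto

text \<open>By the chain rule a derivative of a composition is another composition with the same
  \<open>h\<close>, times a derivative of \<open>h\<close>. So all compositions with
  \<open>h\<close>, for every smooth \<open>p\<close> at once, are taken as generators next to the
  smooth functions.\<close>

lemma smooth_fun_compose:
  fixes h :: "'a::euclidean_space \<Rightarrow> real" and p :: "real \<Rightarrow> real"
  assumes p: "smooth_fun p" and h: "smooth_fun h"
  shows "smooth_fun (\<lambda>x. p (h x))"
proof -
  let ?B = "Collect smooth_fun \<union> {\<lambda>x. p (h x) | p. smooth_fun p}"
  show ?thesis
  proof (rule smooth_fun_alg[where B = ?B])
    show "(\<lambda>x. p (h x)) \<in> fun_alg ?B" using p by (auto intro!: fun_alg.base)
    show "continuous_on UNIV f" if "f \<in> ?B" for f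
      using that h by (auto intro: smooth_fun_continuous continuous_on_compose2)
    show "\<exists>g\<in>fun_alg ?B. \<forall>x. ((\<lambda>s. f (x + s *\<^sub>R b)) has_real_derivative g x) (at 0)"
      if "f \<in> ?B" "b \<in> Basis" for f b
      using that(1)
    proof
      assume "f \<in> Collect smooth_fun"
      then show ?thesis using smooth_fun_has_pd[OF _ that(2)] smooth_fun_pd[OF _ that(2)]
        by (intro bexI[of _ "pd b f"]) (blast intro: fun_alg.base)+
    next
      assume "f \<in> {\<lambda>x. p (h x) | p. smooth_fun p}"
      then obtain q where q: "f = (\<lambda>x. q (h x))" "smooth_fun q" by blast
      have "((\<lambda>s. q (h (x + s *\<^sub>R b))) has_real_derivative pd 1 q (h x) * pd b h x) (at 0)" for x
        by (rule DERIV_chain2[where g="\<lambda>s. h (x + s *\<^sub>R b)"])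
           (use smooth_fun_has_pd[OF h that(2)] smooth_fun_has_pd_along[OF q(2), of 1 0]
             smooth_fun_has_pd_along[OF q(2), of 1 "h x" 0]
             DERIV_shift[of q "pd 1 q (h x)" 0 "h x"] in \<open>auto simp: add.commute\<close>)
      then show ?thesis
        by (intro bexI[of _ "\<lambda>x. pd 1 q (h x) * pd b h x"])
           (use q smooth_fun_pd[OF h that(2)] smooth_fun_pd[OF q(2), of 1] in
             \<open>auto intro!: fun_alg.mult[of "\<lambda>x. pd 1 q (h x)"] intro: fun_alg.base\<close>)
    qed
  qed
qed

text \<open>A derivative of \<open>inverse h\<close> is a smooth function times two copies of
  \<open>inverse h\<close>, so this single generator is enough besides the smooth functions.\<close>

lemma smooth_fun_inverse:
  fixes h :: "'a::euclidean_space \<Rightarrow> real"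
  assumes h: "smooth_fun h" and nz: "\<And>x. h x \<noteq> 0"
  shows "smooth_fun (\<lambda>x. inverse (h x))"
proof -
  let ?i = "\<lambda>x. inverse (h x)"
  let ?B = "insert ?i (Collect smooth_fun)"
  show ?thesis
  proof (rule smooth_fun_alg[where B = ?B])
    show "?i \<in> fun_alg ?B" by (auto intro!: fun_alg.base)
    show "continuous_on UNIV f" if "f \<in> ?B" for f
      using that h nz by (auto intro: smooth_fun_continuous intro!: continuous_on_inverse)
    show "\<exists>g\<in>fun_alg ?B. \<forall>x. ((\<lambda>s. f (x + s *\<^sub>R b)) has_real_derivative g x) (at 0)"
      if "f \<in> ?B" "b \<in> Basis" for f b
      using that(1)
    proof
      assume "f \<in> Collect smooth_fun"
      then show ?thesis using smooth_fun_has_pd[OF _ that(2)] smooth_fun_pd[OF _ that(2)]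
        by (intro bexI[of _ "pd b f"]) (blast intro: fun_alg.base)+
    next
      assume f: "f = ?i"
      have "((\<lambda>s. inverse (h (x + s *\<^sub>R b))) has_real_derivative ((\<lambda>x. -1 * pd b h x) x * (?i x * ?i x))) (at 0)" for x
        by (rule DERIV_cong[OF DERIV_inverse'[OF smooth_fun_has_pd[OF h that(2)]]]) (use nz in auto)
      then show ?thesis unfolding f
        by (intro bexI[of _ "\<lambda>x. (\<lambda>x. -1 * pd b h x) x * (?i x * ?i x)"])
           (rule allI, assumption, intro fun_alg.mult[of "\<lambda>x. - 1 * pd b h x"] fun_alg.mult[of ?i] fun_alg.base,
             use smooth_fun_mult[OF smooth_fun_const[of "-1"] smooth_fun_pd[OF h that(2)]] in auto)
    qed
  qed
qed

lemma smooth_fun_real_derivI: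
  fixes F f :: "real \<Rightarrow> real"
  assumes f: "smooth_fun f" and F: "\<And>x. (F has_real_derivative f x) (at x)"
  shows "smooth_fun F"
proof (rule smooth_fun_coinduct[of _ "insert F (Collect smooth_fun)"])
  show "continuous_on UNIV h" if "h \<in> insert F (Collect smooth_fun)" for h
    using that F by (auto intro: smooth_fun_continuous DERIV_continuous_on)
  have "((\<lambda>s. F (x + s)) has_real_derivative f x) (at 0)" for x
    using F[of x] DERIV_shift[of F "f x" 0 x] by (simp add: add.commute)
  then show "\<exists>g\<in>insert F (Collect smooth_fun). \<forall>x. ((\<lambda>s. h (x + s *\<^sub>R b)) has_real_derivative g x) (at 0)"
    if "h \<in> insert F (Collect smooth_fun)" "b \<in> Basis" for h b
    using that(1) unfolding insert_iff
  proof (elim disjE)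
    assume "h = F"
    with that(2) f \<open>\<And>x. ((\<lambda>s. F (x + s)) has_real_derivative f x) (at 0)\<close> show ?thesis
      by (intro bexI[of _ f]) auto
  next
    assume "h \<in> Collect smooth_fun"
    then show ?thesis using smooth_fun_has_pd[OF _ that(2)] smooth_fun_pd[OF _ that(2)] by blast
  qed
qed auto

lemma smooth_fun_exp: "smooth_fun (\<lambda>s::real. exp (c * s))"
proof (rule smooth_fun_coinduct[of _ "range (\<lambda>a s::real. a * exp (c * s))"])
  show "\<exists>g\<in>range (\<lambda>a s::real. a * exp (c * s)). \<forall>x. ((\<lambda>s. h (x + s *\<^sub>R b)) has_real_derivative g x) (at 0)"
    if "h \<in> range (\<lambda>a s::real. a * exp (c * s))" "b \<in> Basis" for h b
  proof -
    note H = that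
    obtain a where "h = (\<lambda>s. a * exp (c * s))" using H(1) by (elim rangeE)
    with H(2) have a: "h = (\<lambda>s. a * exp (c * s))" "b = 1" by auto
    show ?thesis
      by (rule bexI[of _ "\<lambda>s. (a * c) * exp (c * s)"]) (auto simp: a intro!: derivative_eq_intros)
  qed
qed (auto intro!: continuous_intros image_eqI[of _ _ 1])

lemma smooth_fun_cos: "smooth_fun (\<lambda>s::real. cos (c * s))"
proof (rule smooth_fun_coinduct[of _ "range (\<lambda>(a,b) s::real. a * cos (c * s) + b * sin (c * s))"])
  show "\<exists>g\<in>range (\<lambda>(a,b) s::real. a * cos (c * s) + b * sin (c * s)).
          \<forall>x. ((\<lambda>s. h (x + s *\<^sub>R b)) has_real_derivative g x) (at 0)"
    if "h \<in> range (\<lambda>(a,b) s::real. a * cos (c * s) + b * sin (c * s))" "b \<in> Basis" for h b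
  proof -
    note H = that
    obtain ae where "h = (\<lambda>(a,b) s. a * cos (c * s) + b * sin (c * s)) ae" using H(1) by (elim rangeE)
    then obtain a e where "h = (\<lambda>s. a * cos (c * s) + e * sin (c * s))" by (cases ae) auto
    with H(2) have a: "h = (\<lambda>s. a * cos (c * s) + e * sin (c * s))" "b = 1" by auto
    show ?thesis
      by (rule bexI[of _ "\<lambda>s. (e * c) * cos (c * s) + (- a * c) * sin (c * s)"])
         (auto simp: a intro!: derivative_eq_intros image_eqI[of _ _ "(e * c, - a * c)"])
  qed
qed (auto intro!: continuous_intros image_eqI[of _ _ "(1,0)"])

text \<open>The classical flat function \<open>exp (- (1 / s))\<close>, extended by 0, with powers
  of \<open>1 / s\<close> attached: its derivatives are linear combinations of exactly these
  functions.\<close>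

definition flat_exp :: "nat \<Rightarrow> real \<Rightarrow> real" where
  "flat_exp k s = (if s > 0 then (1 / s) ^ k * exp (- (1 / s)) else 0)"

text \<open>For positive \<open>s\<close> the exponential of \<open>1 / s\<close> exceeds the term
  of order \<open>k + 2\<close> of its series. The two powers beyond \<open>k\<close> leave a
  quadratic bound, which is what makes the derivative at 0 exist and vanish.\<close>

lemma flat_exp_le: "\<bar>flat_exp k s\<bar> \<le> fact (k + 2) * s\<^sup>2"
proof (cases "s > 0")
  case True
  have "(1 / s) ^ (k + 2) / fact (k + 2) \<le> exp (1 / s)"
    using sum_le_suminf[OF summable_exp, of "{k + 2}" "1 / s"] True
    by (simp add: exp_def divide_inverse mult.commute del: fact_Suc power_Suc)
  then have "(1 / s) ^ (k + 2) * exp (- (1 / s)) \<le> fact (k + 2)"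
    by (simp add: exp_minus inverse_eq_divide pos_divide_le_eq mult.commute del: fact_Suc power_Suc)
  then have "((1 / s) ^ (k + 2) * exp (- (1 / s))) * s\<^sup>2 \<le> fact (k + 2) * s\<^sup>2"
    by (rule mult_right_mono) auto
  then show ?thesis using True by (simp add: flat_exp_def power_add divide_simps power2_eq_square mult_ac)
qed (auto simp: flat_exp_def)

lemma DERIV_flat_exp:
  "(flat_exp k has_real_derivative flat_exp (k + 2) s - real k * flat_exp (k + 1) s) (at s)"
proof -
  consider "s > 0" | "s < 0" | "s = 0" by linarith
  then show ?thesis
  proof cases
    case 1
    have inv: "((\<lambda>s. 1 / s) has_real_derivative - ((1 / s) * (1 / s))) (at s)"
      using 1 by (auto intro!: derivative_eq_intros)
    have "((\<lambda>s. (1 / s) ^ k) has_real_derivative - real k * (1 / s) ^ (k + 1)) (at s)"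
      by (rule DERIV_cong[OF DERIV_power[OF inv]]) (cases k; simp add: algebra_simps add_divide_distrib diff_divide_distrib)
    moreover have "((\<lambda>s. exp (- (1 / s))) has_real_derivative exp (- (1 / s)) * ((1 / s) * (1 / s))) (at s)"
      by (rule DERIV_cong[OF DERIV_fun_exp[OF DERIV_minus[OF inv]]]) simp
    ultimately have "((\<lambda>s. (1 / s) ^ k * exp (- (1 / s))) has_real_derivative
        - real k * (1 / s) ^ (k + 1) * exp (- (1 / s)) + exp (- (1 / s)) * ((1 / s) * (1 / s)) * (1 / s) ^ k) (at s)"
      by (rule DERIV_mult)
    then have "((\<lambda>s. (1 / s) ^ k * exp (- (1 / s))) has_real_derivative flat_exp (k + 2) s - real k * flat_exp (k + 1) s) (at s)"
      by (rule DERIV_cong) (use 1 in \<open>simp add: flat_exp_def mult_ac\<close>)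
    then show ?thesis
      by (rule has_field_derivative_transform_within_open[of _ _ _ "{0<..}"]) (use 1 in \<open>auto simp: flat_exp_def\<close>)
  next
    case 2
    have "((\<lambda>s. 0) has_real_derivative flat_exp (k + 2) s - real k * flat_exp (k + 1) s) (at s)"
      using 2 by (auto simp: flat_exp_def)
    then show ?thesis
      by (rule has_field_derivative_transform_within_open[of _ _ _ "{..<0}"]) (use 2 in \<open>auto simp: flat_exp_def\<close>)
  next
    case 3
    have "((\<lambda>h. flat_exp k h / h) \<longlongrightarrow> 0) (at 0)"
    proof (rule Lim_null_comparison[where g="\<lambda>h. fact (k+2) * \<bar>h\<bar>"])
      show "\<forall>\<^sub>F h in at 0. norm (flat_exp k h / h) \<le> fact (k + 2) * \<bar>h\<bar>"
      proof (intro always_eventually allI)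
        fix h :: real
        have "\<bar>flat_exp k h\<bar> \<le> fact (k + 2) * \<bar>h\<bar> * \<bar>h\<bar>"
          using flat_exp_le[of k h] by (simp add: power2_eq_square mult.assoc del: fact_Suc)
        then show "norm (flat_exp k h / h) \<le> fact (k + 2) * \<bar>h\<bar>"
          by (cases "h = 0") (auto simp: pos_divide_le_eq abs_divide simp del: fact_Suc)
      qed
      show "((\<lambda>h::real. fact (k + 2) * \<bar>h\<bar>) \<longlongrightarrow> 0) (at 0)"
        by (auto intro!: tendsto_eq_intros)
    qed
    then show ?thesis using 3 by (simp add: DERIV_def flat_exp_def)
  qed
qed

lemma smooth_fun_flat_exp: "smooth_fun (flat_exp k)"
proof -
  let ?B = "range flat_exp \<union> Collect smooth_fun"
  show ?thesis
  proof (rule smooth_fun_alg[where B = ?B])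
    show "flat_exp k \<in> fun_alg ?B" by (auto intro: fun_alg.base)
    show "continuous_on UNIV f" if "f \<in> ?B" for f
      using that by (auto intro: smooth_fun_continuous DERIV_continuous_on DERIV_flat_exp)
    show "\<exists>g\<in>fun_alg ?B. \<forall>x. ((\<lambda>s. f (x + s *\<^sub>R b)) has_real_derivative g x) (at 0)"
      if "f \<in> ?B" "b \<in> Basis" for f b
      using that(1)
    proof
      assume "f \<in> Collect smooth_fun"
      then show ?thesis using smooth_fun_has_pd[OF _ that(2)] smooth_fun_pd[OF _ that(2)]
        by (intro bexI[of _ "pd b f"]) (blast intro: fun_alg.base)+
    next
      assume "f \<in> range flat_exp"
      then obtain k where k: "f = flat_exp k" by blast
      have "((\<lambda>s. flat_exp k (x + s)) has_real_derivative flat_exp (k + 2) x + (\<lambda>_. - real k) x * flat_exp (k + 1) x) (at 0)" for x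
        using DERIV_flat_exp[of k x] DERIV_shift[of "flat_exp k" _ 0 x] by (simp add: add.commute)
      then show ?thesis using that(2) unfolding k
        by (intro bexI[of _ "\<lambda>x. flat_exp (k + 2) x + (\<lambda>_. - real k) x * flat_exp (k + 1) x"])
           (use that(2) in \<open>simp; fail | (intro fun_alg.add[of "flat_exp (k + 2)"] fun_alg.mult[of "\<lambda>_. - real k"] fun_alg.base; simp)\<close>)+
    qed
  qed
qed

lemma flat_exp_nonneg: "0 \<le> flat_exp k s" and flat_exp_pos: "0 < s \<Longrightarrow> 0 < flat_exp k s"
  and flat_exp_0_le_1: "flat_exp 0 s \<le> 1" and flat_exp_eq_0: "s \<le> 0 \<Longrightarrow> flat_exp k s = 0"
  by (auto simp: flat_exp_def)

lemma smooth_fun_translate: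
  assumes "smooth_fun f" shows "smooth_fun (\<lambda>x. f (x - a))"
proof (rule smooth_fun_coinduct[of _ "{\<lambda>x. f (x - a) | f. smooth_fun f}"])
  show "\<exists>g\<in>{\<lambda>x. f (x - a) | f. smooth_fun f}. \<forall>x. ((\<lambda>s. h (x + s *\<^sub>R b)) has_real_derivative g x) (at 0)"
    if "h \<in> {\<lambda>x. f (x - a) | f. smooth_fun f}" "b \<in> Basis" for h b
  proof -
    note H = that
    obtain f where f: "h = (\<lambda>x. f (x - a))" "smooth_fun f" using H(1) by (elim CollectE exE conjE)
    have "((\<lambda>s. f (x + s *\<^sub>R b - a)) has_real_derivative pd b f (x - a)) (at 0)" for x
      using smooth_fun_has_pd[OF f(2) that(2), of "x - a"] by (simp add: algebra_simps)
    then show ?thesis using f that(2)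
      by (intro bexI[of _ "\<lambda>x. pd b f (x - a)"]) (auto intro: smooth_fun_pd)
  qed
next
  show "(\<lambda>x. f (x - a)) \<in> {\<lambda>x. f (x - a) | f. smooth_fun f}" using assms by blast
  show "continuous_on UNIV h" if "h \<in> {\<lambda>x. f (x - a) | f. smooth_fun f}" for h
  proof -
    note H = that
    obtain f where "h = (\<lambda>x. f (x - a))" "smooth_fun f" using H by (elim CollectE exE conjE)
    then show ?thesis
      using continuous_on_compose2[OF smooth_fun_continuous[of f UNIV], of UNIV "\<lambda>x. x - a"]
      by (simp add: continuous_on_diff)
  qed
qed

lemma pd_translate: "pd b (\<lambda>x. f (x - a)) z = pd b f (z - a)"
  unfolding pd_def by (simp add: algebra_simps)

lemma pd_mult:
  assumes "smooth_fun f" "smooth_fun g" "b \<in> Basis"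
  shows "pd b (\<lambda>x. f x * g x) z = pd b f z * g z + f z * pd b g z"
  by (rule pd_eqI, rule DERIV_cong[OF DERIV_mult[OF smooth_fun_has_pd[OF assms(1,3)] smooth_fun_has_pd[OF assms(2,3)]]])
     (simp add: mult.commute)

lemma pd_inverse:
  assumes "smooth_fun h" "b \<in> Basis" "h z \<noteq> 0"
  shows "pd b (\<lambda>x. inverse (h x)) z = - pd b h z * (inverse (h z) * inverse (h z))"
  by (rule pd_eqI, rule DERIV_cong[OF DERIV_inverse'[OF smooth_fun_has_pd[OF assms(1,2)]]])
     (use assms(3) in simp_all)

subsection \<open>Measures on time, space and the space-time slab\<close>

text \<open>Densities keep the whole space as carrier, so measurability with respect to these
  measures is plain Borel measurability, and integrals over slabs of different length can be
  compared without changing the type of the integrand.\<close>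

definition tm :: "real \<Rightarrow> real measure" where
  "tm T = density lborel (\<lambda>t. ennreal (indicator {0<..<T} t))"

definition cm :: "(real^'d) measure" where
  "cm = density lborel (\<lambda>x. ennreal (indicator cell x))"

definition ST :: "real \<Rightarrow> (real \<times> (real^'d)) measure" where
  "ST T = density lborel (\<lambda>z. ennreal (indicator ({0<..<T} \<times> cell) z))"

lemma space_tm [simp]: "space (tm T) = UNIV"
  and space_cm [simp]: "space cm = UNIV" and space_ST [simp]: "space (ST T) = UNIV"
  by (auto simp: tm_def cm_def ST_def)

lemma sets_tm [simp, measurable_cong]: "sets (tm T) = sets borel"
  and sets_cm [simp, measurable_cong]: "sets cm = sets borel"
  and sets_ST [simp, measurable_cong]: "sets (ST T) = sets borel"
  by (auto simp: tm_def cm_def ST_def)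

lemma borel_measurable_tm_iff [simp]: "borel_measurable (tm T) = borel_measurable borel"
  and borel_measurable_cm_iff [simp]: "borel_measurable cm = borel_measurable borel"
  and borel_measurable_ST_iff [simp]: "borel_measurable (ST T) = borel_measurable borel"
  by (auto intro!: measurable_cong_sets)

lemma cell_borel [measurable, simp]: "cell \<in> sets borel"
  by (simp add: cell_def)

lemma slab_borel [measurable, simp]: "({0<..<T::real} \<times> (cell :: (real^'d) set)) \<in> sets borel"
  by (subst borel_prod[symmetric]) (intro pair_measureI; simp)

lemma finite_measure_density_indicator:
  assumes "A \<in> sets borel" "bounded A"
  shows "finite_measure (density lborel (\<lambda>z::'a::euclidean_space. ennreal (indicator A z)))"
  using emeasure_bounded_finite[OF assms(2)] assms(1)
  by (intro finite_measureI) (simp add: ennreal_indicator emeasure_density less_top)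

lemma bounded_cell: "bounded (cell :: (real^'d) set)"
  by (simp add: cell_def)

interpretation tm: finite_measure "tm T"
  unfolding tm_def by (rule finite_measure_density_indicator) auto

interpretation cm: finite_measure cm
  unfolding cm_def by (rule finite_measure_density_indicator) (auto simp: bounded_cell)

interpretation ST: finite_measure "ST T"
  unfolding ST_def by (rule finite_measure_density_indicator) (auto simp: bounded_cell intro!: bounded_Times)

interpretation TC: pair_sigma_finite "tm T" "cm :: (real^'d) measure" by standard

interpretation STT: pair_sigma_finite "ST S" "ST T" by standard

lemma ST_pair: "ST T = tm T \<Otimes>\<^sub>M (cm :: (real^'d) measure)"
proof -
  have "tm T \<Otimes>\<^sub>M (cm :: (real^'d) measure) =
    density (lborel \<Otimes>\<^sub>M lborel) (\<lambda>(x,y). ennreal (indicator {0<..<T} x) * ennreal (indicator cell y))"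
    unfolding tm_def cm_def
    by (rule pair_measure_density)
       (use cm.sigma_finite_measure_axioms in \<open>auto simp: lborel.sigma_finite_measure_axioms cm_def\<close>)
  also have "\<dots> = ST T" unfolding ST_def lborel_prod
  proof (intro density_cong AE_I2)
    have "(\<lambda>z::real \<times> (real^'d). ennreal (indicator {0<..<T} (fst z)) * ennreal (indicator cell (snd z))) \<in> borel_measurable (borel \<Otimes>\<^sub>M borel)"
      by measurable
    then show "(\<lambda>(x::real, y::real^'d). ennreal (indicator {0<..<T} x) * ennreal (indicator cell y)) \<in> borel_measurable lborel"
      by (simp add: borel_prod case_prod_beta)
  qed (auto simp: indicator_def)
  finally show ?thesis ..
qed

lemma AE_ST: "(AE z in ST T. P z) \<longleftrightarrow> (AE z in lborel. z \<in> {0<..<T} \<times> cell \<longrightarrow> P z)"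
  unfolding ST_def by (subst AE_density) (auto simp: indicator_def)

lemma AE_cm: "(AE x in cm. P x) \<longleftrightarrow> (AE x in lborel. x \<in> cell \<longrightarrow> P x)"
  unfolding cm_def by (subst AE_density) (auto simp: indicator_def)

lemma AE_tm: "(AE x in tm T. P x) \<longleftrightarrow> (AE x in lborel. x \<in> {0<..<T} \<longrightarrow> P x)"
  unfolding tm_def by (subst AE_density) (auto simp: indicator_def)

lemma STint_eq:
  "(\<lambda>z. f (fst z) (snd z)) \<in> borel_measurable borel \<Longrightarrow>
    STint T f = (\<integral>z. f (fst z) (snd z) \<partial>ST T)"
  unfolding STint_def ST_def set_lebesgue_integral_def
  by (subst integral_density) auto

lemma STintegrable_eq:
  "(\<lambda>z. f (fst z) (snd z)) \<in> borel_measurable borel \<Longrightarrow>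
    STintegrable T f = integrable (ST T) (\<lambda>z. f (fst z) (snd z))"
  unfolding STintegrable_def ST_def set_integrable_def
  by (subst integrable_density) auto

lemma Sint_eq: "f \<in> borel_measurable borel \<Longrightarrow> Sint f = (\<integral>x. f x \<partial>cm)"
  unfolding Sint_def cm_def set_lebesgue_integral_def
  by (subst integral_density) auto

lemma set_integrable_cell_eq:
  "f \<in> borel_measurable borel \<Longrightarrow> set_integrable lborel cell f = integrable cm (f :: _ \<Rightarrow> real)"
  unfolding cm_def set_integrable_def by (subst integrable_density) auto

lemma ST_mono_integral:
  fixes f :: "real \<times> (real^'d) \<Rightarrow> real"
  assumes "S \<le> T" and [measurable]: "f \<in> borel_measurable borel"
  shows "(\<integral>z. f z \<partial>ST S) = (\<integral>z. indicator ({..<S} \<times> UNIV) z * f z \<partial>ST T)"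
proof -
  have [measurable]: "({..<S} \<times> (UNIV :: (real^'d) set)) \<in> sets borel"
    by (subst borel_prod[symmetric]) (intro pair_measureI; simp)
  show ?thesis unfolding ST_def
    by (subst (1 2) integral_density) (auto intro!: Bochner_Integration.integral_cong simp: indicator_def assms(1) order_less_le_trans)
qed

lemma integrable_bounded_ST:
  fixes f :: "_ \<Rightarrow> real"
  assumes "f \<in> borel_measurable borel" "AE z in ST T. \<bar>f z\<bar> \<le> C"
  shows "integrable (ST T) f"
  by (rule ST.integrable_const_bound[of _ C]) (use assms in auto)

lemma integrable_mult_bounded:
  fixes f :: "_ \<Rightarrow> real"
  assumes "integrable M A" "f \<in> borel_measurable M" "AE z in M. \<bar>f z\<bar> \<le> C"
  shows "integrable M (\<lambda>z. A z * f z)"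
proof (rule Bochner_Integration.integrable_bound)
  show "integrable M (\<lambda>z. \<bar>C\<bar> * A z)" using assms by auto
  show "AE x in M. norm (A x * f x) \<le> norm (\<bar>C\<bar> * A x)"
    using assms(3)
  proof eventually_elim
    case (elim x)
    then have "\<bar>A x\<bar> * \<bar>f x\<bar> \<le> \<bar>A x\<bar> * \<bar>C\<bar>" by (intro mult_left_mono) auto
    then show ?case by (simp add: abs_mult mult.commute)
  qed
qed (use assms in auto)

subsection \<open>Bounded convergence in the mean\<close>

text \<open>Convergence in the mean under a common almost everywhere bound. This is what
  mollification yields for bounded functions, it survives products and continuous functions, and it
  suffices to pass to the limit against a factor that is merely integrable.\<close>

definition bconv :: "'a measure \<Rightarrow> (nat \<Rightarrow> 'a \<Rightarrow> real) \<Rightarrow> ('a \<Rightarrow> real) \<Rightarrow> bool" where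
  "bconv M F f \<longleftrightarrow> (\<forall>n. F n \<in> borel_measurable M) \<and> f \<in> borel_measurable M \<and>
     (\<exists>C. (\<forall>n. AE x in M. \<bar>F n x\<bar> \<le> C) \<and> (AE x in M. \<bar>f x\<bar> \<le> C)) \<and>
     (\<lambda>n. \<integral>x. \<bar>F n x - f x\<bar> \<partial>M) \<longlonglongrightarrow> 0"

text \<open>Convergence in the mean gives almost everywhere convergence only along subsequences;
  this principle recovers the convergence of the whole sequence.\<close>

lemma tendsto_by_subseq:
  fixes X :: "nat \<Rightarrow> 'a::metric_space"
  assumes "\<And>r. strict_mono r \<Longrightarrow> \<exists>s. strict_mono (s :: nat \<Rightarrow> nat) \<and> (\<lambda>n. X (r (s n))) \<longlonglongrightarrow> L"
  shows "X \<longlonglongrightarrow> L"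
proof (rule ccontr)
  assume "\<not> X \<longlonglongrightarrow> L"
  then have "\<exists>e>0. \<forall>N. \<exists>n\<ge>N. e \<le> dist (X n) L"
    by (simp add: lim_sequentially not_less)
  then obtain e where e: "e > 0" "\<forall>N. \<exists>n\<ge>N. e \<le> dist (X n) L" by (elim exE conjE)
  then have "infinite {n. e \<le> dist (X n) L}"
    by (simp add: infinite_nat_iff_unbounded_le)
  from infinite_enumerate[OF this] obtain r :: "nat \<Rightarrow> nat"
    where r: "strict_mono r" "\<forall>n. r n \<in> {n. e \<le> dist (X n) L}" by (elim exE conjE)
  from assms[OF r(1)] obtain s where s: "strict_mono (s :: nat \<Rightarrow> nat)" "(\<lambda>n. X (r (s n))) \<longlonglongrightarrow> L"
    by (elim exE conjE)
  from tendstoD[OF s(2) e(1)] obtain n where "dist (X (r (s n))) L < e"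
    using eventually_happens' sequentially_bot by blast
  moreover have "e \<le> dist (X (r (s n))) L" using r(2) by simp
  ultimately show False by linarith
qed

lemma L1_AE_subseq:
  fixes F :: "nat \<Rightarrow> 'a \<Rightarrow> real"
  assumes "\<And>n. integrable M (F n)" "integrable M f" "(\<lambda>n. \<integral>x. \<bar>F n x - f x\<bar> \<partial>M) \<longlonglongrightarrow> 0"
  obtains r where "strict_mono (r :: nat \<Rightarrow> nat)" "AE x in M. (\<lambda>n. F (r n) x) \<longlonglongrightarrow> f x"
proof -
  have "\<exists>r. strict_mono (r :: nat \<Rightarrow> nat) \<and> (AE x in M. (\<lambda>n. F (r n) x - f x) \<longlonglongrightarrow> 0)"
    by (rule tendsto_L1_AE_subseq) (use assms in auto)
  then show ?thesis using that by (auto simp: LIM_zero_iff)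
qed

context finite_measure
begin

lemma integrable_AE_bounded:
  fixes f :: "_ \<Rightarrow> real"
  shows "f \<in> borel_measurable M \<Longrightarrow> AE z in M. \<bar>f z\<bar> \<le> C \<Longrightarrow> integrable M f"
  by (rule integrable_const_bound[of _ C]) auto

lemma bconv_integrable: "bconv M F f \<Longrightarrow> integrable M (F n)" "bconv M F f \<Longrightarrow> integrable M f"
  unfolding bconv_def by (auto intro: integrable_AE_bounded)

lemma bconv_bounds:
  assumes "bconv M F f"
  obtains C where "C \<ge> 0" "\<And>n. AE x in M. \<bar>F n x\<bar> \<le> C" "AE x in M. \<bar>f x\<bar> \<le> C"
proof -
  obtain C where C: "\<And>n. AE x in M. \<bar>F n x\<bar> \<le> C" "AE x in M. \<bar>f x\<bar> \<le> C"
    using assms unfolding bconv_def by blast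
  show ?thesis
    by (rule that[of "\<bar>C\<bar>"]) (use C in \<open>auto intro: eventually_mono[OF C(1)] eventually_mono[OF C(2)]\<close>)
qed

text \<open>The bound on the limit need not be known beforehand: it is inherited along an almost
  everywhere convergent subsequence.\<close>

lemma bconv_L1I:
  assumes "\<And>n. F n \<in> borel_measurable M" "\<And>n. AE x in M. \<bar>F n x\<bar> \<le> C" "integrable M f"
    "(\<lambda>n. \<integral>x. \<bar>F n x - f x\<bar> \<partial>M) \<longlonglongrightarrow> 0"
  shows "bconv M F f"
proof -
  obtain r where r: "strict_mono (r :: nat \<Rightarrow> nat)" "AE x in M. (\<lambda>n. F (r n) x) \<longlonglongrightarrow> f x"
    using L1_AE_subseq[of M F f] assms integrable_AE_bounded by blast
  have "AE x in M. \<forall>n. \<bar>F n x\<bar> \<le> C" using assms(2) by (simp add: AE_all_countable)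
  with r(2) have "AE x in M. \<bar>f x\<bar> \<le> C"
  proof eventually_elim
    case (elim x)
    show ?case by (rule LIMSEQ_le_const2[OF tendsto_rabs[OF elim(1)]]) (use elim in auto)
  qed
  then show ?thesis unfolding bconv_def using assms by auto
qed

lemma bconv_AEI:
  assumes "\<And>n. F n \<in> borel_measurable M" "f \<in> borel_measurable M" "\<And>n. AE x in M. \<bar>F n x\<bar> \<le> C"
    "AE x in M. (\<lambda>n. F n x) \<longlonglongrightarrow> f x"
  shows "bconv M F f"
proof -
  have "AE x in M. \<forall>n. \<bar>F n x\<bar> \<le> C" using assms(3) by (simp add: AE_all_countable)
  with assms(4) have f: "AE x in M. \<bar>f x\<bar> \<le> C"
  proof eventually_elim
    case (elim x)
    show ?case by (rule LIMSEQ_le_const2[OF tendsto_rabs[OF elim(1)]]) (use elim in auto)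
  qed
  have "(\<lambda>n. \<integral>x. \<bar>F n x - f x\<bar> \<partial>M) \<longlonglongrightarrow> (\<integral>x. 0 \<partial>M)"
  proof (rule integral_dominated_convergence[where w="\<lambda>_. 2 * C"])
    show "AE x in M. (\<lambda>n. \<bar>F n x - f x\<bar>) \<longlonglongrightarrow> 0"
      using assms(4) by eventually_elim (metis LIM_zero tendsto_rabs_zero)
    show "AE x in M. norm \<bar>F n x - f x\<bar> \<le> 2 * C" for n
      using assms(3)[of n] f by eventually_elim auto
  qed (use assms in auto)
  then show ?thesis unfolding bconv_def using assms f by auto
qed

lemma bconv_subseq: "bconv M F f \<Longrightarrow> strict_mono r \<Longrightarrow> bconv M (\<lambda>n. F (r n)) f"
  unfolding bconv_def by (auto dest: LIMSEQ_subseq_LIMSEQ simp: o_def)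

lemma bconv_const: "f \<in> borel_measurable M \<Longrightarrow> AE x in M. \<bar>f x\<bar> \<le> C \<Longrightarrow> bconv M (\<lambda>_. f) f"
  unfolding bconv_def by auto

lemma bconv_AE_subseq:
  assumes "bconv M F f"
  obtains r where "strict_mono (r :: nat \<Rightarrow> nat)" "AE x in M. (\<lambda>n. F (r n) x) \<longlonglongrightarrow> f x"
  by (rule L1_AE_subseq[of M F f]) (use assms bconv_integrable[OF assms] in \<open>auto simp: bconv_def\<close>)

lemma bconv_cong:
  assumes "bconv M F f" "AE x in M. f x = g x" "\<And>n. AE x in M. F n x = G n x"
    "g \<in> borel_measurable M" "\<And>n. G n \<in> borel_measurable M"
  shows "bconv M G g"
proof -
  obtain C where C: "\<And>n. AE x in M. \<bar>F n x\<bar> \<le> C" "AE x in M. \<bar>f x\<bar> \<le> C" using bconv_bounds[OF assms(1)] by blast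
  have [measurable]: "\<And>n. F n \<in> borel_measurable M" "f \<in> borel_measurable M" using assms(1) by (auto simp: bconv_def)
  note [measurable] = assms(4,5)
  have "(\<integral>x. \<bar>F n x - f x\<bar> \<partial>M) = (\<integral>x. \<bar>G n x - g x\<bar> \<partial>M)" for n
    by (intro integral_cong_AE) (use assms(2) assms(3)[of n] in auto)
  moreover have "AE x in M. \<bar>G n x\<bar> \<le> C" for n using C(1)[of n] assms(3)[of n] by eventually_elim auto
  moreover have "AE x in M. \<bar>g x\<bar> \<le> C" using C(2) assms(2) by eventually_elim auto
  ultimately show ?thesis using assms unfolding bconv_def by auto
qed

text \<open>The values of both sequences stay in a compact rectangle, on which the continuous
  \<open>\<Phi>\<close> is bounded. Along suitable subsequences dominated convergence applies, and
  the limit does not depend on the subsequence.\<close>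

lemma bconv_comp2:
  fixes \<Phi> :: "real \<Rightarrow> real \<Rightarrow> real"
  assumes F: "bconv M F f" and G: "bconv M G g"
    and cont: "continuous_on UNIV (\<lambda>(a, b). \<Phi> a b)"
  shows "bconv M (\<lambda>n x. \<Phi> (F n x) (G n x)) (\<lambda>x. \<Phi> (f x) (g x))"
proof -
  have [measurable]: "\<And>n. F n \<in> borel_measurable M" "f \<in> borel_measurable M"
    "\<And>n. G n \<in> borel_measurable M" "g \<in> borel_measurable M" using F G by (auto simp: bconv_def)
  have meas: "(\<lambda>x. \<Phi> (h x) (k x)) \<in> borel_measurable M"
    if [measurable]: "h \<in> borel_measurable M" "k \<in> borel_measurable M" for h k
  proof -
    have [measurable]: "(\<lambda>(a, b). \<Phi> a b) \<in> borel_measurable borel"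
      by (rule borel_measurable_continuous_onI[OF cont])
    have "(\<lambda>x. (\<lambda>(a, b). \<Phi> a b) (h x, k x)) \<in> borel_measurable M" by measurable
    then show ?thesis by simp
  qed
  obtain C where C: "\<And>n. AE x in M. \<bar>F n x\<bar> \<le> C" "AE x in M. \<bar>f x\<bar> \<le> C" using bconv_bounds[OF F] by blast
  obtain D where D: "\<And>n. AE x in M. \<bar>G n x\<bar> \<le> D" "AE x in M. \<bar>g x\<bar> \<le> D" using bconv_bounds[OF G] by blast
  have "compact ((\<lambda>(a, b). \<Phi> a b) ` ({-C..C} \<times> {-D..D}))"
    by (intro compact_continuous_image continuous_on_subset[OF cont] compact_Times) auto
  from compact_imp_bounded[OF this] obtain B
    where B: "\<forall>y\<in>(\<lambda>(a, b). \<Phi> a b) ` ({-C..C} \<times> {-D..D}). norm y \<le> B"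
    unfolding bounded_iff by (elim exE)
  have Phi: "\<bar>\<Phi> a b\<bar> \<le> B" if "\<bar>a\<bar> \<le> C" "\<bar>b\<bar> \<le> D" for a b
  proof -
    have "(\<lambda>(a, b). \<Phi> a b) (a, b) \<in> (\<lambda>(a, b). \<Phi> a b) ` ({-C..C} \<times> {-D..D})"
      using that by (intro imageI) auto
    from B[rule_format, OF this] show ?thesis by simp
  qed
  have bF: "AE x in M. \<bar>\<Phi> (F n x) (G n x)\<bar> \<le> B" for n
    using C(1)[of n] D(1)[of n] by eventually_elim (rule Phi)
  have bf: "AE x in M. \<bar>\<Phi> (f x) (g x)\<bar> \<le> B"
    using C(2) D(2) by eventually_elim (rule Phi)
  have "(\<lambda>n. \<integral>x. \<bar>\<Phi> (F n x) (G n x) - \<Phi> (f x) (g x)\<bar> \<partial>M) \<longlonglongrightarrow> 0"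
  proof (rule tendsto_by_subseq)
    fix r :: "nat \<Rightarrow> nat" assume r: "strict_mono r"
    obtain s where s: "strict_mono (s :: nat \<Rightarrow> nat)" "AE x in M. (\<lambda>n. F (r (s n)) x) \<longlonglongrightarrow> f x"
      using bconv_AE_subseq[OF bconv_subseq[OF F r]] by blast
    have rs: "strict_mono (\<lambda>n. r (s n))" using r s by (auto simp: strict_mono_def)
    \<comment> \<open>Extracting again from the subsequence already chosen for \<open>F\<close>
      makes both sequences converge at almost every point.\<close>
    obtain q where q: "strict_mono (q :: nat \<Rightarrow> nat)" "AE x in M. (\<lambda>n. G (r (s (q n))) x) \<longlonglongrightarrow> g x"
      using bconv_AE_subseq[OF bconv_subseq[OF G rs]] by blast
    have "bconv M (\<lambda>n x. \<Phi> (F (r (s (q n))) x) (G (r (s (q n))) x)) (\<lambda>x. \<Phi> (f x) (g x))"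
    proof (rule bconv_AEI[where C=B])
      show "AE x in M. (\<lambda>n. \<Phi> (F (r (s (q n))) x) (G (r (s (q n))) x)) \<longlonglongrightarrow> \<Phi> (f x) (g x)"
        using s(2) q(2)
      proof eventually_elim
        case (elim x)
        have "(\<lambda>n. F (r (s (q n))) x) \<longlonglongrightarrow> f x" using LIMSEQ_subseq_LIMSEQ[OF elim(1) q(1)] by (simp add: o_def)
        then have "(\<lambda>n. (F (r (s (q n))) x, G (r (s (q n))) x)) \<longlonglongrightarrow> (f x, g x)"
          using elim(2) by (intro tendsto_Pair)
        then show ?case
          using continuous_on_tendsto_compose[OF cont, of _ "(f x, g x)"] by fastforce
      qed
    qed (use bF in \<open>auto intro: meas\<close>)
    then have "(\<lambda>n. \<integral>x. \<bar>\<Phi> (F (r (s (q n))) x) (G (r (s (q n))) x) - \<Phi> (f x) (g x)\<bar> \<partial>M) \<longlonglongrightarrow> 0"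
      by (simp add: bconv_def)
    then show "\<exists>s. strict_mono (s :: nat \<Rightarrow> nat) \<and>
      (\<lambda>n. \<integral>x. \<bar>\<Phi> (F (r (s n)) x) (G (r (s n)) x) - \<Phi> (f x) (g x)\<bar> \<partial>M) \<longlonglongrightarrow> 0"
      using s(1) q(1) by (intro exI[of _ "\<lambda>n. s (q n)"]) (auto simp: strict_mono_def)
  qed
  then show ?thesis unfolding bconv_def using bF bf by (auto intro: meas)
qed

lemma bconv_mult: "bconv M F f \<Longrightarrow> bconv M G g \<Longrightarrow> bconv M (\<lambda>n x. F n x * G n x) (\<lambda>x. f x * g x)"
  by (rule bconv_comp2) (auto intro!: continuous_intros simp: case_prod_beta)

lemma bconv_add: "bconv M F f \<Longrightarrow> bconv M G g \<Longrightarrow> bconv M (\<lambda>n x. F n x + G n x) (\<lambda>x. f x + g x)"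
  by (rule bconv_comp2) (auto intro!: continuous_intros simp: case_prod_beta)

lemma bconv_comp: "bconv M F f \<Longrightarrow> continuous_on UNIV \<Phi> \<Longrightarrow> bconv M (\<lambda>n x. \<Phi> (F n x)) (\<lambda>x. \<Phi> (f x))"
  by (rule bconv_comp2[of F f F f "\<lambda>a b. \<Phi> a"])
     (auto intro!: continuous_intros continuous_on_compose2[of UNIV \<Phi>] simp: case_prod_beta)

text \<open>Along almost everywhere convergent subsequences the integrands are dominated by a
  multiple of the integrable \<open>A\<close>; no bound on \<open>A\<close> enters.\<close>

lemma bconv_integral:
  assumes F: "bconv M F f" and A: "integrable M A"
  shows "(\<lambda>n. \<integral>x. A x * F n x \<partial>M) \<longlonglongrightarrow> (\<integral>x. A x * f x \<partial>M)"
proof (rule tendsto_by_subseq)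
  fix r :: "nat \<Rightarrow> nat" assume r: "strict_mono r"
  obtain s where s: "strict_mono (s :: nat \<Rightarrow> nat)" "AE x in M. (\<lambda>n. F (r (s n)) x) \<longlonglongrightarrow> f x"
    using bconv_AE_subseq[OF bconv_subseq[OF F r]] by blast
  obtain C where C: "C \<ge> 0" "\<And>n. AE x in M. \<bar>F n x\<bar> \<le> C" using bconv_bounds[OF F] by blast
  have [measurable]: "\<And>n. F n \<in> borel_measurable M" "f \<in> borel_measurable M" using F by (auto simp: bconv_def)
  have "(\<lambda>n. \<integral>x. A x * F (r (s n)) x \<partial>M) \<longlonglongrightarrow> (\<integral>x. A x * f x \<partial>M)"
  proof (rule integral_dominated_convergence[where w="\<lambda>x. \<bar>A x\<bar> * C"])
    show "AE x in M. (\<lambda>n. A x * F (r (s n)) x) \<longlonglongrightarrow> A x * f x"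
      using s(2) by eventually_elim (intro tendsto_intros)
    show "AE x in M. norm (A x * F (r (s n)) x) \<le> \<bar>A x\<bar> * C" for n
      using C(2)[of "r (s n)"] by eventually_elim (auto simp: abs_mult intro!: mult_left_mono)
  qed (use A in auto)
  then show "\<exists>s. strict_mono (s :: nat \<Rightarrow> nat) \<and>
      (\<lambda>n. \<integral>x. A x * F (r (s n)) x \<partial>M) \<longlonglongrightarrow> (\<integral>x. A x * f x \<partial>M)"
    using s(1) by (intro exI[of _ s] conjI)
qed

lemma bconv_integrable_mult:
  assumes F: "bconv M F f" and A: "integrable M A"
  shows "integrable M (\<lambda>x. A x * F n x)" "integrable M (\<lambda>x. A x * f x)"
  using assms bconv_bounds[OF F] by (auto simp: bconv_def intro!: integrable_mult_bounded)

end

subsection \<open>Periodicity\<close>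

definition lattice_pt :: "real^'d \<Rightarrow> bool" where
  "lattice_pt k \<longleftrightarrow> (\<forall>i. k $ i \<in> \<int>)"

text \<open>The three versions of the cell differ by a null set. The half-open one has translates
  that tile space exactly once; the open one keeps a point away from its lattice copies on the
  opposite faces.\<close>

lemma AE_cell_box: "AE x in lborel. x \<in> (cell :: (real^'d) set) \<longleftrightarrow> (\<forall>i. 0 \<le> x $ i \<and> x $ i < 1)"
  and AE_cm_box: "AE x in cm. x \<in> box 0 (One :: real^'d)"
proof -
  have "cbox 0 One - box 0 (One::real^'d) \<in> null_sets lborel"
    using negligible_frontier_interval[of 0 "One::real^'d"]
    by (simp add: negligible_iff_null_sets null_sets_completion_iff)
  then have *: "AE x in lborel. x \<notin> cbox 0 One - box 0 (One::real^'d)" by (rule AE_not_in)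
  have comp: "(One::real^'d) $ i = 1" for i
    by (simp add: cart_eq_inner_axis axis_in_Basis_iff)
  show "AE x in lborel. x \<in> (cell :: (real^'d) set) \<longleftrightarrow> (\<forall>i. 0 \<le> x $ i \<and> x $ i < 1)"
    using * by eventually_elim (auto simp: cell_def mem_box_cart comp less_imp_le simp del: sum_component)
  show "AE x in cm. x \<in> box 0 (One :: real^'d)"
    unfolding AE_cm using * by eventually_elim (auto simp: cell_def)
qed

lemma nn_integral_lborel_shift:
  fixes f :: "'a::euclidean_space \<Rightarrow> ennreal"
  assumes [measurable]: "f \<in> borel_measurable borel"
  shows "(\<integral>\<^sup>+x. f (c + x) \<partial>lborel) = (\<integral>\<^sup>+x. f x \<partial>lborel)"
proof -
  have "(\<integral>\<^sup>+x. f x \<partial>lborel) = (\<integral>\<^sup>+x. f x \<partial>distr lborel borel ((+) c))"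
    by (simp add: lborel_distr_plus)
  also have "\<dots> = (\<integral>\<^sup>+x. f (c + x) \<partial>lborel)" by (subst nn_integral_distr) auto
  finally show ?thesis ..
qed

text \<open>The usual unfolding argument: the sum of the indicator of the cell over all lattice
  translates is 1. Inserting it and exchanging sum and integral turns the shifted cell into the
  original one.\<close>

lemma nn_integral_cell_shift:
  fixes p :: "real^'d \<Rightarrow> ennreal"
  assumes p[measurable]: "p \<in> borel_measurable borel" and per: "\<And>x k. lattice_pt k \<Longrightarrow> p (x + k) = p x"
  shows "(\<integral>\<^sup>+y. p (y - a) \<partial>cm) = (\<integral>\<^sup>+y. p y \<partial>cm)"
proof -
  define Q where "Q = {x::real^'d. \<forall>i. 0 \<le> x $ i \<and> x $ i < 1}"
  have [measurable]: "Q \<in> sets borel" unfolding Q_def by measurable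
  define L where "L = (\<lambda>f::'d \<Rightarrow> int. (\<chi> i. of_int (f i)) :: real^'d)"
  have L: "lattice_pt (L f)" for f by (auto simp: L_def lattice_pt_def)
  \<comment> \<open>Exactly one lattice translate of \<open>z\<close> lies in the half-open box, the
    one by the negated floors of its coordinates.\<close>
  have one: "(\<integral>\<^sup>+f. indicator Q (z + L f) \<partial>count_space UNIV) = (1::ennreal)" for z
  proof -
    have "z + L f \<in> Q \<longleftrightarrow> f = (\<lambda>i. - \<lfloor>z $ i\<rfloor>)" for f
    proof
      assume "z + L f \<in> Q"
      then have "\<lfloor>z $ i + of_int (f i)\<rfloor> = 0" for i
        unfolding floor_eq_iff by (auto simp: Q_def L_def)
      then show "f = (\<lambda>i. - \<lfloor>z $ i\<rfloor>)" by (auto simp: fun_eq_iff algebra_simps eq_neg_iff_add_eq_0)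
    next
      assume "f = (\<lambda>i. - \<lfloor>z $ i\<rfloor>)"
      then show "z + L f \<in> Q" by (simp add: Q_def L_def) linarith
    qed
    then have "(\<integral>\<^sup>+f. indicator Q (z + L f) \<partial>count_space UNIV) =
       (\<integral>\<^sup>+f. indicator {\<lambda>i. - \<lfloor>z $ i\<rfloor>} f \<partial>count_space UNIV)"
      by (intro nn_integral_cong) (auto simp: indicator_def)
    then show ?thesis by simp
  qed
  have cell: "(\<integral>\<^sup>+y. q y \<partial>cm) = (\<integral>\<^sup>+y. indicator Q y * q y \<partial>lborel)"
    if [measurable]: "q \<in> borel_measurable borel" for q :: "real^'d \<Rightarrow> ennreal"
    unfolding cm_def
    by (subst nn_integral_density)
       (use AE_cell_box in \<open>auto intro!: nn_integral_cong_AE elim!: eventually_mono simp: Q_def indicator_def\<close>)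
  have "(\<integral>\<^sup>+y. p (y - a) \<partial>cm) = (\<integral>\<^sup>+y. indicator Q y * p (y - a) \<partial>lborel)"
    by (subst cell) auto
  also have "\<dots> = (\<integral>\<^sup>+y. indicator Q (a + y) * p y \<partial>lborel)"
    using nn_integral_lborel_shift[of "\<lambda>y. indicator Q y * p (y - a)" a] by simp
  also have "\<dots> = (\<integral>\<^sup>+y. (\<integral>\<^sup>+f. indicator Q (y + L f) * (indicator Q (a + y) * p y) \<partial>count_space UNIV) \<partial>lborel)"
    by (subst nn_integral_multc) (auto simp: one)
  also have "\<dots> = (\<integral>\<^sup>+f. (\<integral>\<^sup>+y. indicator Q (y + L f) * (indicator Q (a + y) * p y) \<partial>lborel) \<partial>count_space UNIV)"
    by (rule nn_integral_count_space_nn_integral) auto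
  \<comment> \<open>Each summand is translated by \<open>- L f\<close>. Periodicity leaves
    \<open>p\<close> unchanged, so the lattice sum moves from the indicator at \<open>y\<close> to
    the one at \<open>a + y\<close>, where it equals 1 again.\<close>
  also have "\<dots> = (\<integral>\<^sup>+f. (\<integral>\<^sup>+y. indicator Q (a + y + L (\<lambda>i. - f i)) * (indicator Q y * p y) \<partial>lborel) \<partial>count_space UNIV)"
  proof (rule nn_integral_cong)
    fix f
    have neg: "L (\<lambda>i. - f i) = - L f" by (simp add: L_def vec_eq_iff)
    have "p (- L f + y) = p y" for y using per[OF L[of "\<lambda>i. - f i"], of y] by (simp add: neg)
    then show "(\<integral>\<^sup>+y. indicator Q (y + L f) * (indicator Q (a + y) * p y) \<partial>lborel) =
       (\<integral>\<^sup>+y. indicator Q (a + y + L (\<lambda>i. - f i)) * (indicator Q y * p y) \<partial>lborel)"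
      using nn_integral_lborel_shift[of "\<lambda>y. indicator Q (y + L f) * (indicator Q (a + y) * p y)" "- L f"]
      by (simp add: neg algebra_simps)
  qed
  also have "\<dots> = (\<integral>\<^sup>+y. (\<integral>\<^sup>+f. indicator Q (a + y + L (\<lambda>i. - f i)) * (indicator Q y * p y) \<partial>count_space UNIV) \<partial>lborel)"
    by (rule nn_integral_count_space_nn_integral[symmetric]) auto
  also have "\<dots> = (\<integral>\<^sup>+y. indicator Q y * p y \<partial>lborel)"
  proof (intro nn_integral_cong)
    fix y
    have "bij (\<lambda>f::'d \<Rightarrow> int. (\<lambda>i. - f i))"
      by (rule bij_betw_byWitness[where f'="\<lambda>f i. - f i"]) auto
    then have "(\<integral>\<^sup>+f. indicator Q (a + y + L (\<lambda>i. - f i)) \<partial>count_space UNIV) = (1::ennreal)"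
      using nn_integral_bij_count_space[of "\<lambda>f::'d \<Rightarrow> int. (\<lambda>i. - f i)" UNIV UNIV "\<lambda>f. indicator Q (a + y + L f)"] one
      by simp
    then show "(\<integral>\<^sup>+f. indicator Q (a + y + L (\<lambda>i. - f i)) * (indicator Q y * p y) \<partial>count_space UNIV) = indicator Q y * p y"
      by (subst nn_integral_multc) auto
  qed
  also have "\<dots> = (\<integral>\<^sup>+y. p y \<partial>cm)" by (rule cell[symmetric]) auto
  finally show ?thesis .
qed

subsection \<open>Convolution with smooth kernels over the space-time slab\<close>

text \<open>The kernel is evaluated at \<open>\<zeta> - z\<close>, not at
  \<open>z - \<zeta>\<close>: as a function of \<open>\<zeta>\<close> it is then a translated kernel
  usable as a test function, and a kernel supported in positive times averages over the future of
  \<open>z\<close>.\<close>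

definition stconv :: "real \<Rightarrow> (real \<times> (real^'d) \<Rightarrow> real) \<Rightarrow> (real \<times> (real^'d) \<Rightarrow> real) \<Rightarrow> real \<times> (real^'d) \<Rightarrow> real" where
  "stconv T k f z = (\<integral>\<zeta>. f \<zeta> * k (\<zeta> - z) \<partial>ST T)"

lemma AE_ST_slab: "AE z in ST T. z \<in> {0<..<T} \<times> cell"
  unfolding AE_ST by simp

lemma slab_compact_super: "{0<..<T::real} \<times> cell \<subseteq> {0..T} \<times> (cell :: (real^'d) set)" "compact ({0..T} \<times> (cell :: (real^'d) set))"
  by (auto simp: cell_def intro!: compact_Times)

lemma smooth_fun_borel [measurable]: "smooth_fun f \<Longrightarrow> f \<in> borel_measurable borel"
  by (intro borel_measurable_continuous_onI smooth_fun_continuous)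

lemma kernel_bounded:
  fixes k :: "real \<times> (real^'d) \<Rightarrow> real"
  assumes "continuous_on UNIV k"
  obtains B where "\<And>\<zeta> z. \<zeta> \<in> {0<..<T} \<times> cell \<Longrightarrow> z \<in> cball z0 R \<Longrightarrow> \<bar>k (\<zeta> - z)\<bar> \<le> B"
proof -
  let ?S = "({0..T} \<times> (cell :: (real^'d) set)) \<times> cball z0 R"
  have "compact ((\<lambda>p. k (fst p - snd p)) ` ?S)"
    by (intro compact_continuous_image compact_Times slab_compact_super compact_cball
        continuous_on_compose2[OF assms] continuous_intros) (auto simp: slab_compact_super)
  from compact_imp_bounded[OF this] obtain B where B: "\<forall>y\<in>(\<lambda>p. k (fst p - snd p)) ` ?S. norm y \<le> B"
    unfolding bounded_iff by (elim exE)
  show ?thesis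
  proof (rule that)
    fix \<zeta> :: "real \<times> (real^'d)" and z assume "\<zeta> \<in> {0<..<T} \<times> cell" "z \<in> cball z0 R"
    then have "(\<zeta>, z) \<in> ?S" using slab_compact_super(1) by (auto simp: mem_Times_iff)
    from B[rule_format, OF imageI[OF this]] show "\<bar>k (\<zeta> - z)\<bar> \<le> B" by simp
  qed
qed

lemma stconv_integrable:
  fixes k :: "real \<times> (real^'d) \<Rightarrow> real"
  assumes f: "integrable (ST T) f" and k: "continuous_on UNIV k"
  shows "integrable (ST T) (\<lambda>\<zeta>. f \<zeta> * k (\<zeta> - z))"
proof -
  obtain B where B: "\<And>\<zeta> w. \<zeta> \<in> {0<..<T} \<times> cell \<Longrightarrow> w \<in> cball z 1 \<Longrightarrow> \<bar>k (\<zeta> - w)\<bar> \<le> B"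
    using kernel_bounded[OF k] by blast
  have [measurable]: "k \<in> borel_measurable borel" by (rule borel_measurable_continuous_onI[OF k])
  show ?thesis
  proof (rule integrable_mult_bounded[OF f])
    show "AE \<zeta> in ST T. \<bar>k (\<zeta> - z)\<bar> \<le> B" using AE_ST_slab by eventually_elim (use B in auto)
  qed simp
qed

lemma stconv_tendsto:
  assumes f: "integrable (ST T) f" and k: "continuous_on UNIV k" and x: "x \<longlonglongrightarrow> z"
  shows "(\<lambda>n. stconv T k f (x n)) \<longlonglongrightarrow> stconv T k f z"
proof -
  have "bounded (range x)" using x convergent_imp_bounded by (auto simp: convergent_def)
  then obtain R where R: "\<And>n. x n \<in> cball 0 R" unfolding bounded_iff by force
  obtain B where B: "\<And>\<zeta> w. \<zeta> \<in> {0<..<T} \<times> cell \<Longrightarrow> w \<in> cball 0 R \<Longrightarrow> \<bar>k (\<zeta> - w)\<bar> \<le> B"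
    using kernel_bounded[OF k] by blast
  have [measurable]: "k \<in> borel_measurable borel" by (rule borel_measurable_continuous_onI[OF k])
  have [measurable]: "f \<in> borel_measurable borel" using f by (simp add: integrable_iff_bounded)
  show ?thesis unfolding stconv_def
  proof (rule integral_dominated_convergence[where w="\<lambda>\<zeta>. \<bar>f \<zeta>\<bar> * B"])
    show "AE \<zeta> in ST T. (\<lambda>n. f \<zeta> * k (\<zeta> - x n)) \<longlonglongrightarrow> f \<zeta> * k (\<zeta> - z)"
      by (intro AE_I2 tendsto_intros continuous_on_tendsto_compose[OF k] x) auto
    show "AE \<zeta> in ST T. norm (f \<zeta> * k (\<zeta> - x n)) \<le> \<bar>f \<zeta>\<bar> * B" for n
      using AE_ST_slab
    proof eventually_elim
      case (elim \<zeta>)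
      show ?case using mult_left_mono[OF B[OF elim R, of n], of "\<bar>f \<zeta>\<bar>"] by (simp add: abs_mult)
    qed
  qed (use f in auto)
qed

text \<open>Differentiation under the integral by dominated convergence along an arbitrary null
  sequence. The sign comes from the reflected argument of the kernel.\<close>

lemma stconv_has_deriv:
  assumes f: "integrable (ST T) f" and k: "smooth_fun k" and b: "b \<in> Basis"
  shows "((\<lambda>s. stconv T k f (z + s *\<^sub>R b)) has_real_derivative - stconv T (pd b k) f z) (at 0)"
  unfolding DERIV_def tendsto_at_iff_sequentially
proof (intro allI impI)
  fix X :: "nat \<Rightarrow> real" assume X: "\<forall>i. X i \<in> UNIV - {0}" "X \<longlonglongrightarrow> 0"
  note kc = smooth_fun_continuous[OF k] and pc = smooth_fun_continuous[OF smooth_fun_pd[OF k b]]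
  have "bounded (range X)" using X(2) convergent_imp_bounded by (auto simp: convergent_def)
  then obtain R where R: "\<And>n. norm (X n) \<le> R" unfolding bounded_iff by force
  then have R0: "R \<ge> 0" using norm_ge_zero order_trans by blast
  obtain B where B: "\<And>\<zeta> w. \<zeta> \<in> {0<..<T} \<times> cell \<Longrightarrow> w \<in> cball z R \<Longrightarrow> \<bar>pd b k (\<zeta> - w)\<bar> \<le> B"
    using kernel_bounded[OF pc] by blast
  have [measurable]: "k \<in> borel_measurable borel" "pd b k \<in> borel_measurable borel"
    using k smooth_fun_pd[OF k b] by (auto intro: smooth_fun_borel)
  have [measurable]: "f \<in> borel_measurable borel" using f by (simp add: integrable_iff_bounded)
  have der: "((\<lambda>s. k (\<zeta> - (z + s *\<^sub>R b))) has_real_derivative - pd b k (\<zeta> - (z + s *\<^sub>R b))) (at s)" for \<zeta> s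
  proof -
    have "((\<lambda>s. k ((\<zeta> - z) + s *\<^sub>R b)) has_real_derivative pd b k ((\<zeta> - z) + (- s) *\<^sub>R b)) (at (- s))"
      by (rule smooth_fun_has_pd_along[OF k b])
    then have "((\<lambda>s. k ((\<zeta> - z) + (- s) *\<^sub>R b)) has_real_derivative pd b k ((\<zeta> - z) + (- s) *\<^sub>R b) * (- 1)) (at s)"
      by (rule DERIV_chain2) (auto intro!: derivative_eq_intros)
    then show ?thesis by (simp add: algebra_simps)
  qed
  have "(\<lambda>n. \<integral>\<zeta>. f \<zeta> * ((k (\<zeta> - (z + X n *\<^sub>R b)) - k (\<zeta> - z)) / X n) \<partial>ST T)
      \<longlonglongrightarrow> (\<integral>\<zeta>. f \<zeta> * (- pd b k (\<zeta> - z)) \<partial>ST T)"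
  proof (rule integral_dominated_convergence[where w="\<lambda>\<zeta>. \<bar>f \<zeta>\<bar> * B"])
    show "AE \<zeta> in ST T. (\<lambda>n. f \<zeta> * ((k (\<zeta> - (z + X n *\<^sub>R b)) - k (\<zeta> - z)) / X n)) \<longlonglongrightarrow> f \<zeta> * (- pd b k (\<zeta> - z))"
    proof (intro AE_I2 tendsto_intros)
      fix \<zeta>
      have "((\<lambda>h. (k (\<zeta> - (z + h *\<^sub>R b)) - k (\<zeta> - z)) / h) \<longlongrightarrow> - pd b k (\<zeta> - z)) (at 0)"
        using der[of \<zeta> 0] unfolding DERIV_def by simp
      then show "(\<lambda>n. (k (\<zeta> - (z + X n *\<^sub>R b)) - k (\<zeta> - z)) / X n) \<longlonglongrightarrow> - pd b k (\<zeta> - z)"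
        unfolding tendsto_at_iff_sequentially using X by (auto simp: o_def)
    qed
    show "AE \<zeta> in ST T. norm (f \<zeta> * ((k (\<zeta> - (z + X n *\<^sub>R b)) - k (\<zeta> - z)) / X n)) \<le> \<bar>f \<zeta>\<bar> * B" for n
      using AE_ST_slab
    proof eventually_elim
      case (elim \<zeta>)
      \<comment> \<open>The mean value inequality bounds the difference quotients by the derivative
        of the kernel on the ball of radius \<open>R\<close>, which contains all increments; this
        gives a dominating function independent of \<open>n\<close>.\<close>
      have "norm ((\<lambda>s. k (\<zeta> - (z + s *\<^sub>R b))) (X n) - (\<lambda>s. k (\<zeta> - (z + s *\<^sub>R b))) 0) \<le> B * norm (X n - 0)"
      proof (rule field_differentiable_bound[where S="cball 0 R"])
        show "((\<lambda>s. k (\<zeta> - (z + s *\<^sub>R b))) has_real_derivative - pd b k (\<zeta> - (z + s *\<^sub>R b))) (at s within cball 0 R)" for s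
          using der by (rule has_field_derivative_at_within)
        show "norm (- pd b k (\<zeta> - (z + s *\<^sub>R b))) \<le> B" if "s \<in> cball 0 R" for s
          using B[OF elim, of "z + s *\<^sub>R b"] that b by (simp add: dist_norm)
      qed (use R[of n] R0 in auto)
      then have "\<bar>(k (\<zeta> - (z + X n *\<^sub>R b)) - k (\<zeta> - z)) / X n\<bar> \<le> B"
        using X(1) by (auto simp: abs_divide divide_simps)
      then have "\<bar>f \<zeta>\<bar> * \<bar>(k (\<zeta> - (z + X n *\<^sub>R b)) - k (\<zeta> - z)) / X n\<bar> \<le> \<bar>f \<zeta>\<bar> * B"
        by (rule mult_left_mono) simp
      then show ?case by (simp only: real_norm_def abs_mult)
    qed
  qed (use f in auto)
  moreover have "((stconv T k f (z + X n *\<^sub>R b) - stconv T k f z) / X n) =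
      (\<integral>\<zeta>. f \<zeta> * ((k (\<zeta> - (z + X n *\<^sub>R b)) - k (\<zeta> - z)) / X n) \<partial>ST T)" for n
  proof -
    have "stconv T k f (z + X n *\<^sub>R b) - stconv T k f z =
        (\<integral>\<zeta>. f \<zeta> * k (\<zeta> - (z + X n *\<^sub>R b)) - f \<zeta> * k (\<zeta> - z) \<partial>ST T)"
      unfolding stconv_def by (intro Bochner_Integration.integral_diff[symmetric] stconv_integrable f kc)
    then show ?thesis by (simp add: right_diff_distrib diff_divide_distrib flip: integral_divide_zero)
  qed
  ultimately have "(\<lambda>n. (stconv T k f (z + X n *\<^sub>R b) - stconv T k f z) / X n)
      \<longlonglongrightarrow> (\<integral>\<zeta>. f \<zeta> * (- pd b k (\<zeta> - z)) \<partial>ST T)" by presburger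
  then show "((\<lambda>h. (stconv T k f (z + (0 + h) *\<^sub>R b) - stconv T k f (z + 0 *\<^sub>R b)) / h) \<circ> X)
      \<longlonglongrightarrow> - stconv T (pd b k) f z"
    unfolding o_def by (simp add: stconv_def[of T "pd b k"])
qed

text \<open>All derivatives fall on the kernel, so the convolutions of the fixed \<open>f\<close>
  with arbitrary smooth kernels form a set closed under differentiation.\<close>

lemma smooth_fun_stconv:
  fixes f :: "real \<times> (real^'d) \<Rightarrow> real"
  assumes f: "integrable (ST T) f" and k: "smooth_fun k"
  shows "smooth_fun (stconv T k f)"
proof (rule smooth_fun_coinduct[of _ "{stconv T k f | k. smooth_fun k}"])
  show "stconv T k f \<in> {stconv T k f | k. smooth_fun k}" using k by blast
  show "continuous_on UNIV h" if "h \<in> {stconv T k f | k. smooth_fun k}" for h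
  proof -
    note H = that
    obtain k where k: "h = stconv T k f" "smooth_fun k" using H by blast
    show ?thesis unfolding k(1)
      by (rule continuous_on_sequentiallyI) (rule stconv_tendsto[OF f smooth_fun_continuous[OF k(2)]])
  qed
  show "\<exists>g\<in>{stconv T k f | k. smooth_fun k}. \<forall>x. ((\<lambda>s. h (x + s *\<^sub>R b)) has_real_derivative g x) (at 0)"
    if "h \<in> {stconv T k f | k. smooth_fun k}" "b \<in> Basis" for h b
  proof -
    note H = that
    obtain k where k: "h = stconv T k f" "smooth_fun k" using H(1) by blast
    have "stconv T (\<lambda>x. (-1) * pd b k x) f \<in> {stconv T k f | k. smooth_fun k}"
      using smooth_fun_mult[OF smooth_fun_const smooth_fun_pd[OF k(2) H(2)]] by blast
    moreover have "stconv T (\<lambda>x. (-1) * pd b k x) f x = - stconv T (pd b k) f x" for x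
      by (simp add: stconv_def)
    ultimately show ?thesis
      using stconv_has_deriv[OF f k(2) H(2)] unfolding k(1)
      by (intro bexI[of _ "stconv T (\<lambda>x. (-1) * pd b k x) f"] allI) simp_all
  qed
qed

lemma pd_stconv:
  assumes "integrable (ST T) f" "smooth_fun k" "b \<in> Basis"
  shows "pd b (stconv T k f) z = - stconv T (pd b k) f z"
  by (rule pd_eqI) (rule stconv_has_deriv[OF assms])

subsection \<open>The kernels\<close>

lemma smooth_fun_id: "smooth_fun (\<lambda>x::real. x)"
  using smooth_fun_inner[of "1::real"] by simp

text \<open>A normalised primitive of the bump \<open>b\<close>, which is positive exactly on the
  open interval from 1 to 2. Vanishing of the derivative at both end points is included, so that the
  kernel built from it vanishes there too.\<close>

lemma step_exists:
  "\<exists>\<Theta>::real \<Rightarrow> real. smooth_fun \<Theta> \<and> (\<forall>s. deriv \<Theta> s \<le> 0) \<and>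
    (\<forall>s. (s \<le> 1 \<longrightarrow> \<Theta> s = 1 \<and> deriv \<Theta> s = 0) \<and> (2 \<le> s \<longrightarrow> \<Theta> s = 0 \<and> deriv \<Theta> s = 0))"
proof -
  define b where "b = (\<lambda>s. flat_exp 0 (s - 1) * flat_exp 0 (2 - s))"
  have sb: "smooth_fun b" unfolding b_def
    by (intro smooth_fun_mult smooth_fun_compose[OF smooth_fun_flat_exp] smooth_fun_diff smooth_fun_const smooth_fun_id)
  have "\<exists>F. \<forall>x. - \<infinity> < ereal x \<longrightarrow> ereal x < \<infinity> \<longrightarrow> (F has_vector_derivative b x) (at x)"
    by (rule einterval_antiderivative)
       (use smooth_fun_continuous[OF sb, of UNIV] in \<open>auto simp: continuous_on_eq_continuous_at\<close>)
  then obtain F where F: "\<And>x. (F has_real_derivative b x) (at x)"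
    by (auto simp: has_real_derivative_iff_has_vector_derivative)
  have b0: "b s \<ge> 0" for s by (simp add: b_def flat_exp_nonneg)
  have bz: "b s = 0" if "s \<le> 1 \<or> 2 \<le> s" for s using that by (auto simp: b_def flat_exp_eq_0)
  have lt: "F 1 < F 2"
    by (rule DERIV_pos_imp_increasing_open)
       (use F in \<open>auto simp: b_def intro!: mult_pos_pos flat_exp_pos exI[of _ "b _"] DERIV_isCont intro: DERIV_continuous_on continuous_at_imp_continuous_on\<close>)
  have F1: "F s = F 1" if "s \<le> 1" for s
  proof (cases "s = 1")
    case False
    with that obtain x where "s < x" "x < 1" "F 1 - F s = (1 - s) * b x"
      using MVT2[of s 1 F b] F by auto
    then show ?thesis using bz[of x] by simp
  qed simp
  have F2: "F s = F 2" if "2 \<le> s" for s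
  proof (cases "s = 2")
    case False
    with that obtain x where "2 < x" "x < s" "F s - F 2 = (s - 2) * b x"
      using MVT2[of 2 s F b] F by auto
    then show ?thesis using bz[of x] by simp
  qed simp
  have "smooth_fun F" by (rule smooth_fun_real_derivI[OF sb F])
  define \<Theta> where "\<Theta> = (\<lambda>s. inverse (F 2 - F 1) * (F 2 - F s))"
  have "smooth_fun \<Theta>" unfolding \<Theta>_def
    by (intro smooth_fun_mult smooth_fun_diff smooth_fun_const \<open>smooth_fun F\<close>)
  moreover have "(\<Theta> has_real_derivative - (inverse (F 2 - F 1) * b s)) (at s)" for s
    unfolding \<Theta>_def by (rule derivative_eq_intros F refl)+ simp
  then have "deriv \<Theta> s = - (inverse (F 2 - F 1) * b s)" for s by (rule DERIV_imp_deriv)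
  moreover have "\<Theta> s = 1" if "s \<le> 1" for s using lt F1[OF that] by (simp add: \<Theta>_def)
  moreover have "\<Theta> s = 0" if "2 \<le> s" for s using F2[OF that] by (simp add: \<Theta>_def)
  moreover have "0 \<le> inverse (F 2 - F 1) * b s" for s using lt b0[of s] by simp
  ultimately show ?thesis using bz by (intro exI[of _ \<Theta>]) simp
qed

text \<open>The primitive is kept besides its negated derivative \<open>\<eta>\<close>: rescaled, it
  equals 1 near time 0, and as a factor of a test function it produces the mollification kernel when
  differentiated in time.\<close>

definition step :: "real \<Rightarrow> real" where
  "step = (SOME \<Theta>. smooth_fun \<Theta> \<and> (\<forall>s. deriv \<Theta> s \<le> 0) \<and>
    (\<forall>s. (s \<le> 1 \<longrightarrow> \<Theta> s = 1 \<and> deriv \<Theta> s = 0) \<and> (2 \<le> s \<longrightarrow> \<Theta> s = 0 \<and> deriv \<Theta> s = 0)))"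

definition \<eta> :: "real \<Rightarrow> real" where "\<eta> s = - deriv step s"

lemma step_props:
  "smooth_fun step" "\<eta> s \<ge> 0" "s \<le> 1 \<Longrightarrow> step s = 1" "s \<le> 1 \<Longrightarrow> \<eta> s = 0"
  "2 \<le> s \<Longrightarrow> step s = 0" "2 \<le> s \<Longrightarrow> \<eta> s = 0"
  using someI_ex[OF step_exists] unfolding step_def[symmetric] \<eta>_def by auto

lemma pd_real: "pd 1 f s = deriv f s" for f :: "real \<Rightarrow> real"
proof -
  have "((\<lambda>h. f (s + h)) has_real_derivative D) (at 0) \<longleftrightarrow> (f has_real_derivative D) (at s)" for D
    using DERIV_shift[of f D 0 s] by (simp add: add.commute)
  then show ?thesis by (simp add: pd_def deriv_def)
qed

lemma smooth_fun_real_DERIV: "smooth_fun f \<Longrightarrow> (f has_real_derivative deriv f s) (at s)" for f :: "real \<Rightarrow> real"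
  using smooth_fun_has_pd_along[of f 1 0 s] by (simp add: pd_real)

lemma DERIV_step: "(step has_real_derivative - \<eta> s) (at s)"
  using smooth_fun_real_DERIV[OF step_props(1)] by (simp add: \<eta>_def)

lemma smooth_\<eta>: "smooth_fun \<eta>"
proof -
  have "\<eta> = (\<lambda>s. (-1) * pd 1 step s)" by (simp add: fun_eq_iff \<eta>_def pd_real)
  then show ?thesis
    using smooth_fun_mult[OF smooth_fun_const[of "-1"] smooth_fun_pd[OF step_props(1), of 1]] by simp
qed

lemma step_range: "0 \<le> step s" "step s \<le> 1"
proof -
  have anti: "step y \<le> step x" if "x \<le> y" for x y
    by (rule DERIV_nonpos_imp_nonincreasing[OF that]) (use DERIV_step step_props(2) in \<open>meson neg_le_0_iff_le\<close>)
  show "0 \<le> step s" using anti[of s "max s 2"] step_props(5)[of "max s 2"] by simp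
  show "step s \<le> 1" using anti[of "min s 1" s] step_props(3)[of "min s 1"] by simp
qed

text \<open>A smooth bump concentrated at the lattice points, which is periodic without any summation over
  translates.\<close>
definition pbump :: "nat \<Rightarrow> real^'d \<Rightarrow> real" where
  "pbump n y = flat_exp 0 (1 - real (Suc n) * (\<Sum>j\<in>UNIV. 1 - cos (2 * pi * y $ j)))"

definition pker :: "nat \<Rightarrow> real^'d \<Rightarrow> real" where
  "pker n y = pbump n y / (\<integral>x. pbump n x \<partial>(cm :: (real^'d) measure))"

lemma smooth_coord: "smooth_fun (\<lambda>z::real \<times> (real^'d). snd z $ j)"
proof -
  have "snd z $ j = z \<bullet> (0, axis j 1)" for z :: "real \<times> (real^'d)"
    by (simp add: inner_axis inner_prod_def)
  then show ?thesis by simp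
qed

lemma smooth_time: "smooth_fun p \<Longrightarrow> smooth_fun (\<lambda>z::real \<times> (real^'d). p (fst z))"
proof -
  have "fst z = z \<bullet> (1, 0)" for z :: "real \<times> (real^'d)" by (simp add: inner_prod_def)
  then show "smooth_fun p \<Longrightarrow> smooth_fun (\<lambda>z::real \<times> (real^'d). p (fst z))"
    using smooth_fun_compose[of p "\<lambda>z::real \<times> (real^'d). z \<bullet> (1, 0)"] by simp
qed

lemma smooth_pbump: "smooth_fun (\<lambda>z::real \<times> (real^'d). pbump n (snd z))"
  unfolding pbump_def
  by (intro smooth_fun_compose[OF smooth_fun_flat_exp] smooth_fun_diff smooth_fun_const smooth_fun_mult
      smooth_fun_sum smooth_fun_compose[OF smooth_fun_cos] smooth_coord)

lemma pbump_borel [measurable]: "pbump n \<in> borel_measurable borel"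
  unfolding pbump_def using smooth_fun_borel[OF smooth_fun_flat_exp, of 0] by measurable

lemma pbump_bounds: "0 \<le> pbump n y" "pbump n y \<le> 1"
  by (auto simp: pbump_def flat_exp_nonneg flat_exp_0_le_1)

lemma cos_lattice: "k \<in> \<int> \<Longrightarrow> cos (2 * pi * (x + k)) = cos (2 * pi * x)"
  by (auto elim!: Ints_cases simp: distrib_left cos_add cos_int_2pin sin_int_2pin)

lemma pbump_periodic: "lattice_pt k \<Longrightarrow> pbump n (y + k) = pbump n y"
  by (simp add: pbump_def lattice_pt_def cos_lattice)

lemma pbump_even: "pbump n (- y) = pbump n y"
  by (simp add: pbump_def)

text \<open>The bump is positive on a neighbourhood of the origin, and this neighbourhood meets the
  cell in a set of positive measure.\<close>

lemma integral_pbump_pos: "(\<integral>x. pbump n x \<partial>(cm :: (real^'d) measure)) > 0"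
proof -
  have int: "integrable cm (pbump n :: real^'d \<Rightarrow> real)"
    by (rule cm.integrable_const_bound[of _ 1]) (auto simp: pbump_bounds)
  have "(\<integral>x. pbump n x \<partial>(cm :: (real^'d) measure)) \<noteq> 0"
  proof
    assume "(\<integral>x. pbump n x \<partial>(cm :: (real^'d) measure)) = 0"
    then have "AE x in cm. pbump n (x :: real^'d) = 0"
      by (subst (asm) integral_nonneg_eq_0_iff_AE[OF int]) (auto simp: pbump_bounds)
    let ?V = "{x :: real^'d. real (Suc n) * (\<Sum>j\<in>UNIV. 1 - cos (2 * pi * x $ j)) < 1}"
    have oV: "open ?V"
      by (intro open_Collect_less continuous_intros)
    have "0 \<in> ?V" by simp
    \<comment> \<open>The origin is a corner of the cell and not an interior point; an open set that
      meets the closure of the open box meets the box itself.\<close>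
    moreover have "0 \<in> closure (box 0 (One :: real^'d))"
      by (subst closure_box) (auto simp: box_ne_empty mem_box)
    ultimately have "?V \<inter> box 0 One \<noteq> {}" using open_Int_closure_eq_empty[OF oV] by blast
    then have "\<not> negligible (?V \<inter> box 0 One)"
      using oV by (intro open_not_negligible) auto
    moreover have "AE x in lborel. x \<notin> ?V \<inter> box 0 One"
      using \<open>AE x in cm. pbump n x = 0\<close> unfolding AE_cm
    proof eventually_elim
      case (elim x)
      show ?case
      proof
        assume x: "x \<in> ?V \<inter> box 0 One"
        then have "x \<in> cell" using box_subset_cbox unfolding cell_def by blast
        moreover have "pbump n x > 0" using x by (auto simp: pbump_def intro!: flat_exp_pos)
        ultimately show False using elim by simp
      qed
    qed
    then have "AE x in lebesgue. x \<notin> ?V \<inter> box 0 One" by (rule AE_completion)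
    then have "?V \<inter> box 0 One \<in> null_sets lebesgue"
      using oV by (subst AE_iff_null_sets) auto
    ultimately show False by (simp add: negligible_iff_null_sets)
  qed
  moreover have "(\<integral>x. pbump n x \<partial>(cm :: (real^'d) measure)) \<ge> 0"
    by (rule integral_nonneg_AE) (auto simp: pbump_bounds)
  ultimately show ?thesis by linarith
qed

lemma pker_nonneg: "0 \<le> pker n y"
  using integral_pbump_pos by (simp add: pker_def pbump_bounds less_imp_le)

lemma pker_borel [measurable]: "pker n \<in> borel_measurable borel"
  unfolding pker_def by measurable

lemma smooth_pker: "smooth_fun (\<lambda>z::real \<times> (real^'d). pker n (snd z))"
  unfolding pker_def divide_inverse by (intro smooth_fun_mult smooth_pbump smooth_fun_const)

lemma pker_periodic: "lattice_pt k \<Longrightarrow> pker n (y + k) = pker n y"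
  by (simp add: pker_def pbump_periodic)

lemma pker_even: "pker n (x - y) = pker n (y - x)"
  using pbump_even[of n "y - x"] by (simp add: pker_def)

text \<open>The mass over the cell is the same for every centre because the bump is
  periodic.\<close>

lemma nn_integral_pker: "(\<integral>\<^sup>+y. ennreal (pker n (y - x)) \<partial>(cm :: (real^'d) measure)) = 1"
proof -
  have int: "integrable cm (pbump n :: real^'d \<Rightarrow> real)"
    by (rule cm.integrable_const_bound[of _ 1]) (auto simp: pbump_bounds)
  have "(\<integral>\<^sup>+y. ennreal (pker n (y - x)) \<partial>cm) = (\<integral>\<^sup>+y. ennreal (pker n y) \<partial>(cm :: (real^'d) measure))"
    using nn_integral_cell_shift[of "\<lambda>y. ennreal (pker n y)" x] by (simp add: pker_periodic)
  also have "\<dots> = ennreal (\<integral>y. pker n y \<partial>(cm :: (real^'d) measure))"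
    by (rule nn_integral_eq_integral) (auto simp: pker_nonneg, auto simp: pker_def int)
  also have "(\<integral>y. pker n y \<partial>(cm :: (real^'d) measure)) = 1"
    using integral_pbump_pos[of n, where 'd='d] by (simp add: pker_def)
  finally show ?thesis by simp
qed

text \<open>The kernel is normalised in each of its two times. The first statement gives the bounds
  on mollifications and their value on constants, the second the contraction property in the
  mean.\<close>

lemma nn_integral_\<eta>:
  assumes "e > 0"
  shows "(\<integral>\<^sup>+s. ennreal (\<eta> ((s - t) / e) / e) \<partial>lborel) = 1"
    and "(\<integral>\<^sup>+t. ennreal (\<eta> ((s - t) / e) / e) \<partial>lborel) = 1"
proof -
  have [measurable]: "\<eta> \<in> borel_measurable borel" by (rule smooth_fun_borel[OF smooth_\<eta>])
  have "(\<integral>\<^sup>+s. ennreal (\<eta> ((s - t) / e) / e) \<partial>lborel) =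
      (\<integral>\<^sup>+s. ennreal (\<eta> ((s - t) / e) / e) * indicator {t..t + 2 * e} s \<partial>lborel)"
    using assms by (intro nn_integral_cong) (auto simp: indicator_def step_props field_simps not_le)
  also have "\<dots> = ennreal ((- step ((t + 2 * e - t) / e)) - (- step ((t - t) / e)))"
  proof (rule nn_integral_FTC_Icc)
    show "((\<lambda>s. - step ((s - t) / e)) has_real_derivative \<eta> ((x - t) / e) / e) (at x)" for x
      using assms by (auto intro!: derivative_eq_intros DERIV_chain2[OF DERIV_step])
  qed (use assms in \<open>auto simp: step_props\<close>)
  also have "\<dots> = 1" using assms by (simp add: step_props)
  finally show "(\<integral>\<^sup>+s. ennreal (\<eta> ((s - t) / e) / e) \<partial>lborel) = 1" .
  have "(\<integral>\<^sup>+t. ennreal (\<eta> ((s - t) / e) / e) \<partial>lborel) =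
      (\<integral>\<^sup>+t. ennreal (\<eta> ((s - t) / e) / e) * indicator {s - 2 * e..s} t \<partial>lborel)"
    using assms by (intro nn_integral_cong) (auto simp: indicator_def step_props field_simps not_le)
  also have "\<dots> = ennreal (step ((s - s) / e) - step ((s - (s - 2 * e)) / e))"
  proof (rule nn_integral_FTC_Icc)
    have "((\<lambda>t. (s - t) / e) has_real_derivative - (1 / e)) (at x)" for x
      using assms by (auto intro!: derivative_eq_intros)
    from DERIV_chain2[OF DERIV_step this]
    show "((\<lambda>t. step ((s - t) / e)) has_real_derivative \<eta> ((s - x) / e) / e) (at x)" for x
      using assms by simp
  qed (use assms in \<open>auto simp: step_props\<close>)
  also have "\<dots> = 1" using assms by (simp add: step_props)
  finally show "(\<integral>\<^sup>+t. ennreal (\<eta> ((s - t) / e) / e) \<partial>lborel) = 1" .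
qed

subsection \<open>Mollification forward in time\<close>

text \<open>As \<open>\<eta>\<close> lives on [1, 2], the mollification at time t only sees the times in [t + e, t + 2e]. With
  the choice of e below these stay in (0, T) for all t in [0, \<open>\<tau>\<close>], including the initial time.\<close>
definition kap :: "real \<Rightarrow> nat \<Rightarrow> real \<times> (real^'d) \<Rightarrow> real" where
  "kap e n z = \<eta> (fst z / e) / e * pker n (snd z)"

text \<open>The factor 3 makes \<open>2 * eps\<close> strictly smaller than
  \<open>T - \<tau>\<close> already for the index 0.\<close>

definition eps :: "real \<Rightarrow> real \<Rightarrow> nat \<Rightarrow> real" where
  "eps T \<tau> n = (T - \<tau>) / (3 * real (Suc n))"

definition moll :: "real \<Rightarrow> real \<Rightarrow> nat \<Rightarrow> (real \<times> (real^'d) \<Rightarrow> real) \<Rightarrow> real \<times> (real^'d) \<Rightarrow> real" where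
  "moll T \<tau> n f = stconv T (kap (eps T \<tau> n) n) f"

lemma \<eta>_borel [measurable]: "\<eta> \<in> borel_measurable borel"
  by (rule smooth_fun_borel[OF smooth_\<eta>])

lemma eps_pos: "\<tau> < T \<Longrightarrow> eps T \<tau> n > 0"
  by (simp add: eps_def)

lemma eps_le: "\<tau> < T \<Longrightarrow> \<tau> + 2 * eps T \<tau> n < T"
proof -
  assume "\<tau> < T"
  have "eps T \<tau> n \<le> (T - \<tau>) / 3" unfolding eps_def using \<open>\<tau> < T\<close> by (intro divide_left_mono) auto
  with \<open>\<tau> < T\<close> show ?thesis by simp
qed

lemma eps_tendsto: "eps T \<tau> \<longlonglongrightarrow> 0"
proof -
  have "(\<lambda>n. (T - \<tau>) / 3 * inverse (real (Suc n))) \<longlonglongrightarrow> (T - \<tau>) / 3 * 0"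
    by (intro tendsto_mult tendsto_const LIMSEQ_inverse_real_of_nat)
  then show ?thesis by (simp add: eps_def[abs_def] divide_simps)
qed

lemma smooth_kap: "smooth_fun (kap e n)"
proof -
  have "smooth_fun (\<lambda>s. \<eta> (inverse e * s) * inverse e)"
    by (intro smooth_fun_mult smooth_fun_compose[OF smooth_\<eta>] smooth_fun_const smooth_fun_id)
  from smooth_fun_mult[OF smooth_time[OF this] smooth_pker[of n]]
  show ?thesis unfolding kap_def[abs_def] by (simp add: divide_inverse mult.commute)
qed

lemma kap_borel [measurable]: "kap e n \<in> borel_measurable borel"
  by (rule smooth_fun_borel[OF smooth_kap])

lemma kap_nonneg: "e > 0 \<Longrightarrow> 0 \<le> kap e n z"
  by (simp add: kap_def pker_nonneg step_props)

lemma nn_integral_tm_le: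
  assumes [measurable]: "f \<in> borel_measurable borel"
  shows "(\<integral>\<^sup>+s. f s \<partial>tm T) \<le> (\<integral>\<^sup>+s. f s \<partial>lborel)"
  unfolding tm_def by (subst nn_integral_density) (auto intro!: nn_integral_mono simp: indicator_def)

lemma nn_integral_prod_ST:
  fixes a :: "real \<Rightarrow> real" and b :: "real^'d \<Rightarrow> real"
  assumes [measurable]: "a \<in> borel_measurable borel" "b \<in> borel_measurable borel"
    and a: "\<And>t. a t \<ge> 0"
  shows "(\<integral>\<^sup>+z. ennreal (a (fst z) * b (snd z)) \<partial>ST T) = (\<integral>\<^sup>+t. ennreal (a t) \<partial>tm T) * (\<integral>\<^sup>+x. ennreal (b x) \<partial>cm)"
proof -
  have "(\<integral>\<^sup>+z. ennreal (a (fst z) * b (snd z)) \<partial>ST T) =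
     (\<integral>\<^sup>+t. \<integral>\<^sup>+x. ennreal (a (fst (t, x)) * b (snd (t, x))) \<partial>cm \<partial>tm T)"
    unfolding ST_pair
    by (rule cm.nn_integral_fst[where f="\<lambda>z. ennreal (a (fst z) * b (snd z))", symmetric]) measurable
  also have "\<dots> = (\<integral>\<^sup>+t. ennreal (a t) * (\<integral>\<^sup>+x. ennreal (b x) \<partial>cm) \<partial>tm T)"
    using a by (simp add: ennreal_mult' nn_integral_cmult)
  also have "\<dots> = (\<integral>\<^sup>+t. ennreal (a t) \<partial>tm T) * (\<integral>\<^sup>+x. ennreal (b x) \<partial>cm)"
    by (rule nn_integral_multc) simp
  finally show ?thesis .
qed

lemma nn_integral_kap:
  fixes z :: "real \<times> (real^'d)"
  assumes "e > 0"
  shows "(\<integral>\<^sup>+\<zeta>. ennreal (kap e n (\<zeta> - z)) \<partial>ST T) = (\<integral>\<^sup>+s. ennreal (\<eta> ((s - fst z) / e) / e) \<partial>tm T)"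
proof -
  have "(\<integral>\<^sup>+\<zeta>. ennreal (kap e n (\<zeta> - z)) \<partial>ST T) =
     (\<integral>\<^sup>+s. ennreal (\<eta> ((s - fst z) / e) / e) \<partial>tm T) * (\<integral>\<^sup>+y. ennreal (pker n (y - snd z)) \<partial>cm)"
    unfolding kap_def fst_diff snd_diff
    by (rule nn_integral_prod_ST[where a="\<lambda>s. \<eta> ((s - fst z) / e) / e" and b="\<lambda>y. pker n (y - snd z)"])
       (use assms step_props(2) in auto)
  then show ?thesis by (simp add: nn_integral_pker)
qed

lemma nn_integral_kap_le:
  assumes "e > 0" shows "(\<integral>\<^sup>+\<zeta>. ennreal (kap e n (\<zeta> - z)) \<partial>ST T) \<le> 1"
  unfolding nn_integral_kap[OF assms]
  by (rule order_trans[OF nn_integral_tm_le]) (use nn_integral_\<eta>(1)[OF assms] in auto)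

lemma nn_integral_kap_rev_le:
  fixes \<zeta> :: "real \<times> (real^'d)"
  assumes "e > 0" shows "(\<integral>\<^sup>+z. ennreal (kap e n (\<zeta> - z)) \<partial>ST T) \<le> 1"
proof -
  have "(\<integral>\<^sup>+z. ennreal (kap e n (\<zeta> - z)) \<partial>ST T) =
     (\<integral>\<^sup>+t. ennreal (\<eta> ((fst \<zeta> - t) / e) / e) \<partial>tm T) * (\<integral>\<^sup>+x. ennreal (pker n (snd \<zeta> - x)) \<partial>cm)"
    unfolding kap_def fst_diff snd_diff
    by (rule nn_integral_prod_ST[where a="\<lambda>t. \<eta> ((fst \<zeta> - t) / e) / e" and b="\<lambda>x. pker n (snd \<zeta> - x)"])
       (use assms step_props(2) in auto)
  also have "\<dots> = (\<integral>\<^sup>+t. ennreal (\<eta> ((fst \<zeta> - t) / e) / e) \<partial>tm T)"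
    by (subst pker_even) (simp add: nn_integral_pker)
  also have "\<dots> \<le> 1"
    by (rule order_trans[OF nn_integral_tm_le]) (use nn_integral_\<eta>(2)[OF assms] in auto)
  finally show ?thesis .
qed

lemma nn_integral_kap_eq_1:
  assumes "e > 0" "0 \<le> fst z" "fst z + 2 * e \<le> T"
  shows "(\<integral>\<^sup>+\<zeta>. ennreal (kap e n (\<zeta> - z)) \<partial>ST T) = 1"
proof -
  have eq: "ennreal (\<eta> ((s - fst z) / e) / e) = ennreal (indicator {0<..<T} s) * ennreal (\<eta> ((s - fst z) / e) / e)" for s
  proof (cases "1 \<le> (s - fst z) / e \<and> (s - fst z) / e < 2")
    case True
    with assms have "s \<in> {0<..<T}" by (auto simp: field_simps)
    then show ?thesis by simp
  qed (auto simp: step_props not_le not_less)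
  show ?thesis
    unfolding nn_integral_kap[OF assms(1)] tm_def
    by (subst nn_integral_density) (use nn_integral_\<eta>(1)[OF assms(1), of "fst z"] in \<open>auto simp flip: eq\<close>)
qed

lemma kap_integrable: "integrable (ST T) (\<lambda>\<zeta>. kap e n (\<zeta> - (z :: real \<times> (real^'d))))"
proof -
  have "continuous_on UNIV (kap e n :: real \<times> (real^'d) \<Rightarrow> real)"
    by (rule smooth_fun_continuous[OF smooth_kap])
  from stconv_integrable[OF _ this, of T "\<lambda>_. 1" z] show ?thesis by simp
qed

lemma integral_kap_le: "e > 0 \<Longrightarrow> (\<integral>\<zeta>. kap e n (\<zeta> - z) \<partial>ST T) \<le> 1"
  using nn_integral_kap_le[of e T n z] nn_integral_eq_integral[OF kap_integrable[of T e n z]]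
  by (simp add: kap_nonneg)

lemma integral_kap_eq_1: "e > 0 \<Longrightarrow> 0 \<le> fst z \<Longrightarrow> fst z + 2 * e \<le> T \<Longrightarrow> (\<integral>\<zeta>. kap e n (\<zeta> - z) \<partial>ST T) = 1"
  using nn_integral_kap_eq_1[of e z T n] nn_integral_eq_integral[OF kap_integrable[of T e n z]]
  by (simp add: kap_nonneg integral_nonneg_AE)

lemma stconv_kap_bound:
  assumes f: "integrable (ST T) f" and C: "AE z in ST T. \<bar>f z\<bar> \<le> C" and e: "e > 0" and C0: "0 \<le> C"
  shows "\<bar>stconv T (kap e n) f z\<bar> \<le> C"
proof -
  have "\<bar>stconv T (kap e n) f z\<bar> \<le> (\<integral>\<zeta>. C * kap e n (\<zeta> - z) \<partial>ST T)"
    unfolding stconv_def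
  proof (rule integral_abs_bound[THEN order_trans], rule integral_mono_AE)
    show "integrable (ST T) (\<lambda>\<zeta>. \<bar>f \<zeta> * kap e n (\<zeta> - z)\<bar>)"
      by (intro integrable_abs stconv_integrable f smooth_fun_continuous smooth_kap)
    show "integrable (ST T) (\<lambda>\<zeta>. C * kap e n (\<zeta> - z))" by (intro integrable_mult_right kap_integrable)
    show "AE \<zeta> in ST T. \<bar>f \<zeta> * kap e n (\<zeta> - z)\<bar> \<le> C * kap e n (\<zeta> - z)"
      using C by eventually_elim (auto simp: abs_mult kap_nonneg[OF e] intro!: mult_right_mono)
  qed
  also have "\<dots> \<le> C * 1" unfolding integral_mult_right_zero
    by (intro mult_left_mono integral_kap_le e C0)
  finally show ?thesis by simp
qed

lemma moll_bound:
  assumes "integrable (ST T) f" "AE z in ST T. \<bar>f z\<bar> \<le> C" "\<tau> < T" "0 \<le> C"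
  shows "\<bar>moll T \<tau> n f z\<bar> \<le> C"
  unfolding moll_def by (rule stconv_kap_bound[OF assms(1,2) eps_pos[OF assms(3)] assms(4)])

lemma smooth_moll: "integrable (ST T) f \<Longrightarrow> smooth_fun (moll T \<tau> n f)"
  unfolding moll_def by (rule smooth_fun_stconv[OF _ smooth_kap])

lemma stconv_periodic:
  assumes "\<And>y k. lattice_pt k \<Longrightarrow> K (y + (0, k)) = K y" "lattice_pt k"
  shows "stconv T K f (t, x + k) = stconv T K f (t, x)"
proof -
  have "lattice_pt (- k)" using assms(2) by (auto simp: lattice_pt_def)
  from assms(1)[OF this] have "K (\<zeta> - (t, x) + (0, - k)) = K (\<zeta> - (t, x))" for \<zeta> .
  moreover have "\<zeta> - (t, x) + (0, - k) = \<zeta> - (t, x + k)" for \<zeta>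
    by (simp add: prod_eq_iff)
  ultimately show ?thesis by (simp add: stconv_def)
qed

lemma kap_periodic: "lattice_pt k \<Longrightarrow> kap e n (y + (0, k)) = kap e n y"
  by (simp add: kap_def pker_periodic)

lemma moll_periodic: "lattice_pt k \<Longrightarrow> moll T \<tau> n f (t, x + k) = moll T \<tau> n f (t, x)"
  unfolding moll_def by (rule stconv_periodic) (auto simp: kap_periodic)

text \<open>By Tonelli the kernel may be integrated first over the evaluation point, where its mass
  is at most 1. The horizons \<open>S\<close> and \<open>T\<close> are independent: functions on the
  long slab are mollified, the result is measured on the short one.\<close>

lemma stconv_kap_contraction:
  fixes f :: "real \<times> (real^'d) \<Rightarrow> real"
  assumes f: "integrable (ST T) f" and e: "e > 0"
  shows "integrable (ST S) (stconv T (kap e n) f)"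
    "(\<integral>z. \<bar>stconv T (kap e n) f z\<bar> \<partial>ST S) \<le> (\<integral>z. \<bar>f z\<bar> \<partial>ST T)"
proof -
  have [measurable]: "f \<in> borel_measurable borel" using f by (simp add: integrable_iff_bounded)
  have [measurable]: "stconv T (kap e n) f \<in> borel_measurable borel"
    by (rule smooth_fun_borel[OF smooth_fun_stconv[OF f smooth_kap]])
  have "(\<integral>\<^sup>+z. ennreal \<bar>stconv T (kap e n) f z\<bar> \<partial>ST S) \<le>
     (\<integral>\<^sup>+z. \<integral>\<^sup>+\<zeta>. ennreal (\<bar>f \<zeta>\<bar> * kap e n (\<zeta> - z)) \<partial>ST T \<partial>ST S)"
  proof (rule nn_integral_mono)
    fix z
    have int: "integrable (ST T) (\<lambda>\<zeta>. \<bar>f \<zeta> * kap e n (\<zeta> - z)\<bar>)"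
      by (intro integrable_abs stconv_integrable f smooth_fun_continuous smooth_kap)
    have "ennreal \<bar>stconv T (kap e n) f z\<bar> \<le> ennreal (\<integral>\<zeta>. \<bar>f \<zeta> * kap e n (\<zeta> - z)\<bar> \<partial>ST T)"
      unfolding stconv_def by (intro ennreal_leI integral_abs_bound)
    also have "\<dots> = (\<integral>\<^sup>+\<zeta>. ennreal \<bar>f \<zeta> * kap e n (\<zeta> - z)\<bar> \<partial>ST T)"
      by (rule nn_integral_eq_integral[symmetric, OF int]) auto
    finally show "ennreal \<bar>stconv T (kap e n) f z\<bar> \<le> (\<integral>\<^sup>+\<zeta>. ennreal (\<bar>f \<zeta>\<bar> * kap e n (\<zeta> - z)) \<partial>ST T)"
      by (simp add: abs_mult kap_nonneg[OF e])
  qed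
  also have "\<dots> = (\<integral>\<^sup>+\<zeta>. \<integral>\<^sup>+z. ennreal (\<bar>f \<zeta>\<bar> * kap e n (\<zeta> - z)) \<partial>ST S \<partial>ST T)"
    by (rule STT.Fubini'[symmetric]) measurable
  also have "\<dots> = (\<integral>\<^sup>+\<zeta>. ennreal \<bar>f \<zeta>\<bar> * (\<integral>\<^sup>+z. ennreal (kap e n (\<zeta> - z)) \<partial>ST S) \<partial>ST T)"
    by (simp add: ennreal_mult' nn_integral_cmult)
  also have "\<dots> \<le> (\<integral>\<^sup>+\<zeta>. ennreal \<bar>f \<zeta>\<bar> * 1 \<partial>ST T)"
    by (intro nn_integral_mono mult_left_mono nn_integral_kap_rev_le e) auto
  also have "\<dots> = ennreal (\<integral>z. \<bar>f z\<bar> \<partial>ST T)"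
    using f by (simp add: nn_integral_eq_integral)
  finally have *: "(\<integral>\<^sup>+z. ennreal \<bar>stconv T (kap e n) f z\<bar> \<partial>ST S) \<le> ennreal (\<integral>z. \<bar>f z\<bar> \<partial>ST T)" .
  then show int: "integrable (ST S) (stconv T (kap e n) f)"
    by (intro integrableI_bounded) (auto simp: le_less_trans[OF _ ennreal_less_top])
  have "(\<integral>\<^sup>+z. ennreal \<bar>stconv T (kap e n) f z\<bar> \<partial>ST S) = ennreal (\<integral>z. \<bar>stconv T (kap e n) f z\<bar> \<partial>ST S)"
    by (rule nn_integral_eq_integral) (use int in auto)
  with * show "(\<integral>z. \<bar>stconv T (kap e n) f z\<bar> \<partial>ST S) \<le> (\<integral>z. \<bar>f z\<bar> \<partial>ST T)"
    by (simp add: integral_nonneg_AE)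
qed

text \<open>Continuous approximations are available only almost everywhere and without control of
  their size. Truncating \<open>f\<close> and the approximations at the same height makes dominated
  convergence applicable, and the truncation error of \<open>f\<close> itself is small in the
  mean.\<close>

lemma continuous_L1_dense:
  fixes f :: "real \<times> (real^'d) \<Rightarrow> real"
  assumes f: "integrable (ST T) f" and e: "e > 0"
  obtains g B where "continuous_on UNIV g" "\<And>z. \<bar>g z\<bar> \<le> B" "(\<integral>z. \<bar>f z - g z\<bar> \<partial>ST T) < e"
proof -
  define c where "c = (\<lambda>B y :: real. max (- B) (min B y))"
  have cc: "continuous_on UNIV (c B)" for B unfolding c_def by (intro continuous_intros)
  have [measurable]: "f \<in> borel_measurable borel" using f by (simp add: integrable_iff_bounded)
  have [measurable]: "c B \<in> borel_measurable borel" for B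
    by (rule borel_measurable_continuous_onI[OF cc])
  \<comment> \<open>This notion of measurability provides the continuous functions that converge to
    \<open>f\<close> off a negligible set.\<close>
  have "f measurable_on UNIV"
    by (rule lebesgue_measurable_imp_measurable_on) (auto intro!: measurable_completion)
  then obtain N g where N: "negligible N" and g: "\<And>n. continuous_on UNIV (g n)"
    "\<And>x. x \<notin> N \<Longrightarrow> (\<lambda>n. g n x) \<longlonglongrightarrow> f x"
    unfolding measurable_on_def by auto
  have [measurable]: "g n \<in> borel_measurable borel" for n
    by (rule borel_measurable_continuous_onI[OF g(1)])
  have "AE x in lebesgue. x \<notin> N" using N by (intro AE_not_in) (simp add: negligible_iff_null_sets)
  then have "AE x in lborel. x \<notin> N" by (simp add: AE_completion_iff)
  then have gAE: "AE x in ST T. (\<lambda>n. g n x) \<longlonglongrightarrow> f x"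
    unfolding AE_ST using g(2) by (auto elim: eventually_mono)
  have "(\<lambda>n. \<integral>z. \<bar>f z - c (real n) (f z)\<bar> \<partial>ST T) \<longlonglongrightarrow> (\<integral>z. 0 \<partial>(ST T :: (real \<times> (real^'d)) measure))"
  proof (rule integral_dominated_convergence[where w="\<lambda>z. \<bar>f z\<bar>"])
    show "AE z in ST T. (\<lambda>n. \<bar>f z - c (real n) (f z)\<bar>) \<longlonglongrightarrow> 0"
    proof (rule AE_I2)
      fix z
      obtain m where m: "\<bar>f z\<bar> \<le> real m" using real_arch_simple by blast
      have "\<forall>\<^sub>F n in sequentially. \<bar>f z - c (real n) (f z)\<bar> = 0"
        using eventually_ge_at_top[of m] by eventually_elim (use m in \<open>auto simp: c_def\<close>)
      then show "(\<lambda>n. \<bar>f z - c (real n) (f z)\<bar>) \<longlonglongrightarrow> 0"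
        by (rule tendsto_eventually)
    qed
  qed (use f in \<open>auto simp: c_def\<close>)
  then have "\<forall>\<^sub>F n in sequentially. (\<integral>z. \<bar>f z - c (real n) (f z)\<bar> \<partial>ST T) < e / 2"
    using e by (intro order_tendstoD(2)[of _ 0]) auto
  then obtain m where m: "(\<integral>z. \<bar>f z - c (real m) (f z)\<bar> \<partial>ST T) < e / 2"
    using eventually_happens' sequentially_bot by blast
  have cb: "\<bar>c (real m) y\<bar> \<le> real m" for y by (auto simp: c_def)
  have int: "integrable (ST T) (\<lambda>z. c (real m) (h z))" if [measurable]: "h \<in> borel_measurable borel" for h
    by (rule integrable_bounded_ST[where C="real m"]) (auto simp: cb)
  have "(\<lambda>n. \<integral>z. \<bar>c (real m) (f z) - c (real m) (g n z)\<bar> \<partial>ST T) \<longlonglongrightarrow> (\<integral>z. 0 \<partial>(ST T :: (real \<times> (real^'d)) measure))"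
  proof (rule integral_dominated_convergence[where w="\<lambda>z. 2 * real m"])
    show "AE z in ST T. (\<lambda>n. \<bar>c (real m) (f z) - c (real m) (g n z)\<bar>) \<longlonglongrightarrow> 0"
      using gAE
    proof eventually_elim
      case (elim z)
      have "(\<lambda>n. \<bar>c (real m) (f z) - c (real m) (g n z)\<bar>) \<longlonglongrightarrow> \<bar>c (real m) (f z) - c (real m) (f z)\<bar>"
        by (intro tendsto_intros continuous_on_tendsto_compose[OF cc] elim) auto
      then show ?case by simp
    qed
    show "AE z in ST T. norm \<bar>c (real m) (f z) - c (real m) (g n z)\<bar> \<le> 2 * real m" for n
    proof (rule AE_I2)
      fix z show "norm \<bar>c (real m) (f z) - c (real m) (g n z)\<bar> \<le> 2 * real m"
        using cb[of "f z"] cb[of "g n z"] by simp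
    qed
  qed auto
  then have "\<forall>\<^sub>F n in sequentially. (\<integral>z. \<bar>c (real m) (f z) - c (real m) (g n z)\<bar> \<partial>ST T) < e / 2"
    using e by (intro order_tendstoD(2)[of _ 0]) auto
  then obtain n where n: "(\<integral>z. \<bar>c (real m) (f z) - c (real m) (g n z)\<bar> \<partial>ST T) < e / 2"
    using eventually_happens' sequentially_bot by blast
  have ints: "integrable (ST T) (\<lambda>z. c (real m) (f z))" "integrable (ST T) (\<lambda>z. c (real m) (g n z))"
    by (auto intro!: int)
  have "(\<integral>z. \<bar>f z - c (real m) (g n z)\<bar> \<partial>ST T) \<le>
    (\<integral>z. \<bar>f z - c (real m) (f z)\<bar> + \<bar>c (real m) (f z) - c (real m) (g n z)\<bar> \<partial>ST T)"
    by (rule integral_mono) (use f ints in \<open>auto intro!: integrable_abs Bochner_Integration.integrable_diff Bochner_Integration.integrable_add\<close>)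
  also have "\<dots> = (\<integral>z. \<bar>f z - c (real m) (f z)\<bar> \<partial>ST T) + (\<integral>z. \<bar>c (real m) (f z) - c (real m) (g n z)\<bar> \<partial>ST T)"
    by (rule Bochner_Integration.integral_add) (use f ints in \<open>auto intro!: integrable_abs Bochner_Integration.integrable_diff\<close>)
  also have "\<dots> < e" using m n by linarith
  finally show ?thesis
    by (intro that[of "\<lambda>z. c (real m) (g n z)" "real m"])
       (auto simp: cb intro: continuous_on_compose2[OF cc g(1)])
qed

text \<open>The kernel concentrates at all lattice points, but \<open>g\<close> need not be
  periodic. This is harmless for \<open>x\<close> in the open cell: no other point of the closed
  cell differs from \<open>x\<close> by a lattice vector.\<close>

lemma moll_pointwise:
  fixes g :: "real \<times> (real^'d) \<Rightarrow> real"
  assumes g: "continuous_on UNIV g" and B: "\<And>z. \<bar>g z\<bar> \<le> B" and \<tau>: "\<tau> < T"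
    and t: "0 < t" "t < \<tau>" and x: "x \<in> box 0 (One :: real^'d)"
  shows "(\<lambda>n. moll T \<tau> n g (t, x)) \<longlonglongrightarrow> g (t, x)"
proof (rule LIMSEQ_I)
  fix r :: real assume r: "r > 0"
  have [measurable]: "g \<in> borel_measurable borel" by (rule borel_measurable_continuous_onI[OF g])
  have gi: "integrable (ST T) g" by (rule integrable_bounded_ST[where C=B]) (auto simp: B)
  let ?z = "(t, x)"
  obtain d where d: "d > 0" "\<And>y. dist y ?z < d \<Longrightarrow> dist (g y) (g ?z) < r / 2"
    using g r unfolding continuous_on_iff by (metis UNIV_I half_gt_zero)
  \<comment> \<open>The part of the closed cell at distance at least \<open>d / 2\<close> from
    \<open>x\<close>. The function \<open>\<phi>\<close> vanishes only where \<open>y - x\<close> is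
    a lattice vector, so it is bounded below on the compact \<open>K\<close>, and the kernel is
    eventually zero there.\<close>
  define K where "K = cell - ball x (d / 2)"
  define \<phi> where "\<phi> = (\<lambda>y :: real^'d. \<Sum>j\<in>UNIV. 1 - cos (2 * pi * (y - x) $ j))"
  have "compact K" unfolding K_def cell_def by (intro compact_diff compact_cbox open_ball)
  have \<phi>c: "continuous_on K \<phi>" unfolding \<phi>_def by (intro continuous_intros)
  have \<phi>pos: "\<phi> y > 0" if y: "y \<in> K" for y
  proof (rule ccontr)
    assume "\<not> \<phi> y > 0"
    moreover have "\<phi> y \<ge> 0" unfolding \<phi>_def by (intro sum_nonneg) auto
    ultimately have "\<phi> y = 0" by simp
    then have "\<forall>j. 1 - cos (2 * pi * (y - x) $ j) = 0"
      unfolding \<phi>_def by (subst (asm) sum_nonneg_eq_0_iff) auto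
    then have "y $ j = x $ j" for j
    proof -
      have "cos (2 * pi * (y - x) $ j) = 1" using \<open>\<forall>j. _\<close> by simp
      then obtain m :: int where "2 * pi * (y - x) $ j = of_int m * 2 * pi" by (auto simp: cos_one_2pi_int)
      then have m: "(y - x) $ j = of_int m" by simp
      have comp: "(One::real^'d) $ i = 1" for i by (simp add: cart_eq_inner_axis axis_in_Basis_iff)
      have "0 < x $ j" "x $ j < 1" using x by (auto simp: mem_box_cart comp simp del: sum_component)
      moreover have "0 \<le> y $ j" "y $ j \<le> 1" using y
        by (auto simp: K_def cell_def mem_box_cart comp simp del: sum_component)
      ultimately have "\<bar>of_int m :: real\<bar> < 1" using m by (auto simp: abs_if)
      then have "m = 0" by linarith
      then show ?thesis using m by simp
    qed
    then have "y = x" by (simp add: vec_eq_iff)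
    then show False using y d(1) by (simp add: K_def)
  qed
  obtain \<mu> where \<mu>: "\<mu> > 0" "\<And>y. y \<in> K \<Longrightarrow> \<mu> \<le> \<phi> y"
  proof (cases "K = {}")
    case False
    obtain y0 where "y0 \<in> K" "\<forall>y\<in>K. \<phi> y0 \<le> \<phi> y"
      using continuous_attains_inf[OF \<open>compact K\<close> False \<phi>c] by blast
    then show ?thesis using that[of "\<phi> y0"] \<phi>pos by auto
  qed (use that[of 1] in auto)
  have "\<forall>\<^sub>F n in sequentially. inverse (real (Suc n)) < \<mu>"
    using order_tendstoD(2)[OF LIMSEQ_inverse_real_of_nat \<mu>(1)] .
  moreover have "\<forall>\<^sub>F n in sequentially. eps T \<tau> n < d / 4"
    by (rule order_tendstoD(2)[OF eps_tendsto]) (use d(1) in simp)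
  ultimately have "\<forall>\<^sub>F n in sequentially. norm (moll T \<tau> n g ?z - g ?z) < r"
  proof eventually_elim
    case (elim n)
    let ?e = "eps T \<tau> n"
    note e0 = eps_pos[OF \<tau>, of n]
    have one: "(\<integral>\<zeta>. kap ?e n (\<zeta> - ?z) \<partial>ST T) = 1"
      using integral_kap_eq_1[OF e0, of ?z T n] eps_le[OF \<tau>, of n] t by simp
    have int1: "integrable (ST T) (\<lambda>\<zeta>. g \<zeta> * kap ?e n (\<zeta> - ?z))"
      by (intro stconv_integrable gi smooth_fun_continuous smooth_kap)
    have int2: "integrable (ST T) (\<lambda>\<zeta>. g ?z * kap ?e n (\<zeta> - ?z))"
      by (intro integrable_mult_right kap_integrable)
    have "moll T \<tau> n g ?z - g ?z = (\<integral>\<zeta>. g \<zeta> * kap ?e n (\<zeta> - ?z) \<partial>ST T) - (\<integral>\<zeta>. g ?z * kap ?e n (\<zeta> - ?z) \<partial>ST T)"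
      by (simp add: moll_def stconv_def one)
    also have "\<dots> = (\<integral>\<zeta>. (g \<zeta> - g ?z) * kap ?e n (\<zeta> - ?z) \<partial>ST T)"
      by (simp add: left_diff_distrib Bochner_Integration.integral_diff[OF int1 int2])
    finally have "\<bar>moll T \<tau> n g ?z - g ?z\<bar> \<le> (\<integral>\<zeta>. \<bar>(g \<zeta> - g ?z) * kap ?e n (\<zeta> - ?z)\<bar> \<partial>ST T)"
      by (simp add: integral_abs_bound)
    also have "\<dots> \<le> (\<integral>\<zeta>. r / 2 * kap ?e n (\<zeta> - ?z) \<partial>ST T)"
    proof (rule integral_mono_AE)
      show "integrable (ST T) (\<lambda>\<zeta>. \<bar>(g \<zeta> - g ?z) * kap ?e n (\<zeta> - ?z)\<bar>)"
        using Bochner_Integration.integrable_diff[OF int1 int2] by (intro integrable_abs) (simp add: left_diff_distrib)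
      show "integrable (ST T) (\<lambda>\<zeta>. r / 2 * kap ?e n (\<zeta> - ?z))"
        by (intro integrable_mult_right kap_integrable)
      show "AE \<zeta> in ST T. \<bar>(g \<zeta> - g ?z) * kap ?e n (\<zeta> - ?z)\<bar> \<le> r / 2 * kap ?e n (\<zeta> - ?z)"
        using AE_ST_slab
      proof eventually_elim
        case (elim \<zeta>)
        show ?case
        proof (cases "kap ?e n (\<zeta> - ?z) = 0")
          case False
          \<comment> \<open>A nonzero kernel forces \<open>\<zeta>\<close> to be close to the
            evaluation point: the time factor bounds the difference of times by
            \<open>2 * eps\<close>, and the spatial factor excludes \<open>K\<close>.\<close>
          then have "\<eta> ((fst \<zeta> - t) / ?e) \<noteq> 0" and pb: "pker n (snd \<zeta> - x) \<noteq> 0" by (auto simp: kap_def)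
          then have "1 < (fst \<zeta> - t) / ?e" "(fst \<zeta> - t) / ?e < 2"
            using step_props(4,6) by (meson not_le)+
          then have "0 < fst \<zeta> - t" "fst \<zeta> - t < 2 * ?e"
            using e0 by (auto simp: field_simps)
          then have d1: "dist (fst \<zeta>) t < d / 2"
            using \<open>?e < d / 4\<close> by (simp add: dist_real_def)
          have "pbump n (snd \<zeta> - x) \<noteq> 0" using pb by (auto simp: pker_def)
          then have "real (Suc n) * \<phi> (snd \<zeta>) < 1"
            unfolding pbump_def \<phi>_def using flat_exp_eq_0[of _ 0] by (meson diff_le_0_iff_le not_le)
          then have "\<phi> (snd \<zeta>) < \<mu>"
          proof -
            have "1 < real (Suc n) * \<mu>"
              using \<open>inverse (real (Suc n)) < \<mu>\<close> by (simp add: field_simps del: of_nat_Suc)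
            with \<open>real (Suc n) * \<phi> (snd \<zeta>) < 1\<close> have "real (Suc n) * \<phi> (snd \<zeta>) < real (Suc n) * \<mu>"
              by linarith
            then show ?thesis by (rule mult_left_less_imp_less) simp
          qed
          then have "snd \<zeta> \<notin> K" using \<mu>(2) by fastforce
          then have d2: "dist (snd \<zeta>) x < d / 2"
            using \<open>\<zeta> \<in> {0<..<T} \<times> cell\<close> by (auto simp: K_def dist_commute)
          have "dist \<zeta> ?z \<le> dist (fst \<zeta>) t + dist (snd \<zeta>) x"
            by (simp add: dist_prod_def sqrt_sum_squares_le_sum)
          then have "dist \<zeta> ?z < d" using d1 d2 by simp
          from d(2)[OF this] have "\<bar>g \<zeta> - g ?z\<bar> \<le> r / 2" by (simp add: dist_real_def)
          then have "\<bar>g \<zeta> - g ?z\<bar> * kap ?e n (\<zeta> - ?z) \<le> r / 2 * kap ?e n (\<zeta> - ?z)"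
            by (rule mult_right_mono) (rule kap_nonneg[OF e0])
          then show ?thesis by (simp add: abs_mult kap_nonneg[OF e0])
        qed simp
      qed
    qed
    also have "\<dots> = r / 2" by (simp add: one)
    finally show ?case using r by simp
  qed
  then show "\<exists>no. \<forall>n\<ge>no. norm (moll T \<tau> n g ?z - g ?z) < r"
    by (simp add: eventually_sequentially)
qed

lemma ST_integral_le:
  fixes f :: "real \<times> (real^'d) \<Rightarrow> real"
  assumes "S \<le> T" and f: "integrable (ST T) f" "\<And>z. 0 \<le> f z"
  shows "(\<integral>z. f z \<partial>ST S) \<le> (\<integral>z. f z \<partial>ST T)"
proof -
  have m: "({..<S} \<times> (UNIV :: (real^'d) set)) \<in> sets borel"
    by (subst borel_prod[symmetric]) (intro pair_measureI; simp)
  have fb: "f \<in> borel_measurable borel" using f(1) by (simp add: integrable_iff_bounded)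
  have "(\<integral>z. f z \<partial>ST S) = (\<integral>z. indicator ({..<S} \<times> UNIV) z * f z \<partial>ST T)"
    by (rule ST_mono_integral[OF assms(1) fb])
  also have "\<dots> \<le> (\<integral>z. f z \<partial>ST T)"
  proof (rule integral_mono)
    show "integrable (ST T) (\<lambda>z. indicator ({..<S} \<times> UNIV) z * f z)"
      using integrable_real_mult_indicator[OF _ f(1), of "{..<S} \<times> UNIV"] m by (simp add: mult.commute)
  qed (use f in \<open>auto simp: indicator_def\<close>)
  finally show ?thesis .
qed

lemma integrable_ST_mono:
  fixes f :: "real \<times> (real^'d) \<Rightarrow> real"
  assumes "S \<le> T" and f: "integrable (ST T) f"
  shows "integrable (ST S) f"
proof -
  have fb: "f \<in> borel_measurable borel" using f(1) by (simp add: integrable_iff_bounded)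
  have "integrable lborel (\<lambda>z. indicator ({0<..<T} \<times> cell) z *\<^sub>R f z)"
    using f fb unfolding ST_def by (subst (asm) integrable_density) auto
  then have "integrable lborel (\<lambda>z. indicator ({0<..<S} \<times> cell) z *\<^sub>R f z)"
    by (rule Bochner_Integration.integrable_bound) (use assms(1) fb in \<open>auto simp: indicator_def\<close>)
  then show ?thesis
    unfolding ST_def using fb by (subst integrable_density) auto
qed

lemma AE_ST_mono: "S \<le> T \<Longrightarrow> AE z in ST T. P z \<Longrightarrow> AE z in ST S. P z"
  unfolding AE_ST by (auto elim!: eventually_mono)

text \<open>Three errors, each below \<open>r / 3\<close>: the mollification of
  \<open>f - g\<close>, small by contraction, the mollification error of a bounded continuous
  \<open>g\<close>, small by pointwise convergence, and \<open>f - g\<close> itself.\<close>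

lemma moll_L1:
  fixes f :: "real \<times> (real^'d) \<Rightarrow> real"
  assumes f: "integrable (ST T) f" and \<tau>: "0 < \<tau>" "\<tau> < T"
  shows "(\<lambda>n. \<integral>z. \<bar>moll T \<tau> n f z - f z\<bar> \<partial>ST \<tau>) \<longlonglongrightarrow> 0"
proof (rule LIMSEQ_I)
  fix r :: real assume r: "r > 0"
  then have "r / 3 > 0" by simp
  then obtain g B where g: "continuous_on UNIV g" "\<And>z. \<bar>g z\<bar> \<le> B" "(\<integral>z. \<bar>f z - g z\<bar> \<partial>ST T) < r / 3"
    using continuous_L1_dense[OF f] by blast
  have gb: "g \<in> borel_measurable borel" by (rule borel_measurable_continuous_onI[OF g(1)])
  have gi: "integrable (ST T) g" by (rule integrable_bounded_ST[where C=B]) (auto simp: g gb)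
  have fg: "integrable (ST T) (\<lambda>z. f z - g z)" using f gi by simp
  note int\<tau> = integrable_ST_mono[OF less_imp_le[OF \<tau>(2)]]
  have B0: "0 \<le> B" using g(2)[of undefined] by simp
  have mollint: "integrable (ST \<tau>) (moll T \<tau> n h)" if "integrable (ST T) h" for n h
    unfolding moll_def by (rule stconv_kap_contraction[OF that eps_pos[OF \<tau>(2)]])
  have "(\<lambda>n. \<integral>z. \<bar>moll T \<tau> n g z - g z\<bar> \<partial>ST \<tau>) \<longlonglongrightarrow> (\<integral>z. 0 \<partial>(ST \<tau> :: (real \<times> (real^'d)) measure))"
  proof (rule integral_dominated_convergence[where w="\<lambda>z. 2 * B"])
    show "AE z in ST \<tau>. (\<lambda>n. \<bar>moll T \<tau> n g z - g z\<bar>) \<longlonglongrightarrow> 0"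
    proof -
      have "AE z in ST \<tau>. snd z \<in> box 0 (One :: real^'d)"
        unfolding ST_pair
      proof (rule TC.AE_pair_measure)
        have "{z::real \<times> (real^'d). snd z \<in> box 0 One} = UNIV \<times> box 0 One" by auto
        then show "{x \<in> space (tm \<tau> \<Otimes>\<^sub>M cm). snd x \<in> box 0 (One :: real^'d)} \<in> sets (tm \<tau> \<Otimes>\<^sub>M cm)"
          by (simp add: space_pair_measure del: UNIV_Times_UNIV)
        show "AE x in tm \<tau>. AE y in cm. snd (x, y) \<in> box 0 (One :: real^'d)"
          unfolding snd_conv by (rule AE_I2) (rule AE_cm_box)
      qed
      with AE_ST_slab show ?thesis
      proof eventually_elim
        case (elim z)
        have "(\<lambda>n. moll T \<tau> n g (fst z, snd z)) \<longlonglongrightarrow> g (fst z, snd z)"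
          by (rule moll_pointwise[OF g(1,2) \<tau>(2)]) (use elim in auto)
        then have "(\<lambda>n. \<bar>moll T \<tau> n g z - g z\<bar>) \<longlonglongrightarrow> \<bar>g z - g z\<bar>"
          by (intro tendsto_intros) simp
        then show ?case by simp
      qed
    qed
    show "AE z in ST \<tau>. norm \<bar>moll T \<tau> n g z - g z\<bar> \<le> 2 * B" for n
    proof (rule AE_I2)
      fix z
      have "\<bar>moll T \<tau> n g z\<bar> \<le> B" by (rule moll_bound[OF gi _ \<tau>(2) B0]) (use g(2) in auto)
      then show "norm \<bar>moll T \<tau> n g z - g z\<bar> \<le> 2 * B" using g(2)[of z] by simp
    qed
  qed (use gb smooth_fun_borel[OF smooth_moll[OF gi]] in auto)
  then have "\<forall>\<^sub>F n in sequentially. (\<integral>z. \<bar>moll T \<tau> n g z - g z\<bar> \<partial>ST \<tau>) < r / 3"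
    using r by (intro order_tendstoD(2)[of _ 0]) auto
  then have "\<forall>\<^sub>F n in sequentially. norm ((\<integral>z. \<bar>moll T \<tau> n f z - f z\<bar> \<partial>ST \<tau>) - 0) < r"
  proof eventually_elim
    case (elim n)
    have lin: "moll T \<tau> n (\<lambda>z. f z - g z) z = moll T \<tau> n f z - moll T \<tau> n g z" for z
      unfolding moll_def stconv_def left_diff_distrib
      by (rule Bochner_Integration.integral_diff) (intro stconv_integrable f gi smooth_fun_continuous smooth_kap)+
    have 1: "(\<integral>z. \<bar>moll T \<tau> n (\<lambda>z. f z - g z) z\<bar> \<partial>ST \<tau>) < r / 3"
      using stconv_kap_contraction(2)[OF fg eps_pos[OF \<tau>(2)], of \<tau> n n] g(3) unfolding moll_def by linarith
    have 2: "(\<integral>z. \<bar>f z - g z\<bar> \<partial>ST \<tau>) < r / 3"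
      using ST_integral_le[of \<tau> T "\<lambda>z. \<bar>f z - g z\<bar>"] fg g(3) \<tau> by simp
    note ii = mollint[OF f, of n] mollint[OF gi, of n] int\<tau>[OF f] int\<tau>[OF gi]
    have "(\<integral>z. \<bar>moll T \<tau> n f z - f z\<bar> \<partial>ST \<tau>) \<le>
      (\<integral>z. \<bar>moll T \<tau> n (\<lambda>z. f z - g z) z\<bar> + (\<bar>moll T \<tau> n g z - g z\<bar> + \<bar>f z - g z\<bar>) \<partial>ST \<tau>)"
      unfolding lin by (rule integral_mono) (use ii in auto)
    also have "\<dots> = (\<integral>z. \<bar>moll T \<tau> n (\<lambda>z. f z - g z) z\<bar> \<partial>ST \<tau>) +
       ((\<integral>z. \<bar>moll T \<tau> n g z - g z\<bar> \<partial>ST \<tau>) + (\<integral>z. \<bar>f z - g z\<bar> \<partial>ST \<tau>))"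
      unfolding lin using ii by simp
    finally show ?case using 1 2 elim by (simp add: abs_of_nonneg integral_nonneg_AE)
  qed
  then show "\<exists>no. \<forall>n\<ge>no. norm ((\<integral>z. \<bar>moll T \<tau> n f z - f z\<bar> \<partial>ST \<tau>) - 0) < r"
    by (simp add: eventually_sequentially)
qed

subsection \<open>Weak derivatives and smooth approximation\<close>

abbreviation et :: "real \<times> (real^'d)" where "et \<equiv> (1, 0)"
abbreviation ex :: "'d \<Rightarrow> real \<times> (real^'d)" where "ex j \<equiv> (0, axis j 1)"

lemma et_Basis [simp]: "et \<in> Basis" and ex_Basis [simp]: "ex j \<in> Basis"
  by (auto simp: Basis_prod_def axis_in_Basis_iff)

definition per :: "(real \<times> (real^'d) \<Rightarrow> real) \<Rightarrow> bool" where
  "per \<phi> \<longleftrightarrow> (\<forall>t x k. lattice_pt k \<longrightarrow> \<phi> (t, x + k) = \<phi> (t, x))"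

definition utest :: "real \<Rightarrow> (real \<times> (real^'d) \<Rightarrow> real) \<Rightarrow> bool" where
  "utest T \<phi> \<longleftrightarrow> smooth_fun \<phi> \<and> per \<phi> \<and> (\<exists>\<tau><T. \<forall>z. \<tau> \<le> fst z \<longrightarrow> \<phi> z = 0)"

definition uitest :: "real \<Rightarrow> (real \<times> (real^'d) \<Rightarrow> real) \<Rightarrow> bool" where
  "uitest T \<phi> \<longleftrightarrow> utest T \<phi> \<and> (\<exists>\<tau>>0. \<forall>z. fst z \<le> \<tau> \<longrightarrow> \<phi> z = 0)"

text \<open>Curried functions of time and space are replaced by functions on pairs; the prefix u marks
  the uncurried counterparts of the notions of Defs.\<close>
definition uwdx :: "real \<Rightarrow> (real \<times> (real^'d) \<Rightarrow> real) \<Rightarrow> 'd \<Rightarrow> (real \<times> (real^'d) \<Rightarrow> real) \<Rightarrow> bool" where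
  "uwdx T f j g \<longleftrightarrow> (\<forall>\<phi>. uitest T \<phi> \<longrightarrow>
      (\<integral>z. f z * pd (ex j) \<phi> z \<partial>ST T) = - (\<integral>z. g z * \<phi> z \<partial>ST T))"

definition uwdt :: "real \<Rightarrow> (real \<times> (real^'d) \<Rightarrow> real) \<Rightarrow> (real \<times> (real^'d) \<Rightarrow> real) \<Rightarrow> (real^'d \<Rightarrow> real) \<Rightarrow> bool" where
  "uwdt T f g f0 \<longleftrightarrow> (\<forall>\<phi>. utest T \<phi> \<longrightarrow>
      (\<integral>z. f z * pd et \<phi> z + g z * \<phi> z \<partial>ST T) + (\<integral>x. f0 x * \<phi> (0, x) \<partial>cm) = 0)"

text \<open>Since \<open>\<eta>\<close> vanishes up to 1, the kernel centred at \<open>z\<close>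
  vanishes for all times up to \<open>eps\<close>, even if \<open>z\<close> lies at the initial
  time; this makes it an interior test function.\<close>

lemma uitest_kap:
  fixes z :: "real \<times> (real^'d)"
  assumes "\<tau> < T" "0 \<le> fst z" "fst z \<le> \<tau>"
  shows "uitest T (\<lambda>\<zeta>. kap (eps T \<tau> n) n (\<zeta> - z))"
proof -
  let ?e = "eps T \<tau> n"
  note e0 = eps_pos[OF assms(1), of n]
  have "per (\<lambda>\<zeta>. kap ?e n (\<zeta> - z))"
    unfolding per_def
  proof (intro allI impI)
    fix t x and k :: "real^'d" assume "lattice_pt k"
    have "(t, x + k) - z = ((t, x) - z) + (0, k)" by (simp add: prod_eq_iff)
    then show "kap ?e n ((t, x + k) - z) = kap ?e n ((t, x) - z)"
      by (simp only: kap_periodic[OF \<open>lattice_pt k\<close>])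
  qed
  moreover have "kap ?e n (\<zeta> - z) = 0" if "fst z + 2 * ?e \<le> fst \<zeta>" for \<zeta>
    using that e0 by (auto simp: kap_def step_props field_simps)
  moreover have "kap ?e n (\<zeta> - z) = 0" if "fst \<zeta> \<le> ?e" for \<zeta>
    using that e0 assms by (auto simp: kap_def step_props field_simps)
  moreover have "fst z + 2 * ?e < T" using eps_le[OF assms(1), of n] assms by simp
  ultimately show ?thesis unfolding uitest_def utest_def
    using e0 smooth_fun_translate[OF smooth_kap] by blast
qed

text \<open>The weak derivative is tested with the kernel itself; the sign from the reflected kernel
  and the sign from integration by parts cancel.\<close>

lemma moll_pd_space:
  assumes "uwdx T f j g" and f: "integrable (ST T) f" and "\<tau> < T" "0 \<le> fst z" "fst z \<le> \<tau>"
  shows "pd (ex j) (moll T \<tau> n f) z = moll T \<tau> n g z"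
proof -
  have "pd (ex j) (moll T \<tau> n f) z = - (\<integral>\<zeta>. f \<zeta> * pd (ex j) (kap (eps T \<tau> n) n) (\<zeta> - z) \<partial>ST T)"
    unfolding moll_def by (subst pd_stconv[OF f smooth_kap]) (auto simp: stconv_def)
  also have "\<dots> = - (\<integral>\<zeta>. f \<zeta> * pd (ex j) (\<lambda>\<zeta>. kap (eps T \<tau> n) n (\<zeta> - z)) \<zeta> \<partial>ST T)"
    by (simp add: pd_translate)
  also have "\<dots> = moll T \<tau> n g z"
    using assms(1)[unfolded uwdx_def, rule_format, OF uitest_kap[OF assms(3-5), of n]]
    by (simp add: moll_def stconv_def)
  finally show ?thesis .
qed

lemma moll_pd_time:
  assumes "uwdt T f g f0" and f: "integrable (ST T) f" and g: "integrable (ST T) g"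
    and "\<tau> < T" "0 \<le> fst z" "fst z \<le> \<tau>"
  shows "pd et (moll T \<tau> n f) z = moll T \<tau> n g z"
proof -
  let ?k = "kap (eps T \<tau> n) n"
  let ?\<phi> = "\<lambda>\<zeta>. ?k (\<zeta> - z)"
  note ut = uitest_kap[OF assms(4-6), of n]
  \<comment> \<open>The kernel vanishes at time 0, so the initial values drop out of the weak
    formulation.\<close>
  have "?\<phi> (0, x) = 0" for x using ut unfolding uitest_def
    by (metis fst_conv less_imp_le)
  then have "(\<integral>\<zeta>. f \<zeta> * pd et ?\<phi> \<zeta> + g \<zeta> * ?\<phi> \<zeta> \<partial>ST T) = 0"
    using assms(1)[unfolded uwdt_def, rule_format, of ?\<phi>] ut by (simp add: uitest_def)
  moreover have "(\<integral>\<zeta>. f \<zeta> * pd et ?\<phi> \<zeta> + g \<zeta> * ?\<phi> \<zeta> \<partial>ST T) =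
      (\<integral>\<zeta>. f \<zeta> * pd et ?k (\<zeta> - z) \<partial>ST T) + (\<integral>\<zeta>. g \<zeta> * ?k (\<zeta> - z) \<partial>ST T)"
    unfolding pd_translate
    by (intro Bochner_Integration.integral_add stconv_integrable f g smooth_fun_continuous smooth_kap smooth_fun_pd et_Basis)
  moreover have "pd et (moll T \<tau> n f) z = - (\<integral>\<zeta>. f \<zeta> * pd et ?k (\<zeta> - z) \<partial>ST T)"
    unfolding moll_def by (subst pd_stconv[OF f smooth_kap]) (auto simp: stconv_def)
  ultimately show ?thesis by (simp add: moll_def stconv_def)
qed

subsection \<open>Initial values\<close>

definition spconv :: "nat \<Rightarrow> (real^'d \<Rightarrow> real) \<Rightarrow> real^'d \<Rightarrow> real" where
  "spconv n f x = (\<integral>y. f y * pker n (y - x) \<partial>cm)"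

lemma integral_ST_prod:
  fixes a :: "real \<Rightarrow> real" and b :: "real^'d \<Rightarrow> real"
  assumes "integrable (tm T) a" "integrable cm b"
  shows "integrable (ST T) (\<lambda>z. a (fst z) * b (snd z))"
    "(\<integral>z. a (fst z) * b (snd z) \<partial>ST T) = (\<integral>t. a t \<partial>tm T) * (\<integral>x. b x \<partial>cm)"
proof -
  have [measurable]: "a \<in> borel_measurable borel" "b \<in> borel_measurable borel"
    using assms by (auto simp: integrable_iff_bounded)
  have m: "(\<lambda>z. a (fst z) * b (snd z)) \<in> borel_measurable (tm T \<Otimes>\<^sub>M cm)" by measurable
  have "integrable (tm T \<Otimes>\<^sub>M cm) (\<lambda>z. a (fst z) * b (snd z))"
    by (rule TC.Fubini_integrable[OF m]) (use assms in \<open>auto simp: abs_mult\<close>)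
  then show int: "integrable (ST T) (\<lambda>z. a (fst z) * b (snd z))" by (simp add: ST_pair)
  show "(\<integral>z. a (fst z) * b (snd z) \<partial>ST T) = (\<integral>t. a t \<partial>tm T) * (\<integral>x. b x \<partial>cm)"
    using TC.integral_fst'[OF int[unfolded ST_pair]] by (simp add: ST_pair)
qed

lemma measure_tm: "0 \<le> T \<Longrightarrow> measure (tm T) UNIV = T"
  by (simp add: measure_def tm_def emeasure_density ennreal_indicator)

lemma integrable_\<eta>_tm: "integrable (tm T) (\<lambda>s. \<eta> ((s - t) / e) / e)"
proof -
  have c: "continuous_on UNIV \<eta>" by (rule smooth_fun_continuous[OF smooth_\<eta>])
  have "compact (\<eta> ` {1..2})"
    by (intro compact_continuous_image continuous_on_subset[OF c]) auto
  from compact_imp_bounded[OF this] obtain B where B: "\<forall>y\<in>\<eta> ` {1..2}. norm y \<le> B"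
    unfolding bounded_iff by (elim exE)
  have "\<bar>\<eta> s\<bar> \<le> max B 0" for s
  proof (cases "1 \<le> s \<and> s \<le> 2")
    case True
    then have "norm (\<eta> s) \<le> B" using B by simp
    then show ?thesis by simp
  qed (use step_props(4,6)[of s] in auto)
  then have "\<bar>\<eta> ((s - t) / e) / e\<bar> \<le> max B 0 / \<bar>e\<bar>" for s
    by (simp add: abs_divide divide_right_mono)
  then show ?thesis by (intro tm.integrable_const_bound[of _ "max B 0 / \<bar>e\<bar>"]) auto
qed

lemma pker_bounded: "\<bar>pker n y\<bar> \<le> 1 / (\<integral>x. pbump n x \<partial>(cm :: (real^'d) measure))" for y :: "real^'d"
  using integral_pbump_pos[of n, where 'd='d] pbump_bounds[of n y] by (simp add: pker_def divide_right_mono)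

lemma spconv_integrable:
  "integrable cm f \<Longrightarrow> integrable cm (\<lambda>y. f y * pker n (y - (x :: real^'d)))"
  by (rule integrable_mult_bounded[where C="1 / (\<integral>x. pbump n x \<partial>(cm :: (real^'d) measure))"]) (auto simp: pker_bounded)

text \<open>Extending a spatial function constantly in time embeds spatial mollification into the
  space-time one, whose convergence results then apply to initial data.\<close>

lemma moll_time_const:
  fixes f :: "real^'d \<Rightarrow> real"
  assumes f: "integrable cm f" and \<tau>: "\<tau> < T" "0 \<le> fst z" "fst z \<le> \<tau>"
  shows "moll T \<tau> n (\<lambda>z. f (snd z)) z = spconv n f (snd z)"
proof -
  let ?e = "eps T \<tau> n"
  note e0 = eps_pos[OF \<tau>(1), of n]
  have "moll T \<tau> n (\<lambda>z. f (snd z)) z =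
     (\<integral>\<zeta>. (\<eta> ((fst \<zeta> - fst z) / ?e) / ?e) * (f (snd \<zeta>) * pker n (snd \<zeta> - snd z)) \<partial>ST T)"
    by (simp add: moll_def stconv_def kap_def mult_ac)
  also have "\<dots> = (\<integral>s. \<eta> ((s - fst z) / ?e) / ?e \<partial>tm T) * spconv n f (snd z)"
    unfolding spconv_def by (rule integral_ST_prod(2)[OF integrable_\<eta>_tm spconv_integrable[OF f]])
  also have "(\<integral>s. \<eta> ((s - fst z) / ?e) / ?e \<partial>tm T) = 1"
  proof -
    have "ennreal (\<integral>s. \<eta> ((s - fst z) / ?e) / ?e \<partial>tm T) = (\<integral>\<^sup>+s. ennreal (\<eta> ((s - fst z) / ?e) / ?e) \<partial>tm T)"
      by (rule nn_integral_eq_integral[symmetric, OF integrable_\<eta>_tm]) (use e0 step_props(2) in auto)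
    also have "\<dots> = 1"
      using nn_integral_kap_eq_1[OF e0, of z T n] eps_le[OF \<tau>(1), of n] \<tau> by (simp add: nn_integral_kap[OF e0])
    finally show ?thesis by simp
  qed
  finally show ?thesis by simp
qed

lemma integrable_snd:
  fixes f :: "real^'d \<Rightarrow> real"
  assumes "integrable cm f" shows "integrable (ST T) (\<lambda>z. f (snd z))"
  using integral_ST_prod(1)[of T "\<lambda>_. 1", OF _ assms] by simp

lemma spconv_borel:
  fixes f :: "real^'d \<Rightarrow> real"
  assumes f: "integrable cm f" shows "spconv n f \<in> borel_measurable borel"
proof -
  have "(\<lambda>x. moll 1 0 n (\<lambda>z. f (snd z)) (0, x)) \<in> borel_measurable borel"
    using smooth_fun_borel[OF smooth_moll[OF integrable_snd[OF f, of 1], of 0 n]]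
    by (rule measurable_compose[rotated]) (simp flip: borel_prod)
  moreover have "moll 1 0 n (\<lambda>z. f (snd z)) (0, x) = spconv n f x" for x
    using moll_time_const[OF f, of 0 1 "(0, x)"] by simp
  ultimately show ?thesis by simp
qed

lemma spconv_L1:
  fixes f :: "real^'d \<Rightarrow> real"
  assumes f: "integrable cm f"
  shows "integrable cm (spconv n f)" "(\<lambda>n. \<integral>x. \<bar>spconv n f x - f x\<bar> \<partial>cm) \<longlonglongrightarrow> 0"
proof -
  have bound: "\<bar>spconv n f x\<bar> \<le> (\<integral>y. \<bar>f y\<bar> * (1 / (\<integral>x. pbump n x \<partial>(cm :: (real^'d) measure))) \<partial>cm)" for n x
    unfolding spconv_def
  proof (rule integral_abs_bound[THEN order_trans], rule integral_mono)
    show "integrable cm (\<lambda>y. \<bar>f y * pker n (y - x)\<bar>)" by (intro integrable_abs spconv_integrable f)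
    show "\<bar>f y * pker n (y - x)\<bar> \<le> \<bar>f y\<bar> * (1 / (\<integral>x. pbump n x \<partial>(cm :: (real^'d) measure)))" for y
      unfolding abs_mult by (intro mult_left_mono pker_bounded) auto
  qed (use f in auto)
  then show int: "integrable cm (spconv n f)" for n
    by (rule_tac cm.integrable_const_bound[of _ "(\<integral>y. \<bar>f y\<bar> * (1 / (\<integral>x. pbump n x \<partial>(cm :: (real^'d) measure))) \<partial>cm)"])
       (auto simp: spconv_borel[OF f])
  \<comment> \<open>With the horizons 2 and 1 the integral runs over a slab of length 1, so the
    integral over time contributes the factor 1.\<close>
  have "(\<integral>z. \<bar>moll 2 1 n (\<lambda>z. f (snd z)) z - f (snd z)\<bar> \<partial>ST 1) = (\<integral>x. \<bar>spconv n f x - f x\<bar> \<partial>cm)" for n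
  proof -
    have fb: "f \<in> borel_measurable borel" using f by (simp add: integrable_iff_bounded)
    have "(\<integral>z. \<bar>moll 2 1 n (\<lambda>z. f (snd z)) z - f (snd z)\<bar> \<partial>ST 1) =
        (\<integral>z. (\<lambda>_. 1) (fst z) * (\<lambda>x. \<bar>spconv n f x - f x\<bar>) (snd z) \<partial>ST 1)"
    proof (rule integral_cong_AE)
      have i: "integrable (ST 1) (\<lambda>z. \<bar>moll 2 1 n (\<lambda>z. f (snd z)) z - f (snd z)\<bar>)"
        using stconv_kap_contraction(1)[OF integrable_snd[OF f, of 2] eps_pos[of 1 2 n], of 1 n] integrable_snd[OF f, of 1]
        by (simp add: moll_def)
      then show "(\<lambda>z. \<bar>moll 2 1 n (\<lambda>z. f (snd z)) z - f (snd z)\<bar>) \<in> borel_measurable (ST 1)"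
        by (rule borel_measurable_integrable)
      have "integrable (ST 1) (\<lambda>z. (\<lambda>_. 1) (fst z) * (\<lambda>x. \<bar>spconv n f x - f x\<bar>) (snd z))"
        by (rule integral_ST_prod(1)) (use int f in auto)
      then show "(\<lambda>z. (\<lambda>_. 1) (fst z) * (\<lambda>x. \<bar>spconv n f x - f x\<bar>) (snd z)) \<in> borel_measurable (ST 1)"
        by (rule borel_measurable_integrable)
      show "AE z in ST 1. \<bar>moll 2 1 n (\<lambda>z. f (snd z)) z - f (snd z)\<bar> = 1 * \<bar>spconv n f (snd z) - f (snd z)\<bar>"
        using AE_ST_slab by eventually_elim (auto simp: moll_time_const[OF f])
    qed
    also have "\<dots> = (\<integral>t. 1 \<partial>tm 1) * (\<integral>x. \<bar>spconv n f x - f x\<bar> \<partial>cm)"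
      by (rule integral_ST_prod(2)) (use int f in auto)
    finally show ?thesis by (simp add: measure_tm)
  qed
  with moll_L1[OF integrable_snd[OF f, of 2], of 1] show "(\<lambda>n. \<integral>x. \<bar>spconv n f x - f x\<bar> \<partial>cm) \<longlonglongrightarrow> 0" by simp
qed

text \<open>A test function that does not vanish initially: at time 0 it is the spatial kernel
  centred at \<open>x\<close>, and its time derivative is minus the space-time kernel centred at
  \<open>(0, x)\<close>. Testing with it compares the mollification at time 0 with the mollified
  datum.\<close>

definition initk :: "real \<Rightarrow> nat \<Rightarrow> real^'d \<Rightarrow> real \<times> (real^'d) \<Rightarrow> real" where
  "initk e n x z = step (fst z / e) * pker n (snd z - x)"

lemma smooth_initk: "smooth_fun (initk e n x)"
proof -
  have "smooth_fun (\<lambda>s. step (inverse e * s))"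
    by (intro smooth_fun_compose[OF step_props(1)] smooth_fun_mult smooth_fun_const smooth_fun_id)
  from smooth_fun_mult[OF smooth_time[OF this] smooth_fun_translate[OF smooth_pker[of n], of "(0, x)"]]
  show ?thesis unfolding initk_def[abs_def] by (simp add: divide_inverse mult.commute)
qed

lemma utest_initk:
  fixes x :: "real^'d"
  assumes "0 < e" "2 * e < T" shows "utest T (initk e n x)"
proof -
  have "per (initk e n x)" unfolding per_def initk_def
  proof (intro allI impI)
    fix t y and k :: "real^'d" assume k: "lattice_pt k"
    have "y + k - x = (y - x) + k" by simp
    then have "pker n (y + k - x) = pker n (y - x)" by (simp only: pker_periodic[OF k])
    then show "step (fst (t, y + k) / e) * pker n (snd (t, y + k) - x) = step (fst (t, y) / e) * pker n (snd (t, y) - x)"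
      by simp
  qed
  moreover have "initk e n x z = 0" if "2 * e \<le> fst z" for z
    using that assms by (simp add: initk_def step_props field_simps)
  ultimately show ?thesis using assms smooth_initk unfolding utest_def by blast
qed

lemma pd_et_initk:
  assumes "e > 0" shows "pd et (initk e n x) z = - kap e n (z - (0, x))"
proof (rule pd_eqI)
  have "((\<lambda>s. (fst z + s) / e) has_real_derivative 1 / e) (at 0)"
    using assms by (auto intro!: derivative_eq_intros)
  from DERIV_chain2[OF DERIV_step this]
  have "((\<lambda>s. step ((fst z + s) / e) * pker n (snd z - x)) has_real_derivative
      (- \<eta> (fst z / e) * (1 / e)) * pker n (snd z - x)) (at 0)"
    by (intro DERIV_cmult_right) simp
  then show "((\<lambda>s. initk e n x (z + s *\<^sub>R et)) has_real_derivative - kap e n (z - (0, x))) (at 0)"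
    by (simp add: initk_def kap_def)
qed

lemma pd_ex_initk:
  "pd (ex j) (initk e n x) z = step (fst z / e) * pd (ex j) (\<lambda>z. pker n (snd z)) (z - (0, x))"
proof (rule pd_eqI)
  have "((\<lambda>s. pker n (snd ((z - (0, x)) + s *\<^sub>R ex j))) has_real_derivative
      pd (ex j) (\<lambda>z. pker n (snd z)) (z - (0, x))) (at 0)"
    by (rule smooth_fun_has_pd[OF smooth_pker]) simp
  from DERIV_cmult[OF this, of "step (fst z / e)"]
  show "((\<lambda>s. initk e n x (z + s *\<^sub>R ex j)) has_real_derivative
      step (fst z / e) * pd (ex j) (\<lambda>z. pker n (snd z)) (z - (0, x))) (at 0)"
    by (simp add: initk_def algebra_simps)
qed

lemma step_tm_integral:
  assumes "e > 0"
  shows "integrable (tm T) (\<lambda>s. step (s / e))" "(\<integral>s. step (s / e) \<partial>tm T) \<le> 2 * e"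
proof -
  have [measurable]: "step \<in> borel_measurable borel" by (rule smooth_fun_borel[OF step_props(1)])
  show int: "integrable (tm T) (\<lambda>s. step (s / e))"
    by (rule tm.integrable_const_bound[of _ 1]) (auto simp: step_range abs_of_nonneg)
  have "(\<integral>s. step (s / e) \<partial>tm T) \<le> (\<integral>s. indicator {0..2 * e} s \<partial>tm T)"
  proof (rule integral_mono_AE[OF int])
    show "integrable (tm T) (\<lambda>s. indicator {0..2 * e} s :: real)"
      by (rule tm.integrable_const_bound[of _ 1]) (auto simp: indicator_def)
    show "AE s in tm T. step (s / e) \<le> indicator {0..2 * e} s"
      unfolding AE_tm using assms step_range(2)
      by (intro AE_I2) (auto simp: indicator_def not_le step_props field_simps)
  qed
  also have "\<dots> = measure (tm T) {0..2 * e}" by simp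
  also have "\<dots> \<le> 2 * e"
  proof -
    have "emeasure (tm T) {0..2 * e} \<le> (\<integral>\<^sup>+s. indicator {0..2 * e} s \<partial>lborel)"
      using nn_integral_tm_le[of "indicator {0..2 * e}" T] by simp
    then have "emeasure (tm T) {0..2 * e} \<le> ennreal (2 * e)" using assms by simp
    then show ?thesis using assms by (simp add: measure_def enn2real_leI)
  qed
  finally show "(\<integral>s. step (s / e) \<partial>tm T) \<le> 2 * e" .
qed

text \<open>Testing with \<open>initk\<close> shows that the mollification at time 0 differs from
  the spatially mollified datum by an integral of \<open>g\<close> over a time interval of length
  \<open>2 * eps\<close>, hence by a multiple of \<open>eps\<close> uniformly in
  \<open>x\<close>.\<close>

lemma moll_init:
  fixes f g :: "real \<times> (real^'d) \<Rightarrow> real"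
  assumes dt: "uwdt T f g f0" and f: "integrable (ST T) f" and g: "g \<in> borel_measurable borel"
    "AE z in ST T. \<bar>g z\<bar> \<le> C" and f0: "integrable cm f0" and \<tau>: "0 < \<tau>" "\<tau> < T"
  shows "(\<lambda>n. \<integral>x. \<bar>moll T \<tau> n f (0, x) - f0 x\<bar> \<partial>cm) \<longlonglongrightarrow> 0"
proof -
  have gi: "integrable (ST T) g" by (rule integrable_bounded_ST[OF g])
  have C0: "0 \<le> \<bar>C\<bar>" by simp
  have gC: "AE z in ST T. \<bar>g z\<bar> \<le> \<bar>C\<bar>" using g(2) by eventually_elim auto
  have est: "\<bar>moll T \<tau> n f (0, x) - spconv n f0 x\<bar> \<le> \<bar>C\<bar> * (2 * eps T \<tau> n)" for n x
  proof -
    let ?e = "eps T \<tau> n"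
    let ?\<phi> = "initk ?e n x"
    note e0 = eps_pos[OF \<tau>(2), of n]
    have ut: "utest T ?\<phi>" using eps_le[OF \<tau>(2), of n] e0 \<tau> by (intro utest_initk) auto
    have pint: "integrable (ST T) ?\<phi>" "(\<integral>z. ?\<phi> z \<partial>ST T) \<le> 2 * ?e"
    proof -
      have pi: "integrable cm (\<lambda>y. pker n (y - x))" using spconv_integrable[of "\<lambda>_. 1" n x] by simp
      have "ennreal (\<integral>y. pker n (y - x) \<partial>cm) = 1"
        using nn_integral_eq_integral[OF pi] nn_integral_pker[of n x] by (simp add: pker_nonneg)
      then have one: "(\<integral>y. pker n (y - x) \<partial>cm) = 1" by simp
      show "integrable (ST T) ?\<phi>" "(\<integral>z. ?\<phi> z \<partial>ST T) \<le> 2 * ?e"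
        unfolding initk_def
        using integral_ST_prod[OF step_tm_integral(1)[OF e0, of T] pi] step_tm_integral(2)[OF e0, of T]
        by (auto simp: one)
    qed
    have gp: "integrable (ST T) (\<lambda>z. g z * ?\<phi> z)"
      using integrable_mult_bounded[OF pint(1) _ gC] g(1) by (simp add: mult.commute)
    have fk: "integrable (ST T) (\<lambda>z. f z * kap ?e n (z - (0, x)))"
      by (intro stconv_integrable f smooth_fun_continuous smooth_kap)
    have "(\<integral>z. f z * pd et ?\<phi> z + g z * ?\<phi> z \<partial>ST T) + (\<integral>y. f0 y * ?\<phi> (0, y) \<partial>cm) = 0"
      using dt ut unfolding uwdt_def by blast
    moreover have "(\<integral>y. f0 y * ?\<phi> (0, y) \<partial>cm) = spconv n f0 x"
      by (simp add: spconv_def initk_def step_props)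
    moreover have "(\<integral>z. f z * pd et ?\<phi> z + g z * ?\<phi> z \<partial>ST T) = - moll T \<tau> n f (0, x) + (\<integral>z. g z * ?\<phi> z \<partial>ST T)"
      using gp fk by (simp add: pd_et_initk[OF e0] moll_def stconv_def)
    ultimately have "moll T \<tau> n f (0, x) - spconv n f0 x = (\<integral>z. g z * ?\<phi> z \<partial>ST T)" by simp
    also have "\<bar>\<dots>\<bar> \<le> (\<integral>z. \<bar>C\<bar> * ?\<phi> z \<partial>ST T)"
    proof (rule integral_abs_bound[THEN order_trans], rule integral_mono_AE)
      show "AE z in ST T. \<bar>g z * ?\<phi> z\<bar> \<le> \<bar>C\<bar> * ?\<phi> z"
        using gC by eventually_elim (auto simp: abs_mult initk_def step_range pker_nonneg intro!: mult_right_mono)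
    qed (use gp pint in auto)
    also have "\<dots> \<le> \<bar>C\<bar> * (2 * ?e)" using pint(2) by (simp add: mult_left_mono)
    finally show ?thesis .
  qed
  have mb: "(\<lambda>x. moll T \<tau> n f (0, x)) \<in> borel_measurable borel" for n
    using smooth_fun_borel[OF smooth_moll[OF f, of \<tau> n]]
    by (rule measurable_compose[rotated]) (simp flip: borel_prod)
  note si = spconv_L1(1)[OF f0]
  have di: "integrable cm (\<lambda>x. moll T \<tau> n f (0, x) - spconv n f0 x)" for n
    by (rule cm.integrable_const_bound[of _ "\<bar>C\<bar> * (2 * eps T \<tau> n)"])
       (use est mb spconv_borel[OF f0] in auto)
  show ?thesis
  proof (rule Lim_null_comparison)
    show "\<forall>\<^sub>F n in sequentially. norm (\<integral>x. \<bar>moll T \<tau> n f (0, x) - f0 x\<bar> \<partial>cm) \<le>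
      \<bar>C\<bar> * (2 * eps T \<tau> n) * measure (cm :: (real^'d) measure) UNIV + (\<integral>x. \<bar>spconv n f0 x - f0 x\<bar> \<partial>cm)"
    proof (intro always_eventually allI)
      fix n
      have "(\<integral>x. \<bar>moll T \<tau> n f (0, x) - f0 x\<bar> \<partial>cm) \<le> (\<integral>x. \<bar>C\<bar> * (2 * eps T \<tau> n) + \<bar>spconv n f0 x - f0 x\<bar> \<partial>cm)"
      proof (rule integral_mono)
        have "integrable cm (\<lambda>x. (moll T \<tau> n f (0, x) - spconv n f0 x) + (spconv n f0 x - f0 x))"
          by (rule Bochner_Integration.integrable_add[OF di Bochner_Integration.integrable_diff[OF si f0]])
        then show "integrable cm (\<lambda>x. \<bar>moll T \<tau> n f (0, x) - f0 x\<bar>)"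
          by (intro integrable_abs) (rule Bochner_Integration.integrable_cong[THEN iffD1, OF refl, rotated], assumption, simp)
        show "\<bar>moll T \<tau> n f (0, x) - f0 x\<bar> \<le> \<bar>C\<bar> * (2 * eps T \<tau> n) + \<bar>spconv n f0 x - f0 x\<bar>" for x
          using est[of n x] by linarith
      qed (use si f0 in auto)
      also have "\<dots> = \<bar>C\<bar> * (2 * eps T \<tau> n) * measure (cm :: (real^'d) measure) UNIV + (\<integral>x. \<bar>spconv n f0 x - f0 x\<bar> \<partial>cm)"
        using si f0 by simp
      finally show "norm (\<integral>x. \<bar>moll T \<tau> n f (0, x) - f0 x\<bar> \<partial>cm) \<le> \<dots>"
        by (simp add: abs_of_nonneg integral_nonneg_AE)
    qed
    have "(\<lambda>n. \<bar>C\<bar> * (2 * eps T \<tau> n) * measure (cm :: (real^'d) measure) UNIV + (\<integral>x. \<bar>spconv n f0 x - f0 x\<bar> \<partial>cm))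
       \<longlonglongrightarrow> \<bar>C\<bar> * (2 * 0) * measure (cm :: (real^'d) measure) UNIV + 0"
      by (intro tendsto_intros eps_tendsto spconv_L1(2)[OF f0])
    then show "(\<lambda>n. \<bar>C\<bar> * (2 * eps T \<tau> n) * measure (cm :: (real^'d) measure) UNIV + (\<integral>x. \<bar>spconv n f0 x - f0 x\<bar> \<partial>cm)) \<longlonglongrightarrow> 0"
      by simp
  qed
qed

text \<open>This makes the initial velocities integrable, although only their weighted squares are
  assumed to be.\<close>
lemma initial_lower_bound:
  fixes r :: "real \<times> (real^'d) \<Rightarrow> real"
  assumes eq: "\<And>\<phi>. utest T \<phi> \<Longrightarrow>
      (\<integral>z. r z * pd et \<phi> z + (\<Sum>j\<in>UNIV. F j z * pd (ex j) \<phi> z) \<partial>ST T) + (\<integral>x. r0 x * \<phi> (0, x) \<partial>cm) = 0"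
    and T: "0 < T"
    and r: "integrable (ST T) r" "AE z in ST T. m \<le> r z"
    and F: "\<And>j. F j \<in> borel_measurable borel" "\<And>j. AE z in ST T. \<bar>F j z\<bar> \<le> C"
    and r0: "integrable cm r0"
  shows "AE x in cm. m \<le> r0 x"
proof -
  have Fi: "integrable (ST T) (F j)" for j by (rule integrable_bounded_ST[OF F])
  \<comment> \<open>For fixed \<open>n\<close> the spatial derivatives of the kernel are bounded
    while the test function lives on a time interval of length \<open>2 * e\<close>. Letting
    \<open>e\<close> tend to 0 removes the flux term; only afterwards is \<open>n\<close> sent to
    infinity.\<close>
  have lower: "m \<le> spconv n r0 x" for n x
  proof -
    let ?P = "\<lambda>j. pd (ex j) (\<lambda>z::real \<times> (real^'d). pker n (snd z))"
    have Pc: "continuous_on UNIV (?P j)" for j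
      by (intro smooth_fun_continuous smooth_fun_pd smooth_pker) simp
    have "\<exists>B. \<forall>\<zeta>\<in>{0<..<T} \<times> cell. \<bar>?P j (\<zeta> - (0, x))\<bar> \<le> B" for j
      using kernel_bounded[OF Pc, of T "(0, x)" 1 j] centre_in_cball[of "(0::real, x)" 1]
      by (metis zero_le_one)
    then obtain B where B: "\<And>j \<zeta>. \<zeta> \<in> {0<..<T} \<times> cell \<Longrightarrow> \<bar>?P j (\<zeta> - (0, x))\<bar> \<le> B j" by metis
    define A where "A = (\<Sum>j\<in>UNIV. \<bar>C\<bar> * \<bar>B j\<bar>)"
    let ?V = "measure (cm :: (real^'d) measure) UNIV"
    have est: "m - A * ?V * (2 * e) \<le> spconv n r0 x" if e: "0 < e" "2 * e < T" for e
    proof -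
      let ?\<phi> = "initk e n x"
      note ut = utest_initk[OF e, of n x]
      have "(\<integral>z. r z * pd et ?\<phi> z + (\<Sum>j\<in>UNIV. F j z * pd (ex j) ?\<phi> z) \<partial>ST T) + (\<integral>y. r0 y * ?\<phi> (0, y) \<partial>cm) = 0"
        by (rule eq[OF ut])
      moreover have "(\<integral>y. r0 y * ?\<phi> (0, y) \<partial>cm) = spconv n r0 x"
        by (simp add: spconv_def initk_def step_props)
      moreover have rk: "integrable (ST T) (\<lambda>z. r z * kap e n (z - (0, x)))"
        by (intro stconv_integrable r smooth_fun_continuous smooth_kap)
      moreover have "integrable (ST T) (\<lambda>z. F j z * pd (ex j) ?\<phi> ((z - 0)))" for j
        by (intro stconv_integrable Fi smooth_fun_continuous smooth_fun_pd smooth_initk ex_Basis)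
      then have Fk: "integrable (ST T) (\<lambda>z. \<Sum>j\<in>UNIV. F j z * pd (ex j) ?\<phi> z)" by simp
      ultimately have eq2: "spconv n r0 x = (\<integral>z. r z * kap e n (z - (0, x)) \<partial>ST T) - (\<integral>z. (\<Sum>j\<in>UNIV. F j z * pd (ex j) ?\<phi> z) \<partial>ST T)"
        by (simp add: pd_et_initk[OF e(1)])
      have "(\<integral>z. m * kap e n (z - (0, x)) \<partial>ST T) \<le> (\<integral>z. r z * kap e n (z - (0, x)) \<partial>ST T)"
      proof (rule integral_mono_AE)
        show "AE z in ST T. m * kap e n (z - (0, x)) \<le> r z * kap e n (z - (0, x))"
          using r(2) by eventually_elim (intro mult_right_mono kap_nonneg e)
        show "integrable (ST T) (\<lambda>z. m * kap e n (z - (0, x)))"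
          by (rule integrable_mult_right[OF kap_integrable])
      qed (rule rk)
      moreover have "(\<integral>z. m * kap e n (z - (0, x)) \<partial>ST T) = m"
        using integral_kap_eq_1[OF e(1), of "(0, x)" T n] e by simp
      moreover have "(\<integral>z. (\<Sum>j\<in>UNIV. F j z * pd (ex j) ?\<phi> z) \<partial>ST T) \<le> (\<integral>z. step (fst z / e) * (\<lambda>_::real^'d. A) (snd z) \<partial>ST T)"
      proof (rule integral_mono_AE[OF Fk])
        show "integrable (ST T) (\<lambda>z. step (fst z / e) * (\<lambda>_::real^'d. A) (snd z))"
          by (rule integral_ST_prod(1)[OF step_tm_integral(1)[OF e(1)]]) simp
        have "AE z in ST T. \<forall>j. \<bar>F j z\<bar> \<le> C" using F(2) by (simp add: AE_all_countable)
        with AE_ST_slab show "AE z in ST T. (\<Sum>j\<in>UNIV. F j z * pd (ex j) ?\<phi> z) \<le> step (fst z / e) * (\<lambda>_::real^'d. A) (snd z)"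
        proof eventually_elim
          case (elim z)
          have "F j z * pd (ex j) ?\<phi> z \<le> step (fst z / e) * (\<bar>C\<bar> * \<bar>B j\<bar>)" for j
          proof -
            have "\<bar>F j z * ?P j (z - (0, x))\<bar> \<le> \<bar>C\<bar> * \<bar>B j\<bar>"
              unfolding abs_mult using elim(2) B[OF elim(1), of j]
              by (intro mult_mono) (auto intro: order_trans[OF _ abs_ge_self])
            then have "step (fst z / e) * (F j z * ?P j (z - (0, x))) \<le> step (fst z / e) * (\<bar>C\<bar> * \<bar>B j\<bar>)"
              by (intro mult_left_mono step_range) auto
            then show ?thesis unfolding pd_ex_initk by (simp only: mult.left_commute)
          qed
          then have "(\<Sum>j\<in>UNIV. F j z * pd (ex j) ?\<phi> z) \<le> (\<Sum>j\<in>UNIV. step (fst z / e) * (\<bar>C\<bar> * \<bar>B j\<bar>))"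
            by (intro sum_mono)
          then show ?case by (simp add: A_def sum_distrib_left)
        qed
      qed
      moreover have "(\<integral>z. step (fst z / e) * (\<lambda>_::real^'d. A) (snd z) \<partial>ST T) \<le> A * ?V * (2 * e)"
      proof -
        have "(\<integral>z. step (fst z / e) * (\<lambda>_::real^'d. A) (snd z) \<partial>ST T) = (\<integral>s. step (s / e) \<partial>tm T) * (\<integral>x. A \<partial>(cm :: (real^'d) measure))"
          by (rule integral_ST_prod(2)[OF step_tm_integral(1)[OF e(1)]]) simp
        also have "(\<integral>x. A \<partial>(cm :: (real^'d) measure)) = A * ?V" by simp
        also have "(\<integral>s. step (s / e) \<partial>tm T) * (A * ?V) \<le> 2 * e * (A * ?V)"
          by (intro mult_right_mono step_tm_integral(2) e) (auto simp: A_def sum_nonneg)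
        finally show ?thesis by (simp add: mult_ac)
      qed
      ultimately show ?thesis using eq2 by linarith
    qed
    have "(\<lambda>k. m - A * ?V * (2 * (T / 4 * inverse (real (Suc k))))) \<longlonglongrightarrow> m - A * ?V * (2 * (T / 4 * 0))"
      by (intro tendsto_intros LIMSEQ_inverse_real_of_nat)
    then have lim: "(\<lambda>k. m - A * ?V * (2 * (T / 4 * inverse (real (Suc k))))) \<longlonglongrightarrow> m" by simp
    show ?thesis
    proof (rule LIMSEQ_le_const2[OF lim], intro exI[of _ 0] allI impI est)
      fix k :: nat
      have "inverse (real (Suc k)) \<le> 1" by (simp add: inverse_le_1_iff)
      then have "T * inverse (real (Suc k)) \<le> T * 1" using T by (intro mult_left_mono) auto
      then show "2 * (T / 4 * inverse (real (Suc k))) < T" using T by simp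
    qed (use T in auto)
  qed
  obtain q where "strict_mono (q :: nat \<Rightarrow> nat)" "AE x in cm. (\<lambda>n. spconv (q n) r0 x) \<longlonglongrightarrow> r0 x"
    using L1_AE_subseq[of cm "\<lambda>n. spconv n r0" r0] spconv_L1[OF r0] r0 by blast
  from this(2) show ?thesis
    by eventually_elim (rule LIMSEQ_le_const, assumption, use lower in auto)
qed

subsection \<open>Approximable test functions\<close>

definition bdd :: "real \<Rightarrow> (real \<times> (real^'d) \<Rightarrow> real) \<Rightarrow> bool" where
  "bdd T f \<longleftrightarrow> f \<in> borel_measurable borel \<and> (\<exists>C. AE z in ST T. \<bar>f z\<bar> \<le> C)"

text \<open>The functions with their gradients that arise as bounded limits of smooth periodic
  functions. No decay in time is demanded; it is provided separately by a cutoff.\<close>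

definition sapx :: "real \<Rightarrow> (real \<times> (real^'d) \<Rightarrow> real) \<Rightarrow> ('d \<Rightarrow> real \<times> (real^'d) \<Rightarrow> real) \<Rightarrow> bool" where
  "sapx \<tau> f fx \<longleftrightarrow> (\<exists>\<phi>. (\<forall>n. smooth_fun (\<phi> n) \<and> per (\<phi> n)) \<and> bconv (ST \<tau>) \<phi> f \<and>
     (\<forall>j. bconv (ST \<tau>) (\<lambda>n. pd (ex j) (\<phi> n)) (fx j)))"

definition tapx :: "real \<Rightarrow> (real \<times> (real^'d) \<Rightarrow> real) \<Rightarrow> (real \<times> (real^'d) \<Rightarrow> real) \<Rightarrow>
    ('d \<Rightarrow> real \<times> (real^'d) \<Rightarrow> real) \<Rightarrow> (real^'d \<Rightarrow> real) \<Rightarrow> bool" where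
  "tapx \<tau> f ft fx f0 \<longleftrightarrow> (\<exists>\<phi>. (\<forall>n. smooth_fun (\<phi> n) \<and> per (\<phi> n)) \<and> bconv (ST \<tau>) \<phi> f \<and>
     bconv (ST \<tau>) (\<lambda>n. pd et (\<phi> n)) ft \<and>
     (\<forall>j. bconv (ST \<tau>) (\<lambda>n. pd (ex j) (\<phi> n)) (fx j)) \<and> bconv cm (\<lambda>n x. \<phi> n (0, x)) f0)"

lemma bdd_integrable: "bdd T f \<Longrightarrow> integrable (ST T) f"
  unfolding bdd_def using integrable_bounded_ST by blast

lemma bdd_obtain:
  assumes "bdd T f"
  obtains C where "0 \<le> C" "AE z in ST T. \<bar>f z\<bar> \<le> C"
proof -
  obtain C where "AE z in ST T. \<bar>f z\<bar> \<le> C" using assms by (auto simp: bdd_def)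
  then have "AE z in ST T. \<bar>f z\<bar> \<le> \<bar>C\<bar>" by eventually_elim auto
  then show ?thesis using that[of "\<bar>C\<bar>"] by simp
qed

lemma bconv_moll:
  assumes f: "bdd T f" and \<tau>: "0 < \<tau>" "\<tau> < T"
  shows "bconv (ST \<tau>) (\<lambda>n. moll T \<tau> n f) f"
proof -
  note fi = bdd_integrable[OF f]
  obtain C where C: "0 \<le> C" "AE z in ST T. \<bar>f z\<bar> \<le> C" using bdd_obtain[OF f] by blast
  show ?thesis
  proof (rule ST.bconv_L1I[where C=C])
    show "moll T \<tau> n f \<in> borel_measurable (ST \<tau>)" for n
      using smooth_fun_borel[OF smooth_moll[OF fi]] by simp
    show "AE z in ST \<tau>. \<bar>moll T \<tau> n f z\<bar> \<le> C" for n
      by (intro AE_I2 moll_bound fi C \<tau>)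
    show "integrable (ST \<tau>) f" using integrable_ST_mono[OF _ fi] \<tau> by simp
    show "(\<lambda>n. \<integral>z. \<bar>moll T \<tau> n f z - f z\<bar> \<partial>ST \<tau>) \<longlonglongrightarrow> 0" by (rule moll_L1[OF fi \<tau>])
  qed
qed

lemma per_moll: "per (moll T \<tau> n f)"
  by (simp add: per_def moll_periodic)

lemma bconv_moll_pd_space:
  assumes f: "bdd T f" and g: "bdd T g" and \<tau>: "0 < \<tau>" "\<tau> < T" and w: "uwdx T f j g"
  shows "bconv (ST \<tau>) (\<lambda>n. pd (ex j) (moll T \<tau> n f)) g"
proof (rule ST.bconv_cong[OF bconv_moll[OF g \<tau>]])
  show "AE z in ST \<tau>. moll T \<tau> n g z = pd (ex j) (moll T \<tau> n f) z" for n
    using AE_ST_slab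
    by eventually_elim (rule moll_pd_space[OF w bdd_integrable[OF f] \<tau>(2), symmetric]; auto)
  show "pd (ex j) (moll T \<tau> n f) \<in> borel_measurable (ST \<tau>)" for n
    using smooth_fun_borel[OF smooth_fun_pd[OF smooth_moll[OF bdd_integrable[OF f]] ex_Basis]] by simp
qed (use g in \<open>auto simp: bdd_def\<close>)

lemma sapx_moll:
  assumes f: "bdd T f" and g: "\<And>j. bdd T (fx j)" and \<tau>: "0 < \<tau>" "\<tau> < T" and w: "\<And>j. uwdx T f j (fx j)"
  shows "sapx \<tau> f fx"
  unfolding sapx_def
  by (rule exI[of _ "\<lambda>n. moll T \<tau> n f"])
     (auto simp: per_moll intro!: smooth_moll bdd_integrable f bconv_moll bconv_moll_pd_space g \<tau> w)

lemma tapx_moll: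
  assumes f: "bdd T f" and g: "\<And>j. bdd T (fx j)" and ft: "bdd T ft" and f0: "integrable cm f0"
    and \<tau>: "0 < \<tau>" "\<tau> < T" and w: "\<And>j. uwdx T f j (fx j)" and wt: "uwdt T f ft f0"
  shows "tapx \<tau> f ft fx f0"
proof -
  note fi = bdd_integrable[OF f]
  have "bconv (ST \<tau>) (\<lambda>n. pd et (moll T \<tau> n f)) ft"
  proof (rule ST.bconv_cong[OF bconv_moll[OF ft \<tau>]])
    show "AE z in ST \<tau>. moll T \<tau> n ft z = pd et (moll T \<tau> n f) z" for n
      using AE_ST_slab
      by eventually_elim (rule moll_pd_time[OF wt fi bdd_integrable[OF ft] \<tau>(2), symmetric]; auto)
    show "pd et (moll T \<tau> n f) \<in> borel_measurable (ST \<tau>)" for n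
      using smooth_fun_borel[OF smooth_fun_pd[OF smooth_moll[OF fi] et_Basis]] by simp
  qed (use ft in \<open>auto simp: bdd_def\<close>)
  moreover have "bconv cm (\<lambda>n x. moll T \<tau> n f (0, x)) f0"
  proof -
    obtain C where C: "0 \<le> C" "AE z in ST T. \<bar>f z\<bar> \<le> C" using bdd_obtain[OF f] by blast
    show ?thesis
    proof (rule cm.bconv_L1I[where C=C])
      show "(\<lambda>x. moll T \<tau> n f (0, x)) \<in> borel_measurable cm" for n
        unfolding borel_measurable_cm_iff using smooth_fun_borel[OF smooth_moll[OF fi, of \<tau> n]]
        by (rule measurable_compose[rotated]) (simp flip: borel_prod)
      show "AE x in cm. \<bar>moll T \<tau> n f (0, x)\<bar> \<le> C" for n
        by (intro AE_I2 moll_bound fi C \<tau>)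
      show "(\<lambda>n. \<integral>x. \<bar>moll T \<tau> n f (0, x) - f0 x\<bar> \<partial>cm) \<longlonglongrightarrow> 0"
        using ft \<tau> unfolding bdd_def by (auto intro: moll_init[OF wt fi _ _ f0])
    qed (rule f0)
  qed
  ultimately show ?thesis
    unfolding tapx_def
    by (intro exI[of _ "\<lambda>n. moll T \<tau> n f"])
       (auto simp: per_moll intro!: smooth_moll fi bconv_moll f bconv_moll_pd_space g \<tau> w)
qed

lemma tapx_sapx: "tapx \<tau> f ft fx f0 \<Longrightarrow> sapx \<tau> f fx"
  unfolding tapx_def sapx_def by blast

lemma per_mult: "per f \<Longrightarrow> per g \<Longrightarrow> per (\<lambda>z. f z * g z)"
  by (simp add: per_def)

lemma bconv_pd_mult:
  assumes "\<And>n. smooth_fun (\<phi> n)" "\<And>n. smooth_fun (\<psi> n)" "b \<in> Basis"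
    "bconv (ST \<tau>) \<phi> f" "bconv (ST \<tau>) \<psi> g" "bconv (ST \<tau>) (\<lambda>n. pd b (\<phi> n)) f'" "bconv (ST \<tau>) (\<lambda>n. pd b (\<psi> n)) g'"
  shows "bconv (ST \<tau>) (\<lambda>n. pd b (\<lambda>z. \<phi> n z * \<psi> n z)) (\<lambda>z. f' z * g z + f z * g' z)"
proof -
  have "bconv (ST \<tau>) (\<lambda>n z. pd b (\<phi> n) z * \<psi> n z + \<phi> n z * pd b (\<psi> n) z) (\<lambda>z. f' z * g z + f z * g' z)"
    by (intro ST.bconv_add ST.bconv_mult assms)
  moreover have "pd b (\<lambda>z. \<phi> n z * \<psi> n z) = (\<lambda>z. pd b (\<phi> n) z * \<psi> n z + \<phi> n z * pd b (\<psi> n) z)" for n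
    by (rule ext) (rule pd_mult[OF assms(1-3)])
  ultimately show ?thesis by simp
qed

text \<open>Bounded convergence survives products, so the Leibniz rule closes the class. This admits
  the products of a velocity with its gradient, and test functions divided by
  \<open>r\<close>.\<close>

lemma sapx_mult:
  assumes "sapx \<tau> f fx" "sapx \<tau> g gx"
  shows "sapx \<tau> (\<lambda>z. f z * g z) (\<lambda>j z. fx j z * g z + f z * gx j z)"
proof -
  obtain \<phi> where \<phi>: "\<And>n. smooth_fun (\<phi> n)" "\<And>n. per (\<phi> n)" "bconv (ST \<tau>) \<phi> f"
    "\<And>j. bconv (ST \<tau>) (\<lambda>n. pd (ex j) (\<phi> n)) (fx j)" using assms(1) by (auto simp: sapx_def)
  obtain \<psi> where \<psi>: "\<And>n. smooth_fun (\<psi> n)" "\<And>n. per (\<psi> n)" "bconv (ST \<tau>) \<psi> g"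
    "\<And>j. bconv (ST \<tau>) (\<lambda>n. pd (ex j) (\<psi> n)) (gx j)" using assms(2) by (auto simp: sapx_def)
  show ?thesis unfolding sapx_def
    by (intro exI[of _ "\<lambda>n z. \<phi> n z * \<psi> n z"] conjI allI smooth_fun_mult per_mult ST.bconv_mult bconv_pd_mult \<phi> \<psi> ex_Basis)
qed

lemma tapx_mult:
  assumes "tapx \<tau> f ft fx f0" "tapx \<tau> g gt gx g0"
  shows "tapx \<tau> (\<lambda>z. f z * g z) (\<lambda>z. ft z * g z + f z * gt z) (\<lambda>j z. fx j z * g z + f z * gx j z) (\<lambda>x. f0 x * g0 x)"
proof -
  obtain \<phi> where \<phi>: "\<And>n. smooth_fun (\<phi> n)" "\<And>n. per (\<phi> n)" "bconv (ST \<tau>) \<phi> f"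
    "bconv (ST \<tau>) (\<lambda>n. pd et (\<phi> n)) ft" "bconv cm (\<lambda>n x. \<phi> n (0, x)) f0"
    "\<And>j. bconv (ST \<tau>) (\<lambda>n. pd (ex j) (\<phi> n)) (fx j)" using assms(1) by (auto simp: tapx_def)
  obtain \<psi> where \<psi>: "\<And>n. smooth_fun (\<psi> n)" "\<And>n. per (\<psi> n)" "bconv (ST \<tau>) \<psi> g"
    "bconv (ST \<tau>) (\<lambda>n. pd et (\<psi> n)) gt" "bconv cm (\<lambda>n x. \<psi> n (0, x)) g0"
    "\<And>j. bconv (ST \<tau>) (\<lambda>n. pd (ex j) (\<psi> n)) (gx j)" using assms(2) by (auto simp: tapx_def)
  show ?thesis unfolding tapx_def
    by (intro exI[of _ "\<lambda>n z. \<phi> n z * \<psi> n z"] conjI allI smooth_fun_mult per_mult ST.bconv_mult cm.bconv_mult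
        bconv_pd_mult \<phi> \<psi> ex_Basis et_Basis)
qed

lemma moll_one: "\<tau> < T \<Longrightarrow> 0 \<le> fst z \<Longrightarrow> fst z \<le> \<tau> \<Longrightarrow> moll T \<tau> n (\<lambda>_. 1) z = 1"
  using integral_kap_eq_1[OF eps_pos[of \<tau> T n], of z T n] eps_le[of \<tau> T n]
  by (simp add: moll_def stconv_def)

text \<open>The maximum with m only matters on a null set; it keeps the inverse bounded everywhere.\<close>
lemma sapx_inverse_moll:
  assumes r: "bdd T r" "AE z in ST T. m \<le> r z" and m: "0 < m" and G: "\<And>j. bdd T (G j)"
    and \<tau>: "0 < \<tau>" "\<tau> < T" and w: "\<And>j. uwdx T r j (G j)"
  shows "sapx \<tau> (\<lambda>z. inverse (max m (r z))) (\<lambda>j z. - G j z * (inverse (max m (r z)) * inverse (max m (r z))))"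
proof -
  have one: "bdd T (\<lambda>_::real \<times> (real^'d). 1)" by (auto simp: bdd_def intro: exI[of _ 1])
  note ri = bdd_integrable[OF r(1)] and oi = bdd_integrable[OF one]
  \<comment> \<open>For times beyond \<tau> the kernel may lose mass, and the mollification of
    \<open>r\<close> may fall below \<open>m\<close>. The bracket makes up for the lost mass, so
    that \<open>D\<close> is at least \<open>m\<close> everywhere and its inverse is smooth; for
    times in [0, \<tau>] the bracket is zero.\<close>
  define D where "D = (\<lambda>n z. moll T \<tau> n r z + (m - m * moll T \<tau> n (\<lambda>_. 1) z))"
  have Dge: "m \<le> D n z" for n z
  proof -
    have "(\<integral>\<zeta>. m * (1 * kap (eps T \<tau> n) n (\<zeta> - z)) \<partial>ST T) \<le> (\<integral>\<zeta>. r \<zeta> * kap (eps T \<tau> n) n (\<zeta> - z) \<partial>ST T)"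
    proof (rule integral_mono_AE)
      show "integrable (ST T) (\<lambda>\<zeta>. m * (1 * kap (eps T \<tau> n) n (\<zeta> - z)))"
        by (intro integrable_mult_right stconv_integrable oi smooth_fun_continuous smooth_kap)
      show "integrable (ST T) (\<lambda>\<zeta>. r \<zeta> * kap (eps T \<tau> n) n (\<zeta> - z))"
        by (intro stconv_integrable ri smooth_fun_continuous smooth_kap)
      show "AE \<zeta> in ST T. m * (1 * kap (eps T \<tau> n) n (\<zeta> - z)) \<le> r \<zeta> * kap (eps T \<tau> n) n (\<zeta> - z)"
        using r(2)
      proof eventually_elim
        case (elim \<zeta>)
        show ?case using mult_right_mono[OF elim kap_nonneg[OF eps_pos[OF \<tau>(2)]]] by simp
      qed
    qed
    then show ?thesis by (simp add: D_def moll_def stconv_def)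
  qed
  have Ds: "smooth_fun (D n)" for n
    unfolding D_def by (intro smooth_fun_add smooth_fun_diff smooth_fun_mult smooth_fun_const smooth_moll ri oi)
  have Dnz: "D n z \<noteq> 0" for n z using Dge[of n z] m by auto
  have Deq: "D n z = moll T \<tau> n r z" if "0 \<le> fst z" "fst z \<le> \<tau>" for n z
    using moll_one[OF \<tau>(2) that] by (simp add: D_def)
  have Dpd: "pd (ex j) (D n) z = pd (ex j) (moll T \<tau> n r) z" if "0 \<le> fst z" "fst z \<le> \<tau>" for n z j
    unfolding pd_def using that by (simp add: Deq)
  have bD: "bconv (ST \<tau>) D r"
  proof (rule ST.bconv_cong[OF bconv_moll[OF r(1) \<tau>]])
    show "AE z in ST \<tau>. moll T \<tau> n r z = D n z" for n
      using AE_ST_slab by eventually_elim (auto simp: Deq)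
  qed (use r smooth_fun_borel[OF Ds] in \<open>auto simp: bdd_def\<close>)
  have bDx: "bconv (ST \<tau>) (\<lambda>n. pd (ex j) (D n)) (G j)" for j
  proof (rule ST.bconv_cong[OF bconv_moll_pd_space[OF r(1) G \<tau> w]])
    show "AE z in ST \<tau>. pd (ex j) (moll T \<tau> n r) z = pd (ex j) (D n) z" for n
      using AE_ST_slab by eventually_elim (auto simp: Dpd)
  qed (use G smooth_fun_borel[OF smooth_fun_pd[OF Ds ex_Basis]] in \<open>auto simp: bdd_def\<close>)
  have bi: "bconv (ST \<tau>) (\<lambda>n z. inverse (D n z)) (\<lambda>z. inverse (max m (r z)))"
  proof -
    have "bconv (ST \<tau>) (\<lambda>n z. inverse (max m (D n z))) (\<lambda>z. inverse (max m (r z)))"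
      by (rule ST.bconv_comp[OF bD]) (use m in \<open>auto intro!: continuous_intros\<close>)
    then show ?thesis using Dge by (simp add: max_absorb2)
  qed
  have bix: "bconv (ST \<tau>) (\<lambda>n. pd (ex j) (\<lambda>z. inverse (D n z)))
     (\<lambda>z. - G j z * (inverse (max m (r z)) * inverse (max m (r z))))" for j
  proof -
    have "bconv (ST \<tau>) (\<lambda>n z. - pd (ex j) (D n) z) (\<lambda>z. - G j z)"
      by (rule ST.bconv_comp[OF bDx]) (auto intro!: continuous_intros)
    then have "bconv (ST \<tau>) (\<lambda>n z. - pd (ex j) (D n) z * (inverse (D n z) * inverse (D n z)))
       (\<lambda>z. - G j z * (inverse (max m (r z)) * inverse (max m (r z))))"
      by (intro ST.bconv_mult bi)
    moreover have "pd (ex j) (\<lambda>z. inverse (D n z)) = (\<lambda>z. - pd (ex j) (D n) z * (inverse (D n z) * inverse (D n z)))" for n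
      by (rule ext) (rule pd_inverse[OF Ds ex_Basis Dnz])
    ultimately show ?thesis by simp
  qed
  have "per (\<lambda>z. inverse (D n z))" for n
    by (simp add: per_def D_def moll_periodic)
  then show ?thesis unfolding sapx_def
    by (intro exI[of _ "\<lambda>n z. inverse (D n z)"] conjI allI smooth_fun_inverse Ds Dnz bi bix)
qed

subsection \<open>Extending the class of test functions\<close>

lemma ST_restrict:
  fixes h :: "real \<times> (real^'d) \<Rightarrow> real"
  assumes "h \<in> borel_measurable borel" "\<And>z. \<tau> \<le> fst z \<Longrightarrow> h z = 0" "\<tau> \<le> T"
  shows "(\<integral>z. h z \<partial>ST T) = (\<integral>z. h z \<partial>ST \<tau>)"
proof -
  have "indicator ({..<\<tau>} \<times> UNIV) z * h z = h z" for z
    using assms(2)[of z] by (cases z) (auto simp: indicator_def)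
  then have "(\<lambda>z. indicator ({..<\<tau>} \<times> UNIV) z * h z) = h" by (rule ext)
  then show ?thesis using ST_mono_integral[OF assms(3,1)] by (simp only:)
qed

definition cutoff :: "real \<Rightarrow> (real \<Rightarrow> real) \<Rightarrow> bool" where
  "cutoff \<tau> \<theta> \<longleftrightarrow> smooth_fun \<theta> \<and> (\<exists>\<tau>0<\<tau>. \<forall>t\<ge>\<tau>0. \<theta> t = 0)"

lemma cutoff_zero: "cutoff \<tau> \<theta> \<Longrightarrow> \<tau> \<le> t \<Longrightarrow> \<theta> t = 0"
  by (auto simp: cutoff_def)

lemma cutoff_deriv_zero:
  assumes "cutoff \<tau> \<theta>" "\<tau> \<le> t" shows "deriv \<theta> t = 0"
proof -
  obtain \<tau>0 where t0: "\<tau>0 < \<tau>" "\<forall>t\<ge>\<tau>0. \<theta> t = 0" using assms(1) by (auto simp: cutoff_def)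
  have "((\<lambda>_. 0) has_real_derivative 0) (at t)" by simp
  then have "(\<theta> has_real_derivative 0) (at t)"
    by (rule has_field_derivative_transform_within_open[of _ _ _ "{\<tau>0<..}"]) (use t0 assms(2) in auto)
  then show ?thesis by (rule DERIV_imp_deriv)
qed

lemma pd_et_time: "smooth_fun \<theta> \<Longrightarrow> pd et (\<lambda>z::real \<times> (real^'d). \<theta> (fst z)) z = deriv \<theta> (fst z)"
  and pd_ex_time: "pd (ex j) (\<lambda>z::real \<times> (real^'d). \<theta> (fst z)) z = 0"
proof -
  show "smooth_fun \<theta> \<Longrightarrow> pd et (\<lambda>z::real \<times> (real^'d). \<theta> (fst z)) z = deriv \<theta> (fst z)"
    using pd_real[of \<theta> "fst z"] by (simp add: pd_def)
  show "pd (ex j) (\<lambda>z::real \<times> (real^'d). \<theta> (fst z)) z = 0"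
    by (simp add: pd_def)
qed

lemma smooth_deriv: "smooth_fun \<theta> \<Longrightarrow> smooth_fun (deriv \<theta>)" for \<theta> :: "real \<Rightarrow> real"
  using smooth_fun_pd[of \<theta> 1] by (simp add: pd_real[abs_def])

lemma bconv_time:
  assumes "smooth_fun \<theta>"
  shows "bconv (ST \<tau>) (\<lambda>_ (z :: real \<times> (real^'d)). \<theta> (fst z)) (\<lambda>z. \<theta> (fst z))"
proof -
  have "compact (\<theta> ` {0..\<tau>})"
    by (intro compact_continuous_image smooth_fun_continuous assms) auto
  from compact_imp_bounded[OF this] obtain B where B: "\<forall>y\<in>\<theta> ` {0..\<tau>}. norm y \<le> B"
    unfolding bounded_iff by (elim exE)
  show ?thesis
  proof (rule ST.bconv_const[where C=B])
    show "AE z in ST \<tau>. \<bar>\<theta> (fst (z :: real \<times> (real^'d)))\<bar> \<le> B"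
      using AE_ST_slab by eventually_elim (use B in force)
    show "(\<lambda>z. \<theta> (fst z)) \<in> borel_measurable (ST \<tau> :: (real \<times> (real^'d)) measure)"
      using smooth_fun_borel[OF smooth_time[OF assms]] by simp
  qed
qed

lemma utest_cutoff:
  assumes "cutoff \<tau> \<theta>" "\<tau> \<le> T" "smooth_fun \<psi>" "per \<psi>"
  shows "utest T (\<lambda>z. \<theta> (fst z) * \<psi> z)"
proof -
  obtain \<tau>0 where t0: "\<tau>0 < \<tau>" "\<forall>t\<ge>\<tau>0. \<theta> t = 0" using assms(1) by (auto simp: cutoff_def)
  have "smooth_fun \<theta>" using assms(1) by (simp add: cutoff_def)
  then show ?thesis unfolding utest_def using t0 assms
    by (intro conjI smooth_fun_mult smooth_time exI[of _ \<tau>0]) (auto simp: per_def)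
qed

text \<open>The products of the cutoff with the smooth approximations are admissible, and each term
  passes to the limit because the coefficients are integrable. Recording value and integrability
  together lets the tested relations be added freely later.\<close>

lemma weak_tapx:
  fixes A :: "real \<times> (real^'d) \<Rightarrow> real"
  assumes eq: "\<And>\<phi>. utest T \<phi> \<Longrightarrow>
      (\<integral>z. A z * pd et \<phi> z + (\<Sum>j\<in>UNIV. B j z * pd (ex j) \<phi> z) \<partial>ST T) + (\<integral>x. A0 x * \<phi> (0, x) \<partial>cm) = 0"
    and A: "integrable (ST T) A" and B: "\<And>j. integrable (ST T) (B j)" and A0: "integrable cm A0"
    and f: "tapx \<tau> f ft fx f0" and \<theta>: "cutoff \<tau> \<theta>" and \<tau>: "\<tau> < T"
  shows "has_bochner_integral (ST \<tau>)
     (\<lambda>z. A z * (deriv \<theta> (fst z) * f z + \<theta> (fst z) * ft z) + (\<Sum>j\<in>UNIV. B j z * (\<theta> (fst z) * fx j z)))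
     (- \<theta> 0 * (\<integral>x. A0 x * f0 x \<partial>cm))"
    and "integrable cm (\<lambda>x. A0 x * f0 x)"
proof -
  obtain \<psi> where \<psi>: "\<And>n. smooth_fun (\<psi> n)" "\<And>n. per (\<psi> n)" "bconv (ST \<tau>) \<psi> f"
    "bconv (ST \<tau>) (\<lambda>n. pd et (\<psi> n)) ft" "bconv cm (\<lambda>n x. \<psi> n (0, x)) f0"
    "\<And>j. bconv (ST \<tau>) (\<lambda>n. pd (ex j) (\<psi> n)) (fx j)" using f by (auto simp: tapx_def)
  have sm: "smooth_fun \<theta>" using \<theta> by (simp add: cutoff_def)
  note A' = integrable_ST_mono[OF less_imp_le[OF \<tau>] A]
  note B' = integrable_ST_mono[OF less_imp_le[OF \<tau>] B]
  let ?F = "\<lambda>n z. deriv \<theta> (fst z) * \<psi> n z + \<theta> (fst z) * pd et (\<psi> n) z"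
  let ?G = "\<lambda>j n z. \<theta> (fst z) * pd (ex j) (\<psi> n) z"
  have bF: "bconv (ST \<tau>) ?F (\<lambda>z. deriv \<theta> (fst z) * f z + \<theta> (fst z) * ft z)"
    by (intro ST.bconv_add ST.bconv_mult bconv_time \<psi> smooth_deriv sm)
  have bG: "bconv (ST \<tau>) (?G j) (\<lambda>z. \<theta> (fst z) * fx j z)" for j
    by (intro ST.bconv_mult bconv_time \<psi> sm)
  have zero: "(\<integral>z. A z * ?F n z \<partial>ST \<tau>) + (\<Sum>j\<in>UNIV. \<integral>z. B j z * ?G j n z \<partial>ST \<tau>) + \<theta> 0 * (\<integral>x. A0 x * \<psi> n (0, x) \<partial>cm) = 0" for n
  proof -
    let ?\<phi> = "\<lambda>z. \<theta> (fst z) * \<psi> n z"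
    have pdt: "pd et ?\<phi> z = ?F n z" for z
      using pd_mult[OF smooth_time[OF sm] \<psi>(1)[of n] et_Basis, of z] by (simp add: pd_et_time[OF sm])
    have pdx: "pd (ex j) ?\<phi> z = ?G j n z" for z j
      using pd_mult[OF smooth_time[OF sm] \<psi>(1)[of n] ex_Basis, of j z] by (simp add: pd_ex_time)
    have "(\<integral>z. A z * ?F n z + (\<Sum>j\<in>UNIV. B j z * ?G j n z) \<partial>ST T) + (\<integral>x. A0 x * ?\<phi> (0, x) \<partial>cm) = 0"
      using eq[OF utest_cutoff[OF \<theta> less_imp_le[OF \<tau>] \<psi>(1,2)], of n] unfolding pdt pdx .
    also have "(\<integral>z. A z * ?F n z + (\<Sum>j\<in>UNIV. B j z * ?G j n z) \<partial>ST T) = (\<integral>z. A z * ?F n z + (\<Sum>j\<in>UNIV. B j z * ?G j n z) \<partial>ST \<tau>)"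
    proof (rule ST_restrict)
      have [measurable]: "A \<in> borel_measurable borel" "\<And>j. B j \<in> borel_measurable borel"
        using A B by (auto simp: integrable_iff_bounded)
      have [measurable]: "?F n \<in> borel_measurable borel" "\<And>j. ?G j n \<in> borel_measurable borel"
        using bF bG by (auto simp: bconv_def)
      show "(\<lambda>z. A z * ?F n z + (\<Sum>j\<in>UNIV. B j z * ?G j n z)) \<in> borel_measurable borel"
        by measurable
    qed (use \<tau> cutoff_zero[OF \<theta>] cutoff_deriv_zero[OF \<theta>] in auto)
    also have "\<dots> = (\<integral>z. A z * ?F n z \<partial>ST \<tau>) + (\<Sum>j\<in>UNIV. \<integral>z. B j z * ?G j n z \<partial>ST \<tau>)"
      using ST.bconv_integrable_mult(1)[OF bF A'] ST.bconv_integrable_mult(1)[OF bG B'] by simp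
    also have "(\<integral>x. A0 x * ?\<phi> (0, x) \<partial>cm) = \<theta> 0 * (\<integral>x. A0 x * \<psi> n (0, x) \<partial>cm)"
      unfolding integral_mult_right_zero[symmetric]
      by (rule Bochner_Integration.integral_cong) simp_all
    finally show ?thesis .
  qed
  have "(\<lambda>n. (\<integral>z. A z * ?F n z \<partial>ST \<tau>) + (\<Sum>j\<in>UNIV. \<integral>z. B j z * ?G j n z \<partial>ST \<tau>) + \<theta> 0 * (\<integral>x. A0 x * \<psi> n (0, x) \<partial>cm))
    \<longlonglongrightarrow> (\<integral>z. A z * (deriv \<theta> (fst z) * f z + \<theta> (fst z) * ft z) \<partial>ST \<tau>) +
      (\<Sum>j\<in>UNIV. \<integral>z. B j z * (\<theta> (fst z) * fx j z) \<partial>ST \<tau>) + \<theta> 0 * (\<integral>x. A0 x * f0 x \<partial>cm)"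
    by (intro tendsto_intros ST.bconv_integral[OF bF A'] ST.bconv_integral[OF bG B'] cm.bconv_integral[OF \<psi>(5) A0])
  then have lim: "(\<integral>z. A z * (deriv \<theta> (fst z) * f z + \<theta> (fst z) * ft z) \<partial>ST \<tau>) +
      (\<Sum>j\<in>UNIV. \<integral>z. B j z * (\<theta> (fst z) * fx j z) \<partial>ST \<tau>) + \<theta> 0 * (\<integral>x. A0 x * f0 x \<partial>cm) = 0"
    unfolding zero using LIMSEQ_unique tendsto_const by blast
  note i1 = ST.bconv_integrable_mult(2)[OF bF A'] and i2 = ST.bconv_integrable_mult(2)[OF bG B']
  have hb: "has_bochner_integral (ST \<tau>)
     (\<lambda>z. A z * (deriv \<theta> (fst z) * f z + \<theta> (fst z) * ft z) + (\<Sum>j\<in>UNIV. B j z * (\<theta> (fst z) * fx j z)))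
     ((\<integral>z. A z * (deriv \<theta> (fst z) * f z + \<theta> (fst z) * ft z) \<partial>ST \<tau>) +
      (\<Sum>j\<in>UNIV. \<integral>z. B j z * (\<theta> (fst z) * fx j z) \<partial>ST \<tau>))"
    by (intro has_bochner_integral_add has_bochner_integral_sum has_bochner_integral_integrable i1 i2)
  have eqv: "(\<integral>z. A z * (deriv \<theta> (fst z) * f z + \<theta> (fst z) * ft z) \<partial>ST \<tau>) +
      (\<Sum>j\<in>UNIV. \<integral>z. B j z * (\<theta> (fst z) * fx j z) \<partial>ST \<tau>) = - \<theta> 0 * (\<integral>x. A0 x * f0 x \<partial>cm)"
    using lim by (simp only: eq_neg_iff_add_eq_0 mult_minus_left)
  show "has_bochner_integral (ST \<tau>)
     (\<lambda>z. A z * (deriv \<theta> (fst z) * f z + \<theta> (fst z) * ft z) + (\<Sum>j\<in>UNIV. B j z * (\<theta> (fst z) * fx j z)))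
     (- \<theta> 0 * (\<integral>x. A0 x * f0 x \<partial>cm))" using hb unfolding eqv .
  show "integrable cm (\<lambda>x. A0 x * f0 x)" by (rule cm.bconv_integrable_mult(2)[OF \<psi>(5) A0])
qed

text \<open>The flat cutoffs vanish near the initial time and increase to 1, so test functions that
  do not vanish initially become admissible as long as no time derivative occurs.\<close>

lemma bconv_flat_cutoff:
  "bconv (ST \<tau>) (\<lambda>n z. flat_exp 0 (real (Suc n) * fst z - 1)) (\<lambda>z::real \<times> (real^'d). 1)"
proof (rule ST.bconv_AEI[where C=1])
  show "(\<lambda>z::real \<times> (real^'d). flat_exp 0 (real (Suc n) * fst z - 1)) \<in> borel_measurable (ST \<tau>)" for n
    unfolding borel_measurable_ST_iff
    by (intro smooth_fun_borel smooth_time[where p="\<lambda>t. flat_exp 0 (real (Suc n) * t - 1)"]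
        smooth_fun_compose[OF smooth_fun_flat_exp] smooth_fun_diff smooth_fun_mult smooth_fun_const smooth_fun_id)
  show "AE z in ST \<tau>. (\<lambda>n. flat_exp 0 (real (Suc n) * fst (z :: real \<times> (real^'d)) - 1)) \<longlonglongrightarrow> 1"
    using AE_ST_slab
  proof eventually_elim
    case (elim z)
    then have t: "0 < fst z" by auto
    \<comment> \<open>At a positive time the argument of the flat exponential tends to infinity,
      where its value \<open>exp (- (1 / s))\<close> tends to 1.\<close>
    have fl: "filterlim (\<lambda>n. real (Suc n) * fst z - 1) at_top sequentially"
      unfolding filterlim_at_top
    proof
      fix Z :: real
      obtain k :: nat where k: "(Z + 1) / fst z \<le> real k" using real_arch_simple by blast
      show "\<forall>\<^sub>F n in sequentially. Z \<le> real (Suc n) * fst z - 1"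
        using eventually_ge_at_top[of k]
      proof eventually_elim
        case (elim n)
        then have "(Z + 1) / fst z \<le> real (Suc n)" using k by simp
        then show ?case using t by (simp add: pos_divide_le_eq del: of_nat_Suc)
      qed
    qed
    have "(\<lambda>n. 1 / (real (Suc n) * fst z - 1)) \<longlonglongrightarrow> 0"
      by (rule tendsto_divide_0[OF tendsto_const filterlim_at_top_imp_at_infinity[OF fl]])
    then have "(\<lambda>n. exp (- (1 / (real (Suc n) * fst z - 1)))) \<longlonglongrightarrow> exp (- 0)"
      by (intro tendsto_exp tendsto_minus)
    then have lim: "(\<lambda>n. exp (- (1 / (real (Suc n) * fst z - 1)))) \<longlonglongrightarrow> 1" by simp
    have "\<forall>\<^sub>F n in sequentially. 0 < real (Suc n) * fst z - 1"
      using fl unfolding filterlim_at_top_dense by blast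
    then have "\<forall>\<^sub>F n in sequentially. exp (- (1 / (real (Suc n) * fst z - 1))) = flat_exp 0 (real (Suc n) * fst z - 1)"
      by eventually_elim (simp add: flat_exp_def)
    from Lim_transform_eventually[OF lim this] show ?case .
  qed
qed (auto simp: flat_exp_nonneg flat_exp_0_le_1)

lemma weak_sapx:
  fixes A :: "real \<times> (real^'d) \<Rightarrow> real"
  assumes eq: "\<And>\<phi>. uitest T \<phi> \<Longrightarrow>
      (\<integral>z. S z * \<phi> z + A z * pd (ex j) \<phi> z \<partial>ST T) = 0"
    and S: "integrable (ST T) S" and A: "integrable (ST T) A"
    and f: "sapx \<tau> f fx" and \<theta>: "cutoff \<tau> \<theta>" and \<tau>: "\<tau> < T"
  shows "has_bochner_integral (ST \<tau>) (\<lambda>z. S z * (\<theta> (fst z) * f z) + A z * (\<theta> (fst z) * fx j z)) 0"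
proof -
  obtain \<psi> where \<psi>: "\<And>n. smooth_fun (\<psi> n)" "\<And>n. per (\<psi> n)" "bconv (ST \<tau>) \<psi> f"
    "\<And>j. bconv (ST \<tau>) (\<lambda>n. pd (ex j) (\<psi> n)) (fx j)" using f by (auto simp: sapx_def)
  have sm: "smooth_fun \<theta>" using \<theta> by (simp add: cutoff_def)
  note S' = integrable_ST_mono[OF less_imp_le[OF \<tau>] S]
  note A' = integrable_ST_mono[OF less_imp_le[OF \<tau>] A]
  let ?c = "\<lambda>n t. flat_exp 0 (real (Suc n) * t - 1)"
  let ?F = "\<lambda>n z. ?c n (fst z) * (\<theta> (fst z) * \<psi> n z)"
  let ?G = "\<lambda>n z. ?c n (fst z) * (\<theta> (fst z) * pd (ex j) (\<psi> n) z)"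
  have bF: "bconv (ST \<tau>) ?F (\<lambda>z. 1 * (\<theta> (fst z) * f z))"
    by (intro ST.bconv_mult bconv_flat_cutoff bconv_time \<psi> sm)
  have bG: "bconv (ST \<tau>) ?G (\<lambda>z. 1 * (\<theta> (fst z) * fx j z))"
    by (intro ST.bconv_mult bconv_flat_cutoff bconv_time \<psi> sm)
  have zero: "(\<integral>z. S z * ?F n z \<partial>ST \<tau>) + (\<integral>z. A z * ?G n z \<partial>ST \<tau>) = 0" for n
  proof -
    have sc: "smooth_fun (?c n)"
      by (intro smooth_fun_compose[OF smooth_fun_flat_exp] smooth_fun_diff smooth_fun_mult smooth_fun_const smooth_fun_id)
    have sct: "smooth_fun (\<lambda>t. ?c n t * \<theta> t)" by (intro smooth_fun_mult sc sm)
    obtain \<tau>0 where t0: "\<tau>0 < \<tau>" "\<forall>t\<ge>\<tau>0. \<theta> t = 0" using \<theta> by (auto simp: cutoff_def)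
    have "cutoff \<tau> (\<lambda>t. ?c n t * \<theta> t)" using sct t0 by (auto simp: cutoff_def)
    then have "utest T (\<lambda>z. (?c n (fst z) * \<theta> (fst z)) * \<psi> n z)"
      using utest_cutoff[OF _ less_imp_le[OF \<tau>] \<psi>(1,2), of "\<lambda>t. ?c n t * \<theta> t" n] by simp
    moreover have "\<exists>\<tau>>0. \<forall>z. fst z \<le> \<tau> \<longrightarrow> (?c n (fst z) * \<theta> (fst z)) * \<psi> n z = 0"
    proof (intro exI[of _ "1 / real (Suc n)"] conjI allI impI)
      fix z :: "real \<times> (real^'d)" assume "fst z \<le> 1 / real (Suc n)"
      then have "real (Suc n) * fst z - 1 \<le> 0" by (simp add: field_simps del: of_nat_Suc)
      then show "(?c n (fst z) * \<theta> (fst z)) * \<psi> n z = 0" by (simp add: flat_exp_eq_0)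
    qed simp
    ultimately have ui: "uitest T (\<lambda>z. (?c n (fst z) * \<theta> (fst z)) * \<psi> n z)" by (simp add: uitest_def)
    have pdx: "pd (ex j) (\<lambda>z. (?c n (fst z) * \<theta> (fst z)) * \<psi> n z) z = ?G n z" for z
      using pd_mult[OF smooth_time[OF sct] \<psi>(1)[of n] ex_Basis, of j z]
        pd_ex_time[of j "\<lambda>t. ?c n t * \<theta> t" z] by (simp add: mult.assoc)
    have "(\<integral>z. S z * ((?c n (fst z) * \<theta> (fst z)) * \<psi> n z) + A z * ?G n z \<partial>ST T) = 0"
      using eq[OF ui] unfolding pdx .
    then have "(\<integral>z. S z * ?F n z + A z * ?G n z \<partial>ST T) = 0" by (simp only: mult.assoc)
    also have "(\<integral>z. S z * ?F n z + A z * ?G n z \<partial>ST T) = (\<integral>z. S z * ?F n z + A z * ?G n z \<partial>ST \<tau>)"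
    proof (rule ST_restrict)
      have [measurable]: "A \<in> borel_measurable borel" "S \<in> borel_measurable borel"
        using A S by (auto simp: integrable_iff_bounded)
      have [measurable]: "?F n \<in> borel_measurable borel" "?G n \<in> borel_measurable borel"
        using bF bG unfolding bconv_def borel_measurable_ST_iff by blast+
      show "(\<lambda>z. S z * ?F n z + A z * ?G n z) \<in> borel_measurable borel" by measurable
    qed (use \<tau> cutoff_zero[OF \<theta>] in auto)
    also have "\<dots> = (\<integral>z. S z * ?F n z \<partial>ST \<tau>) + (\<integral>z. A z * ?G n z \<partial>ST \<tau>)"
      by (rule Bochner_Integration.integral_add[OF ST.bconv_integrable_mult(1)[OF bF S'] ST.bconv_integrable_mult(1)[OF bG A']])
    finally show ?thesis .
  qed
  have "(\<lambda>n. (\<integral>z. S z * ?F n z \<partial>ST \<tau>) + (\<integral>z. A z * ?G n z \<partial>ST \<tau>)) \<longlonglongrightarrow>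
     (\<integral>z. S z * (1 * (\<theta> (fst z) * f z)) \<partial>ST \<tau>) + (\<integral>z. A z * (1 * (\<theta> (fst z) * fx j z)) \<partial>ST \<tau>)"
    by (intro tendsto_add ST.bconv_integral[OF bF S'] ST.bconv_integral[OF bG A'])
  then have lim: "(\<integral>z. S z * (1 * (\<theta> (fst z) * f z)) \<partial>ST \<tau>) + (\<integral>z. A z * (1 * (\<theta> (fst z) * fx j z)) \<partial>ST \<tau>) = 0"
    unfolding zero using LIMSEQ_unique tendsto_const by blast
  have "has_bochner_integral (ST \<tau>) (\<lambda>z. S z * (1 * (\<theta> (fst z) * f z)) + A z * (1 * (\<theta> (fst z) * fx j z)))
     ((\<integral>z. S z * (1 * (\<theta> (fst z) * f z)) \<partial>ST \<tau>) + (\<integral>z. A z * (1 * (\<theta> (fst z) * fx j z)) \<partial>ST \<tau>))"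
    by (intro has_bochner_integral_add has_bochner_integral_integrable
        ST.bconv_integrable_mult(2)[OF bF S'] ST.bconv_integrable_mult(2)[OF bG A'])
  then show ?thesis unfolding lim by simp
qed

subsection \<open>The energy inequality tested in time\<close>

interpretation TST: pair_sigma_finite "tm S" "ST T" by standard

text \<open>A weight that vanishes at the end is the integral of its negated derivative over all
  later times.\<close>

lemma cutoff_integral:
  assumes \<theta>: "cutoff \<tau> \<theta>" and "0 \<le> s" "s < T" "\<tau> \<le> T"
  shows "integrable (tm T) (deriv \<theta>)" "(\<integral>t. - deriv \<theta> t * indicator {s<..} t \<partial>tm T) = \<theta> s"
proof -
  have sm: "smooth_fun \<theta>" using \<theta> by (simp add: cutoff_def)
  have c: "continuous_on A (deriv \<theta>)" for A by (rule smooth_fun_continuous[OF smooth_deriv[OF sm]])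
  have [measurable]: "deriv \<theta> \<in> borel_measurable borel" by (rule smooth_fun_borel[OF smooth_deriv[OF sm]])
  have "compact (deriv \<theta> ` {0..T})" by (intro compact_continuous_image c) auto
  from compact_imp_bounded[OF this] obtain B where B: "\<forall>y\<in>deriv \<theta> ` {0..T}. norm y \<le> B"
    unfolding bounded_iff by (elim exE)
  show "integrable (tm T) (deriv \<theta>)"
    by (rule tm.integrable_const_bound[where B=B]) (use B in \<open>auto simp: AE_tm\<close>)
  have "(\<integral>t. - deriv \<theta> t * indicator {s<..} t \<partial>tm T) = (\<integral>t. indicator {0<..<T} t *\<^sub>R (- deriv \<theta> t * indicator {s<..} t) \<partial>lborel)"
    unfolding tm_def by (subst integral_density) auto
  also have "\<dots> = (\<integral>t. (- deriv \<theta> t) * indicator {s..T} t \<partial>lborel)"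
  proof (rule integral_cong_AE)
    have "AE t in lborel. t \<noteq> s \<and> t \<noteq> T" using AE_lborel_singleton[of s] AE_lborel_singleton[of T] by eventually_elim auto
    then show "AE t in lborel. indicator {0<..<T} t *\<^sub>R (- deriv \<theta> t * indicator {s<..} t) = (- deriv \<theta> t) * indicator {s..T} t"
      by eventually_elim (use assms in \<open>auto simp: indicator_def\<close>)
  qed auto
  also have "\<dots> = (- \<theta> T) - (- \<theta> s)"
  proof (rule integral_FTC_Icc_real)
    show "((\<lambda>t. - \<theta> t) has_real_derivative - deriv \<theta> x) (at x)" for x
      by (intro DERIV_minus smooth_fun_real_DERIV sm)
    show "isCont (\<lambda>t. - deriv \<theta> t) x" for x
      using c[of UNIV] by (auto simp: continuous_on_eq_continuous_at)
  qed (use assms in auto)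
  also have "\<dots> = \<theta> s" using cutoff_zero[OF \<theta> assms(4)] by simp
  finally show "(\<integral>t. - deriv \<theta> t * indicator {s<..} t \<partial>tm T) = \<theta> s" .
qed

text \<open>The inequality is multiplied by the nonnegative \<open>- deriv \<theta>\<close> and
  integrated in time. Fubini turns the dissipation accumulated up to \<open>t\<close> into the
  dissipation weighted by \<open>\<theta>\<close>.\<close>

lemma energy_tested:
  fixes E D :: "real \<times> (real^'d) \<Rightarrow> real"
  assumes E: "integrable (ST T) E" and D: "integrable (ST T) D"
    and en: "AE t in tm T. (\<integral>x. E (t, x) \<partial>cm) + \<nu> * (\<integral>z. D z \<partial>ST t) \<le> e0"
    and \<theta>: "cutoff \<tau> \<theta>" and \<tau>: "0 < T" "\<tau> \<le> T" and mono: "\<And>t. deriv \<theta> t \<le> 0"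
  shows "(\<integral>z. - deriv \<theta> (fst z) * E z + \<nu> * (\<theta> (fst z) * D z) \<partial>ST T) \<le> \<theta> 0 * e0"
    "integrable (ST T) (\<lambda>z. deriv \<theta> (fst z) * E z)" "integrable (ST T) (\<lambda>z. \<theta> (fst z) * D z)"
proof -
  have sm: "smooth_fun \<theta>" using \<theta> by (simp add: cutoff_def)
  have [measurable]: "E \<in> borel_measurable borel" "D \<in> borel_measurable borel" "deriv \<theta> \<in> borel_measurable borel"
    using E D smooth_fun_borel[OF smooth_deriv[OF sm]] by (auto simp: integrable_iff_bounded)
  show iE: "integrable (ST T) (\<lambda>z. deriv \<theta> (fst z) * E z)"
    using ST.bconv_integrable_mult(2)[OF bconv_time[OF smooth_deriv[OF sm]] E] by (simp add: mult.commute)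
  show iD: "integrable (ST T) (\<lambda>z. \<theta> (fst z) * D z)"
    using ST.bconv_integrable_mult(2)[OF bconv_time[OF sm] D] by (simp add: mult.commute)
  note c = cutoff_integral[OF \<theta> _ _ \<tau>(2)]
  have i1: "integrable (tm T) (\<lambda>t. - deriv \<theta> t * (\<integral>x. E (t, x) \<partial>cm))"
    "(\<integral>t. - deriv \<theta> t * (\<integral>x. E (t, x) \<partial>cm) \<partial>tm T) = (\<integral>z. - deriv \<theta> (fst z) * E z \<partial>ST T)"
  proof -
    have i: "integrable (tm T \<Otimes>\<^sub>M cm) (\<lambda>z. - deriv \<theta> (fst z) * E z)" using iE by (simp add: ST_pair)
    show "integrable (tm T) (\<lambda>t. - deriv \<theta> t * (\<integral>x. E (t, x) \<partial>cm))"
      using TC.integrable_fst'[OF i] by simp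
    show "(\<integral>t. - deriv \<theta> t * (\<integral>x. E (t, x) \<partial>cm) \<partial>tm T) = (\<integral>z. - deriv \<theta> (fst z) * E z \<partial>ST T)"
      using TC.integral_fst'[OF i] by (simp add: ST_pair)
  qed
  \<comment> \<open>Dissipation at times before \<open>t\<close>, weighted by
    \<open>- deriv \<theta> t\<close>. Integrated over the slab first it gives the dissipation up to
    \<open>t\<close>; integrated over \<open>t\<close> first it gives the weight
    \<open>\<theta>\<close>.\<close>
  let ?K = "\<lambda>p. - deriv \<theta> (fst p) * (indicator {..<fst p} (fst (snd p)) * D (snd p))"
  have iK: "integrable (tm T \<Otimes>\<^sub>M ST T) ?K"
  proof -
    have "integrable (tm T \<Otimes>\<^sub>M ST T) (\<lambda>p. - deriv \<theta> (fst p) * D (snd p))"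
      by (rule TST.Fubini_integrable) (use c(1)[of 0] \<tau> D in \<open>auto simp: abs_mult\<close>)
    then show ?thesis
    proof (rule Bochner_Integration.integrable_bound)
      have [measurable]: "(fst :: real \<times> (real^'d) \<Rightarrow> real) \<in> borel_measurable borel"
        by (intro borel_measurable_continuous_onI continuous_intros)
      have "?K = (\<lambda>p. - deriv \<theta> (fst p) * ((if fst (snd p) < fst p then 1 else 0) * D (snd p)))"
        by (auto simp: fun_eq_iff indicator_def)
      also have "\<dots> \<in> borel_measurable (tm T \<Otimes>\<^sub>M ST T)" by measurable
      finally show "?K \<in> borel_measurable (tm T \<Otimes>\<^sub>M ST T)" .
      show "AE p in tm T \<Otimes>\<^sub>M ST T. norm (?K p) \<le> norm (- deriv \<theta> (fst p) * D (snd p))"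
        by (intro AE_I2) (auto simp: indicator_def abs_mult)
    qed
  qed
  have iK': "integrable (tm T \<Otimes>\<^sub>M ST T) (case_prod (\<lambda>t z. ?K (t, z)))"
  proof -
    have "case_prod (\<lambda>t z. ?K (t, z)) = ?K" by (simp add: fun_eq_iff)
    with iK show ?thesis by (simp only:)
  qed
  have inner: "(\<integral>z. ?K (t, z) \<partial>ST T) = - deriv \<theta> t * (\<integral>z. D z \<partial>ST t)" if "t \<le> T" for t
  proof -
    have "(\<integral>z. D z \<partial>ST t) = (\<integral>z. indicator {..<t} (fst z) * D z \<partial>ST T)"
      using ST_mono_integral[OF that, of D] by (simp add: indicator_times)
    then show ?thesis by simp
  qed
  have AEt: "AE t in tm T. t < T" unfolding AE_tm by simp
  have i2: "integrable (tm T) (\<lambda>t. \<integral>z. ?K (t, z) \<partial>ST T)"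
    "(\<integral>t. (\<integral>z. ?K (t, z) \<partial>ST T) \<partial>tm T) = (\<integral>z. \<theta> (fst z) * D z \<partial>ST T)"
  proof -
    show "integrable (tm T) (\<lambda>t. \<integral>z. ?K (t, z) \<partial>ST T)" by (rule TST.integrable_fst'[OF iK])
    have "(\<integral>t. (\<integral>z. ?K (t, z) \<partial>ST T) \<partial>tm T) = (\<integral>z. (\<integral>t. ?K (t, z) \<partial>tm T) \<partial>ST T)"
      by (rule TST.Fubini_integral[OF iK', symmetric])
    also have "\<dots> = (\<integral>z. \<theta> (fst z) * D z \<partial>ST T)"
    proof (rule integral_cong_AE)
      show "(\<lambda>z. \<integral>t. ?K (t, z) \<partial>tm T) \<in> borel_measurable (ST T)"
        by (rule borel_measurable_integrable[OF TST.integrable_snd[OF iK']])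
      show "AE z in ST T. (\<integral>t. ?K (t, z) \<partial>tm T) = \<theta> (fst z) * D z"
        using AE_ST_slab
      proof eventually_elim
        case (elim z)
        have "?K (t, z) = (- deriv \<theta> t * indicator {fst z<..} t) * D z" for t
          by (auto simp: indicator_def)
        then have "(\<integral>t. ?K (t, z) \<partial>tm T) = (\<integral>t. (- deriv \<theta> t * indicator {fst z<..} t) * D z \<partial>tm T)"
          by (intro Bochner_Integration.integral_cong refl)
        also have "\<dots> = (\<integral>t. - deriv \<theta> t * indicator {fst z<..} t \<partial>tm T) * D z"
          by (rule integral_mult_left_zero)
        also have "(\<integral>t. - deriv \<theta> t * indicator {fst z<..} t \<partial>tm T) = \<theta> (fst z)"
          by (rule c(2)) (use elim in auto)
        finally show ?case .
      qed
    qed (rule borel_measurable_integrable[OF iD])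
    finally show "(\<integral>t. (\<integral>z. ?K (t, z) \<partial>ST T) \<partial>tm T) = (\<integral>z. \<theta> (fst z) * D z \<partial>ST T)" .
  qed
  have "(\<integral>z. - deriv \<theta> (fst z) * E z + \<nu> * (\<theta> (fst z) * D z) \<partial>ST T) =
     (\<integral>z. - deriv \<theta> (fst z) * E z \<partial>ST T) + (\<integral>z. \<nu> * (\<theta> (fst z) * D z) \<partial>ST T)"
    by (rule Bochner_Integration.integral_add) (use iE iD in auto)
  also have "\<dots> = (\<integral>t. - deriv \<theta> t * (\<integral>x. E (t, x) \<partial>cm) \<partial>tm T) + \<nu> * (\<integral>t. (\<integral>z. ?K (t, z) \<partial>ST T) \<partial>tm T)"
    unfolding i1(2) i2(2) by simp
  also have "\<dots> = (\<integral>t. - deriv \<theta> t * (\<integral>x. E (t, x) \<partial>cm) + \<nu> * (\<integral>z. ?K (t, z) \<partial>ST T) \<partial>tm T)"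
    using i1(1) i2(1) by (subst Bochner_Integration.integral_add) auto
  also have "\<dots> \<le> (\<integral>t. - deriv \<theta> t * e0 \<partial>tm T)"
  proof (rule integral_mono_AE)
    show "integrable (tm T) (\<lambda>t. - deriv \<theta> t * (\<integral>x. E (t, x) \<partial>cm) + \<nu> * (\<integral>z. ?K (t, z) \<partial>ST T))"
      by (intro Bochner_Integration.integrable_add integrable_mult_right i1(1) i2(1))
    show "integrable (tm T) (\<lambda>t. - deriv \<theta> t * e0)" using c(1)[of 0] \<tau> by simp
    show "AE t in tm T. - deriv \<theta> t * (\<integral>x. E (t, x) \<partial>cm) + \<nu> * (\<integral>z. ?K (t, z) \<partial>ST T) \<le> - deriv \<theta> t * e0"
      using en AEt
    proof eventually_elim
      case (elim t)
      have "- deriv \<theta> t * ((\<integral>x. E (t, x) \<partial>cm) + \<nu> * (\<integral>z. D z \<partial>ST t)) \<le> - deriv \<theta> t * e0"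
        using elim(1) mono[of t] by (intro mult_left_mono) auto
      then show ?case using inner[of t] elim(2) by (simp add: algebra_simps)
    qed
  qed
  also have "\<dots> = (\<integral>t. - deriv \<theta> t * indicator {0<..} t \<partial>tm T) * e0"
  proof -
    have "(\<integral>t. - deriv \<theta> t * e0 \<partial>tm T) = (\<integral>t. (- deriv \<theta> t * indicator {0<..} t) * e0 \<partial>tm T)"
      by (rule integral_cong_AE) (auto simp: AE_tm)
    then show ?thesis by simp
  qed
  also have "\<dots> = \<theta> 0 * e0" using c(2)[of 0] \<tau> by simp
  finally show "(\<integral>z. - deriv \<theta> (fst z) * E z + \<nu> * (\<theta> (fst z) * D z) \<partial>ST T) \<le> \<theta> 0 * e0" .
qed

subsection \<open>A function with vanishing weak gradient\<close>

lemma real_antiderivative: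
  assumes "smooth_fun (f :: real \<Rightarrow> real)"
  obtains F where "smooth_fun F" "\<And>x. (F has_real_derivative f x) (at x)"
proof -
  have "\<exists>F. \<forall>x. - \<infinity> < ereal x \<longrightarrow> ereal x < \<infinity> \<longrightarrow> (F has_vector_derivative f x) (at x)"
    by (rule einterval_antiderivative)
       (use smooth_fun_continuous[OF assms, of UNIV] in \<open>auto simp: continuous_on_eq_continuous_at\<close>)
  then obtain F where F: "\<And>x. (F has_real_derivative f x) (at x)"
    by (auto simp: has_real_derivative_iff_has_vector_derivative)
  then show ?thesis using that smooth_fun_real_derivI[OF assms F] by blast
qed

text \<open>A primitive of \<open>\<psi>\<close> in time is a test function without spatial
  derivatives. Both fluxes disappear, and the two equations share their initial term.\<close>

lemma mass_conserved:
  assumes eq1: "\<And>\<phi>. utest T \<phi> \<Longrightarrow>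
      (\<integral>z. \<rho> z * pd et \<phi> z + (\<Sum>j\<in>UNIV. F j z * pd (ex j) \<phi> z) \<partial>ST T) + (\<integral>x. \<rho>0 x * \<phi> (0, x) \<partial>cm) = 0"
    and eq2: "\<And>\<phi>. utest T \<phi> \<Longrightarrow>
      (\<integral>z. r z * pd et \<phi> z + (\<Sum>j\<in>UNIV. G j z * pd (ex j) \<phi> z) \<partial>ST T) + (\<integral>x. \<rho>0 x * \<phi> (0, x) \<partial>cm) = 0"
    and \<psi>: "cutoff T \<psi>"
  shows "(\<integral>z. \<rho> z * \<psi> (fst z) \<partial>ST T) = (\<integral>z. r z * \<psi> (fst z) \<partial>(ST T :: (real \<times> (real^'d)) measure))"
proof -
  have sm: "smooth_fun \<psi>" using \<psi> by (simp add: cutoff_def)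
  obtain t0 where t0: "t0 < T" "\<forall>t\<ge>t0. \<psi> t = 0" using \<psi> by (auto simp: cutoff_def)
  obtain F where F: "smooth_fun F" "\<And>x. (F has_real_derivative \<psi> x) (at x)" using real_antiderivative[OF sm] by blast
  have const: "F t = F t0" if "t0 \<le> t" for t
  proof (cases "t = t0")
    case False
    with that obtain x where "t0 < x" "x < t" "F t - F t0 = (t - t0) * \<psi> x"
      using MVT2[of t0 t F \<psi>] F(2) by auto
    then show ?thesis using t0(2) by simp
  qed simp
  \<comment> \<open>This constant of integration makes the primitive vanish from \<open>t0\<close>
    on, as a test function must.\<close>
  define \<Theta> where "\<Theta> = (\<lambda>t. F t - F t0)"
  have s\<Theta>: "smooth_fun \<Theta>" unfolding \<Theta>_def by (intro smooth_fun_diff F smooth_fun_const)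
  have "(\<Theta> has_real_derivative \<psi> x) (at x)" for x
    unfolding \<Theta>_def using F(2)[of x] by (auto intro!: derivative_eq_intros)
  then have d\<Theta>: "deriv \<Theta> x = \<psi> x" for x by (rule DERIV_imp_deriv)
  have ut: "utest T (\<lambda>z::real \<times> (real^'d). \<Theta> (fst z))"
    unfolding utest_def
  proof (intro conjI exI[of _ t0] allI impI smooth_time[OF s\<Theta>] t0(1))
    show "per (\<lambda>z::real \<times> (real^'d). \<Theta> (fst z))" by (simp add: per_def)
    show "\<Theta> (fst z) = 0" if "t0 \<le> fst z" for z :: "real \<times> (real^'d)"
      using const[OF that] by (simp add: \<Theta>_def)
  qed
  from eq1[OF ut] eq2[OF ut] show ?thesis
    by (simp add: pd_et_time[OF s\<Theta>] pd_ex_time d\<Theta>)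
qed

lemma smooth_fun_slice:
  assumes "smooth_fun (f :: real \<times> (real^'d) \<Rightarrow> real)" shows "smooth_fun (\<lambda>t. f (t, x))"
proof (rule smooth_fun_coinduct[of _ "{\<lambda>t::real. f (t, x) | f. smooth_fun f}"])
  show "(\<lambda>t. f (t, x)) \<in> {\<lambda>t::real. f (t, x) | f. smooth_fun f}" using assms by blast
  show "continuous_on UNIV h" if "h \<in> {\<lambda>t::real. f (t, x) | f. smooth_fun f}" for h
  proof -
    note H = that
    obtain f where f: "h = (\<lambda>t. f (t, x))" "smooth_fun f" using H by (elim CollectE exE conjE)
    show ?thesis unfolding f(1)
      by (rule continuous_on_compose2[OF smooth_fun_continuous[OF f(2), of UNIV]]) (auto intro!: continuous_intros)
  qed
  show "\<exists>g\<in>{\<lambda>t::real. f (t, x) | f. smooth_fun f}. \<forall>s. ((\<lambda>h'. h (s + h' *\<^sub>R b)) has_real_derivative g s) (at 0)"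
    if "h \<in> {\<lambda>t::real. f (t, x) | f. smooth_fun f}" "b \<in> Basis" for h b
  proof -
    note H = that
    obtain f where f: "h = (\<lambda>t. f (t, x))" "smooth_fun f" using H(1) by (elim CollectE exE conjE)
    have "((\<lambda>h'. f ((s, x) + h' *\<^sub>R et)) has_real_derivative pd et f (s, x)) (at 0)" for s
      by (rule smooth_fun_has_pd[OF f(2) et_Basis])
    then show ?thesis using H(2) smooth_fun_pd[OF f(2) et_Basis] unfolding f(1)
      by (intro bexI[of _ "\<lambda>t. pd et f (t, x)"]) auto
  qed
qed

text \<open>Any two points are joined by moving along the axes, one coordinate at a time.\<close>

lemma pd_zero_const:
  fixes f :: "real \<times> (real^'d) \<Rightarrow> real"
  assumes f: "smooth_fun f" and z: "\<And>j x. pd (ex j) f (t, x) = 0"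
  shows "f (t, x) = f (t, y)"
proof -
  have step: "f (t, x + s *\<^sub>R axis j 1) = f (t, x)" for x s j
  proof -
    have "((\<lambda>s. f ((t, x) + s *\<^sub>R ex j)) has_real_derivative pd (ex j) f ((t, x) + s *\<^sub>R ex j)) (at s)" for s
      by (rule smooth_fun_has_pd_along[OF f ex_Basis])
    then have "((\<lambda>s. f (t, x + s *\<^sub>R axis j 1)) has_real_derivative 0) (at s)" for s
      using z by simp
    from DERIV_isconst_all[of "\<lambda>s. f (t, x + s *\<^sub>R axis j 1)" s 0] this show ?thesis by auto
  qed
  have "f (t, y + (\<Sum>j\<in>J. (x - y) $ j *\<^sub>R axis j 1)) = f (t, y)" if "finite J" for J
    using that
  proof (induction J)
    case (insert j J)
    then show ?case using step[of "y + (\<Sum>j\<in>J. (x - y) $ j *\<^sub>R axis j 1)" "(x - y) $ j" j]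
      by (simp add: algebra_simps)
  qed simp
  from this[of UNIV] have "f (t, y + (x - y)) = f (t, y)"
    using basis_expansion[of "x - y"] by (simp add: scalar_mult_eq_scaleR)
  then show ?thesis by simp
qed

text \<open>As \<open>q\<close> is merely integrable, its mollifications converge only in the mean.
  A Lipschitz \<open>S\<close> carries this convergence over, a bounded \<open>S\<close> allows
  pairing with the integrable \<open>\<rho> - r\<close>, and \<open>c * S c\<close> is positive
  except at 0. Since \<open>\<rho> - r = r * (q - 1)\<close>, the limit is an integral of a
  nonnegative function with value 0.\<close>

lemma density_ratio_one:
  fixes \<rho> r q :: "real \<times> (real^'d) \<Rightarrow> real"
  assumes q: "integrable (ST T) q" and r: "integrable (ST T) r" and \<rho>: "integrable (ST T) \<rho>"
    and pos: "AE z in ST T. 0 < r z" and \<rho>q: "AE z in ST T. \<rho> z = q z * r z"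
    and grad: "\<And>j. uwdx T q j (\<lambda>_. 0)"
    and mass: "\<And>\<psi>. cutoff T \<psi> \<Longrightarrow> (\<integral>z. \<rho> z * \<psi> (fst z) \<partial>ST T) = (\<integral>z. r z * \<psi> (fst z) \<partial>ST T)"
    and \<tau>: "0 < \<tau>0" "\<tau>0 < \<tau>" "\<tau> < T"
  shows "AE z in ST \<tau>0. q z = 1"
proof -
  have t0: "0 < \<tau>" using \<tau> by simp
  define S where "S = (\<lambda>c::real. c * inverse (1 + c * c))"
  have nz: "1 + c * c \<noteq> (0::real)" for c using zero_le_square[of c] by linarith
  have sS: "smooth_fun S" unfolding S_def
    by (intro smooth_fun_mult smooth_fun_id smooth_fun_inverse smooth_fun_add smooth_fun_const nz)
  have Sb: "\<bar>S c\<bar> \<le> 1" for c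
  proof -
    have pos: "0 < 1 + c * c" using zero_le_square[of c] by linarith
    have "0 \<le> (\<bar>c\<bar> - 1) * (\<bar>c\<bar> - 1)" by simp
    then have "2 * \<bar>c\<bar> \<le> 1 + c * c" by (simp add: algebra_simps)
    then have "\<bar>c\<bar> \<le> 1 + c * c" by linarith
    then have "\<bar>c\<bar> / (1 + c * c) \<le> 1" using pos by (simp add: divide_le_eq_1_pos)
    then show ?thesis using pos by (simp add: S_def abs_mult abs_of_pos divide_inverse)
  qed
  have Slip: "\<bar>S a - S b\<bar> \<le> \<bar>a - b\<bar>" for a b
  proof -
    have der: "(S has_real_derivative (1 - c * c) * (inverse (1 + c * c) * inverse (1 + c * c))) (at c within UNIV)" for c
    proof -
      have di: "((\<lambda>c. inverse (1 + c * c)) has_real_derivative - (inverse (1 + c * c) * (c + c) * inverse (1 + c * c))) (at c)"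
        by (rule DERIV_cong[OF DERIV_inverse'[where D="c + c"]]) (auto intro!: derivative_eq_intros simp: nz)
      have i1: "(1 + c * c) * inverse (1 + c * c) = 1" using nz[of c] by simp
      show ?thesis unfolding S_def
        by (rule DERIV_cong[OF DERIV_mult[OF DERIV_ident di]]) (use i1 in algebra)
    qed
    have "norm (S a - S b) \<le> 1 * norm (a - b)"
    proof (rule field_differentiable_bound[OF convex_UNIV der])
      fix c :: real
      have "\<bar>1 - c * c\<bar> \<le> 1 + c * c" by (auto simp: abs_if)
      also have "\<dots> \<le> (1 + c * c) * (1 + c * c)" using mult_left_mono[of 1 "1 + c * c" "1 + c * c"] by simp
      finally have "\<bar>1 - c * c\<bar> \<le> (1 + c * c) * (1 + c * c)" .
      moreover have "0 < (1 + c * c) * (1 + c * c)" using nz[of c] zero_le_square[of c] by (intro mult_pos_pos) linarith+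
      ultimately have "\<bar>1 - c * c\<bar> / ((1 + c * c) * (1 + c * c)) \<le> 1" by (simp only: divide_le_eq_1_pos)
      then show "norm ((1 - c * c) * (inverse (1 + c * c) * inverse (1 + c * c))) \<le> 1"
        by (simp add: abs_mult divide_inverse)
    qed auto
    then show ?thesis by simp
  qed
  have Spos: "c * S c \<ge> 0" "c * S c = 0 \<longleftrightarrow> c = 0" for c
    using nz[of c] by (auto simp: S_def intro!: mult_nonneg_nonneg[of "c * c", unfolded mult.assoc])
  \<comment> \<open>Positive exactly before \<open>\<tau>0\<close>, so nothing is lost on the slab
    of the claim, and zero well before the horizon \<open>\<tau>\<close> up to which mollification
    is controlled.\<close>
  define \<theta> where "\<theta> = (\<lambda>t. flat_exp 0 (\<tau>0 - t))"
  have s\<theta>: "smooth_fun \<theta>" unfolding \<theta>_def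
    by (intro smooth_fun_compose[OF smooth_fun_flat_exp] smooth_fun_diff smooth_fun_const smooth_fun_id)
  \<comment> \<open>For times up to \<open>\<tau>\<close> the mollified ratio has zero gradient, so
    its value at the spatial origin represents it everywhere. A smooth function of time alone
    results, which mass conservation accepts as a weight.\<close>
  define c where "c = (\<lambda>n t. moll T \<tau> n q (t, 0) - 1)"
  have sc: "smooth_fun (c n)" for n unfolding c_def
    by (intro smooth_fun_diff smooth_fun_const smooth_fun_slice smooth_moll q)
  have cz: "c n (fst z) = moll T \<tau> n q z - 1" if "0 \<le> fst z" "fst z \<le> \<tau>" for n z
  proof -
    have "pd (ex j) (moll T \<tau> n q) (fst z, x) = 0" for j x
      using moll_pd_space[OF grad q \<tau>(3), of "(fst z, x)" j n] that by (simp add: moll_def stconv_def)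
    from pd_zero_const[OF smooth_moll[OF q] this, of "snd z" 0] show ?thesis by (simp add: c_def)
  qed
  define \<psi> where "\<psi> = (\<lambda>n t. \<theta> t * S (c n t))"
  have s\<psi>: "smooth_fun (\<psi> n)" for n unfolding \<psi>_def by (intro smooth_fun_mult s\<theta> smooth_fun_compose[OF sS] sc)
  have \<psi>cut: "cutoff T (\<psi> n)" for n
    unfolding cutoff_def using s\<psi> \<tau> by (intro conjI exI[of _ \<tau>0]) (auto simp: \<psi>_def \<theta>_def flat_exp_eq_0)
  have Sm: "S \<in> borel_measurable borel" by (rule smooth_fun_borel[OF sS])
  note le = less_imp_le[OF \<tau>(3)]
  note q' = integrable_ST_mono[OF le q] and r' = integrable_ST_mono[OF le r] and \<rho>' = integrable_ST_mono[OF le \<rho>]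
  have [measurable]: "q \<in> borel_measurable borel" "r \<in> borel_measurable borel" "\<rho> \<in> borel_measurable borel"
    using q r \<rho> by (auto simp: integrable_iff_bounded)
  have mm: "moll T \<tau> n q \<in> borel_measurable borel" for n by (rule smooth_fun_borel[OF smooth_moll[OF q]])
  have mi: "integrable (ST \<tau>) (moll T \<tau> n q)" for n
    unfolding moll_def by (rule stconv_kap_contraction[OF q eps_pos[OF \<tau>(3)]])
  have bS: "bconv (ST \<tau>) (\<lambda>n z. S (moll T \<tau> n q z - 1)) (\<lambda>z. S (q z - 1))"
  proof (rule ST.bconv_L1I[where C=1])
    show "(\<lambda>z. S (moll T \<tau> n q z - 1)) \<in> borel_measurable (ST \<tau>)" for n
      using Sm mm[of n] by simp
    show Si: "integrable (ST \<tau>) (\<lambda>z. S (q z - 1))"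
      by (rule integrable_bounded_ST[where C=1]) (use Sm Sb in auto)
    have Sni: "integrable (ST \<tau>) (\<lambda>z. S (moll T \<tau> n q z - 1))" for n
      by (rule integrable_bounded_ST[where C=1]) (use Sm Sb mm[of n] in auto)
    show "(\<lambda>n. \<integral>z. \<bar>S (moll T \<tau> n q z - 1) - S (q z - 1)\<bar> \<partial>ST \<tau>) \<longlonglongrightarrow> 0"
    proof (rule Lim_null_comparison[OF _ moll_L1[OF q t0 \<tau>(3)]], intro always_eventually allI)
      fix n
      have "(\<integral>z. \<bar>S (moll T \<tau> n q z - 1) - S (q z - 1)\<bar> \<partial>ST \<tau>) \<le> (\<integral>z. \<bar>moll T \<tau> n q z - q z\<bar> \<partial>ST \<tau>)"
      proof (rule integral_mono)
        show "\<bar>S (moll T \<tau> n q z - 1) - S (q z - 1)\<bar> \<le> \<bar>moll T \<tau> n q z - q z\<bar>" for z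
          using Slip[of "moll T \<tau> n q z - 1" "q z - 1"] by simp
      qed (use Si Sni[of n] mi[of n] q' in auto)
      then show "norm (\<integral>z. \<bar>S (moll T \<tau> n q z - 1) - S (q z - 1)\<bar> \<partial>ST \<tau>) \<le> (\<integral>z. \<bar>moll T \<tau> n q z - q z\<bar> \<partial>ST \<tau>)"
        by (simp add: abs_of_nonneg integral_nonneg_AE)
    qed
  qed (use Sb in auto)
  have b: "bconv (ST \<tau>) (\<lambda>n z. \<theta> (fst z) * S (moll T \<tau> n q z - 1)) (\<lambda>z. \<theta> (fst z) * S (q z - 1))"
    by (intro ST.bconv_mult bconv_time s\<theta> bS)
  have d: "integrable (ST \<tau>) (\<lambda>z. \<rho> z - r z)" using r' \<rho>' by simp
  have zero: "(\<integral>z. (\<rho> z - r z) * (\<theta> (fst z) * S (moll T \<tau> n q z - 1)) \<partial>ST \<tau>) = 0" for n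
  proof -
    have \<psi>m: "(\<lambda>z::real \<times> (real^'d). \<psi> n (fst z)) \<in> borel_measurable borel"
      using smooth_fun_borel[OF smooth_time[OF s\<psi>]] .
    have i: "integrable (ST T) (\<lambda>z. h z * \<psi> n (fst z))" if "integrable (ST T) h" for h :: "real \<times> (real^'d) \<Rightarrow> real"
      using ST.bconv_integrable_mult(2)[OF bconv_time[OF s\<psi>] that] .
    have "(\<integral>z. (\<rho> z - r z) * (\<theta> (fst z) * S (moll T \<tau> n q z - 1)) \<partial>ST \<tau>) = (\<integral>z. (\<rho> z - r z) * \<psi> n (fst z) \<partial>ST \<tau>)"
    proof (rule integral_cong_AE)
      show "AE z in ST \<tau>. (\<rho> z - r z) * (\<theta> (fst z) * S (moll T \<tau> n q z - 1)) = (\<rho> z - r z) * \<psi> n (fst z)"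
        using AE_ST_slab
      proof eventually_elim
        case (elim z)
        then have "c n (fst z) = moll T \<tau> n q z - 1" by (intro cz) auto
        then show ?case by (simp add: \<psi>_def)
      qed
      have "(\<lambda>z. \<theta> (fst z) * S (moll T \<tau> n q z - 1)) \<in> borel_measurable borel"
        using b unfolding bconv_def borel_measurable_ST_iff by blast
      then show "(\<lambda>z. (\<rho> z - r z) * (\<theta> (fst z) * S (moll T \<tau> n q z - 1))) \<in> borel_measurable (ST \<tau>)"
        unfolding borel_measurable_ST_iff by (rule borel_measurable_times[rotated]) measurable
    qed (use \<psi>m in simp)
    also have "\<dots> = (\<integral>z. (\<rho> z - r z) * \<psi> n (fst z) \<partial>ST T)"
      by (rule ST_restrict[symmetric]) (use \<psi>m \<tau> in \<open>auto simp: \<psi>_def \<theta>_def flat_exp_eq_0\<close>)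
    also have "\<dots> = (\<integral>z. \<rho> z * \<psi> n (fst z) \<partial>ST T) - (\<integral>z. r z * \<psi> n (fst z) \<partial>ST T)"
      by (simp add: left_diff_distrib Bochner_Integration.integral_diff[OF i[OF \<rho>] i[OF r]])
    also have "\<dots> = 0" using mass[OF \<psi>cut] by simp
    finally show ?thesis .
  qed
  have "(\<lambda>n. \<integral>z. (\<rho> z - r z) * (\<theta> (fst z) * S (moll T \<tau> n q z - 1)) \<partial>ST \<tau>) \<longlonglongrightarrow> (\<integral>z. (\<rho> z - r z) * (\<theta> (fst z) * S (q z - 1)) \<partial>ST \<tau>)"
    by (rule ST.bconv_integral[OF b d])
  then have lim: "(\<integral>z. (\<rho> z - r z) * (\<theta> (fst z) * S (q z - 1)) \<partial>ST \<tau>) = 0"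
    unfolding zero using LIMSEQ_unique tendsto_const by blast
  have nn: "AE z in ST \<tau>. (\<rho> z - r z) * (\<theta> (fst z) * S (q z - 1)) = r z * \<theta> (fst z) * ((q z - 1) * S (q z - 1)) \<and> 0 < r z"
    using AE_ST_mono[OF le pos] AE_ST_mono[OF le \<rho>q] by eventually_elim (simp add: algebra_simps)
  have "AE z in ST \<tau>. (\<rho> z - r z) * (\<theta> (fst z) * S (q z - 1)) = 0"
  proof (subst integral_nonneg_eq_0_iff_AE[symmetric])
    show "integrable (ST \<tau>) (\<lambda>z. (\<rho> z - r z) * (\<theta> (fst z) * S (q z - 1)))"
      by (rule ST.bconv_integrable_mult(2)[OF b d])
    show "AE z in ST \<tau>. 0 \<le> (\<rho> z - r z) * (\<theta> (fst z) * S (q z - 1))"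
      using nn
    proof eventually_elim
      case (elim z)
      have "0 \<le> r z * \<theta> (fst z) * ((q z - 1) * S (q z - 1))"
        by (rule mult_nonneg_nonneg[OF mult_nonneg_nonneg Spos(1)]) (use elim in \<open>auto simp: \<theta>_def flat_exp_nonneg\<close>)
      then show ?case using elim by (simp only:)
    qed
  qed (rule lim)
  then have "AE z in ST \<tau>. \<theta> (fst z) = 0 \<or> q z = 1"
    using nn
  proof eventually_elim
    case (elim z)
    then have "r z * \<theta> (fst z) * ((q z - 1) * S (q z - 1)) = 0" "r z \<noteq> 0" by auto
    then show ?case using Spos(2)[of "q z - 1"] by simp
  qed
  from AE_ST_mono[OF less_imp_le[OF \<tau>(2)] this] AE_ST_slab show ?thesis
  proof eventually_elim
    case (elim z)
    then have "\<theta> (fst z) > 0" by (auto simp: \<theta>_def intro!: flat_exp_pos)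
    then show ?case using elim by auto
  qed
qed

subsection \<open>The relative energy\<close>

lemma integrable_weighted_prod:
  fixes \<rho> f g :: "'a \<Rightarrow> real"
  assumes nn: "AE z in M. 0 \<le> \<rho> z" and [measurable]: "\<rho> \<in> borel_measurable M" "f \<in> borel_measurable M" "g \<in> borel_measurable M"
    and f: "integrable M (\<lambda>z. \<rho> z * (f z)\<^sup>2)" and g: "integrable M (\<lambda>z. \<rho> z * (g z)\<^sup>2)"
  shows "integrable M (\<lambda>z. \<rho> z * f z * g z)"
proof (rule Bochner_Integration.integrable_bound)
  show "integrable M (\<lambda>z. \<rho> z * (f z)\<^sup>2 + \<rho> z * (g z)\<^sup>2)" using f g by simp
  show "AE z in M. norm (\<rho> z * f z * g z) \<le> norm (\<rho> z * (f z)\<^sup>2 + \<rho> z * (g z)\<^sup>2)"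
    using nn
  proof eventually_elim
    case (elim z)
    have "0 \<le> (\<bar>f z\<bar> - \<bar>g z\<bar>)\<^sup>2" by simp
    then have "2 * (\<bar>f z\<bar> * \<bar>g z\<bar>) \<le> (f z)\<^sup>2 + (g z)\<^sup>2" by (simp add: power2_eq_square algebra_simps)
    moreover have "0 \<le> \<bar>f z\<bar> * \<bar>g z\<bar>" by simp
    ultimately have "\<bar>f z\<bar> * \<bar>g z\<bar> \<le> (f z)\<^sup>2 + (g z)\<^sup>2" by linarith
    then have "\<rho> z * (\<bar>f z\<bar> * \<bar>g z\<bar>) \<le> \<rho> z * ((f z)\<^sup>2 + (g z)\<^sup>2)" by (rule mult_left_mono) (rule elim)
    then show ?case using elim by (simp add: abs_mult algebra_simps)
  qed
qed measurable

lemma AE_ST_exhaust: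
  assumes "0 < T" "\<And>\<tau>0. 0 < \<tau>0 \<Longrightarrow> \<tau>0 < T \<Longrightarrow> AE z in ST \<tau>0. P z"
  shows "AE z in ST T. P z"
proof -
  \<comment> \<open>With \<open>n + 2\<close> the first horizon is \<open>T / 2\<close>;
    \<open>n + 1\<close> would start with the empty slab.\<close>
  define t where "t = (\<lambda>n. T - T / real (n + 2))"
  have t: "0 < t n" "t n < T" for n
  proof -
    have "T / real (n + 2) < T" using assms(1) by (simp add: divide_less_eq)
    then show "0 < t n" by (simp add: t_def)
    show "t n < T" using assms(1) by (simp add: t_def)
  qed
  have "AE z in lborel. \<forall>n. z \<in> {0<..<t n} \<times> cell \<longrightarrow> P z"
    unfolding AE_all_countable using assms(2)[OF t] by (simp add: AE_ST)
  then show ?thesis unfolding AE_ST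
  proof eventually_elim
    case (elim z)
    show ?case
    proof
      assume z: "z \<in> {0<..<T} \<times> cell"
      then have "0 < T - fst z" by auto
      then obtain n where "T / (T - fst z) < real n" using reals_Archimedean2 by blast
      then have "T / (T - fst z) < real (n + 2)" by simp
      then have "T < real (n + 2) * (T - fst z)" using \<open>0 < T - fst z\<close> by (simp only: pos_divide_less_eq)
      then have "T / real (n + 2) < T - fst z" by (simp add: pos_divide_less_eq mult.commute)
      then have "z \<in> {0<..<t n} \<times> cell" using z by (auto simp: t_def)
      then show "P z" using elim by blast
    qed
  qed
qed

lemma integrable_mult_smooth:
  fixes A :: "real \<times> (real^'d) \<Rightarrow> real"
  assumes "integrable (ST T) A" "smooth_fun \<phi>" shows "integrable (ST T) (\<lambda>z. A z * \<phi> z)"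
  using stconv_integrable[OF assms(1) smooth_fun_continuous[OF assms(2)], of 0] by simp

lemma sapx_smooth:
  fixes \<phi> :: "real \<times> (real^'d) \<Rightarrow> real"
  assumes "smooth_fun \<phi>" "per \<phi>"
  shows "sapx \<tau> \<phi> (\<lambda>j. pd (ex j) \<phi>)"
proof -
  have "bconv (ST \<tau>) (\<lambda>_. \<psi>) \<psi>" if s: "smooth_fun \<psi>" for \<psi> :: "real \<times> (real^'d) \<Rightarrow> real"
  proof -
    obtain B where B: "\<And>\<zeta> z. \<zeta> \<in> {0<..<\<tau>} \<times> cell \<Longrightarrow> z \<in> cball 0 1 \<Longrightarrow> \<bar>\<psi> (\<zeta> - z)\<bar> \<le> B"
      using kernel_bounded[OF smooth_fun_continuous[OF s]] by blast
    have "AE z in ST \<tau>. \<bar>\<psi> z\<bar> \<le> B"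
      using AE_ST_slab by eventually_elim (use B[of _ 0] in simp)
    then show ?thesis using smooth_fun_borel[OF s] by (intro ST.bconv_const[where C=B]) auto
  qed
  then show ?thesis unfolding sapx_def using assms smooth_fun_pd[OF assms(1) ex_Basis]
    by (intro exI[of _ "\<lambda>_. \<phi>"]) auto
qed

text \<open>Everything is stated in components, for functions on pairs. The velocity
  \<open>u\<close> is eliminated in favour of \<open>w\<close> and \<open>v\<close>, and the strong
  equations are already divided by \<open>r\<close> with its gradient written as
  \<open>r * V j / c\<close>, so that only bounded functions of the strong solution remain.\<close>

locale weak_strong =
  fixes T \<nu> c m :: real
    and \<rho> r :: "real \<times> (real^'d) \<Rightarrow> real"
    and w v W V DtW DtV :: "'d \<Rightarrow> real \<times> (real^'d) \<Rightarrow> real"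
    and Tw Tv DW DV :: "'d \<Rightarrow> 'd \<Rightarrow> real \<times> (real^'d) \<Rightarrow> real"
    and D2W D2V :: "'d \<Rightarrow> 'd \<Rightarrow> 'd \<Rightarrow> real \<times> (real^'d) \<Rightarrow> real"
    and \<rho>0 :: "real^'d \<Rightarrow> real" and w0 v0 :: "'d \<Rightarrow> real^'d \<Rightarrow> real"
  assumes T: "0 < T" and \<nu>: "0 < \<nu>" and c: "0 < c" and m: "0 < m"
    and meas [measurable]: "\<rho> \<in> borel_measurable borel" "\<And>i. w i \<in> borel_measurable borel" "\<And>i. v i \<in> borel_measurable borel"
      "\<And>i j. Tw i j \<in> borel_measurable borel" "\<And>i j. Tv i j \<in> borel_measurable borel"
      "\<And>i. w0 i \<in> borel_measurable borel" "\<And>i. v0 i \<in> borel_measurable borel"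
    and \<rho>_nonneg: "AE z in ST T. 0 \<le> \<rho> z"
    and \<rho>_int: "integrable (ST T) \<rho>"
    and w_int: "\<And>i. integrable (ST T) (\<lambda>z. \<rho> z * (w i z)\<^sup>2)"
    and v_int: "\<And>i. integrable (ST T) (\<lambda>z. \<rho> z * (v i z)\<^sup>2)"
    and Tw_int: "\<And>i j. integrable (ST T) (\<lambda>z. (Tw i j z)\<^sup>2)"
    and Tv_int: "\<And>i j. integrable (ST T) (\<lambda>z. (Tv i j z)\<^sup>2)"
    and \<rho>0_int: "integrable cm \<rho>0"
    and w0_int: "\<And>i. integrable cm (\<lambda>x. \<rho>0 x * (w0 i x)\<^sup>2)"
    and v0_int: "\<And>i. integrable cm (\<lambda>x. \<rho>0 x * (v0 i x)\<^sup>2)"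
    and flux_\<rho>: "\<And>\<phi> j. uitest T \<phi> \<Longrightarrow> (\<integral>z. \<rho> z * v j z * \<phi> z \<partial>ST T) = - c * (\<integral>z. \<rho> z * pd (ex j) \<phi> z \<partial>ST T)"
    and flux_w: "\<And>\<phi> i j. uitest T \<phi> \<Longrightarrow> (\<integral>z. sqrt (\<rho> z) * Tw i j z * \<phi> z \<partial>ST T) =
      - (\<integral>z. \<rho> z * w i z * pd (ex j) \<phi> z \<partial>ST T) - 1 / c * (\<integral>z. \<rho> z * w i z * v j z * \<phi> z \<partial>ST T)"
    and flux_v: "\<And>\<phi> i j. uitest T \<phi> \<Longrightarrow> (\<integral>z. sqrt (\<rho> z) * Tv i j z * \<phi> z \<partial>ST T) =
      - (\<integral>z. \<rho> z * v i z * pd (ex j) \<phi> z \<partial>ST T) - 1 / c * (\<integral>z. \<rho> z * v i z * v j z * \<phi> z \<partial>ST T)"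
    and cont: "\<And>\<phi>. utest T \<phi> \<Longrightarrow>
      (\<integral>z. \<rho> z * pd et \<phi> z + (\<Sum>j\<in>UNIV. (\<rho> z * (w j z - \<nu> / c * v j z)) * pd (ex j) \<phi> z) \<partial>ST T)
        + (\<integral>x. \<rho>0 x * \<phi> (0, x) \<partial>cm) = 0"
    and eq_w: "\<And>\<phi> i. utest T \<phi> \<Longrightarrow>
      (\<integral>z. (\<rho> z * w i z) * pd et \<phi> z + (\<Sum>j\<in>UNIV. (\<rho> z * w i z * (w j z - \<nu> / c * v j z)
          - \<nu> * (sqrt (\<rho> z) * Tw i j z) - c * (sqrt (\<rho> z) * Tv i j z)) * pd (ex j) \<phi> z) \<partial>ST T)
        + (\<integral>x. (\<rho>0 x * w0 i x) * \<phi> (0, x) \<partial>cm) = 0"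
    and eq_v: "\<And>\<phi> i. utest T \<phi> \<Longrightarrow>
      (\<integral>z. (\<rho> z * v i z) * pd et \<phi> z + (\<Sum>j\<in>UNIV. (\<rho> z * v i z * (w j z - \<nu> / c * v j z)
          - \<nu> * (sqrt (\<rho> z) * Tv i j z) + c * (sqrt (\<rho> z) * Tw i j z)) * pd (ex j) \<phi> z) \<partial>ST T)
        + (\<integral>x. (\<rho>0 x * v0 i x) * \<phi> (0, x) \<partial>cm) = 0"
    and energy: "AE t in tm T. (\<integral>x. (\<lambda>z. 1/2 * (\<Sum>i\<in>UNIV. \<rho> z * (w i z)\<^sup>2 + \<rho> z * (v i z)\<^sup>2)) (t, x) \<partial>cm)
        + \<nu> * (\<integral>z. (\<Sum>i\<in>UNIV. \<Sum>j\<in>UNIV. (Tw i j z)\<^sup>2 + (Tv i j z)\<^sup>2) \<partial>ST t)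
        \<le> 1/2 * (\<Sum>i\<in>UNIV. (\<integral>x. \<rho>0 x * (w0 i x)\<^sup>2 \<partial>cm) + (\<integral>x. \<rho>0 x * (v0 i x)\<^sup>2 \<partial>cm))"
    and bdd_r: "bdd T r" and r_ge: "AE z in ST T. m \<le> r z"
    and bdds: "\<And>i. bdd T (W i)" "\<And>i. bdd T (V i)" "\<And>i. bdd T (DtW i)" "\<And>i. bdd T (DtV i)"
      "\<And>i j. bdd T (DW i j)" "\<And>i j. bdd T (DV i j)" "\<And>i j k. bdd T (D2W i j k)" "\<And>i j k. bdd T (D2V i j k)"
    and dx_r: "\<And>j. uwdx T r j (\<lambda>z. r z * V j z / c)"
    and dx_W: "\<And>i j. uwdx T (W i) j (DW i j)" and dx_V: "\<And>i j. uwdx T (V i) j (DV i j)"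
    and dx_DW: "\<And>i j k. uwdx T (DW i j) k (D2W i j k)" and dx_DV: "\<And>i j k. uwdx T (DV i j) k (D2V i j k)"
    and dt_W: "\<And>i. uwdt T (W i) (DtW i) (w0 i)" and dt_V: "\<And>i. uwdt T (V i) (DtV i) (v0 i)"
    and cont_r: "\<And>\<phi>. utest T \<phi> \<Longrightarrow>
      (\<integral>z. r z * pd et \<phi> z + (\<Sum>j\<in>UNIV. (r z * (W j z - \<nu> / c * V j z)) * pd (ex j) \<phi> z) \<partial>ST T)
        + (\<integral>x. \<rho>0 x * \<phi> (0, x) \<partial>cm) = 0"
    and strong_W: "AE z in ST T. \<forall>i. DtW i z = (\<Sum>j\<in>UNIV. - (DW i j z * (W j z - \<nu> / c * V j z))
        + \<nu> * (V j z / c * DW i j z + D2W i j j z) + c * (V j z / c * DV i j z + D2V i j j z))"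
    and strong_V: "AE z in ST T. \<forall>i. DtV i z = (\<Sum>j\<in>UNIV. - (DV i j z * (W j z - \<nu> / c * V j z))
        + \<nu> * (V j z / c * DV i j z + D2V i j j z) - c * (V j z / c * DW i j z + D2W i j j z))"
begin

section \<open>Integrability and the flux identities in homogeneous form\<close>

lemma meas_strong [measurable]:
  "r \<in> borel_measurable borel" "W i \<in> borel_measurable borel" "V i \<in> borel_measurable borel"
  "DtW i \<in> borel_measurable borel" "DtV i \<in> borel_measurable borel"
  "DW i j \<in> borel_measurable borel" "DV i j \<in> borel_measurable borel"
  "D2W i j k \<in> borel_measurable borel" "D2V i j k \<in> borel_measurable borel"
  using bdd_r bdds by (auto simp: bdd_def)

lemma ints:
  "integrable (ST T) (\<lambda>z. \<rho> z * w i z * w j z)" "integrable (ST T) (\<lambda>z. \<rho> z * w i z * v j z)"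
  "integrable (ST T) (\<lambda>z. \<rho> z * v i z * w j z)" "integrable (ST T) (\<lambda>z. \<rho> z * v i z * v j z)"
  "integrable (ST T) (\<lambda>z. \<rho> z * w i z)" "integrable (ST T) (\<lambda>z. \<rho> z * v i z)"
  "integrable (ST T) (\<lambda>z. sqrt (\<rho> z) * Tw i j z)" "integrable (ST T) (\<lambda>z. sqrt (\<rho> z) * Tv i j z)"
proof -
  have one: "integrable (ST T) (\<lambda>z. \<rho> z * ((\<lambda>_. 1) z)\<^sup>2)" using \<rho>_int by simp
  note P = integrable_weighted_prod[OF \<rho>_nonneg]
  show "integrable (ST T) (\<lambda>z. \<rho> z * w i z * w j z)" "integrable (ST T) (\<lambda>z. \<rho> z * w i z * v j z)"
    "integrable (ST T) (\<lambda>z. \<rho> z * v i z * w j z)" "integrable (ST T) (\<lambda>z. \<rho> z * v i z * v j z)"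
    by (rule P; simp add: w_int v_int)+
  show "integrable (ST T) (\<lambda>z. \<rho> z * w i z)" "integrable (ST T) (\<lambda>z. \<rho> z * v i z)"
    using P[OF _ _ _ w_int one, of i] P[OF _ _ _ v_int one, of i] by simp_all
  have sq: "integrable (ST T) (\<lambda>z. 1 * (sqrt (\<rho> z))\<^sup>2)"
  proof (rule Bochner_Integration.integrable_bound[OF \<rho>_int])
    show "AE z in ST T. norm (1 * (sqrt (\<rho> z))\<^sup>2) \<le> norm (\<rho> z)"
      using \<rho>_nonneg by eventually_elim simp
  qed simp
  have Q: "integrable (ST T) (\<lambda>z. 1 * sqrt (\<rho> z) * g z)"
    if "integrable (ST T) (\<lambda>z. 1 * (g z)\<^sup>2)" "g \<in> borel_measurable borel" for g
    by (rule integrable_weighted_prod) (use that sq in auto)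
  show "integrable (ST T) (\<lambda>z. sqrt (\<rho> z) * Tw i j z)" "integrable (ST T) (\<lambda>z. sqrt (\<rho> z) * Tv i j z)"
    using Q[of "Tw i j"] Q[of "Tv i j"] Tw_int[of i j] Tv_int[of i j] by simp_all
qed

lemma grad_\<rho>:
  assumes "uitest T \<phi>"
  shows "(\<integral>z. (\<rho> z * v j z) * \<phi> z + (c * \<rho> z) * pd (ex j) \<phi> z \<partial>ST T) = 0"
proof -
  have sm: "smooth_fun \<phi>" using assms by (auto simp: uitest_def utest_def)
  note i1 = integrable_mult_smooth[OF ints(6) sm] and i2 = integrable_mult_smooth[OF \<rho>_int smooth_fun_pd[OF sm ex_Basis]]
  have "(\<integral>z. (\<rho> z * v j z) * \<phi> z + c * (\<rho> z * pd (ex j) \<phi> z) \<partial>ST T) = 0"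
    by (simp add: Bochner_Integration.integral_add[OF i1 integrable_mult_right[OF i2]] flux_\<rho>[OF assms])
  then show ?thesis by (simp only: mult.assoc)
qed

text \<open>Collects an identity of flux type into one integral with value 0, the form in which the
  class of test functions is extended by \<open>weak_sapx\<close>.\<close>

lemma grad_aux:
  fixes S A B :: "real \<times> (real^'d) \<Rightarrow> real"
  assumes "smooth_fun \<phi>" "integrable (ST T) S" "integrable (ST T) A" "integrable (ST T) B"
    and "(\<integral>z. S z * \<phi> z \<partial>ST T) = - (\<integral>z. A z * pd (ex j) \<phi> z \<partial>ST T) - p * (\<integral>z. B z * \<phi> z \<partial>ST T)"
  shows "(\<integral>z. (S z + p * B z) * \<phi> z + A z * pd (ex j) \<phi> z \<partial>ST T) = 0"
proof -
  note i1 = integrable_mult_smooth[OF assms(2,1)] and i2 = integrable_mult_smooth[OF assms(4,1)]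
    and i3 = integrable_mult_smooth[OF assms(3) smooth_fun_pd[OF assms(1) ex_Basis]]
  have "(\<integral>z. (S z * \<phi> z + p * (B z * \<phi> z)) + A z * pd (ex j) \<phi> z \<partial>ST T) = 0"
    using assms(5) by (simp add: Bochner_Integration.integral_add i1 i2 i3)
  then show ?thesis by (simp only: distrib_right mult.assoc)
qed

lemma grad_w: "uitest T \<phi> \<Longrightarrow>
    (\<integral>z. (sqrt (\<rho> z) * Tw i j z + 1 / c * (\<rho> z * w i z * v j z)) * \<phi> z + (\<rho> z * w i z) * pd (ex j) \<phi> z \<partial>ST T) = 0"
  and grad_v: "uitest T \<phi> \<Longrightarrow>
    (\<integral>z. (sqrt (\<rho> z) * Tv i j z + 1 / c * (\<rho> z * v i z * v j z)) * \<phi> z + (\<rho> z * v i z) * pd (ex j) \<phi> z \<partial>ST T) = 0"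
  using grad_aux[OF _ ints(7,5,2) flux_w] grad_aux[OF _ ints(8,6,4) flux_v]
  by (auto simp: uitest_def utest_def)

text \<open>Both solutions start from the same density, and the continuity equation of the strong
  one transfers the lower bound of \<open>r\<close> to it.\<close>

lemma \<rho>0_ge: "AE x in cm. m \<le> \<rho>0 x"
proof -
  have "\<exists>C. \<forall>j. AE z in ST T. \<bar>r z * (W j z - \<nu> / c * V j z)\<bar> \<le> C"
  proof -
    obtain R where R: "0 \<le> R" "AE z in ST T. \<bar>r z\<bar> \<le> R" using bdd_obtain[OF bdd_r] by blast
    have "\<forall>j. \<exists>C. AE z in ST T. \<bar>W j z\<bar> \<le> C" "\<forall>j. \<exists>C. AE z in ST T. \<bar>V j z\<bar> \<le> C"
      using bdds(1,2) by (auto simp: bdd_def)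
    then obtain a b where a: "\<And>j. AE z in ST T. \<bar>W j z\<bar> \<le> a j" and b: "\<And>j. AE z in ST T. \<bar>V j z\<bar> \<le> b j" by metis
    show ?thesis
    proof (intro exI allI)
      fix j
      show "AE z in ST T. \<bar>r z * (W j z - \<nu> / c * V j z)\<bar> \<le> R * (\<Sum>j\<in>UNIV. \<bar>a j\<bar> + \<nu> / c * \<bar>b j\<bar>)"
        using R(2) a[of j] b[of j]
      proof eventually_elim
        case (elim z)
        have "\<bar>W j z - \<nu> / c * V j z\<bar> \<le> \<bar>W j z\<bar> + \<bar>\<nu> / c * V j z\<bar>" by (rule abs_triangle_ineq4)
        also have "\<dots> \<le> \<bar>a j\<bar> + \<nu> / c * \<bar>b j\<bar>"
          unfolding abs_mult using elim \<nu> c by (intro add_mono mult_mono) auto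
        also have "\<dots> \<le> (\<Sum>j\<in>UNIV. \<bar>a j\<bar> + \<nu> / c * \<bar>b j\<bar>)"
          using \<nu> c by (intro member_le_sum) auto
        finally show ?case unfolding abs_mult using elim(1) R(1) by (intro mult_mono) auto
      qed
    qed
  qed
  then obtain C where C: "\<And>j. AE z in ST T. \<bar>r z * (W j z - \<nu> / c * V j z)\<bar> \<le> C" by blast
  show ?thesis
    by (rule initial_lower_bound[OF cont_r T bdd_integrable[OF bdd_r] r_ge _ C \<rho>0_int]) auto
qed

text \<open>With \<open>\<rho>0\<close> bounded below, weighted squares control squares, and these
  together with 1 control the absolute value. Integrable initial values are what the approximation
  of W and V by test functions requires.\<close>

lemma data_L1: "integrable cm (w0 i)" "integrable cm (v0 i)"
proof -
  have H: "integrable cm f" if [measurable]: "f \<in> borel_measurable borel" and i: "integrable cm (\<lambda>x. \<rho>0 x * (f x)\<^sup>2)" for f :: "real^'d \<Rightarrow> real"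
  proof (rule Bochner_Integration.integrable_bound)
    show "integrable cm (\<lambda>x. 1 + inverse m * (\<rho>0 x * (f x)\<^sup>2))" using i by simp
    show "AE x in cm. norm (f x) \<le> norm (1 + inverse m * (\<rho>0 x * (f x)\<^sup>2))"
      using \<rho>0_ge
    proof eventually_elim
      case (elim x)
      have "0 \<le> (\<bar>f x\<bar> - 1)\<^sup>2" by simp
      then have "2 * \<bar>f x\<bar> \<le> 1 + (f x)\<^sup>2" by (simp add: power2_eq_square algebra_simps)
      moreover have "(f x)\<^sup>2 = inverse m * (m * (f x)\<^sup>2)" using m by (simp add: field_simps)
      moreover have "inverse m * (m * (f x)\<^sup>2) \<le> inverse m * (\<rho>0 x * (f x)\<^sup>2)"
        using elim m by (intro mult_left_mono mult_right_mono) auto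
      ultimately have "\<bar>f x\<bar> \<le> 1 + inverse m * (\<rho>0 x * (f x)\<^sup>2)" by linarith
      then show ?case by simp
    qed
  qed simp
  show "integrable cm (w0 i)" by (rule H[OF meas(6) w0_int])
  show "integrable cm (v0 i)" by (rule H[OF meas(7) v0_int])
qed

lemma apx:
  assumes "0 < \<tau>" "\<tau> < T"
  shows "tapx \<tau> (W i) (DtW i) (DW i) (w0 i)" "tapx \<tau> (V i) (DtV i) (DV i) (v0 i)"
    "sapx \<tau> (DW i j) (D2W i j)" "sapx \<tau> (DV i j) (D2V i j)"
proof -
  show "tapx \<tau> (W i) (DtW i) (DW i) (w0 i)"
    by (rule tapx_moll[OF bdds(1) bdds(5) bdds(3) data_L1(1) assms dx_W dt_W])
  show "tapx \<tau> (V i) (DtV i) (DV i) (v0 i)"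
    by (rule tapx_moll[OF bdds(2) bdds(6) bdds(4) data_L1(2) assms dx_V dt_V])
  show "sapx \<tau> (DW i j) (D2W i j)" by (rule sapx_moll[OF bdds(5) bdds(7) assms dx_DW])
  show "sapx \<tau> (DV i j) (D2V i j)" by (rule sapx_moll[OF bdds(6) bdds(8) assms dx_DV])
qed

lemma \<rho>0w0_int: "integrable cm (\<lambda>x. \<rho>0 x * w0 i x)" "integrable cm (\<lambda>x. \<rho>0 x * v0 i x)"
proof -
  have nn: "AE x in cm. 0 \<le> \<rho>0 x" using \<rho>0_ge m by (auto elim: eventually_mono)
  have [measurable]: "\<rho>0 \<in> borel_measurable borel" using \<rho>0_int by (simp add: integrable_iff_bounded)
  have one: "integrable cm (\<lambda>z. \<rho>0 z * ((\<lambda>_. 1) z)\<^sup>2)" using \<rho>0_int by simp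
  note P = integrable_weighted_prod[OF nn]
  show "integrable cm (\<lambda>z. \<rho>0 z * w0 i z)" "integrable cm (\<lambda>z. \<rho>0 z * v0 i z)"
    using P[OF _ _ _ w0_int one, of i] P[OF _ _ _ v0_int one, of i] by simp_all
qed

text \<open>Neither the weight nor the factor 1/2 is included: the relative energy density is
  \<open>1/2 * (\<rho> z * reldens z)\<close>.\<close>

definition reldens :: "real \<times> (real^'d) \<Rightarrow> real" where
  "reldens z = (\<Sum>i\<in>UNIV. (w i z - W i z)\<^sup>2 + (v i z - V i z)\<^sup>2)"

lemma gradient_bound:
  obtains L where "0 \<le> L" "AE z in ST T. \<forall>i j. \<bar>DW i j z\<bar> \<le> L \<and> \<bar>DV i j z\<bar> \<le> L"
proof -
  have "\<forall>i j. \<exists>C. AE z in ST T. \<bar>DW i j z\<bar> \<le> C" "\<forall>i j. \<exists>C. AE z in ST T. \<bar>DV i j z\<bar> \<le> C"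
    using bdds(5,6) by (auto simp: bdd_def)
  then obtain a b where a: "\<And>i j. AE z in ST T. \<bar>DW i j z\<bar> \<le> a i j" and b: "\<And>i j. AE z in ST T. \<bar>DV i j z\<bar> \<le> b i j" by metis
  define L where "L = (\<Sum>i\<in>UNIV. \<Sum>j\<in>UNIV. \<bar>a i j\<bar> + \<bar>b i j\<bar>)"
  have le: "\<bar>a i j\<bar> + \<bar>b i j\<bar> \<le> L" for i j
  proof -
    have "\<bar>a i j\<bar> + \<bar>b i j\<bar> \<le> (\<Sum>j\<in>UNIV. \<bar>a i j\<bar> + \<bar>b i j\<bar>)" by (intro member_le_sum) auto
    also have "\<dots> \<le> L" unfolding L_def
      by (rule member_le_sum[of i UNIV "\<lambda>i. \<Sum>j\<in>UNIV. \<bar>a i j\<bar> + \<bar>b i j\<bar>"]) (auto intro: sum_nonneg)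
    finally show ?thesis .
  qed
  have "AE z in ST T. \<forall>i j. \<bar>DW i j z\<bar> \<le> a i j \<and> \<bar>DV i j z\<bar> \<le> b i j"
    using a b by (simp add: AE_all_countable)
  then have "AE z in ST T. \<forall>i j. \<bar>DW i j z\<bar> \<le> L \<and> \<bar>DV i j z\<bar> \<le> L"
  proof eventually_elim
    case (elim z)
    show ?case
    proof (intro allI)
      fix i j show "\<bar>DW i j z\<bar> \<le> L \<and> \<bar>DV i j z\<bar> \<le> L" using elim[rule_format, of i j] le[of i j] by linarith
    qed
  qed
  moreover have "0 \<le> L" unfolding L_def by (intro sum_nonneg) auto
  ultimately show ?thesis using that by blast
qed

text \<open>With \<open>e i\<close> the sum of the squares of \<open>a i\<close> and
  \<open>b i\<close>, every product is at most \<open>L * ((e i + e j) / 2)\<close>. After expansion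
  four products have coefficient of modulus 1 and two have modulus \<open>2 * k\<close>, which gives
  \<open>(2 + 2 * k) * L * (e i + e j)\<close>; summation over both indices contributes
  \<open>2 * CARD('d)\<close>.\<close>

lemma pointwise_lower:
  fixes a b :: "'d \<Rightarrow> real" and P Q :: "'d \<Rightarrow> 'd \<Rightarrow> real"
  assumes L: "\<And>i j. \<bar>P i j\<bar> \<le> L" "\<And>i j. \<bar>Q i j\<bar> \<le> L" and k: "0 \<le> k"
  shows "- ((2 + 2 * k) * L * (2 * real CARD('d)) * (\<Sum>i\<in>UNIV. (a i)\<^sup>2 + (b i)\<^sup>2)) \<le>
    (\<Sum>i\<in>UNIV. \<Sum>j\<in>UNIV. a i * (a j - k * b j) * P i j + b i * (a j - k * b j) * Q i j
      - k * (a i * b j) * P i j - k * (b i * b j) * Q i j - a i * b j * Q i j + b i * b j * P i j)"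
proof -
  define e where "e = (\<lambda>i. (a i)\<^sup>2 + (b i)\<^sup>2)"
  have prod: "\<bar>x * y\<bar> \<le> (e i + e j) / 2" if "x = a i \<or> x = b i" "y = a j \<or> y = b j" for x y i j
  proof -
    have "0 \<le> (\<bar>x\<bar> - \<bar>y\<bar>)\<^sup>2" by simp
    then have "2 * (\<bar>x\<bar> * \<bar>y\<bar>) \<le> x\<^sup>2 + y\<^sup>2" by (simp add: power2_eq_square algebra_simps)
    moreover have "x\<^sup>2 \<le> e i" "y\<^sup>2 \<le> e j" using that by (auto simp: e_def)
    ultimately show ?thesis by (simp add: abs_mult)
  qed
  have L0: "0 \<le> L" using L(1)[of undefined undefined] by (auto intro: order_trans[OF abs_ge_zero])
  have tb: "\<bar>x * y * R\<bar> \<le> L * ((e i + e j) / 2)" if "x = a i \<or> x = b i" "y = a j \<or> y = b j" "\<bar>R\<bar> \<le> L" for x y i j R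
  proof -
    have "\<bar>x * y\<bar> * \<bar>R\<bar> \<le> (e i + e j) / 2 * L" using prod[OF that(1,2)] that(3) by (intro mult_mono) (auto simp: e_def)
    then show ?thesis by (simp add: abs_mult mult.commute)
  qed
  have ij: "- (L * (2 + 2 * k) * (e i + e j)) \<le> a i * (a j - k * b j) * P i j + b i * (a j - k * b j) * Q i j
      - k * (a i * b j) * P i j - k * (b i * b j) * Q i j - a i * b j * Q i j + b i * b j * P i j" for i j
  proof -
    let ?H = "L * ((e i + e j) / 2)"
    have 1: "\<bar>a i * a j * P i j\<bar> \<le> ?H" "\<bar>a i * b j * P i j\<bar> \<le> ?H" "\<bar>b i * a j * Q i j\<bar> \<le> ?H"
      "\<bar>b i * b j * Q i j\<bar> \<le> ?H" "\<bar>a i * b j * Q i j\<bar> \<le> ?H" "\<bar>b i * b j * P i j\<bar> \<le> ?H"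
      by (rule tb; simp add: L)+
    have 2: "k * (a i * b j * P i j) \<le> k * ?H" "k * (b i * b j * Q i j) \<le> k * ?H"
      using mult_left_mono[OF order_trans[OF abs_ge_self 1(2)] k] mult_left_mono[OF order_trans[OF abs_ge_self 1(4)] k]
      by (simp_all only: mult.assoc)
    have "a i * (a j - k * b j) * P i j + b i * (a j - k * b j) * Q i j
      - k * (a i * b j) * P i j - k * (b i * b j) * Q i j - a i * b j * Q i j + b i * b j * P i j =
      a i * a j * P i j + b i * a j * Q i j - a i * b j * Q i j + b i * b j * P i j
       - 2 * (k * (a i * b j * P i j)) - 2 * (k * (b i * b j * Q i j))"
      by (simp add: algebra_simps)
    moreover have "L * (2 + 2 * k) * (e i + e j) = 4 * ?H + 4 * (k * ?H)" by (simp add: field_simps)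
    ultimately show ?thesis using 1 2 unfolding abs_le_iff by linarith
  qed
  have "- ((2 + 2 * k) * L * (2 * real CARD('d)) * (\<Sum>i\<in>UNIV. e i)) = (\<Sum>i\<in>UNIV. \<Sum>j\<in>UNIV. - (L * (2 + 2 * k) * (e i + e j)))"
    by (simp add: sum_negf sum.distrib flip: sum_distrib_left)
  also have "\<dots> \<le> (\<Sum>i\<in>UNIV. \<Sum>j\<in>UNIV. a i * (a j - k * b j) * P i j + b i * (a j - k * b j) * Q i j
      - k * (a i * b j) * P i j - k * (b i * b j) * Q i j - a i * b j * Q i j + b i * b j * P i j)"
    by (intro sum_mono ij)
  finally show ?thesis by (simp only: e_def)
qed

text \<open>Completing the squares: after all integrations by parts the relative energy production
  consists of the two squares of the differences of the viscous fluxes and of terms that are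
  quadratic in the differences of the velocities.\<close>

lemma sum_combine:
  fixes t1 dW dV s1 s2 s3 s4 y Z :: "'d \<Rightarrow> real"
  assumes "\<And>j. \<nu> * (th * t1 j) + th * R * a * dW j + th * R * b * dV j + s1 j + s2 j + - (1/2) * s3 j + - (1/2) * s4 j + y j = th * Z j"
  shows "\<nu> * (th * (\<Sum>j\<in>UNIV. t1 j)) + th * R * a * (\<Sum>j\<in>UNIV. dW j) + th * R * b * (\<Sum>j\<in>UNIV. dV j)
    + (\<Sum>j\<in>UNIV. s1 j) + (\<Sum>j\<in>UNIV. s2 j) + - (1/2) * (\<Sum>j\<in>UNIV. s3 j) + - (1/2) * (\<Sum>j\<in>UNIV. s4 j) + (\<Sum>j\<in>UNIV. y j)
    = th * (\<Sum>j\<in>UNIV. Z j)"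
  unfolding sum_distrib_left sum.distrib[symmetric] using assms by (intro sum.cong refl)

text \<open>The terms with \<open>th'\<close> form the negative squares of \<open>wi - Wi\<close>
  and \<open>vi - Vi\<close>. The terms with \<open>dtW\<close> and \<open>dtV\<close> combine to
  the same differences as factors, which is how they enter the assumption.\<close>

lemma square_arith:
  fixes A B1 B2 B3 B4 Y Z dtW dtV R th th' wi vi Wi Vi :: real
  assumes "\<nu> * (th * A) + th * R * (wi - Wi) * dtW + th * R * (vi - Vi) * dtV + B1 + B2 + - (1/2) * B3 + - (1/2) * B4 + Y = th * Z"
  shows "- th' * (1/2 * (R * wi\<^sup>2 + R * vi\<^sup>2)) + \<nu> * (th * A) + (R * wi * (th' * Wi + th * dtW) + B1)
    + (R * vi * (th' * Vi + th * dtV) + B2)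
    + - (1/2) * (R * (th' * (Wi * Wi) + th * (dtW * Wi + Wi * dtW)) + B3)
    + - (1/2) * (R * (th' * (Vi * Vi) + th * (dtV * Vi + Vi * dtV)) + B4) + Y
    = - th' * (1/2 * R * ((wi - Wi)\<^sup>2 + (vi - Vi)\<^sup>2)) + th * Z"
  unfolding assms[symmetric] by (simp add: field_simps power2_eq_square)

text \<open>The left side adds, for one component, the tested energy, the two momentum equations,
  the continuity equation tested with squares, and eight flux identities. The coefficients of the
  latter are forced: inserting the strong equations produces \<open>PP\<close> and \<open>QQ\<close>
  with the factors \<nu> and c, and each such term must cancel. The terms with factor \<nu> then
  complete the viscous squares, and the cross terms of \<open>tw\<close> with \<open>Q\<close>, of
  \<open>tv\<close> with \<open>P\<close> and of \<open>P\<close> with \<open>Q\<close> cancel by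
  antisymmetry.\<close>

lemma production_identity:
  fixes s R th th' wi vi Wi Vi :: real
    and wj vj Wj Vj tw tv P Q PP QQ dW dV :: "'d \<Rightarrow> real"
  assumes s: "s * s = R" and dW: "dtW = (\<Sum>j\<in>UNIV. dW j)" and dV: "dtV = (\<Sum>j\<in>UNIV. dV j)"
    and dWj: "\<And>j. dW j = - (P j * (Wj j - \<nu> / c * Vj j)) + \<nu> * (Vj j / c * P j + PP j) + c * (Vj j / c * Q j + QQ j)"
    and dVj: "\<And>j. dV j = - (Q j * (Wj j - \<nu> / c * Vj j)) + \<nu> * (Vj j / c * Q j + QQ j) - c * (Vj j / c * P j + PP j)"
  shows "- th' * (1/2 * (R * wi\<^sup>2 + R * vi\<^sup>2)) + \<nu> * (th * (\<Sum>j\<in>UNIV. (tw j)\<^sup>2 + (tv j)\<^sup>2))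
   + (R * wi * (th' * Wi + th * dtW) + (\<Sum>j\<in>UNIV. (R * wi * (wj j - \<nu> / c * vj j) - \<nu> * (s * tw j) - c * (s * tv j)) * (th * P j)))
   + (R * vi * (th' * Vi + th * dtV) + (\<Sum>j\<in>UNIV. (R * vi * (wj j - \<nu> / c * vj j) - \<nu> * (s * tv j) + c * (s * tw j)) * (th * Q j)))
   + - (1/2) * (R * (th' * (Wi * Wi) + th * (dtW * Wi + Wi * dtW)) + (\<Sum>j\<in>UNIV. R * (wj j - \<nu> / c * vj j) * (th * (P j * Wi + Wi * P j))))
   + - (1/2) * (R * (th' * (Vi * Vi) + th * (dtV * Vi + Vi * dtV)) + (\<Sum>j\<in>UNIV. R * (wj j - \<nu> / c * vj j) * (th * (Q j * Vi + Vi * Q j))))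
   + (\<Sum>j\<in>UNIV.
        - \<nu> * ((s * tw j + 1 / c * (R * wi * vj j)) * (th * P j) + R * wi * (th * PP j))
      + - c * ((s * tw j + 1 / c * (R * wi * vj j)) * (th * Q j) + R * wi * (th * QQ j))
      + c * ((s * tv j + 1 / c * (R * vi * vj j)) * (th * P j) + R * vi * (th * PP j))
      + - \<nu> * ((s * tv j + 1 / c * (R * vi * vj j)) * (th * Q j) + R * vi * (th * QQ j))
      + \<nu> / c * (R * vj j * (th * (Wi * P j)) + c * R * (th * (P j * P j + Wi * PP j)))
      + 1 * (R * vj j * (th * (Wi * Q j)) + c * R * (th * (P j * Q j + Wi * QQ j)))
      + - 1 * (R * vj j * (th * (Vi * P j)) + c * R * (th * (Q j * P j + Vi * PP j)))
      + \<nu> / c * (R * vj j * (th * (Vi * Q j)) + c * R * (th * (Q j * Q j + Vi * QQ j))))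
   = - th' * (1/2 * R * ((wi - Wi)\<^sup>2 + (vi - Vi)\<^sup>2))
     + th * (\<Sum>j\<in>UNIV. \<nu> * (tw j - s * P j)\<^sup>2 + \<nu> * (tv j - s * Q j)\<^sup>2
       + R * ((wi - Wi) * ((wj j - Wj j) - \<nu> / c * (vj j - Vj j)) * P j + (vi - Vi) * ((wj j - Wj j) - \<nu> / c * (vj j - Vj j)) * Q j
         - \<nu> / c * ((wi - Wi) * (vj j - Vj j)) * P j - \<nu> / c * ((vi - Vi) * (vj j - Vj j)) * Q j
         - (wi - Wi) * (vj j - Vj j) * Q j + (vi - Vi) * (vj j - Vj j) * P j))"
proof -
  have c0: "c \<noteq> 0" using c by simp
  \<comment> \<open>The identity already holds for each \<open>j\<close> separately. It is
    polynomial once \<open>R\<close> is replaced by \<open>s * s\<close> and the denominators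
    \<open>c\<close> are cleared.\<close>
  have per_j: "\<nu> * (th * ((tw j)\<^sup>2 + (tv j)\<^sup>2))
     + th * R * (wi - Wi) * dW j + th * R * (vi - Vi) * dV j
     + (R * wi * (wj j - \<nu> / c * vj j) - \<nu> * (s * tw j) - c * (s * tv j)) * (th * P j)
     + (R * vi * (wj j - \<nu> / c * vj j) - \<nu> * (s * tv j) + c * (s * tw j)) * (th * Q j)
     + - (1/2) * (R * (wj j - \<nu> / c * vj j) * (th * (P j * Wi + Wi * P j)))
     + - (1/2) * (R * (wj j - \<nu> / c * vj j) * (th * (Q j * Vi + Vi * Q j)))
     + (- \<nu> * ((s * tw j + 1 / c * (R * wi * vj j)) * (th * P j) + R * wi * (th * PP j))
      + - c * ((s * tw j + 1 / c * (R * wi * vj j)) * (th * Q j) + R * wi * (th * QQ j))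
      + c * ((s * tv j + 1 / c * (R * vi * vj j)) * (th * P j) + R * vi * (th * PP j))
      + - \<nu> * ((s * tv j + 1 / c * (R * vi * vj j)) * (th * Q j) + R * vi * (th * QQ j))
      + \<nu> / c * (R * vj j * (th * (Wi * P j)) + c * R * (th * (P j * P j + Wi * PP j)))
      + 1 * (R * vj j * (th * (Wi * Q j)) + c * R * (th * (P j * Q j + Wi * QQ j)))
      + - 1 * (R * vj j * (th * (Vi * P j)) + c * R * (th * (Q j * P j + Vi * PP j)))
      + \<nu> / c * (R * vj j * (th * (Vi * Q j)) + c * R * (th * (Q j * Q j + Vi * QQ j))))
     = th * (\<nu> * (tw j - s * P j)\<^sup>2 + \<nu> * (tv j - s * Q j)\<^sup>2
       + R * ((wi - Wi) * ((wj j - Wj j) - \<nu> / c * (vj j - Vj j)) * P j + (vi - Vi) * ((wj j - Wj j) - \<nu> / c * (vj j - Vj j)) * Q j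
         - \<nu> / c * ((wi - Wi) * (vj j - Vj j)) * P j - \<nu> / c * ((vi - Vi) * (vj j - Vj j)) * Q j
         - (wi - Wi) * (vj j - Vj j) * Q j + (vi - Vi) * (vj j - Vj j) * P j))" for j
    unfolding dWj dVj s[symmetric] using c0 by (simp add: field_simps power2_eq_square)
  show ?thesis
    using sum_combine[of th _ R "wi - Wi" dW "vi - Vi" dV, OF per_j] unfolding dW[symmetric] dV[symmetric]
    by (rule square_arith)
qed

lemma sum_three:
  fixes e d x :: "'d \<Rightarrow> real"
  shows "a * (1/2 * (\<Sum>i\<in>UNIV. e i)) + b * (t * (\<Sum>i\<in>UNIV. d i)) + (\<Sum>i\<in>UNIV. x i)
    = (\<Sum>i\<in>UNIV. a * (1/2 * e i) + b * (t * d i) + x i)"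
  by (simp add: sum.distrib sum_distrib_left)

lemma sum_two:
  fixes e :: "'d \<Rightarrow> real" and s q :: "'d \<Rightarrow> 'd \<Rightarrow> real"
  shows "(\<Sum>i\<in>UNIV. a * (1/2 * R * e i) + t * (\<Sum>j\<in>UNIV. s i j + R * q i j))
    = a * (1/2 * R * (\<Sum>i\<in>UNIV. e i)) + t * ((\<Sum>i\<in>UNIV. \<Sum>j\<in>UNIV. s i j) + R * (\<Sum>i\<in>UNIV. \<Sum>j\<in>UNIV. q i j))"
  by (simp add: sum.distrib sum_distrib_left distrib_left)

text \<open>All tested relations are added. Their initial terms cancel because the data coincide, so
  the total integral is at most 0, while its integrand is at least \<open>\<gamma>\<close> times the
  relative energy density.\<close>

lemma relative_energy_zero_before:
  assumes \<tau>0: "0 < \<tau>0" "\<tau>0 < T"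
  shows "AE z in ST \<tau>0. \<rho> z * reldens z = 0"
proof -
  obtain L where L: "0 \<le> L" "AE z in ST T. \<forall>i j. \<bar>DW i j z\<bar> \<le> L \<and> \<bar>DV i j z\<bar> \<le> L"
    using gradient_bound by blast
  define k where "k = \<nu> / c"
  have k: "0 \<le> k" using \<nu> c by (simp add: k_def)
  \<comment> \<open>Twice the constant of \<open>pointwise_lower\<close>, since the relative energy
    carries the factor 1/2.\<close>
  define K where "K = 2 * ((2 + 2 * k) * L * (2 * real CARD('d)))"
  have K: "0 \<le> K" using k L(1) by (simp add: K_def)
  define \<theta> where "\<theta> = (\<lambda>t. exp (- K * t) * flat_exp 0 (\<tau>0 - t))"
  \<comment> \<open>The part of the derivative of \<open>\<theta>\<close> that comes from the flat
    factor: \<open>flat_exp 2\<close> is the derivative of \<open>flat_exp 0\<close>, so that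
    \<open>deriv \<theta> = - K * \<theta> - \<gamma>\<close>.\<close>
  define \<gamma> where "\<gamma> = (\<lambda>t. exp (- K * t) * flat_exp 2 (\<tau>0 - t))"
  \<comment> \<open>An intermediate horizon: the weight vanishes before it, and the mollifications
    up to it only use times before \<open>T\<close>.\<close>
  define \<tau> where "\<tau> = (\<tau>0 + T) / 2"
  have \<tau>: "0 < \<tau>" "\<tau> < T" "\<tau>0 < \<tau>" using \<tau>0 by (auto simp: \<tau>_def)
  have s\<theta>: "smooth_fun \<theta>" unfolding \<theta>_def
    by (intro smooth_fun_mult smooth_fun_exp smooth_fun_compose[OF smooth_fun_flat_exp] smooth_fun_diff smooth_fun_const smooth_fun_id)
  have s\<gamma>: "smooth_fun \<gamma>" unfolding \<gamma>_def
    by (intro smooth_fun_mult smooth_fun_exp smooth_fun_compose[OF smooth_fun_flat_exp] smooth_fun_diff smooth_fun_const smooth_fun_id)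
  have \<theta>cut: "cutoff \<tau> \<theta>"
    unfolding cutoff_def using s\<theta> \<tau> by (intro conjI exI[of _ \<tau>0]) (auto simp: \<theta>_def flat_exp_eq_0)
  have d\<theta>: "deriv \<theta> t = - K * \<theta> t - \<gamma> t" for t
  proof (rule DERIV_imp_deriv)
    have "((\<lambda>t. flat_exp 0 (\<tau>0 - t)) has_real_derivative flat_exp 2 (\<tau>0 - t) * (- 1)) (at t)"
      using DERIV_flat_exp[of 0 "\<tau>0 - t"]
      by (intro DERIV_chain2[where g="\<lambda>t. \<tau>0 - t"]) (auto intro!: derivative_eq_intros simp: numeral_2_eq_2)
    moreover have "((\<lambda>t. exp (- K * t)) has_real_derivative - K * exp (- K * t)) (at t)"
      by (auto intro!: derivative_eq_intros)
    ultimately have "(\<theta> has_real_derivative - K * exp (- K * t) * flat_exp 0 (\<tau>0 - t) + flat_exp 2 (\<tau>0 - t) * (- 1) * exp (- K * t)) (at t)"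
      unfolding \<theta>_def by (intro DERIV_mult)
    then show "(\<theta> has_real_derivative - K * \<theta> t - \<gamma> t) (at t)"
      by (rule DERIV_cong) (simp add: \<theta>_def \<gamma>_def)
  qed
  have \<theta>0: "0 \<le> \<theta> t" and \<gamma>0: "0 \<le> \<gamma> t" for t by (auto simp: \<theta>_def \<gamma>_def flat_exp_nonneg)
  have mono: "deriv \<theta> t \<le> 0" for t
  proof -
    have "0 \<le> K * \<theta> t" using K \<theta>0[of t] by simp
    then show ?thesis using d\<theta>[of t] \<gamma>0[of t] by simp
  qed
  note le = less_imp_le[OF \<tau>(2)]
  note ap = apx[OF \<tau>(1,2)]
  have split: "a * (x - p * y) = a * x - p * (a * y)" for a x p y :: real by (simp add: algebra_simps)
  have Bw: "integrable (ST T) (\<lambda>z. \<rho> z * w i z * (w j z - \<nu> / c * v j z) - \<nu> * (sqrt (\<rho> z) * Tw i j z) - c * (sqrt (\<rho> z) * Tv i j z))" for i j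
    unfolding split by (intro Bochner_Integration.integrable_diff integrable_mult_right ints)
  have Bv: "integrable (ST T) (\<lambda>z. \<rho> z * v i z * (w j z - \<nu> / c * v j z) - \<nu> * (sqrt (\<rho> z) * Tv i j z) + c * (sqrt (\<rho> z) * Tw i j z))" for i j
    unfolding split by (intro Bochner_Integration.integrable_diff Bochner_Integration.integrable_add integrable_mult_right ints)
  have Bc: "integrable (ST T) (\<lambda>z. \<rho> z * (w j z - \<nu> / c * v j z))" for j
    unfolding split by (intro Bochner_Integration.integrable_diff integrable_mult_right ints)
  have Sw: "integrable (ST T) (\<lambda>z. sqrt (\<rho> z) * Tw i j z + 1 / c * (\<rho> z * w i z * v j z))" for i j
    by (intro Bochner_Integration.integrable_add integrable_mult_right ints)
  have Sv: "integrable (ST T) (\<lambda>z. sqrt (\<rho> z) * Tv i j z + 1 / c * (\<rho> z * v i z * v j z))" for i j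
    by (intro Bochner_Integration.integrable_add integrable_mult_right ints)
  have c\<rho>: "integrable (ST T) (\<lambda>z. c * \<rho> z)" using \<rho>_int by simp
  note hA = weak_tapx(1)[OF eq_w ints(5) Bw \<rho>0w0_int(1) ap(1) \<theta>cut \<tau>(2)]
  note hB = weak_tapx(1)[OF eq_v ints(6) Bv \<rho>0w0_int(2) ap(2) \<theta>cut \<tau>(2)]
  note hC = weak_tapx(1)[OF cont \<rho>_int Bc \<rho>0_int tapx_mult[OF ap(1) ap(1)] \<theta>cut \<tau>(2)]
  note hC' = weak_tapx(1)[OF cont \<rho>_int Bc \<rho>0_int tapx_mult[OF ap(2) ap(2)] \<theta>cut \<tau>(2)]
  note hD1 = weak_sapx[OF grad_w Sw ints(5) ap(3) \<theta>cut \<tau>(2)]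
  note hD2 = weak_sapx[OF grad_w Sw ints(5) ap(4) \<theta>cut \<tau>(2)]
  note hD3 = weak_sapx[OF grad_v Sv ints(6) ap(3) \<theta>cut \<tau>(2)]
  note hD4 = weak_sapx[OF grad_v Sv ints(6) ap(4) \<theta>cut \<tau>(2)]
  note sW = tapx_sapx[OF ap(1)] and sV = tapx_sapx[OF ap(2)]
  note hF1 = weak_sapx[OF grad_\<rho> ints(6) c\<rho> sapx_mult[OF sW ap(3)] \<theta>cut \<tau>(2)]
  note hF2 = weak_sapx[OF grad_\<rho> ints(6) c\<rho> sapx_mult[OF sW ap(4)] \<theta>cut \<tau>(2)]
  note hF3 = weak_sapx[OF grad_\<rho> ints(6) c\<rho> sapx_mult[OF sV ap(3)] \<theta>cut \<tau>(2)]
  note hF4 = weak_sapx[OF grad_\<rho> ints(6) c\<rho> sapx_mult[OF sV ap(4)] \<theta>cut \<tau>(2)]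
  let ?E = "\<lambda>z. 1/2 * (\<Sum>i\<in>UNIV. \<rho> z * (w i z)\<^sup>2 + \<rho> z * (v i z)\<^sup>2)"
  let ?D = "\<lambda>z. \<Sum>i\<in>UNIV. \<Sum>j\<in>UNIV. (Tw i j z)\<^sup>2 + (Tv i j z)\<^sup>2"
  let ?I = "\<lambda>i. (\<integral>x. \<rho>0 x * (w0 i x)\<^sup>2 \<partial>cm) + (\<integral>x. \<rho>0 x * (v0 i x)\<^sup>2 \<partial>cm)"
  have iE: "integrable (ST T) ?E" using w_int v_int by (intro integrable_mult_right Bochner_Integration.integrable_sum Bochner_Integration.integrable_add) auto
  have iD: "integrable (ST T) ?D" using Tw_int Tv_int by (intro Bochner_Integration.integrable_sum Bochner_Integration.integrable_add) auto
  have en\<tau>: "AE t in tm \<tau>. (\<integral>x. ?E (t, x) \<partial>cm) + \<nu> * (\<integral>z. ?D z \<partial>ST t) \<le> 1/2 * (\<Sum>i\<in>UNIV. ?I i)"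
    using energy unfolding AE_tm by eventually_elim (use \<tau> in auto)
  note en = energy_tested[OF integrable_ST_mono[OF le iE] integrable_ST_mono[OF le iD] en\<tau> \<theta>cut \<tau>(1) order_refl mono]
  let ?th = "\<lambda>z. \<theta> (fst z)" and ?th' = "\<lambda>z. deriv \<theta> (fst z)"
  define X0 where "X0 = (\<lambda>z. - ?th' z * ?E z + \<nu> * (?th z * ?D z))"
  have X0: "integrable (ST \<tau>) X0" "(\<integral>z. X0 z \<partial>ST \<tau>) \<le> \<theta> 0 * (1/2 * (\<Sum>i\<in>UNIV. ?I i))"
  proof -
    have i: "integrable (ST \<tau>) (\<lambda>z. - 1 * (?th' z * ?E z) + \<nu> * (?th z * ?D z))"
      by (intro Bochner_Integration.integrable_add integrable_mult_right en)
    then show "integrable (ST \<tau>) X0" unfolding X0_def by (simp only: mult_minus_left mult_1_left)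
    show "(\<integral>z. X0 z \<partial>ST \<tau>) \<le> \<theta> 0 * (1/2 * (\<Sum>i\<in>UNIV. ?I i))" unfolding X0_def by (rule en(1))
  qed
  \<comment> \<open>\<open>XA\<close> and \<open>XB\<close> are the momentum equations tested with
    \<open>W i\<close> and \<open>V i\<close>, \<open>XC\<close> and \<open>XC'\<close> the
    continuity equation tested with their squares; the cutoff contributes the terms with
    \<open>?th'\<close>. Their integrals are initial terms only.\<close>
  define XA where "XA = (\<lambda>i z. \<rho> z * w i z * (?th' z * W i z + ?th z * DtW i z) +
     (\<Sum>j\<in>UNIV. (\<rho> z * w i z * (w j z - \<nu> / c * v j z) - \<nu> * (sqrt (\<rho> z) * Tw i j z) - c * (sqrt (\<rho> z) * Tv i j z)) * (?th z * DW i j z)))"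
  define XB where "XB = (\<lambda>i z. \<rho> z * v i z * (?th' z * V i z + ?th z * DtV i z) +
     (\<Sum>j\<in>UNIV. (\<rho> z * v i z * (w j z - \<nu> / c * v j z) - \<nu> * (sqrt (\<rho> z) * Tv i j z) + c * (sqrt (\<rho> z) * Tw i j z)) * (?th z * DV i j z)))"
  define XC where "XC = (\<lambda>i z. \<rho> z * (?th' z * (W i z * W i z) + ?th z * (DtW i z * W i z + W i z * DtW i z)) +
     (\<Sum>j\<in>UNIV. \<rho> z * (w j z - \<nu> / c * v j z) * (?th z * (DW i j z * W i z + W i z * DW i j z))))"
  define XC' where "XC' = (\<lambda>i z. \<rho> z * (?th' z * (V i z * V i z) + ?th z * (DtV i z * V i z + V i z * DtV i z)) +
     (\<Sum>j\<in>UNIV. \<rho> z * (w j z - \<nu> / c * v j z) * (?th z * (DV i j z * V i z + V i z * DV i j z))))"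
  \<comment> \<open>The flux identities for T(w) and T(v) tested with the gradients of W and V, and
    the one for the gradient of \<open>\<rho>\<close> tested with the products of velocity and
    gradient. Each bracket has integral 0, and the coefficients are those of
    \<open>production_identity\<close>.\<close>
  define Y where "Y = (\<lambda>i j z.
        - \<nu> * ((sqrt (\<rho> z) * Tw i j z + 1 / c * (\<rho> z * w i z * v j z)) * (?th z * DW i j z) + \<rho> z * w i z * (?th z * D2W i j j z))
      + - c * ((sqrt (\<rho> z) * Tw i j z + 1 / c * (\<rho> z * w i z * v j z)) * (?th z * DV i j z) + \<rho> z * w i z * (?th z * D2V i j j z))
      + c * ((sqrt (\<rho> z) * Tv i j z + 1 / c * (\<rho> z * v i z * v j z)) * (?th z * DW i j z) + \<rho> z * v i z * (?th z * D2W i j j z))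
      + - \<nu> * ((sqrt (\<rho> z) * Tv i j z + 1 / c * (\<rho> z * v i z * v j z)) * (?th z * DV i j z) + \<rho> z * v i z * (?th z * D2V i j j z))
      + \<nu> / c * (\<rho> z * v j z * (?th z * (W i z * DW i j z)) + c * \<rho> z * (?th z * (DW i j z * DW i j z + W i z * D2W i j j z)))
      + 1 * (\<rho> z * v j z * (?th z * (W i z * DV i j z)) + c * \<rho> z * (?th z * (DW i j z * DV i j z + W i z * D2V i j j z)))
      + - 1 * (\<rho> z * v j z * (?th z * (V i z * DW i j z)) + c * \<rho> z * (?th z * (DV i j z * DW i j z + V i z * D2W i j j z)))
      + \<nu> / c * (\<rho> z * v j z * (?th z * (V i z * DV i j z)) + c * \<rho> z * (?th z * (DV i j z * DV i j z + V i z * D2V i j j z))))"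
  have XA: "has_bochner_integral (ST \<tau>) (XA i) (- \<theta> 0 * (\<integral>x. \<rho>0 x * (w0 i x)\<^sup>2 \<partial>cm))" for i
    using hA[of i i] unfolding XA_def by (simp only: power2_eq_square mult.assoc)
  have XB: "has_bochner_integral (ST \<tau>) (XB i) (- \<theta> 0 * (\<integral>x. \<rho>0 x * (v0 i x)\<^sup>2 \<partial>cm))" for i
    using hB[of i i] unfolding XB_def by (simp only: power2_eq_square mult.assoc)
  have XC: "has_bochner_integral (ST \<tau>) (XC i) (- \<theta> 0 * (\<integral>x. \<rho>0 x * (w0 i x)\<^sup>2 \<partial>cm))" for i
    using hC[of i i] unfolding XC_def by (simp only: power2_eq_square mult.assoc)
  have XC': "has_bochner_integral (ST \<tau>) (XC' i) (- \<theta> 0 * (\<integral>x. \<rho>0 x * (v0 i x)\<^sup>2 \<partial>cm))" for i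
    using hC'[of i i] unfolding XC'_def by (simp only: power2_eq_square mult.assoc)
  have Y: "has_bochner_integral (ST \<tau>) (Y i j) (- \<nu> * 0 + - c * 0 + c * 0 + - \<nu> * 0 + \<nu> / c * 0 + 1 * 0 + - 1 * 0 + \<nu> / c * 0)" for i j
    unfolding Y_def
    by (intro has_bochner_integral_add has_bochner_integral_mult_right hD1 hD2 hD3 hD4 hF1 hF2 hF3 hF4)
  define X where "X = (\<lambda>i z. XA i z + XB i z + - (1/2) * XC i z + - (1/2) * XC' i z + (\<Sum>j\<in>UNIV. Y i j z))"
  \<comment> \<open>The momentum equations contribute the initial energies once with negative sign,
    the squares give back half of them. What is left compensates the initial term of the energy
    inequality exactly.\<close>
  have X: "has_bochner_integral (ST \<tau>) (X i) (- (\<theta> 0 * (1/2 * ?I i)))" for i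
  proof -
    have "has_bochner_integral (ST \<tau>) (X i)
      (- \<theta> 0 * (\<integral>x. \<rho>0 x * (w0 i x)\<^sup>2 \<partial>cm) + - \<theta> 0 * (\<integral>x. \<rho>0 x * (v0 i x)\<^sup>2 \<partial>cm)
       + - (1/2) * (- \<theta> 0 * (\<integral>x. \<rho>0 x * (w0 i x)\<^sup>2 \<partial>cm)) + - (1/2) * (- \<theta> 0 * (\<integral>x. \<rho>0 x * (v0 i x)\<^sup>2 \<partial>cm))
       + (\<Sum>j\<in>(UNIV :: 'd set). - \<nu> * 0 + - c * 0 + c * 0 + - \<nu> * 0 + \<nu> / c * 0 + 1 * 0 + - 1 * 0 + \<nu> / c * 0))"
      unfolding X_def
      by (intro has_bochner_integral_add has_bochner_integral_mult_right has_bochner_integral_sum XA XB XC XC' Y)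
    then show ?thesis by (simp add: algebra_simps)
  qed
  have tot_int: "integrable (ST \<tau>) (\<lambda>z. X0 z + (\<Sum>i\<in>UNIV. X i z))"
    using X0(1) X by (intro Bochner_Integration.integrable_add Bochner_Integration.integrable_sum)
      (auto simp: has_bochner_integral_iff)
  have tot_le: "(\<integral>z. X0 z + (\<Sum>i\<in>UNIV. X i z) \<partial>ST \<tau>) \<le> 0"
  proof -
    have "(\<integral>z. X0 z + (\<Sum>i\<in>UNIV. X i z) \<partial>ST \<tau>) = (\<integral>z. X0 z \<partial>ST \<tau>) + (\<Sum>i\<in>UNIV. \<integral>z. X i z \<partial>ST \<tau>)"
      using X0(1) X by (subst Bochner_Integration.integral_add) (auto simp: has_bochner_integral_iff)
    also have "(\<Sum>i\<in>UNIV. \<integral>z. X i z \<partial>ST \<tau>) = - (\<theta> 0 * (1/2 * (\<Sum>i\<in>UNIV. ?I i)))"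
      using X unfolding has_bochner_integral_iff by (simp add: sum_negf sum_distrib_left)
    finally show ?thesis using X0(2) by linarith
  qed
  have prod: "- ?th' z * (1/2 * (\<rho> z * (w i z)\<^sup>2 + \<rho> z * (v i z)\<^sup>2)) + \<nu> * (?th z * (\<Sum>j\<in>UNIV. (Tw i j z)\<^sup>2 + (Tv i j z)\<^sup>2)) + X i z
     = - ?th' z * (1/2 * \<rho> z * ((w i z - W i z)\<^sup>2 + (v i z - V i z)\<^sup>2))
       + ?th z * (\<Sum>j\<in>UNIV. \<nu> * (Tw i j z - sqrt (\<rho> z) * DW i j z)\<^sup>2 + \<nu> * (Tv i j z - sqrt (\<rho> z) * DV i j z)\<^sup>2
         + \<rho> z * ((w i z - W i z) * ((w j z - W j z) - \<nu> / c * (v j z - V j z)) * DW i j z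
         + (v i z - V i z) * ((w j z - W j z) - \<nu> / c * (v j z - V j z)) * DV i j z
         - \<nu> / c * ((w i z - W i z) * (v j z - V j z)) * DW i j z - \<nu> / c * ((v i z - V i z) * (v j z - V j z)) * DV i j z
         - (w i z - W i z) * (v j z - V j z) * DV i j z + (v i z - V i z) * (v j z - V j z) * DW i j z))"
    if "0 \<le> \<rho> z"
      "DtW i z = (\<Sum>j\<in>UNIV. - (DW i j z * (W j z - \<nu> / c * V j z))
        + \<nu> * (V j z / c * DW i j z + D2W i j j z) + c * (V j z / c * DV i j z + D2V i j j z))"
      "DtV i z = (\<Sum>j\<in>UNIV. - (DV i j z * (W j z - \<nu> / c * V j z))
        + \<nu> * (V j z / c * DV i j z + D2V i j j z) - c * (V j z / c * DW i j z + D2W i j j z))" for i z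
  proof -
    have "sqrt (\<rho> z) * sqrt (\<rho> z) = \<rho> z" using that(1) by simp
    from production_identity[where s="sqrt (\<rho> z)" and R="\<rho> z" and th="?th z" and th'="?th' z" and wi="w i z" and vi="v i z"
        and Wi="W i z" and Vi="V i z" and wj="\<lambda>j. w j z" and vj="\<lambda>j. v j z" and Wj="\<lambda>j. W j z" and Vj="\<lambda>j. V j z"
        and tw="\<lambda>j. Tw i j z" and tv="\<lambda>j. Tv i j z" and P="\<lambda>j. DW i j z" and Q="\<lambda>j. DV i j z"
        and PP="\<lambda>j. D2W i j j z" and QQ="\<lambda>j. D2V i j j z", OF this that(2,3) refl refl]
    show ?thesis unfolding X_def XA_def XB_def XC_def XC'_def Y_def by (simp only: add.assoc)
  qed
  \<comment> \<open>Pointwise the viscous part is a sum of squares and is dropped; the quadratic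
    part is bounded below by a multiple of the relative energy density.\<close>
  have lower: "AE z in ST \<tau>. \<gamma> (fst z) * (1/2 * (\<rho> z * reldens z)) \<le> X0 z + (\<Sum>i\<in>UNIV. X i z)"
    using AE_ST_mono[OF le \<rho>_nonneg] AE_ST_mono[OF le strong_W] AE_ST_mono[OF le strong_V] AE_ST_mono[OF le L(2)]
  proof eventually_elim
    case (elim z)
    let ?a = "\<lambda>i. w i z - W i z" and ?b = "\<lambda>i. v i z - V i z"
    let ?q = "\<lambda>i j. ?a i * (?a j - \<nu> / c * ?b j) * DW i j z + ?b i * (?a j - \<nu> / c * ?b j) * DV i j z
         - \<nu> / c * (?a i * ?b j) * DW i j z - \<nu> / c * (?b i * ?b j) * DV i j z
         - ?a i * ?b j * DV i j z + ?b i * ?b j * DW i j z"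
    let ?s = "\<lambda>i j. \<nu> * (Tw i j z - sqrt (\<rho> z) * DW i j z)\<^sup>2 + \<nu> * (Tv i j z - sqrt (\<rho> z) * DV i j z)\<^sup>2"
    have "X0 z + (\<Sum>i\<in>UNIV. X i z) = (\<Sum>i\<in>UNIV. - ?th' z * (1/2 * (\<rho> z * (w i z)\<^sup>2 + \<rho> z * (v i z)\<^sup>2))
        + \<nu> * (?th z * (\<Sum>j\<in>UNIV. (Tw i j z)\<^sup>2 + (Tv i j z)\<^sup>2)) + X i z)"
      unfolding X0_def by (rule sum_three)
    also have "\<dots> = (\<Sum>i\<in>UNIV. - ?th' z * (1/2 * \<rho> z * ((?a i)\<^sup>2 + (?b i)\<^sup>2)) + ?th z * (\<Sum>j\<in>UNIV. ?s i j + \<rho> z * ?q i j))"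
      by (intro sum.cong refl prod elim(1) elim(2)[rule_format] elim(3)[rule_format])
    also have "\<dots> = - ?th' z * (1/2 * \<rho> z * reldens z) + ?th z * ((\<Sum>i\<in>UNIV. \<Sum>j\<in>UNIV. ?s i j) + \<rho> z * (\<Sum>i\<in>UNIV. \<Sum>j\<in>UNIV. ?q i j))"
      unfolding reldens_def by (rule sum_two)
    finally have eq: "X0 z + (\<Sum>i\<in>UNIV. X i z) = \<dots>" .
    have s0: "0 \<le> (\<Sum>i\<in>UNIV. \<Sum>j\<in>UNIV. ?s i j)" using \<nu> by (intro sum_nonneg add_nonneg_nonneg mult_nonneg_nonneg) auto
    have "- (K / 2 * reldens z) \<le> (\<Sum>i\<in>UNIV. \<Sum>j\<in>UNIV. ?q i j)"
    proof -
      have K2: "K / 2 = (2 + 2 * k) * L * (2 * real CARD('d))" by (simp add: K_def)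
      have "\<bar>DW i j z\<bar> \<le> L" "\<bar>DV i j z\<bar> \<le> L" for i j using elim(4) by auto
      from pointwise_lower[of "\<lambda>i j. DW i j z" L "\<lambda>i j. DV i j z" k ?a ?b, OF this k]
      show ?thesis unfolding K2 reldens_def k_def .
    qed
    then have "\<rho> z * (- (K / 2 * reldens z)) \<le> \<rho> z * (\<Sum>i\<in>UNIV. \<Sum>j\<in>UNIV. ?q i j)"
      by (rule mult_left_mono) (rule elim(1))
    then have "\<rho> z * (- (K / 2 * reldens z)) \<le> (\<Sum>i\<in>UNIV. \<Sum>j\<in>UNIV. ?s i j) + \<rho> z * (\<Sum>i\<in>UNIV. \<Sum>j\<in>UNIV. ?q i j)"
      using s0 by linarith
    then have "?th z * (\<rho> z * (- (K / 2 * reldens z))) \<le> ?th z * ((\<Sum>i\<in>UNIV. \<Sum>j\<in>UNIV. ?s i j) + \<rho> z * (\<Sum>i\<in>UNIV. \<Sum>j\<in>UNIV. ?q i j))"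
      by (rule mult_left_mono) (rule \<theta>0)
    \<comment> \<open>Here \<open>K\<close> takes effect: the part \<open>K * \<theta>\<close> of
      \<open>- deriv \<theta>\<close> absorbs the quadratic terms, and \<open>\<gamma>\<close> is
      what survives.\<close>
    moreover have "- ?th' z * (1/2 * \<rho> z * reldens z) + ?th z * (\<rho> z * (- (K / 2 * reldens z))) = \<gamma> (fst z) * (1/2 * (\<rho> z * reldens z))"
      unfolding d\<theta> by (simp add: algebra_simps)
    ultimately show ?case unfolding eq by linarith
  qed
  have rd0: "0 \<le> reldens z" for z unfolding reldens_def by (intro sum_nonneg) auto
  have rdm [measurable]: "reldens \<in> borel_measurable borel" unfolding reldens_def[abs_def] by measurable
  have nn: "AE z in ST \<tau>. 0 \<le> \<gamma> (fst z) * (1/2 * (\<rho> z * reldens z))"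
    using AE_ST_mono[OF le \<rho>_nonneg] by eventually_elim (use \<gamma>0 rd0 in auto)
  have hm: "(\<lambda>z. \<gamma> (fst z) * (1/2 * (\<rho> z * reldens z))) \<in> borel_measurable borel"
    using smooth_fun_borel[OF smooth_time[OF s\<gamma>], where 'd1='d] by measurable
  have hi: "integrable (ST \<tau>) (\<lambda>z. \<gamma> (fst z) * (1/2 * (\<rho> z * reldens z)))"
  proof (rule Bochner_Integration.integrable_bound[OF tot_int])
    show "AE z in ST \<tau>. norm (\<gamma> (fst z) * (1/2 * (\<rho> z * reldens z))) \<le> norm (X0 z + (\<Sum>i\<in>UNIV. X i z))"
      using lower nn
    proof eventually_elim
      case (elim z)
      then show ?case unfolding real_norm_def by linarith
    qed
  qed (use hm in simp)
  have "(\<integral>z. \<gamma> (fst z) * (1/2 * (\<rho> z * reldens z)) \<partial>ST \<tau>) \<le> 0"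
    using integral_mono_AE[OF hi tot_int lower] tot_le by linarith
  moreover have "0 \<le> (\<integral>z. \<gamma> (fst z) * (1/2 * (\<rho> z * reldens z)) \<partial>ST \<tau>)" by (rule integral_nonneg_AE[OF nn])
  ultimately have "(\<integral>z. \<gamma> (fst z) * (1/2 * (\<rho> z * reldens z)) \<partial>ST \<tau>) = 0" by linarith
  then have "AE z in ST \<tau>. \<gamma> (fst z) * (1/2 * (\<rho> z * reldens z)) = 0"
    by (subst (asm) integral_nonneg_eq_0_iff_AE[OF hi nn])
  from AE_ST_mono[OF less_imp_le[OF \<tau>(3)] this] AE_ST_slab show ?thesis
  proof eventually_elim
    case (elim z)
    have "fst z < \<tau>0" using elim(2) by auto
    then have "\<gamma> (fst z) > 0" unfolding \<gamma>_def by (intro mult_pos_pos flat_exp_pos) auto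
    then show ?case using elim(1) by auto
  qed
qed

lemma relative_energy_zero: "AE z in ST T. \<rho> z = 0 \<or> (\<forall>i. w i z = W i z \<and> v i z = V i z)"
proof -
  have "AE z in ST T. \<rho> z * reldens z = 0"
    by (rule AE_ST_exhaust[OF T relative_energy_zero_before])
  then show ?thesis
  proof eventually_elim
    case (elim z)
    show ?case
    proof (cases "\<rho> z = 0")
      case False
      then have "(\<Sum>i\<in>UNIV. (w i z - W i z)\<^sup>2 + (v i z - V i z)\<^sup>2) = 0" using elim by (simp add: reldens_def)
      then have "\<forall>i\<in>UNIV. (w i z - W i z)\<^sup>2 + (v i z - V i z)\<^sup>2 = 0"
        by (subst (asm) sum_nonneg_eq_0_iff) auto
      then show ?thesis by (simp add: sum_power2_eq_zero_iff)
    qed simp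
  qed
qed

section \<open>Equality of the densities\<close>

definition ratio :: "real \<times> (real^'d) \<Rightarrow> real" where
  "ratio z = \<rho> z * inverse (max m (r z))"

lemma ratio_int: "integrable (ST T) ratio"
  unfolding ratio_def[abs_def]
proof (rule integrable_mult_bounded[OF \<rho>_int])
  show "AE z in ST T. \<bar>inverse (max m (r z))\<bar> \<le> inverse m"
    using m by (intro AE_I2) (auto intro!: le_imp_inverse_le)
qed simp

text \<open>The identity for the gradient of \<open>\<rho>\<close> is tested with
  \<open>\<phi>\<close> divided by \<open>r\<close>. Since \<open>\<rho> v = \<rho> V\<close>, the
  term with \<open>\<phi>\<close> cancels against the derivative of \<open>1 / r\<close>, and only
  the ratio times the derivative of \<open>\<phi>\<close> remains. Vacuum does no harm, as both
  sides of \<open>\<rho> v = \<rho> V\<close> vanish there.\<close>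

lemma ratio_gradient: "uwdx T ratio j (\<lambda>_. 0)"
  unfolding uwdx_def
proof (intro allI impI)
  fix \<phi> :: "real \<times> (real^'d) \<Rightarrow> real" assume \<phi>: "uitest T \<phi>"
  then have sm: "smooth_fun \<phi>" and pe: "per \<phi>" by (auto simp: uitest_def utest_def)
  obtain a0 where a0: "a0 < T" "\<And>z. a0 \<le> fst z \<Longrightarrow> \<phi> z = 0" using \<phi> by (auto simp: uitest_def utest_def)
  \<comment> \<open>From \<open>a\<close> on the test function is zero, between \<open>a\<close> and
    \<open>b\<close> the time cutoff falls from 1 to 0, and \<open>\<tau>\<close> lies between
    \<open>b\<close> and \<open>T\<close>. The maximum with \<open>T / 2\<close> makes
    \<open>a\<close> positive.\<close>
  define a where "a = max a0 (T / 2)"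
  define b where "b = (a + T) / 2"
  define \<tau> where "\<tau> = (b + T) / 2"
  have aT: "a < T" "0 < a" using a0(1) T by (auto simp: a_def)
  have ab: "a < b" "b < \<tau>" "\<tau> < T" "0 < \<tau>" using aT by (simp_all add: b_def \<tau>_def field_simps add_pos_pos)
  have pz: "pd (ex j) \<phi> z = 0" if "a \<le> fst z" for z
    using a0(2) that by (auto simp: pd_def a_def)
  \<comment> \<open>The affine change of time sends \<open>a\<close> to 1 and \<open>b\<close> to 2,
    the points where \<open>step\<close> starts and stops to decrease.\<close>
  define \<theta> where "\<theta> = (\<lambda>t. step (1 + inverse (b - a) * (t - a)))"
  have "smooth_fun \<theta>" unfolding \<theta>_def
    by (intro smooth_fun_compose[OF step_props(1)] smooth_fun_add smooth_fun_mult smooth_fun_diff smooth_fun_const smooth_fun_id)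
  moreover have "\<theta> t = 0" if "b \<le> t" for t
    unfolding \<theta>_def using ab that by (intro step_props(5)) (simp add: field_simps)
  ultimately have \<theta>: "cutoff \<tau> \<theta>" using ab(2) by (auto simp: cutoff_def)
  have \<theta>1: "\<theta> t = 1" if "t \<le> a" for t
    unfolding \<theta>_def using ab that by (intro step_props(3)) (simp add: mult_nonneg_nonpos)
  have G: "bdd T (\<lambda>z. r z * V j z / c)" for j
  proof -
    obtain R where R: "0 \<le> R" "AE z in ST T. \<bar>r z\<bar> \<le> R" using bdd_obtain[OF bdd_r] by blast
    obtain Q where Q: "0 \<le> Q" "AE z in ST T. \<bar>V j z\<bar> \<le> Q" using bdd_obtain[OF bdds(2)] by blast
    have "AE z in ST T. \<bar>r z * V j z / c\<bar> \<le> R * Q / c"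
      using R(2) Q(2)
    proof eventually_elim
      case (elim z)
      then have "\<bar>r z\<bar> * \<bar>V j z\<bar> \<le> R * Q" using R(1) by (intro mult_mono) auto
      then show ?case using c by (simp add: abs_mult abs_divide divide_right_mono)
    qed
    moreover have "(\<lambda>z. r z * V j z / c) \<in> borel_measurable borel" by measurable
    ultimately show ?thesis unfolding bdd_def by (intro conjI exI[of _ "R * Q / c"])
  qed
  note sapx_mult[OF sapx_inverse_moll[OF bdd_r r_ge m G ab(4,3) dx_r] sapx_smooth[OF sm pe]]
  from weak_sapx[OF grad_\<rho> ints(6) integrable_mult_right[OF \<rho>_int] this \<theta> ab(3), of j]
  have "(\<integral>z. \<rho> z * v j z * (\<theta> (fst z) * (inverse (max m (r z)) * \<phi> z)) + c * \<rho> z * (\<theta> (fst z) *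
      (- (r z * V j z / c) * (inverse (max m (r z)) * inverse (max m (r z))) * \<phi> z + inverse (max m (r z)) * pd (ex j) \<phi> z)) \<partial>ST \<tau>) = 0"
    (is "(\<integral>z. ?h z \<partial>ST \<tau>) = 0")
    by (simp only: has_bochner_integral_iff)
  moreover have "AE z in ST \<tau>. ?h z = c * (ratio z * pd (ex j) \<phi> z)"
    using AE_ST_mono[OF less_imp_le[OF ab(3)] relative_energy_zero] AE_ST_mono[OF less_imp_le[OF ab(3)] r_ge]
  proof eventually_elim
    case (elim z)
    define i where "i = inverse (max m (r z))"
    have ri: "r z * i = 1" using elim(2) m by (simp add: i_def max_absorb2)
    \<comment> \<open>The cutoff can differ from 1 only after \<open>a\<close>, where the derivative
      of \<open>\<phi>\<close> is zero.\<close>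
    have th: "\<theta> (fst z) * pd (ex j) \<phi> z = pd (ex j) \<phi> z" using \<theta>1 pz by (cases "fst z \<le> a") auto
    have "\<rho> z * v j z = \<rho> z * V j z" using elim(1) by auto
    then have "?h z = \<rho> z * V j z * (\<theta> (fst z) * (i * \<phi> z)) + c * \<rho> z * (\<theta> (fst z) *
      (- (r z * V j z / c) * (i * i) * \<phi> z + i * pd (ex j) \<phi> z))" by (simp only: i_def)
    also have "\<dots> = \<rho> z * V j z * \<theta> (fst z) * i * \<phi> z * (1 - r z * i) + c * (\<rho> z * i * (\<theta> (fst z) * pd (ex j) \<phi> z))"
      using c by (simp add: field_simps)
    also have "\<dots> = c * (ratio z * pd (ex j) \<phi> z)" unfolding ri th by (simp add: ratio_def i_def)
    finally show ?case .
  qed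
  moreover have meas_pd: "pd (ex j) \<phi> \<in> borel_measurable borel" "\<phi> \<in> borel_measurable borel"
      "(\<lambda>z::real \<times> (real^'d). \<theta> (fst z)) \<in> borel_measurable borel"
    using smooth_fun_borel[OF smooth_fun_pd[OF sm ex_Basis]] smooth_fun_borel[OF sm] smooth_fun_borel[OF smooth_time[OF \<open>smooth_fun \<theta>\<close>]] by auto
  have rb: "ratio \<in> borel_measurable borel" unfolding ratio_def[abs_def] by measurable
  have "(\<integral>z. ?h z \<partial>ST \<tau>) = (\<integral>z. c * (ratio z * pd (ex j) \<phi> z) \<partial>ST \<tau>)"
  proof (rule integral_cong_AE)
    note [measurable] = meas_pd rb
    show "?h \<in> borel_measurable (ST \<tau>)" unfolding borel_measurable_ST_iff by measurable
    show "(\<lambda>z. c * (ratio z * pd (ex j) \<phi> z)) \<in> borel_measurable (ST \<tau>)" unfolding borel_measurable_ST_iff by measurable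
  qed (rule calculation(2))
  then have "(\<integral>z. c * (ratio z * pd (ex j) \<phi> z) \<partial>ST \<tau>) = 0" using calculation(1) by simp
  then have "(\<integral>z. ratio z * pd (ex j) \<phi> z \<partial>ST \<tau>) = 0" using c by simp
  moreover have "(\<integral>z. ratio z * pd (ex j) \<phi> z \<partial>ST T) = (\<integral>z. ratio z * pd (ex j) \<phi> z \<partial>ST \<tau>)"
    by (rule ST_restrict) (use meas_pd rb pz ab in auto)
  ultimately show "(\<integral>z. ratio z * pd (ex j) \<phi> z \<partial>ST T) = - (\<integral>z. 0 * \<phi> z \<partial>ST T)" by simp
qed

text \<open>Once the ratio is 1, the density equals the positive \<open>r\<close>, which rules out
  the vacuum alternative of \<open>relative_energy_zero\<close> almost everywhere.\<close>

theorem weak_strong_uniqueness: "AE z in ST T. \<rho> z = r z \<and> (\<forall>i. w i z = W i z \<and> v i z = V i z)"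
proof -
  have pos: "AE z in ST T. 0 < r z" using r_ge m by (auto elim: eventually_mono)
  have \<rho>q: "AE z in ST T. \<rho> z = ratio z * r z"
    using r_ge by eventually_elim (use m in \<open>simp add: ratio_def max_absorb2\<close>)
  have "AE z in ST T. ratio z = 1"
  proof (rule AE_ST_exhaust[OF T])
    fix \<tau>0 assume t: "0 < \<tau>0" "\<tau>0 < T"
    show "AE z in ST \<tau>0. ratio z = 1"
      by (rule density_ratio_one[OF ratio_int bdd_integrable[OF bdd_r] \<rho>_int pos \<rho>q ratio_gradient
            mass_conserved[OF cont cont_r] t(1), where \<tau>="(\<tau>0 + T) / 2"]) (use t in auto)
  qed
  with \<rho>q pos relative_energy_zero show ?thesis by eventually_elim auto
qed

end

subsection \<open>Passing to components\<close>

lemma pdx_eq: "pdx j (\<lambda>t x. \<phi> (t, x)) t x = pd (ex j) \<phi> (t, x)"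
  by (simp add: pdx_def pd_def)

lemma pdt_eq: "pdt (\<lambda>t x. \<phi> (t, x)) t x = pd et \<phi> (t, x)"
  using pd_real[of "\<lambda>s. \<phi> (s, x)" t] by (simp add: pdt_def pd_def)

lemma test_funI: "utest T \<phi> \<Longrightarrow> test_fun T (\<lambda>t x. \<phi> (t, x))"
  unfolding utest_def test_fun_def periodic_sp_def per_def lattice_pt_def by auto

lemma itest_funI:
  assumes "uitest T \<phi>" shows "itest_fun T (\<lambda>t x. \<phi> (t, x))"
proof -
  obtain \<tau> where "0 < \<tau>" "\<And>z. fst z \<le> \<tau> \<Longrightarrow> \<phi> z = 0" using assms by (auto simp: uitest_def)
  then show ?thesis using assms test_funI[of T \<phi>] unfolding itest_fun_def uitest_def
    by (intro conjI exI[of _ \<tau>]) auto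
qed

lemma STint_pair:
  "f \<in> borel_measurable borel \<Longrightarrow> STint T (\<lambda>t x. f (t, x)) = (\<integral>z. f z \<partial>ST T)"
  by (subst STint_eq) simp_all

lemma STint_pairI:
  assumes "f \<in> borel_measurable borel" "\<And>t x. h t x = f (t, x)"
  shows "STint T h = (\<integral>z. f z \<partial>ST T)"
  using STint_pair[OF assms(1), of T] by (simp add: assms(2)[symmetric])

lemma slice_borel:
  fixes f :: "real \<times> (real^'d) \<Rightarrow> real"
  assumes "f \<in> borel_measurable borel" shows "(\<lambda>x. f (t, x)) \<in> borel_measurable borel"
  using assms by (rule measurable_compose[rotated]) (simp flip: borel_prod)

lemma st_ae_eq: "st_ae T P \<longleftrightarrow> (AE z in ST T. P (fst z) (snd z))"
  by (simp add: st_ae_def AE_ST)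

lemma utest_borel:
  assumes "utest T \<phi>"
  shows "\<phi> \<in> borel_measurable borel" "pd et \<phi> \<in> borel_measurable borel" "pd (ex j) \<phi> \<in> borel_measurable borel"
    "(\<lambda>x. \<phi> (t, x)) \<in> borel_measurable borel"
proof -
  have sm: "smooth_fun \<phi>" using assms by (simp add: utest_def)
  show b: "\<phi> \<in> borel_measurable borel" "pd et \<phi> \<in> borel_measurable borel" "pd (ex j) \<phi> \<in> borel_measurable borel"
    by (intro smooth_fun_borel smooth_fun_pd sm et_Basis ex_Basis)+
  show "(\<lambda>x. \<phi> (t, x)) \<in> borel_measurable borel"
    using b(1) by (rule measurable_compose[rotated]) (simp flip: borel_prod)
qed

lemma wdx_uwdx:
  assumes w: "wdx T (\<lambda>t x. f (t, x)) j (\<lambda>t x. g (t, x))"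
    and [measurable]: "f \<in> borel_measurable borel" "g \<in> borel_measurable borel"
  shows "uwdx T f j g"
  unfolding uwdx_def
proof (intro allI impI)
  fix \<phi> :: "real \<times> (real^'a) \<Rightarrow> real" assume \<phi>: "uitest T \<phi>"
  then have ut: "utest T \<phi>" by (simp add: uitest_def)
  note [measurable] = utest_borel[OF ut]
  have "STint T (\<lambda>t x. (\<lambda>z. f z * pd (ex j) \<phi> z) (t, x)) = - STint T (\<lambda>t x. (\<lambda>z. g z * \<phi> z) (t, x))"
    using w[unfolded wdx_def, rule_format, OF itest_funI[OF \<phi>]] by (simp add: pdx_eq)
  then show "(\<integral>z. f z * pd (ex j) \<phi> z \<partial>ST T) = - (\<integral>z. g z * \<phi> z \<partial>ST T)"
    by (subst (asm) (1 2) STint_pair) measurable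
qed

lemma wdt_uwdt:
  assumes w: "wdt T (\<lambda>t x. f (t, x)) (\<lambda>t x. g (t, x)) f0"
    and [measurable]: "f \<in> borel_measurable borel" "g \<in> borel_measurable borel" "f0 \<in> borel_measurable borel"
  shows "uwdt T f g f0"
  unfolding uwdt_def
proof (intro allI impI)
  fix \<phi> :: "real \<times> (real^'a) \<Rightarrow> real" assume ut: "utest T \<phi>"
  note [measurable] = utest_borel[OF ut]
  have "STint T (\<lambda>t x. (\<lambda>z. f z * pd et \<phi> z + g z * \<phi> z) (t, x)) + Sint (\<lambda>x. f0 x * \<phi> (0, x)) = 0"
    using w[unfolded wdt_def, rule_format, OF test_funI[OF ut]] by (simp add: pdt_eq)
  moreover have "STint T (\<lambda>t x. (\<lambda>z. f z * pd et \<phi> z + g z * \<phi> z) (t, x)) = (\<integral>z. f z * pd et \<phi> z + g z * \<phi> z \<partial>ST T)"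
    by (rule STint_pair) measurable
  moreover have "Sint (\<lambda>x. f0 x * \<phi> (0, x)) = (\<integral>x. f0 x * \<phi> (0, x) \<partial>cm)"
    by (rule Sint_eq) measurable
  ultimately show "(\<integral>z. f z * pd et \<phi> z + g z * \<phi> z \<partial>ST T) + (\<integral>x. f0 x * \<phi> (0, x) \<partial>cm) = 0"
    by (simp only:)
qed

lemma vec_nth_borel:
  fixes f :: "'a \<Rightarrow> 'b::topological_space^'n"
  assumes "f \<in> borel_measurable M" shows "(\<lambda>z. f z $ i) \<in> borel_measurable M"
proof -
  have "(\<lambda>v::'b^'n. v $ i) \<in> borel_measurable borel"
    by (intro borel_measurable_continuous_onI continuous_intros)
  from measurable_compose[OF assms this] show ?thesis .
qed

lemma st_meas_borel: "st_meas f \<Longrightarrow> (\<lambda>z. f (fst z) (snd z)) \<in> borel_measurable borel"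
  by (simp add: st_meas_def)

lemma bdd_component:
  assumes f: "st_bdd T f" and g: "g \<in> borel_measurable borel" and le: "\<And>z. \<bar>g z\<bar> \<le> norm (f (fst z) (snd z))"
  shows "bdd T g"
proof -
  obtain C where "AE z in ST T. norm (f (fst z) (snd z)) \<le> C" using f by (auto simp: st_bdd_def st_ae_eq)
  then have "AE z in ST T. \<bar>g z\<bar> \<le> C" by eventually_elim (use le order_trans in blast)
  then show ?thesis using g by (auto simp: bdd_def)
qed

lemma abs_nth2_le: "\<bar>(x :: real^'n^'m) $ i $ j\<bar> \<le> norm x"
  using order_trans[OF Finite_Cartesian_Product.norm_nth_le[of "x $ i" j] Finite_Cartesian_Product.norm_nth_le[of x i]] by simp

lemma abs_nth3_le: "\<bar>(x :: real^'n^'m^'l) $ i $ j $ k\<bar> \<le> norm x"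
  using order_trans[OF abs_nth2_le[of "x $ i" j k] Finite_Cartesian_Product.norm_nth_le[of x i]] by simp

lemma norm2_vec: "(norm (x :: real^'n))\<^sup>2 = (\<Sum>i\<in>UNIV. (x $ i)\<^sup>2)"
  unfolding power2_norm_eq_inner by (simp add: inner_vec_def power2_eq_square)

lemma norm2_mat: "(norm (x :: real^'n^'m))\<^sup>2 = (\<Sum>i\<in>UNIV. \<Sum>j\<in>UNIV. (x $ i $ j)\<^sup>2)"
  unfolding power2_norm_eq_inner by (simp add: inner_vec_def power2_eq_square)

lemma integrable_component:
  fixes a g :: "'a \<Rightarrow> real" and f :: "'a \<Rightarrow> 'b::real_normed_vector"
  assumes i: "integrable M (\<lambda>z. a z * (norm (f z))\<^sup>2)" and [measurable]: "a \<in> borel_measurable M" "g \<in> borel_measurable M"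
    and le: "\<And>z. \<bar>g z\<bar> \<le> norm (f z)"
  shows "integrable M (\<lambda>z. a z * (g z)\<^sup>2)"
proof (rule Bochner_Integration.integrable_bound[OF i])
  show "AE z in M. norm (a z * (g z)\<^sup>2) \<le> norm (a z * (norm (f z))\<^sup>2)"
  proof (rule AE_I2)
    fix z
    have "\<bar>g z\<bar>\<^sup>2 \<le> (norm (f z))\<^sup>2" using le[of z] by (rule power_mono) simp
    then have "\<bar>a z\<bar> * (g z)\<^sup>2 \<le> \<bar>a z\<bar> * (norm (f z))\<^sup>2" by (intro mult_left_mono) simp_all
    then show "norm (a z * (g z)\<^sup>2) \<le> norm (a z * (norm (f z))\<^sup>2)"
      by (simp only: real_norm_def abs_mult abs_power2)
  qed
qed measurable

text \<open>One form covers both strong equations, with \<open>p\<close> equal to \<open>- c\<close>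
  for W and \<open>c\<close> for the other velocity. After substitution of the gradient of
  \<open>r\<close> the factor \<open>r\<close> is common to all terms and cancels.\<close>

lemma strong_eq_divide:
  fixes r d c \<nu> p :: real and A U V P P2 Q Q2 G :: "'d::finite \<Rightarrow> real"
  assumes r: "0 < r" and c: "0 < c" and G: "\<And>j. G j = r * V j / c"
    and eq: "r * (d + (\<Sum>j\<in>UNIV. P j * U j)) - \<nu> * (\<Sum>j\<in>UNIV. G j * A j + r * P2 j) + p * (\<Sum>j\<in>UNIV. G j * Q j + r * Q2 j) = 0"
  shows "d = (\<Sum>j\<in>UNIV. - (P j * U j) + \<nu> * (V j / c * A j + P2 j) - p * (V j / c * Q j + Q2 j))"
proof -
  have s: "(\<Sum>j\<in>UNIV. G j * B j + r * B2 j) = r * (\<Sum>j\<in>UNIV. V j / c * B j + B2 j)" for B B2 :: "'d \<Rightarrow> real"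
    by (simp add: G sum_distrib_left distrib_left mult.assoc)
  have "r * (d + (\<Sum>j\<in>UNIV. P j * U j) - \<nu> * (\<Sum>j\<in>UNIV. V j / c * A j + P2 j) + p * (\<Sum>j\<in>UNIV. V j / c * Q j + Q2 j)) = 0"
    using eq unfolding s by (simp add: algebra_simps)
  then have "d = - (\<Sum>j\<in>UNIV. P j * U j) + \<nu> * (\<Sum>j\<in>UNIV. V j / c * A j + P2 j) - p * (\<Sum>j\<in>UNIV. V j / c * Q j + Q2 j)"
    using r by simp
  then show ?thesis
    by (simp only: sum_distrib_left sum_negf[symmetric] sum.distrib[symmetric] sum_subtractf[symmetric])
qed

theorem theorem3p4:
  fixes T \<nu> \<kappa> :: real
    and \<rho>0 :: "real^'d \<Rightarrow> real" and w0 vb0 :: "real^'d \<Rightarrow> real^'d"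
    and \<rho> r :: "real \<Rightarrow> real^'d \<Rightarrow> real"
    and u vb U :: "real \<Rightarrow> real^'d \<Rightarrow> real^'d"
    and Tw Tv :: "real \<Rightarrow> real^'d \<Rightarrow> real^'d^'d"
  assumes dim: "CARD('d) = 2 \<or> CARD('d) = 3"
    and nu_pos: "0 < \<nu>" and kappa_gt: "\<nu> < \<kappa>" and T_pos: "0 < T"
    and data_meas: "\<rho>0 \<in> borel_measurable lborel" "w0 \<in> borel_measurable lborel"
                   "vb0 \<in> borel_measurable lborel"
    and data_int: "set_integrable lborel cell \<rho>0"
                  "set_integrable lborel cell (\<lambda>x. \<rho>0 x * (norm (w0 x))\<^sup>2)"
                  "set_integrable lborel cell (\<lambda>x. \<rho>0 x * (norm (vb0 x))\<^sup>2)"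
    and weak: "weak_sol T \<nu> \<kappa> \<rho>0 w0 vb0 \<rho> u vb Tw Tv"
    and strong: "strong_sol T \<nu> \<kappa> \<rho>0 w0 vb0 r U"
  shows "st_ae T (\<lambda>t x. \<rho> t x = r t x \<and> u t x = U t x)"
proof -

  \<comment> \<open>The two solution concepts unfolded into components\<close>
  define c where "c = sqrt (\<kappa>\<^sup>2 - \<nu>\<^sup>2)"
  have c: "0 < c"
    using nu_pos kappa_gt by (simp add: c_def power_strict_mono)
  define w where "w = (\<lambda>t x. u t x + (\<nu> / c) *\<^sub>R vb t x)"
  have w_eq: "u t x + (\<nu> / c) *\<^sub>R vb t x = w t x" for t x by (simp add: w_def)
  note weak' = weak[unfolded weak_sol_def Let_def c_def[symmetric] w_eq]
  have wk_meas: "st_meas \<rho>" "st_meas u" "st_meas vb" "st_meas Tw" "st_meas Tv"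
    and wk_nn: "st_ae T (\<lambda>t x. 0 \<le> \<rho> t x)"
    and wk_int: "STintegrable T \<rho>" "STintegrable T (\<lambda>t x. \<rho> t x * (norm (w t x))\<^sup>2)"
      "STintegrable T (\<lambda>t x. \<rho> t x * (norm (vb t x))\<^sup>2)"
      "STintegrable T (\<lambda>t x. (norm (Tw t x))\<^sup>2)" "STintegrable T (\<lambda>t x. (norm (Tv t x))\<^sup>2)"
    and wk_\<rho>: "\<forall>\<phi> j. itest_fun T \<phi> \<longrightarrow>
        STint T (\<lambda>t x. \<rho> t x * vb t x $ j * \<phi> t x) = - c * STint T (\<lambda>t x. \<rho> t x * pdx j \<phi> t x)"
    and wk_Tw: "\<forall>\<phi> i j. itest_fun T \<phi> \<longrightarrow>
        STint T (\<lambda>t x. sqrt (\<rho> t x) * Tw t x $ i $ j * \<phi> t x)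
          = - STint T (\<lambda>t x. \<rho> t x * w t x $ i * pdx j \<phi> t x)
            - (1 / c) * STint T (\<lambda>t x. \<rho> t x * w t x $ i * vb t x $ j * \<phi> t x)"
    and wk_Tv: "\<forall>\<phi> i j. itest_fun T \<phi> \<longrightarrow>
        STint T (\<lambda>t x. sqrt (\<rho> t x) * Tv t x $ i $ j * \<phi> t x)
          = - STint T (\<lambda>t x. \<rho> t x * vb t x $ i * pdx j \<phi> t x)
            - (1 / c) * STint T (\<lambda>t x. \<rho> t x * vb t x $ i * vb t x $ j * \<phi> t x)"
    and wk_cont: "\<forall>\<phi>. test_fun T \<phi> \<longrightarrow>
        STint T (\<lambda>t x. \<rho> t x * pdt \<phi> t x + \<rho> t x * (\<Sum>j\<in>UNIV. u t x $ j * pdx j \<phi> t x))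
          + Sint (\<lambda>x. \<rho>0 x * \<phi> 0 x) = 0"
    and wk_w: "\<forall>\<phi> i. test_fun T \<phi> \<longrightarrow>
        STint T (\<lambda>t x. \<rho> t x * w t x $ i * pdt \<phi> t x
            + (\<Sum>j\<in>UNIV. \<rho> t x * w t x $ i * u t x $ j * pdx j \<phi> t x)
            - \<nu> * (\<Sum>j\<in>UNIV. sqrt (\<rho> t x) * Tw t x $ i $ j * pdx j \<phi> t x)
            - c * (\<Sum>j\<in>UNIV. sqrt (\<rho> t x) * Tv t x $ i $ j * pdx j \<phi> t x))
          + Sint (\<lambda>x. \<rho>0 x * w0 x $ i * \<phi> 0 x) = 0"
    and wk_v: "\<forall>\<phi> i. test_fun T \<phi> \<longrightarrow>
        STint T (\<lambda>t x. \<rho> t x * vb t x $ i * pdt \<phi> t x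
            + (\<Sum>j\<in>UNIV. \<rho> t x * vb t x $ i * u t x $ j * pdx j \<phi> t x)
            - \<nu> * (\<Sum>j\<in>UNIV. sqrt (\<rho> t x) * Tv t x $ i $ j * pdx j \<phi> t x)
            + c * (\<Sum>j\<in>UNIV. sqrt (\<rho> t x) * Tw t x $ i $ j * pdx j \<phi> t x))
          + Sint (\<lambda>x. \<rho>0 x * vb0 x $ i * \<phi> 0 x) = 0"
    and wk_en: "AE t in lborel. t \<in> {0<..<T} \<longrightarrow>
        (1/2) * Sint (\<lambda>x. \<rho> t x * ((norm (w t x))\<^sup>2 + (norm (vb t x))\<^sup>2))
        + \<nu> * STint t (\<lambda>s x. (norm (Tw s x))\<^sup>2 + (norm (Tv s x))\<^sup>2)
        \<le> (1/2) * Sint (\<lambda>x. \<rho>0 x * ((norm (w0 x))\<^sup>2 + (norm (vb0 x))\<^sup>2))"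
    by (insert weak', (elim conjE, assumption)+)
  note strong' = strong[unfolded strong_sol_def Let_def c_def[symmetric]]
  have st_r: "st_meas r" "st_meas U" and exm: "\<exists>m M. 0 < m \<and> st_ae T (\<lambda>t x. m \<le> r t x \<and> r t x \<le> M)"
    by (insert strong', (elim conjE, assumption)+)
  obtain m M where m: "0 < m" and rM: "st_ae T (\<lambda>t x. m \<le> r t x \<and> r t x \<le> M)"
    using exm by (elim exE conjE)
  from strong'[THEN conjunct2, THEN conjunct2, THEN conjunct2]
  obtain G :: "real \<Rightarrow> real^'d \<Rightarrow> real^'d" and W Vb :: "real \<Rightarrow> real^'d \<Rightarrow> real^'d" and DW DVb :: "real \<Rightarrow> real^'d \<Rightarrow> real^'d^'d"
      and D2W D2Vb :: "real \<Rightarrow> real^'d \<Rightarrow> real^'d^'d^'d" and DtW DtVb :: "real \<Rightarrow> real^'d \<Rightarrow> real^'d"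
    where G: "st_meas G" "\<forall>j. wdx T r j (\<lambda>t x. G t x $ j)"
      and B: "st_bdd T W" "st_bdd T Vb" "st_bdd T DW" "st_bdd T DVb" "st_bdd T D2W" "st_bdd T D2Vb" "st_bdd T DtW" "st_bdd T DtVb"
      and dW: "\<forall>i j. wdx T (\<lambda>t x. W t x $ i) j (\<lambda>t x. DW t x $ i $ j)"
      and dV: "\<forall>i j. wdx T (\<lambda>t x. Vb t x $ i) j (\<lambda>t x. DVb t x $ i $ j)"
      and d2W: "\<forall>i j k. wdx T (\<lambda>t x. DW t x $ i $ j) k (\<lambda>t x. D2W t x $ i $ j $ k)"
      and d2V: "\<forall>i j k. wdx T (\<lambda>t x. DVb t x $ i $ j) k (\<lambda>t x. D2Vb t x $ i $ j $ k)"
      and tW: "\<forall>i. wdt T (\<lambda>t x. W t x $ i) (\<lambda>t x. DtW t x $ i) (\<lambda>x. w0 x $ i)"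
      and tV: "\<forall>i. wdt T (\<lambda>t x. Vb t x $ i) (\<lambda>t x. DtVb t x $ i) (\<lambda>x. vb0 x $ i)"
      and VU: "st_ae T (\<lambda>t x. Vb t x = (c / r t x) *\<^sub>R G t x \<and> U t x = W t x - (\<nu> / c) *\<^sub>R Vb t x)"
      and s_cont: "\<forall>\<phi>. test_fun T \<phi> \<longrightarrow>
            STint T (\<lambda>t x. r t x * pdt \<phi> t x + r t x * (\<Sum>j\<in>UNIV. U t x $ j * pdx j \<phi> t x))
              + Sint (\<lambda>x. \<rho>0 x * \<phi> 0 x) = 0"
      and s_W: "st_ae T (\<lambda>t x. \<forall>i.
            r t x * (DtW t x $ i + (\<Sum>j\<in>UNIV. DW t x $ i $ j * U t x $ j))
            - \<nu> * (\<Sum>j\<in>UNIV. G t x $ j * DW t x $ i $ j + r t x * D2W t x $ i $ j $ j)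
            - c * (\<Sum>j\<in>UNIV. G t x $ j * DVb t x $ i $ j + r t x * D2Vb t x $ i $ j $ j) = 0)"
      and s_V: "st_ae T (\<lambda>t x. \<forall>i.
            r t x * (DtVb t x $ i + (\<Sum>j\<in>UNIV. DVb t x $ i $ j * U t x $ j))
            - \<nu> * (\<Sum>j\<in>UNIV. G t x $ j * DVb t x $ i $ j + r t x * D2Vb t x $ i $ j $ j)
            + c * (\<Sum>j\<in>UNIV. G t x $ j * DW t x $ i $ j + r t x * D2W t x $ i $ j $ j) = 0)"
    by (elim exE conjE) (rule that; assumption)
  define \<rho>' r' where "\<rho>' = (\<lambda>z. \<rho> (fst z) (snd z))" and "r' = (\<lambda>z. r (fst z) (snd z))"
  define w' v' W' V' DtW' DtV' G' U' u' where "w' = (\<lambda>i z. w (fst z) (snd z) $ i)" and "v' = (\<lambda>i z. vb (fst z) (snd z) $ i)"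
    and "W' = (\<lambda>i z. W (fst z) (snd z) $ i)" and "V' = (\<lambda>i z. Vb (fst z) (snd z) $ i)"
    and "DtW' = (\<lambda>i z. DtW (fst z) (snd z) $ i)" and "DtV' = (\<lambda>i z. DtVb (fst z) (snd z) $ i)"
    and "G' = (\<lambda>i z. G (fst z) (snd z) $ i)" and "U' = (\<lambda>i z. U (fst z) (snd z) $ i)" and "u' = (\<lambda>i z. u (fst z) (snd z) $ i)"
  define Tw' Tv' DW' DV' where "Tw' = (\<lambda>i j z. Tw (fst z) (snd z) $ i $ j)" and "Tv' = (\<lambda>i j z. Tv (fst z) (snd z) $ i $ j)"
    and "DW' = (\<lambda>i j z. DW (fst z) (snd z) $ i $ j)" and "DV' = (\<lambda>i j z. DVb (fst z) (snd z) $ i $ j)"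
  define D2W' D2V' where "D2W' = (\<lambda>i j k z. D2W (fst z) (snd z) $ i $ j $ k)" and "D2V' = (\<lambda>i j k z. D2Vb (fst z) (snd z) $ i $ j $ k)"
  note defs = \<rho>'_def r'_def w'_def v'_def W'_def V'_def DtW'_def DtV'_def G'_def U'_def u'_def Tw'_def Tv'_def DW'_def DV'_def D2W'_def D2V'_def
  have st: "st_meas W" "st_meas Vb" "st_meas DW" "st_meas DVb" "st_meas D2W" "st_meas D2Vb" "st_meas DtW" "st_meas DtVb"
    using B by (auto simp: st_bdd_def)
  have wu: "w' i z = u' i z + \<nu> / c * v' i z" for i z by (simp add: defs w_def)
  have uw: "u' i z = w' i z - \<nu> / c * v' i z" for i z by (simp add: wu)
  have bm [measurable]: "\<rho>' \<in> borel_measurable borel" "r' \<in> borel_measurable borel"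
    "\<And>i. u' i \<in> borel_measurable borel" "\<And>i. v' i \<in> borel_measurable borel"
    "\<And>i. W' i \<in> borel_measurable borel" "\<And>i. V' i \<in> borel_measurable borel" "\<And>i. DtW' i \<in> borel_measurable borel"
    "\<And>i. DtV' i \<in> borel_measurable borel" "\<And>i. G' i \<in> borel_measurable borel" "\<And>i. U' i \<in> borel_measurable borel"
    "\<And>i j. Tw' i j \<in> borel_measurable borel" "\<And>i j. Tv' i j \<in> borel_measurable borel"
    "\<And>i j. DW' i j \<in> borel_measurable borel" "\<And>i j. DV' i j \<in> borel_measurable borel"
    "\<And>i j k. D2W' i j k \<in> borel_measurable borel" "\<And>i j k. D2V' i j k \<in> borel_measurable borel"
    unfolding defs by (intro vec_nth_borel st_meas_borel wk_meas st_r G st)+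
  have wm [measurable]: "w' i \<in> borel_measurable borel" for i
  proof -
    have "w' i = (\<lambda>z. u' i z + \<nu> / c * v' i z)" by (rule ext) (rule wu)
    then show ?thesis by simp
  qed
  have dm [measurable]: "\<rho>0 \<in> borel_measurable borel" "\<And>i. (\<lambda>x. w0 x $ i) \<in> borel_measurable borel" "\<And>i. (\<lambda>x. vb0 x $ i) \<in> borel_measurable borel"
    using data_meas by (auto intro!: vec_nth_borel)
  have r_pos: "AE z in ST T. m \<le> r' z" using rM unfolding st_ae_eq r'_def by eventually_elim simp
  \<comment> \<open>The definition of the strong solution gives \<open>Vb\<close> in terms of the
    gradient \<open>G\<close>; it is solved for \<open>G\<close> here, with the lower bound of
    \<open>r\<close> ensuring that the division is genuine.\<close>
  have VU': "AE z in ST T. \<forall>j. G' j z = r' z * V' j z / c \<and> U' j z = W' j z - \<nu> / c * V' j z"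
    using r_pos VU unfolding st_ae_eq
  proof eventually_elim
    case (elim z)
    then have "r (fst z) (snd z) \<noteq> 0" using m by (auto simp: r'_def)
    then show ?case using elim(2) c by (simp add: defs)
  qed
  have nonneg: "AE z in ST T. 0 \<le> \<rho>' z" using wk_nn by (simp add: st_ae_eq \<rho>'_def)

  \<comment> \<open>Integrability of the components\<close>
  have \<rho>_int: "integrable (ST T) \<rho>'"
    using wk_int(1) STintegrable_eq[of \<rho> T] by (simp add: \<rho>'_def[symmetric])
  have w_meas: "(\<lambda>z. w (fst z) (snd z)) \<in> borel_measurable borel"
    unfolding w_def using st_meas_borel[OF wk_meas(2)] st_meas_borel[OF wk_meas(3)] by simp
  have nm: "(\<lambda>z. norm (w (fst z) (snd z))) \<in> borel_measurable borel" "(\<lambda>z. norm (vb (fst z) (snd z))) \<in> borel_measurable borel"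
    "(\<lambda>z. norm (Tw (fst z) (snd z))) \<in> borel_measurable borel" "(\<lambda>z. norm (Tv (fst z) (snd z))) \<in> borel_measurable borel"
    using w_meas st_meas_borel[OF wk_meas(3)] st_meas_borel[OF wk_meas(4)] st_meas_borel[OF wk_meas(5)]
    by (simp_all add: measurable_compose[OF _ borel_measurable_norm])
  have w_int: "integrable (ST T) (\<lambda>z. \<rho>' z * (w' i z)\<^sup>2)" for i
  proof (rule integrable_component)
    show "integrable (ST T) (\<lambda>z. \<rho>' z * (norm (w (fst z) (snd z)))\<^sup>2)"
      unfolding \<rho>'_def using wk_int(2) nm(1) st_meas_borel[OF wk_meas(1)] by (subst (asm) STintegrable_eq) auto
    show "\<bar>w' i z\<bar> \<le> norm (w (fst z) (snd z))" for z
      unfolding w'_def by (rule component_le_norm_cart)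
  qed auto
  have v_int: "integrable (ST T) (\<lambda>z. \<rho>' z * (v' i z)\<^sup>2)" for i
  proof (rule integrable_component)
    show "integrable (ST T) (\<lambda>z. \<rho>' z * (norm (vb (fst z) (snd z)))\<^sup>2)"
      unfolding \<rho>'_def using wk_int(3) nm(2) st_meas_borel[OF wk_meas(1)] by (subst (asm) STintegrable_eq) auto
    show "\<bar>v' i z\<bar> \<le> norm (vb (fst z) (snd z))" for z
      unfolding v'_def by (rule component_le_norm_cart)
  qed auto
  have Tw_int: "integrable (ST T) (\<lambda>z. (Tw' i j z)\<^sup>2)" for i j
  proof -
    have "integrable (ST T) (\<lambda>z. 1 * (Tw' i j z)\<^sup>2)"
    proof (rule integrable_component)
      show "integrable (ST T) (\<lambda>z. 1 * (norm (Tw (fst z) (snd z)))\<^sup>2)"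
        using wk_int(4) nm(3) by (subst (asm) STintegrable_eq) auto
      show "\<bar>Tw' i j z\<bar> \<le> norm (Tw (fst z) (snd z))" for z
        unfolding Tw'_def by (rule abs_nth2_le)
    qed auto
    then show ?thesis by simp
  qed
  have Tv_int: "integrable (ST T) (\<lambda>z. (Tv' i j z)\<^sup>2)" for i j
  proof -
    have "integrable (ST T) (\<lambda>z. 1 * (Tv' i j z)\<^sup>2)"
    proof (rule integrable_component)
      show "integrable (ST T) (\<lambda>z. 1 * (norm (Tv (fst z) (snd z)))\<^sup>2)"
        using wk_int(5) nm(4) by (subst (asm) STintegrable_eq) auto
      show "\<bar>Tv' i j z\<bar> \<le> norm (Tv (fst z) (snd z))" for z
        unfolding Tv'_def by (rule abs_nth2_le)
    qed auto
    then show ?thesis by simp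
  qed
  have \<rho>0_int: "integrable cm \<rho>0" using data_int(1) by (simp add: set_integrable_cell_eq)
  have nm0: "(\<lambda>x. norm (w0 x)) \<in> borel_measurable borel" "(\<lambda>x. norm (vb0 x)) \<in> borel_measurable borel"
    using data_meas by (auto intro: borel_measurable_norm)
  have w0_int: "integrable cm (\<lambda>x. \<rho>0 x * (w0 x $ i)\<^sup>2)" for i
  proof (rule integrable_component)
    show "integrable cm (\<lambda>x. \<rho>0 x * (norm (w0 x))\<^sup>2)"
      using data_int(2) nm0(1) by (subst (asm) set_integrable_cell_eq) auto
    show "\<bar>w0 x $ i\<bar> \<le> norm (w0 x)" for x by (rule component_le_norm_cart)
  qed auto
  have v0_int: "integrable cm (\<lambda>x. \<rho>0 x * (vb0 x $ i)\<^sup>2)" for i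
  proof (rule integrable_component)
    show "integrable cm (\<lambda>x. \<rho>0 x * (norm (vb0 x))\<^sup>2)"
      using data_int(3) nm0(2) by (subst (asm) set_integrable_cell_eq) auto
    show "\<bar>vb0 x $ i\<bar> \<le> norm (vb0 x)" for x by (rule component_le_norm_cart)
  qed auto

  \<comment> \<open>The weak formulation and the energy inequality in components\<close>
  have flux_\<rho>: "(\<integral>z. \<rho>' z * v' j z * \<phi> z \<partial>ST T) = - c * (\<integral>z. \<rho>' z * pd (ex j) \<phi> z \<partial>ST T)"
    if \<phi>: "uitest T \<phi>" for \<phi> j
  proof -
    note [measurable] = utest_borel[OF \<phi>[unfolded uitest_def, THEN conjunct1]]
    have "STint T (\<lambda>t x. \<rho> t x * vb t x $ j * \<phi> (t, x)) = (\<integral>z. \<rho>' z * v' j z * \<phi> z \<partial>ST T)"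
      by (rule STint_pairI) (measurable, simp add: defs)
    moreover have "STint T (\<lambda>t x. \<rho> t x * pdx j (\<lambda>t x. \<phi> (t, x)) t x) = (\<integral>z. \<rho>' z * pd (ex j) \<phi> z \<partial>ST T)"
      by (rule STint_pairI) (measurable, simp add: defs pdx_eq)
    ultimately show ?thesis using wk_\<rho>[rule_format, OF itest_funI[OF \<phi>], of j] by (simp only:)
  qed
  have flux_w: "(\<integral>z. sqrt (\<rho>' z) * Tw' i j z * \<phi> z \<partial>ST T) =
      - (\<integral>z. \<rho>' z * w' i z * pd (ex j) \<phi> z \<partial>ST T) - 1 / c * (\<integral>z. \<rho>' z * w' i z * v' j z * \<phi> z \<partial>ST T)"
    if \<phi>: "uitest T \<phi>" for \<phi> i j
  proof -
    note [measurable] = utest_borel[OF \<phi>[unfolded uitest_def, THEN conjunct1]]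
    have "STint T (\<lambda>t x. sqrt (\<rho> t x) * Tw t x $ i $ j * \<phi> (t, x)) = (\<integral>z. sqrt (\<rho>' z) * Tw' i j z * \<phi> z \<partial>ST T)"
      by (rule STint_pairI) (measurable, simp add: defs)
    moreover have "STint T (\<lambda>t x. \<rho> t x * w t x $ i * pdx j (\<lambda>t x. \<phi> (t, x)) t x) = (\<integral>z. \<rho>' z * w' i z * pd (ex j) \<phi> z \<partial>ST T)"
      by (rule STint_pairI) (measurable, simp add: defs pdx_eq)
    moreover have "STint T (\<lambda>t x. \<rho> t x * w t x $ i * vb t x $ j * \<phi> (t, x)) = (\<integral>z. \<rho>' z * w' i z * v' j z * \<phi> z \<partial>ST T)"
      by (rule STint_pairI) (measurable, simp add: defs)
    ultimately show ?thesis using wk_Tw[rule_format, OF itest_funI[OF \<phi>], of i j] by (simp only:)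
  qed
  have flux_v: "(\<integral>z. sqrt (\<rho>' z) * Tv' i j z * \<phi> z \<partial>ST T) =
      - (\<integral>z. \<rho>' z * v' i z * pd (ex j) \<phi> z \<partial>ST T) - 1 / c * (\<integral>z. \<rho>' z * v' i z * v' j z * \<phi> z \<partial>ST T)"
    if \<phi>: "uitest T \<phi>" for \<phi> i j
  proof -
    note [measurable] = utest_borel[OF \<phi>[unfolded uitest_def, THEN conjunct1]]
    have "STint T (\<lambda>t x. sqrt (\<rho> t x) * Tv t x $ i $ j * \<phi> (t, x)) = (\<integral>z. sqrt (\<rho>' z) * Tv' i j z * \<phi> z \<partial>ST T)"
      by (rule STint_pairI) (measurable, simp add: defs)
    moreover have "STint T (\<lambda>t x. \<rho> t x * vb t x $ i * pdx j (\<lambda>t x. \<phi> (t, x)) t x) = (\<integral>z. \<rho>' z * v' i z * pd (ex j) \<phi> z \<partial>ST T)"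
      by (rule STint_pairI) (measurable, simp add: defs pdx_eq)
    moreover have "STint T (\<lambda>t x. \<rho> t x * vb t x $ i * vb t x $ j * \<phi> (t, x)) = (\<integral>z. \<rho>' z * v' i z * v' j z * \<phi> z \<partial>ST T)"
      by (rule STint_pairI) (measurable, simp add: defs)
    ultimately show ?thesis using wk_Tv[rule_format, OF itest_funI[OF \<phi>], of i j] by (simp only:)
  qed
  have cont: "(\<integral>z. \<rho>' z * pd et \<phi> z + (\<Sum>j\<in>UNIV. (\<rho>' z * (w' j z - \<nu> / c * v' j z)) * pd (ex j) \<phi> z) \<partial>ST T)
        + (\<integral>x. \<rho>0 x * \<phi> (0, x) \<partial>cm) = 0" if \<phi>: "utest T \<phi>" for \<phi>
  proof -
    note [measurable] = utest_borel[OF \<phi>]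
    have "STint T (\<lambda>t x. \<rho> t x * pdt (\<lambda>t x. \<phi> (t, x)) t x + \<rho> t x * (\<Sum>j\<in>UNIV. u t x $ j * pdx j (\<lambda>t x. \<phi> (t, x)) t x))
      = (\<integral>z. \<rho>' z * pd et \<phi> z + (\<Sum>j\<in>UNIV. (\<rho>' z * u' j z) * pd (ex j) \<phi> z) \<partial>ST T)"
      by (rule STint_pairI) (measurable, simp add: defs pdx_eq pdt_eq sum_distrib_left mult.assoc)
    moreover have "Sint (\<lambda>x. \<rho>0 x * \<phi> (0, x)) = (\<integral>x. \<rho>0 x * \<phi> (0, x) \<partial>cm)"
      by (rule Sint_eq) measurable
    ultimately show ?thesis using wk_cont[rule_format, OF test_funI[OF \<phi>]] unfolding uw[symmetric] by (simp only:)
  qed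
  have eq_w: "(\<integral>z. (\<rho>' z * w' i z) * pd et \<phi> z + (\<Sum>j\<in>UNIV. (\<rho>' z * w' i z * (w' j z - \<nu> / c * v' j z)
          - \<nu> * (sqrt (\<rho>' z) * Tw' i j z) - c * (sqrt (\<rho>' z) * Tv' i j z)) * pd (ex j) \<phi> z) \<partial>ST T)
        + (\<integral>x. (\<rho>0 x * w0 x $ i) * \<phi> (0, x) \<partial>cm) = 0" if \<phi>: "utest T \<phi>" for \<phi> i
  proof -
    note [measurable] = utest_borel[OF \<phi>]
    have "STint T (\<lambda>t x. \<rho> t x * w t x $ i * pdt (\<lambda>t x. \<phi> (t, x)) t x
            + (\<Sum>j\<in>UNIV. \<rho> t x * w t x $ i * u t x $ j * pdx j (\<lambda>t x. \<phi> (t, x)) t x)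
            - \<nu> * (\<Sum>j\<in>UNIV. sqrt (\<rho> t x) * Tw t x $ i $ j * pdx j (\<lambda>t x. \<phi> (t, x)) t x)
            - c * (\<Sum>j\<in>UNIV. sqrt (\<rho> t x) * Tv t x $ i $ j * pdx j (\<lambda>t x. \<phi> (t, x)) t x))
      = (\<integral>z. (\<rho>' z * w' i z) * pd et \<phi> z + (\<Sum>j\<in>UNIV. (\<rho>' z * w' i z * u' j z
          - \<nu> * (sqrt (\<rho>' z) * Tw' i j z) - c * (sqrt (\<rho>' z) * Tv' i j z)) * pd (ex j) \<phi> z) \<partial>ST T)"
      by (rule STint_pairI)
         (measurable, simp add: defs pdx_eq pdt_eq left_diff_distrib sum_subtractf sum_distrib_left mult.assoc)
    moreover have "Sint (\<lambda>x. \<rho>0 x * w0 x $ i * \<phi> (0, x)) = (\<integral>x. (\<rho>0 x * w0 x $ i) * \<phi> (0, x) \<partial>cm)"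
      by (rule Sint_eq) measurable
    ultimately show ?thesis using wk_w[rule_format, OF test_funI[OF \<phi>], of i] unfolding uw[symmetric] by (simp only:)
  qed
  have eq_v: "(\<integral>z. (\<rho>' z * v' i z) * pd et \<phi> z + (\<Sum>j\<in>UNIV. (\<rho>' z * v' i z * (w' j z - \<nu> / c * v' j z)
          - \<nu> * (sqrt (\<rho>' z) * Tv' i j z) + c * (sqrt (\<rho>' z) * Tw' i j z)) * pd (ex j) \<phi> z) \<partial>ST T)
        + (\<integral>x. (\<rho>0 x * vb0 x $ i) * \<phi> (0, x) \<partial>cm) = 0" if \<phi>: "utest T \<phi>" for \<phi> i
  proof -
    note [measurable] = utest_borel[OF \<phi>]
    have "STint T (\<lambda>t x. \<rho> t x * vb t x $ i * pdt (\<lambda>t x. \<phi> (t, x)) t x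
            + (\<Sum>j\<in>UNIV. \<rho> t x * vb t x $ i * u t x $ j * pdx j (\<lambda>t x. \<phi> (t, x)) t x)
            - \<nu> * (\<Sum>j\<in>UNIV. sqrt (\<rho> t x) * Tv t x $ i $ j * pdx j (\<lambda>t x. \<phi> (t, x)) t x)
            + c * (\<Sum>j\<in>UNIV. sqrt (\<rho> t x) * Tw t x $ i $ j * pdx j (\<lambda>t x. \<phi> (t, x)) t x))
      = (\<integral>z. (\<rho>' z * v' i z) * pd et \<phi> z + (\<Sum>j\<in>UNIV. (\<rho>' z * v' i z * u' j z
          - \<nu> * (sqrt (\<rho>' z) * Tv' i j z) + c * (sqrt (\<rho>' z) * Tw' i j z)) * pd (ex j) \<phi> z) \<partial>ST T)"
      by (rule STint_pairI)
         (measurable, simp add: defs pdx_eq pdt_eq left_diff_distrib distrib_right sum.distrib sum_subtractf sum_distrib_left mult.assoc)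
    moreover have "Sint (\<lambda>x. \<rho>0 x * vb0 x $ i * \<phi> (0, x)) = (\<integral>x. (\<rho>0 x * vb0 x $ i) * \<phi> (0, x) \<partial>cm)"
      by (rule Sint_eq) measurable
    ultimately show ?thesis using wk_v[rule_format, OF test_funI[OF \<phi>], of i] unfolding uw[symmetric] by (simp only:)
  qed
  have energy: "AE t in tm T. (\<integral>x. (\<lambda>z. 1/2 * (\<Sum>i\<in>UNIV. \<rho>' z * (w' i z)\<^sup>2 + \<rho>' z * (v' i z)\<^sup>2)) (t, x) \<partial>cm)
        + \<nu> * (\<integral>z. (\<Sum>i\<in>UNIV. \<Sum>j\<in>UNIV. (Tw' i j z)\<^sup>2 + (Tv' i j z)\<^sup>2) \<partial>ST t)
        \<le> 1/2 * (\<Sum>i\<in>UNIV. (\<integral>x. \<rho>0 x * (w0 x $ i)\<^sup>2 \<partial>cm) + (\<integral>x. \<rho>0 x * (vb0 x $ i)\<^sup>2 \<partial>cm))"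
  proof -
    have e1: "(1/2) * Sint (\<lambda>x. \<rho> t x * ((norm (w t x))\<^sup>2 + (norm (vb t x))\<^sup>2)) =
      (\<integral>x. (\<lambda>z. 1/2 * (\<Sum>i\<in>UNIV. \<rho>' z * (w' i z)\<^sup>2 + \<rho>' z * (v' i z)\<^sup>2)) (t, x) \<partial>cm)" for t
    proof -
      let ?F = "\<lambda>z. \<Sum>i\<in>UNIV. \<rho>' z * (w' i z)\<^sup>2 + \<rho>' z * (v' i z)\<^sup>2"
      have F: "(\<lambda>x. \<rho> t x * ((norm (w t x))\<^sup>2 + (norm (vb t x))\<^sup>2)) = (\<lambda>x. ?F (t, x))"
        by (simp add: fun_eq_iff norm2_vec defs sum.distrib sum_distrib_left distrib_left)
      have "?F \<in> borel_measurable borel" by measurable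
      from Sint_eq[OF slice_borel[OF this, of t]] show ?thesis unfolding F by simp
    qed
    have e2: "STint t (\<lambda>s x. (norm (Tw s x))\<^sup>2 + (norm (Tv s x))\<^sup>2) =
      (\<integral>z. (\<Sum>i\<in>UNIV. \<Sum>j\<in>UNIV. (Tw' i j z)\<^sup>2 + (Tv' i j z)\<^sup>2) \<partial>ST t)" for t
      by (rule STint_pairI) (measurable, simp add: norm2_mat defs sum.distrib)
    have e3: "Sint (\<lambda>x. \<rho>0 x * ((norm (w0 x))\<^sup>2 + (norm (vb0 x))\<^sup>2)) =
      (\<Sum>i\<in>UNIV. (\<integral>x. \<rho>0 x * (w0 x $ i)\<^sup>2 \<partial>cm) + (\<integral>x. \<rho>0 x * (vb0 x $ i)\<^sup>2 \<partial>cm))"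
    proof -
      have F: "(\<lambda>x. \<rho>0 x * ((norm (w0 x))\<^sup>2 + (norm (vb0 x))\<^sup>2)) = (\<lambda>x. \<Sum>i\<in>UNIV. \<rho>0 x * (w0 x $ i)\<^sup>2 + \<rho>0 x * (vb0 x $ i)\<^sup>2)"
        by (simp add: fun_eq_iff norm2_vec sum.distrib sum_distrib_left distrib_left)
      have "(\<lambda>x. \<Sum>i\<in>UNIV. \<rho>0 x * (w0 x $ i)\<^sup>2 + \<rho>0 x * (vb0 x $ i)\<^sup>2) \<in> borel_measurable borel" by measurable
      from Sint_eq[OF this] show ?thesis unfolding F using w0_int v0_int by simp
    qed
    show ?thesis using wk_en unfolding AE_tm e1 e2 e3 .
  qed

  \<comment> \<open>The strong solution in components\<close>
  have bdd_r: "bdd T r'"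
  proof -
    have "AE z in ST T. \<bar>r' z\<bar> \<le> M" using rM unfolding st_ae_eq by eventually_elim (use m in \<open>auto simp: r'_def\<close>)
    then show ?thesis unfolding bdd_def by auto
  qed
  have bW: "bdd T (W' i)" "bdd T (V' i)" "bdd T (DtW' i)" "bdd T (DtV' i)" for i
    by (rule bdd_component[OF B(1)] bdd_component[OF B(2)] bdd_component[OF B(7)] bdd_component[OF B(8)];
        (measurable; fail | simp add: defs component_le_norm_cart))+
  have bDW: "bdd T (DW' i j)" "bdd T (DV' i j)" for i j
    by (rule bdd_component[OF B(3)] bdd_component[OF B(4)]; (measurable; fail | simp add: defs abs_nth2_le))+
  have bD2W: "bdd T (D2W' i j k)" "bdd T (D2V' i j k)" for i j k
    by (rule bdd_component[OF B(5)] bdd_component[OF B(6)]; (measurable; fail | simp add: defs abs_nth3_le))+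
  \<comment> \<open>A weak derivative matters only up to null sets, so \<open>G'\<close> may be
    replaced by its almost everywhere expression through \<open>V'\<close>.\<close>
  have dx_r: "uwdx T r' j (\<lambda>z. r' z * V' j z / c)" for j
  proof -
    have "uwdx T r' j (G' j)"
    proof (rule wdx_uwdx)
      show "wdx T (\<lambda>t x. r' (t, x)) j (\<lambda>t x. G' j (t, x))" using G(2) by (simp add: r'_def G'_def)
    qed measurable
    moreover have "(\<integral>z. G' j z * \<phi> z \<partial>ST T) = (\<integral>z. r' z * V' j z / c * \<phi> z \<partial>ST T)" if "uitest T \<phi>" for \<phi>
    proof (rule integral_cong_AE)
      note [measurable] = utest_borel(1)[OF that[unfolded uitest_def, THEN conjunct1]]
      show "(\<lambda>z. G' j z * \<phi> z) \<in> borel_measurable (ST T)" "(\<lambda>z. r' z * V' j z / c * \<phi> z) \<in> borel_measurable (ST T)"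
        by measurable
      show "AE z in ST T. G' j z * \<phi> z = r' z * V' j z / c * \<phi> z" using VU' by eventually_elim simp
    qed
    ultimately show ?thesis by (simp add: uwdx_def)
  qed
  have dx_W: "uwdx T (W' i) j (DW' i j)" "uwdx T (V' i) j (DV' i j)" for i j
    by (rule wdx_uwdx; (measurable; fail | insert dW dV, simp add: defs))+
  have dx_DW: "uwdx T (DW' i j) k (D2W' i j k)" "uwdx T (DV' i j) k (D2V' i j k)" for i j k
    by (rule wdx_uwdx; (measurable; fail | insert d2W d2V, simp add: defs))+
  have dt_W: "uwdt T (W' i) (DtW' i) (\<lambda>x. w0 x $ i)" "uwdt T (V' i) (DtV' i) (\<lambda>x. vb0 x $ i)" for i
    by (rule wdt_uwdt; (measurable; fail | insert tW tV, simp add: defs))+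
  have cont_r: "(\<integral>z. r' z * pd et \<phi> z + (\<Sum>j\<in>UNIV. (r' z * (W' j z - \<nu> / c * V' j z)) * pd (ex j) \<phi> z) \<partial>ST T)
        + (\<integral>x. \<rho>0 x * \<phi> (0, x) \<partial>cm) = 0" if \<phi>: "utest T \<phi>" for \<phi>
  proof -
    note [measurable] = utest_borel[OF \<phi>]
    have "STint T (\<lambda>t x. r t x * pdt (\<lambda>t x. \<phi> (t, x)) t x + r t x * (\<Sum>j\<in>UNIV. U t x $ j * pdx j (\<lambda>t x. \<phi> (t, x)) t x))
      = (\<integral>z. r' z * pd et \<phi> z + (\<Sum>j\<in>UNIV. (r' z * U' j z) * pd (ex j) \<phi> z) \<partial>ST T)"
      by (rule STint_pairI) (measurable, simp add: defs pdx_eq pdt_eq sum_distrib_left mult.assoc)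
    moreover have "\<dots> = (\<integral>z. r' z * pd et \<phi> z + (\<Sum>j\<in>UNIV. (r' z * (W' j z - \<nu> / c * V' j z)) * pd (ex j) \<phi> z) \<partial>ST T)"
    proof (rule integral_cong_AE)
      show "(\<lambda>z. r' z * pd et \<phi> z + (\<Sum>j\<in>UNIV. (r' z * U' j z) * pd (ex j) \<phi> z)) \<in> borel_measurable (ST T)"
        "(\<lambda>z. r' z * pd et \<phi> z + (\<Sum>j\<in>UNIV. (r' z * (W' j z - \<nu> / c * V' j z)) * pd (ex j) \<phi> z)) \<in> borel_measurable (ST T)"
        by measurable
      show "AE z in ST T. r' z * pd et \<phi> z + (\<Sum>j\<in>UNIV. (r' z * U' j z) * pd (ex j) \<phi> z)
          = r' z * pd et \<phi> z + (\<Sum>j\<in>UNIV. (r' z * (W' j z - \<nu> / c * V' j z)) * pd (ex j) \<phi> z)"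
        using VU' by eventually_elim simp
    qed
    moreover have "Sint (\<lambda>x. \<rho>0 x * \<phi> (0, x)) = (\<integral>x. \<rho>0 x * \<phi> (0, x) \<partial>cm)"
      by (rule Sint_eq) measurable
    ultimately show ?thesis using s_cont[rule_format, OF test_funI[OF \<phi>]] by (simp only:)
  qed
  have strong_W: "AE z in ST T. \<forall>i. DtW' i z = (\<Sum>j\<in>UNIV. - (DW' i j z * (W' j z - \<nu> / c * V' j z))
        + \<nu> * (V' j z / c * DW' i j z + D2W' i j j z) + c * (V' j z / c * DV' i j z + D2V' i j j z))"
    using s_W[unfolded st_ae_eq] VU' r_pos
  proof eventually_elim
    case (elim z)
    show ?case
    proof
      fix i
      have "DtW' i z = (\<Sum>j\<in>UNIV. - (DW' i j z * U' j z)
        + \<nu> * (V' j z / c * DW' i j z + D2W' i j j z) - (- c) * (V' j z / c * DV' i j z + D2V' i j j z))"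
        by (rule strong_eq_divide[of "r' z" c "\<lambda>j. G' j z"]) (use elim m c in \<open>auto simp: defs\<close>)
      then show "DtW' i z = (\<Sum>j\<in>UNIV. - (DW' i j z * (W' j z - \<nu> / c * V' j z))
        + \<nu> * (V' j z / c * DW' i j z + D2W' i j j z) + c * (V' j z / c * DV' i j z + D2V' i j j z))"
        using elim(2) by simp
    qed
  qed
  have strong_V: "AE z in ST T. \<forall>i. DtV' i z = (\<Sum>j\<in>UNIV. - (DV' i j z * (W' j z - \<nu> / c * V' j z))
        + \<nu> * (V' j z / c * DV' i j z + D2V' i j j z) - c * (V' j z / c * DW' i j z + D2W' i j j z))"
    using s_V[unfolded st_ae_eq] VU' r_pos
  proof eventually_elim
    case (elim z)
    show ?case
    proof
      fix i
      have "DtV' i z = (\<Sum>j\<in>UNIV. - (DV' i j z * U' j z)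
        + \<nu> * (V' j z / c * DV' i j z + D2V' i j j z) - c * (V' j z / c * DW' i j z + D2W' i j j z))"
        by (rule strong_eq_divide[of "r' z" c "\<lambda>j. G' j z"]) (use elim m c in \<open>auto simp: defs\<close>)
      then show "DtV' i z = (\<Sum>j\<in>UNIV. - (DV' i j z * (W' j z - \<nu> / c * V' j z))
        + \<nu> * (V' j z / c * DV' i j z + D2V' i j j z) - c * (V' j z / c * DW' i j z + D2W' i j j z))"
        using elim(2) by simp
    qed
  qed
  have "weak_strong T \<nu> c m \<rho>' r' w' v' W' V' DtW' DtV' Tw' Tv' DW' DV' D2W' D2V' \<rho>0 (\<lambda>i x. w0 x $ i) (\<lambda>i x. vb0 x $ i)"
    by (rule weak_strong.intro[OF T_pos nu_pos c m bm(1) wm bm(4) bm(11) bm(12) dm(2) dm(3) nonneg \<rho>_int w_int v_int Tw_int Tv_int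
        \<rho>0_int w0_int v0_int flux_\<rho> flux_w flux_v cont eq_w eq_v energy bdd_r r_pos bW bDW bD2W dx_r dx_W dx_DW dt_W
        cont_r strong_W strong_V])
  \<comment> \<open>Both velocities arise by the same formula, \<open>u = w - (\<nu> / c) v\<close>,
    from quantities that now agree.\<close>
  from weak_strong.weak_strong_uniqueness[OF this] VU' show ?thesis
    unfolding st_ae_eq
  proof eventually_elim
    case (elim z)
    have "u (fst z) (snd z) $ i = U (fst z) (snd z) $ i" for i
      using elim uw[of i z] by (simp add: u'_def U'_def)
    then show ?case using elim(1) by (simp add: vec_eq_iff \<rho>'_def r'_def)
  qed
qed

end
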